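(* Let $(T_t)_{t\in\mathbb{R}}$ be a topologically transitive Axiom A flow on a basic set $X$. Let $m$ be a Gibbs measure with respect to a H\"older continuous potential. Let $f:X\to\mathbb{R}$ be a H\"older continuous function with zero average ($\int f\,dm=0$), and let $\sigma^2\ge0$ be such that $\frac{1}{\sqrt R}\int_0^Rf\circ T_t\,dt$ converges in distribution (with respect to $m$) as $R\to\infty$ to $\mathcal{N}(0,\sigma^2)$ (such a $\sigma^2$ exists by the classical central limit theorem). Then, for $m$-almost every $x\in X$, the measures $$\frac{1}{\log R}\int_1^R\frac1t\,\delta_{\frac{1}{\sqrt t}\int_0^tf\circ T_s(x)\,ds}\,dt$$ on $\mathbb{R}$ converge weakly to $\mathcal{N}(0,\sigma^2)$ as $R\to\infty$.
   Context: $\delta_y$ is the Dirac mass at $y\in\mathbb{R}$, and $\mathcal{N}(0,0)$ is the Dirac mass at $0$. The average of the measures is understood weakly: its integral against a bounded continuous $g:\mathbb{R}\to\mathbb{R}$ is $\frac{1}{\log R}\int_1^R\frac1t\,g\left(\frac{1}{\sqrt t}\int_0^tf\circ T_s(x)\,ds\right)dt$. *)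

theory Defs
  imports "HOL-Probability.Probability"
begin

section \<open>Compact Riemannian manifolds in local coordinates\<close>

text \<open>
  The manifold is a whole type \<open>'a\<close>; a chart is a pair of its domain and its coordinate map into
  a Euclidean space \<open>'e\<close>. Tangent vectors, subspaces of tangent spaces, and Riemannian metrics are
  given by their coordinate representatives in every chart, with the usual compatibility under
  change of coordinates.
\<close>

type_synonym ('a, 'e) chart = "'a set \<times> ('a \<Rightarrow> 'e)"

definition is_chart :: "('a::topological_space, 'e::euclidean_space) chart \<Rightarrow> bool" where
  "is_chart c \<longleftrightarrow> open (fst c) \<and> open (snd c ` fst c) \<and>
     (\<exists>\<psi>. homeomorphism (fst c) (snd c ` fst c) (snd c) \<psi>)"

definition chart_inv :: "('a, 'e) chart \<Rightarrow> 'e \<Rightarrow> 'a" where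
  "chart_inv c = inv_into (fst c) (snd c)"

text \<open>\<open>k\<close>-fold continuous differentiability, meant for open \<open>S\<close> and finite-dimensional spaces.\<close>

primrec Ck_on :: "nat \<Rightarrow> 'b::euclidean_space set \<Rightarrow> ('b \<Rightarrow> 'c::real_normed_vector) \<Rightarrow> bool" where
  "Ck_on 0 S f \<longleftrightarrow> continuous_on S f"
| "Ck_on (Suc k) S f \<longleftrightarrow> (\<forall>p\<in>S. f differentiable (at p)) \<and>
     (\<forall>v. Ck_on k S (\<lambda>p. frechet_derivative f (at p) v))"

definition smooth_on :: "'b::euclidean_space set \<Rightarrow> ('b \<Rightarrow> 'c::real_normed_vector) \<Rightarrow> bool" where
  "smooth_on S f \<longleftrightarrow> (\<forall>k. Ck_on k S f)"

definition smooth_atlas :: "('a::topological_space, 'e::euclidean_space) chart set \<Rightarrow> bool" where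
  "smooth_atlas A \<longleftrightarrow> (\<forall>c\<in>A. is_chart c) \<and> (\<Union>c\<in>A. fst c) = UNIV \<and>
     (\<forall>c\<in>A. \<forall>d\<in>A. smooth_on (snd c ` (fst c \<inter> fst d)) (snd d \<circ> chart_inv c))"

text \<open>
  The derivative at \<open>x\<close> of a map \<open>h\<close> between manifolds, read in a chart \<open>c\<close> around \<open>x\<close> and a chart
  \<open>d\<close> around \<open>h x\<close>. For \<open>h = id\<close> it is the change of coordinates of tangent vectors at \<open>x\<close>.
\<close>

definition deriv_in_charts ::
    "('a, 'e::euclidean_space) chart \<Rightarrow> ('a, 'e) chart \<Rightarrow> ('a \<Rightarrow> 'a) \<Rightarrow> 'a \<Rightarrow> 'e \<Rightarrow> 'e" where
  "deriv_in_charts c d h x = frechet_derivative (snd d \<circ> h \<circ> chart_inv c) (at (snd c x))"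

text \<open>\<open>G c x\<close> is the inner product on the tangent space at \<open>x\<close>, read in the chart \<open>c\<close>.\<close>

type_synonym ('a, 'e) metric_tensor = "('a, 'e) chart \<Rightarrow> 'a \<Rightarrow> 'e \<Rightarrow> 'e \<Rightarrow> real"

definition riemannian_metric ::
    "('a, 'e::euclidean_space) chart set \<Rightarrow> ('a, 'e) metric_tensor \<Rightarrow> bool" where
  "riemannian_metric A G \<longleftrightarrow>
     (\<forall>c\<in>A. \<forall>x\<in>fst c. bilinear (G c x) \<and> (\<forall>v w. G c x v w = G c x w v) \<and>
        (\<forall>v. v \<noteq> 0 \<longrightarrow> G c x v v > 0)) \<and>
     (\<forall>c\<in>A. \<forall>v w. smooth_on (snd c ` fst c) (\<lambda>p. G c (chart_inv c p) v w)) \<and>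
     (\<forall>c\<in>A. \<forall>d\<in>A. \<forall>x\<in>fst c \<inter> fst d. \<forall>v w.
        G d x (deriv_in_charts c d id x v) (deriv_in_charts c d id x w) = G c x v w)"

definition tangent_norm :: "('a, 'e) metric_tensor \<Rightarrow> ('a, 'e) chart \<Rightarrow> 'a \<Rightarrow> 'e \<Rightarrow> real" where
  "tangent_norm G c x v = sqrt (G c x v v)"

definition C1_curve ::
    "('a::topological_space, 'e::euclidean_space) chart set \<Rightarrow> (real \<Rightarrow> 'a) \<Rightarrow> bool" where
  "C1_curve A \<gamma> \<longleftrightarrow> continuous_on UNIV \<gamma> \<and>
     (\<forall>c\<in>A. (snd c \<circ> \<gamma>) C1_differentiable_on (\<gamma> -` fst c))"

text \<open>The speed does not depend on the chart chosen around \<open>\<gamma> t\<close>.\<close>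

definition curve_speed ::
    "('a, 'e::euclidean_space) chart set \<Rightarrow> ('a, 'e) metric_tensor \<Rightarrow> (real \<Rightarrow> 'a) \<Rightarrow> real \<Rightarrow> real" where
  "curve_speed A G \<gamma> t = (let c = (SOME c. c \<in> A \<and> \<gamma> t \<in> fst c) in
     tangent_norm G c (\<gamma> t) (vector_derivative (snd c \<circ> \<gamma>) (at t)))"

text \<open>
  Riemannian distance. Curves are \<open>C\<^sup>1\<close> on the whole line and only their part over \<open>[0, 1]\<close> is
  measured; piecewise \<open>C\<^sup>1\<close> curves on \<open>[0, 1]\<close> give the same infimum, by slowing down to speed zero
  at corners and at the end points. The value is meaningful only for two points of the same
  component of the manifold; below it is only used on a basic set, which is connected.
\<close>

definition riemannian_dist ::
    "('a::topological_space, 'e::euclidean_space) chart set \<Rightarrow> ('a, 'e) metric_tensor \<Rightarrow> 'a \<Rightarrow> 'a \<Rightarrow> real"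
  where
  "riemannian_dist A G x y =
     Inf {integral {0..1} (curve_speed A G \<gamma>) | \<gamma>. C1_curve A \<gamma> \<and> \<gamma> 0 = x \<and> \<gamma> 1 = y}"

section \<open>Axiom A flows and basic sets\<close>

definition C1_flow ::
    "('a::topological_space, 'e::euclidean_space) chart set \<Rightarrow> (real \<Rightarrow> 'a \<Rightarrow> 'a) \<Rightarrow> bool" where
  "C1_flow A T \<longleftrightarrow>
     T 0 = id \<and> (\<forall>s t. T (s + t) = T s \<circ> T t) \<and>
     continuous_on UNIV (\<lambda>(t, x). T t x) \<and>
     (\<forall>c\<in>A. \<forall>d\<in>A. Ck_on 1 {(t, p). p \<in> snd c ` fst c \<and> T t (chart_inv c p) \<in> fst d}
        (\<lambda>(t, p). snd d (T t (chart_inv c p))))"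

definition generator ::
    "(real \<Rightarrow> 'a \<Rightarrow> 'a) \<Rightarrow> ('a, 'e::euclidean_space) chart \<Rightarrow> 'a \<Rightarrow> 'e" where
  "generator T c x = vector_derivative (\<lambda>t. snd c (T t x)) (at 0)"

definition flow_invariant :: "(real \<Rightarrow> 'a \<Rightarrow> 'a) \<Rightarrow> 'a set \<Rightarrow> bool" where
  "flow_invariant T \<Lambda> \<longleftrightarrow> (\<forall>t. T t ` \<Lambda> = \<Lambda>)"

definition fixed_point :: "(real \<Rightarrow> 'a \<Rightarrow> 'a) \<Rightarrow> 'a \<Rightarrow> bool" where
  "fixed_point T x \<longleftrightarrow> (\<forall>t. T t x = x)"

text \<open>
  Continuous subbundles of the tangent bundle over \<open>\<Lambda>\<close>: \<open>E c x\<close> is the fibre at \<open>x\<close> read in the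
  chart \<open>c\<close>. The last clause is the existence of continuous local frames.
\<close>

definition tangent_subbundle ::
    "('a::topological_space, 'e::euclidean_space) chart set \<Rightarrow> 'a set \<Rightarrow>
     (('a, 'e) chart \<Rightarrow> 'a \<Rightarrow> 'e set) \<Rightarrow> bool" where
  "tangent_subbundle A \<Lambda> E \<longleftrightarrow>
     (\<forall>c\<in>A. \<forall>x\<in>\<Lambda> \<inter> fst c. subspace (E c x)) \<and>
     (\<forall>c\<in>A. \<forall>d\<in>A. \<forall>x\<in>\<Lambda> \<inter> fst c \<inter> fst d. deriv_in_charts c d id x ` E c x = E d x) \<and>
     (\<forall>c\<in>A. \<forall>x\<in>\<Lambda> \<inter> fst c. \<exists>U (k::nat) e. open U \<and> x \<in> U \<and> U \<subseteq> fst c \<and>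
        (\<forall>i<k. continuous_on (\<Lambda> \<inter> U) (e i)) \<and>
        (\<forall>y\<in>\<Lambda> \<inter> U. inj_on (\<lambda>i. e i y) {..<k} \<and> independent ((\<lambda>i. e i y) ` {..<k}) \<and>
           span ((\<lambda>i. e i y) ` {..<k}) = E c y))"

definition deriv_invariant ::
    "('a, 'e::euclidean_space) chart set \<Rightarrow> (real \<Rightarrow> 'a \<Rightarrow> 'a) \<Rightarrow> 'a set \<Rightarrow>
     (('a, 'e) chart \<Rightarrow> 'a \<Rightarrow> 'e set) \<Rightarrow> bool" where
  "deriv_invariant A T \<Lambda> E \<longleftrightarrow>
     (\<forall>t. \<forall>c\<in>A. \<forall>d\<in>A. \<forall>x\<in>\<Lambda>. x \<in> fst c \<longrightarrow> T t x \<in> fst d \<longrightarrow>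
        deriv_in_charts c d (T t) x ` E c x = E d (T t x))"

text \<open>
  Exponential contraction of \<open>E\<close> in forward time (\<open>\<epsilon> = 1\<close>) or in backward time (\<open>\<epsilon> = -1\<close>).
\<close>

definition exp_contracted ::
    "('a, 'e::euclidean_space) chart set \<Rightarrow> ('a, 'e) metric_tensor \<Rightarrow> (real \<Rightarrow> 'a \<Rightarrow> 'a) \<Rightarrow> real \<Rightarrow>
     'a set \<Rightarrow> (('a, 'e) chart \<Rightarrow> 'a \<Rightarrow> 'e set) \<Rightarrow> bool" where
  "exp_contracted A G T \<epsilon> \<Lambda> E \<longleftrightarrow>
     (\<exists>C>0. \<exists>\<theta>>0. \<forall>t\<ge>0. \<forall>c\<in>A. \<forall>d\<in>A. \<forall>x\<in>\<Lambda>. x \<in> fst c \<longrightarrow> T (\<epsilon> * t) x \<in> fst d \<longrightarrow>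
        (\<forall>v\<in>E c x. tangent_norm G d (T (\<epsilon> * t) x) (deriv_in_charts c d (T (\<epsilon> * t)) x v)
           \<le> C * exp (- \<theta> * t) * tangent_norm G c x v))"

text \<open>
  Hyperbolicity. The neutral direction is spanned by the generator, so it is a line over a set
  without fixed points and trivial at a fixed point; hyperbolic fixed points are thus the case of
  \<open>\<Lambda>\<close> a singleton.
\<close>

definition hyperbolic_set ::
    "('a::topological_space, 'e::euclidean_space) chart set \<Rightarrow> ('a, 'e) metric_tensor \<Rightarrow>
     (real \<Rightarrow> 'a \<Rightarrow> 'a) \<Rightarrow> 'a set \<Rightarrow> bool" where
  "hyperbolic_set A G T \<Lambda> \<longleftrightarrow> closed \<Lambda> \<and> flow_invariant T \<Lambda> \<and>
     (\<exists>Es Eu. tangent_subbundle A \<Lambda> Es \<and> tangent_subbundle A \<Lambda> Eu \<and>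
        deriv_invariant A T \<Lambda> Es \<and> deriv_invariant A T \<Lambda> Eu \<and>
        (\<forall>c\<in>A. \<forall>x\<in>\<Lambda> \<inter> fst c. \<forall>v. \<exists>!w. w \<in> span {generator T c x} \<times> Es c x \<times> Eu c x \<and>
           v = fst w + fst (snd w) + snd (snd w)) \<and>
        exp_contracted A G T 1 \<Lambda> Es \<and> exp_contracted A G T (-1) \<Lambda> Eu)"

definition nonwandering_set :: "(real \<Rightarrow> 'a::topological_space \<Rightarrow> 'a) \<Rightarrow> 'a set" where
  "nonwandering_set T =
     {x. \<forall>U. open U \<longrightarrow> x \<in> U \<longrightarrow> (\<forall>t0. \<exists>t\<ge>t0. T t ` U \<inter> U \<noteq> {})}"

definition periodic_points_dense :: "(real \<Rightarrow> 'a::topological_space \<Rightarrow> 'a) \<Rightarrow> 'a set \<Rightarrow> bool" where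
  "periodic_points_dense T \<Lambda> \<longleftrightarrow> \<Lambda> \<subseteq> closure {x\<in>\<Lambda>. \<exists>t>0. T t x = x}"

definition topologically_transitive_on :: "(real \<Rightarrow> 'a::topological_space \<Rightarrow> 'a) \<Rightarrow> 'a set \<Rightarrow> bool"
  where
  "topologically_transitive_on T \<Lambda> \<longleftrightarrow> (\<exists>x\<in>\<Lambda>. \<Lambda> \<subseteq> closure (range (\<lambda>t. T t x)))"

definition axiom_A ::
    "('a::topological_space, 'e::euclidean_space) chart set \<Rightarrow> ('a, 'e) metric_tensor \<Rightarrow>
     (real \<Rightarrow> 'a \<Rightarrow> 'a) \<Rightarrow> bool" where
  "axiom_A A G T \<longleftrightarrow>
     (\<exists>\<Lambda> F. nonwandering_set T = \<Lambda> \<union> F \<and> \<Lambda> \<inter> F = {} \<and>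
        hyperbolic_set A G T \<Lambda> \<and> (\<forall>x\<in>\<Lambda>. \<not> fixed_point T x) \<and> periodic_points_dense T \<Lambda> \<and>
        finite F \<and> (\<forall>p\<in>F. fixed_point T p \<and> hyperbolic_set A G T {p}))"

text \<open>Basic (hyperbolic) sets in the sense of Bowen and Ruelle.\<close>

definition basic_set ::
    "('a::topological_space, 'e::euclidean_space) chart set \<Rightarrow> ('a, 'e) metric_tensor \<Rightarrow>
     (real \<Rightarrow> 'a \<Rightarrow> 'a) \<Rightarrow> 'a set \<Rightarrow> bool" where
  "basic_set A G T X \<longleftrightarrow>
     hyperbolic_set A G T X \<and> (\<forall>x\<in>X. \<not> fixed_point T x) \<and>
     periodic_points_dense T X \<and> topologically_transitive_on T X \<and>
     (\<exists>U. open U \<and> X \<subseteq> U \<and> X = (\<Inter>t. T t ` U))"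

section \<open>Hoelder functions, Gibbs measures, limit laws\<close>

definition hoelder_on :: "('a \<Rightarrow> 'a \<Rightarrow> real) \<Rightarrow> 'a set \<Rightarrow> ('a \<Rightarrow> real) \<Rightarrow> bool" where
  "hoelder_on d X f \<longleftrightarrow>
     (\<exists>\<alpha> C. 0 < \<alpha> \<and> \<alpha> \<le> 1 \<and> (\<forall>x\<in>X. \<forall>y\<in>X. \<bar>f x - f y\<bar> \<le> C * d x y powr \<alpha>))"

definition birkhoff_integral :: "(real \<Rightarrow> 'a \<Rightarrow> 'a) \<Rightarrow> ('a \<Rightarrow> real) \<Rightarrow> real \<Rightarrow> 'a \<Rightarrow> real" where
  "birkhoff_integral T f t x = integral {0..t} (\<lambda>s. f (T s x))"

definition bowen_ball ::
    "('a \<Rightarrow> 'a \<Rightarrow> real) \<Rightarrow> (real \<Rightarrow> 'a \<Rightarrow> 'a) \<Rightarrow> 'a set \<Rightarrow> 'a \<Rightarrow> real \<Rightarrow> real \<Rightarrow> 'a set" where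
  "bowen_ball d T X x \<epsilon> t = {y\<in>X. \<forall>s\<in>{0..t}. d (T s x) (T s y) < \<epsilon>}"

text \<open>
  Flow-invariant Borel probability measures on \<open>X\<close> with the Gibbs property for the potential \<open>\<phi>\<close>
  on Bowen balls; the constant \<open>P\<close> is then the topological pressure of \<open>\<phi>\<close>.
\<close>

definition gibbs_measure ::
    "('a::topological_space \<Rightarrow> 'a \<Rightarrow> real) \<Rightarrow> (real \<Rightarrow> 'a \<Rightarrow> 'a) \<Rightarrow> 'a set \<Rightarrow> ('a \<Rightarrow> real) \<Rightarrow>
     'a measure \<Rightarrow> bool" where
  "gibbs_measure d T X \<phi> m \<longleftrightarrow>
     prob_space m \<and> sets m = sets (restrict_space borel X) \<and> (\<forall>t. distr m m (T t) = m) \<and>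
     (\<exists>P. \<exists>\<epsilon>0>0. \<forall>\<epsilon>. 0 < \<epsilon> \<and> \<epsilon> < \<epsilon>0 \<longrightarrow>
        (\<exists>C>0. \<forall>x\<in>X. \<forall>t\<ge>0.
           exp (birkhoff_integral T \<phi> t x - P * t) / C \<le> measure m (bowen_ball d T X x \<epsilon> t) \<and>
           measure m (bowen_ball d T X x \<epsilon> t) \<le> C * exp (birkhoff_integral T \<phi> t x - P * t)))"

definition centred_normal :: "real \<Rightarrow> real measure" where
  "centred_normal v =
     (if v = 0 then return borel 0 else density lborel (normal_density 0 (sqrt v)))"

text \<open>
  \<open>weak_conv_m\<close> of the library is for sequences of measures; here the parameter is real.
\<close>

definition weak_conv_at_top :: "(real \<Rightarrow> real measure) \<Rightarrow> real measure \<Rightarrow> bool" where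
  "weak_conv_at_top \<mu> \<nu> \<longleftrightarrow>
     (\<forall>g::real \<Rightarrow> real. continuous_on UNIV g \<longrightarrow> bounded (range g) \<longrightarrow>
        ((\<lambda>R. \<integral>y. g y \<partial>\<mu> R) \<longlongrightarrow> (\<integral>y. g y \<partial>\<nu>)) at_top)"

end

theory Submission
 imports Defs "HOL-Real_Asymp.Real_Asymp"
begin

text \<open>
 Orbits that stay close for a time \<open>n\<close> are, after bounded time shifts, exponentially close away from
 the ends, because a blow-up limit of two orbits with at most linear deviation is a multiple of the
 generator. Hence Birkhoff integrals of Hoelder functions vary boundedly on Bowen balls, and a Gibbs
 measure is quasi-Bernoulli: the itineraries with respect to cells squeezed between Bowen balls have,
 on consecutive time blocks, at most \<open>K ^ n\<close> times the product measure. Neither Markov partitions nor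
 spectral gaps are needed. Gluing orbits gives a quantitative ergodicity statement, from which the
 covariance of \<open>g (S a / sqrt a)\<close> and \<open>g (S b / sqrt b)\<close> tends to 0 as \<open>b\<close> grows; with the
 quasi-Bernoulli bound this yields mixing of distant blocks, and together with the tightness
 contained in the central limit theorem also \<open>E \<bar>S n\<bar> = O(sqrt n)\<close>. On the geometric
 blocks \<open>[Q ^ j, Q ^ (j + 1))\<close> the logarithmic average is replaced by a function of the block alone,
 whose exponential moments are controlled by the quasi-Bernoulli bound; Borel-Cantelli concludes for
 one Lipschitz function \<open>g\<close>, and countably many \<open>g\<close> determine weak convergence.
\<close>

section \<open>Strict differentiability\<close>

text \<open>The constant \<open>K\<close> of the quasi-Bernoulli bound is lost once per block and
  cannot be brought near 1, so whatever is used over \<open>J\<close> blocks must survive a factor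
  \<open>K ^ J\<close>. This dictates the form of the argument. Up to time \<open>Q ^ J\<close>
  there are about \<open>J\<close> blocks, while the logarithmic mass is \<open>J * ln Q\<close>: a
  fixed loss per block is negligible once \<open>Q\<close> is large, provided that it does not
  depend on \<open>Q\<close>. Hence the influence of earlier blocks has to be of logarithmic size.
  For the same reason variances cannot simply be added, and the growth of \<open>S n\<close> is
  controlled through third moments, where halving the time leaves room for the mixed terms.
  Decorrelation cannot come from the quasi-Bernoulli bound, which bounds probabilities only from
  above; it comes from minimising the \<open>L2\<close> norm over a class of functions closed under
  shifts and midpoints. On the geometric side the distance is used only through two-sided estimates
  in charts; these give neither symmetry nor an exact triangle inequality, only versions with
  constants.\<close>

lemma Ck_on_1_iff:
 "Ck_on 1 S f \<longleftrightarrow> (\<forall>p\<in>S. f differentiable (at p)) \<and>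
   (\<forall>v. continuous_on S (%p. frechet_derivative f (at p) v))"
 by simp

text \<open>The error is measured by the mutual distance of two moving points, as the later blow-up
  requires, where both points vary. The proof is the mean value inequality for \<open>f\<close>
  minus its derivative at \<open>p\<close>; \<open>Ck_on\<close> gives continuity of the derivative
  only direction by direction, so its operator norm is controlled through the basis vectors.\<close>

lemma Ck_on_1_strictly_differentiable:
 fixes f :: "'b::euclidean_space => 'c::real_normed_vector"
 assumes C1: "Ck_on 1 S f" and S: "open S" "p \<in> S" and e: "e > 0"
 obtains de where "de > 0" "ball p de \<subseteq> S"
  "\<And>y z. y \<in> ball p de ==> z \<in> ball p de ==>
    norm (f y - f z - frechet_derivative f (at p) (y - z)) <= e * norm (y - z)"
proof -
 let ?D = "%q. frechet_derivative f (at q)"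
 have diff: "(f has_derivative ?D q) (at q)" if "q \<in> S" for q
  using C1 that frechet_derivative_works unfolding Ck_on_1_iff by blast
 obtain d0 where d0: "d0 > 0" "ball p d0 \<subseteq> S"
  using S openE by blast
 have "\<exists>d>0. \<forall>q\<in>S. dist q p < d --> norm (?D q b - ?D p b) < e / DIM('b)" for b
 proof -
  have "continuous_on S (%q. ?D q b)" using C1 unfolding Ck_on_1_iff by blast
  moreover have "e / DIM('b) > 0" using e by simp
  ultimately show ?thesis
   using S(2) unfolding continuous_on_iff dist_norm by blast
 qed
 then obtain d where d: "\<And>b. d b > 0"
  "\<And>b q. q \<in> S ==> dist q p < d b ==> norm (?D q b - ?D p b) < e / DIM('b)" by metis
 define de where "de = min d0 (Min (d ` Basis))"
 have dpos: "de > 0" using d0 d(1) by (simp add: de_def)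
 have dle: "de <= d b" if "b \<in> Basis" for b :: 'b using that by (simp add: de_def min.coboundedI2)
 have sub: "ball p de \<subseteq> S" using d0(2) by (auto simp: de_def)
 have bd: "norm (?D q v - ?D p v) <= e * norm v" if q: "q \<in> ball p de" for q v
 proof -
  have qS: "q \<in> S" using sub q by blast
  have lin: "linear (%v. ?D q v - ?D p v)"
   using diff[OF qS] diff[OF S(2)] by (intro linear_compose_sub has_derivative_linear)
  have "?D q v - ?D p v = (\<Sum>b\<in>Basis. (v \<bullet> b) *\<^sub>R (?D q b - ?D p b))"
   using linear_sum[OF lin, of "%b. (v \<bullet> b) *\<^sub>R b" Basis]
   by (simp add: euclidean_representation linear_scale[OF lin])
  also have "norm ... <= (\<Sum>b\<in>(Basis::'b set). norm v * (e / DIM('b)))"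
  proof (rule sum_norm_le)
   fix b :: 'b assume b: "b \<in> Basis"
   have "dist q p < d b" using q dle[OF b] by (simp add: dist_commute)
   hence "norm (?D q b - ?D p b) <= e / DIM('b)" using d(2)[OF qS] by (simp add: less_imp_le)
   thus "norm ((v \<bullet> b) *\<^sub>R (?D q b - ?D p b)) <= norm v * (e / DIM('b))"
    using mult_mono[OF Basis_le_norm[OF b, of v], of "norm (?D q b - ?D p b)" "e / DIM('b)"] by simp
  qed
  also have "... = e * norm v" by simp
  finally show ?thesis .
 qed
 show thesis
 proof (rule that[OF dpos sub])
  fix y z assume yz: "y \<in> ball p de" "z \<in> ball p de"
  have "norm ((f y - ?D p y) - (f z - ?D p z)) <= e * norm (y - z)"
  proof (rule differentiable_bound[OF convex_ball _ _ yz(1) yz(2)])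
   fix q assume q: "q \<in> ball p de"
   hence qS: "q \<in> S" using sub by blast
   show "((%x. f x - ?D p x) has_derivative (%v. ?D q v - ?D p v)) (at q within ball p de)"
    using diff[OF qS] has_derivative_at_withinI diff[OF S(2)]
    by (intro has_derivative_diff has_derivative_linear[THEN linear_imp_has_derivative]) auto
   show "onorm (%v. ?D q v - ?D p v) <= e"
    using bd[OF q] by (intro onorm_le) (simp add: mult.commute)
  qed
  moreover have "?D p (y - z) = ?D p y - ?D p z"
   using diff[OF S(2)] by (intro linear_diff has_derivative_linear)
  moreover have "f y - f z - (?D p y - ?D p z) = (f y - ?D p y) - (f z - ?D p z)" by simp
  ultimately show "norm (f y - f z - ?D p (y - z)) <= e * norm (y - z)" by metis
 qed
qed

section \<open>Quadratic forms\<close>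

lemma bilinear_expand:
 fixes B :: "'e::euclidean_space => 'e => real"
 assumes "bilinear B"
 shows "B v w = (\<Sum>(b, b')\<in>Basis \<times> Basis. (v \<bullet> b) * (w \<bullet> b') * B b b')"
 using bilinear_sum[OF assms, where f="%b. (v \<bullet> b) *\<^sub>R b" and g="%b. (w \<bullet> b) *\<^sub>R b"
   and S=Basis and T=Basis]
 by (simp add: euclidean_representation bilinear_lmul[OF assms] bilinear_rmul[OF assms]
   mult_ac split_def)

locale scalar_product =
 fixes B :: "'e::euclidean_space => 'e => real"
 assumes bilinear: "bilinear B" and sym: "B v w = B w v" and pos: "v ~= 0 ==> B v v > 0"
begin

abbreviation nrm :: "'e => real" where "nrm v \<equiv> sqrt (B v v)"

lemma zero [simp]: "B 0 v = 0" "B v 0 = 0"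
 using bilinear_lzero[OF bilinear] bilinear_rzero[OF bilinear] by auto

lemma nonneg: "B v v >= 0"
 using pos[of v] by (cases "v = 0") auto

lemma scale: "B (r *\<^sub>R v) (r *\<^sub>R v) = r\<^sup>2 * B v v"
 by (simp add: bilinear_lmul[OF bilinear] bilinear_rmul[OF bilinear] power2_eq_square)

lemma nrm_scale: "nrm (r *\<^sub>R v) = \<bar>r\<bar> * nrm v"
 by (simp add: scale real_sqrt_mult)

lemma cauchy_schwarz: "\<bar>B v w\<bar> <= nrm v * nrm w"
proof (cases "w = 0")
 case False
 note b = bilinear
 let ?a = "B w w" and ?b = "B v w"
 have a: "?a > 0" using pos False by blast
 have "0 <= B (?a *\<^sub>R v - ?b *\<^sub>R w) (?a *\<^sub>R v - ?b *\<^sub>R w)" by (rule nonneg)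
 also have "... = ?a * (?a * B v v - ?b\<^sup>2)"
  by (simp add: bilinear_lsub[OF b] bilinear_rsub[OF b] bilinear_lmul[OF b] bilinear_rmul[OF b]
    sym[of w v] power2_eq_square algebra_simps)
 finally have "?b\<^sup>2 <= B v v * B w w"
  using a by (simp add: zero_le_mult_iff mult.commute)
 hence "sqrt (?b\<^sup>2) <= sqrt (B v v * B w w)" using real_sqrt_le_mono by blast
 thus ?thesis by (simp add: real_sqrt_mult)
qed auto

lemma nrm_triangle: "nrm (v + w) <= nrm v + nrm w"
proof -
 have "B (v + w) (v + w) = B v v + 2 * B v w + B w w"
  by (simp add: bilinear_ladd[OF bilinear] bilinear_radd[OF bilinear] sym[of w v])
 also have "... <= (nrm v + nrm w)\<^sup>2"
  using cauchy_schwarz[of v w] nonneg by (simp add: power2_sum)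
 finally show ?thesis
  using nonneg by (simp add: real_le_lsqrt)
qed

lemma cont: "continuous_on UNIV (%v. B v v)"
proof -
 have "bounded_bilinear B" using bilinear by (simp add: bilinear_conv_bounded_bilinear)
 thus ?thesis by (rule bounded_bilinear.continuous_on) (auto intro: continuous_on_id)
qed

lemma lower: obtains ka where "ka > 0" "\<And>v. B v v >= ka * (norm v)\<^sup>2"
proof -
 have "\<exists>u\<in>sphere 0 1. \<forall>v\<in>sphere 0 1. B u u <= B v v"
  by (rule continuous_attains_inf) (auto intro: continuous_on_subset[OF cont])
 then obtain u where u: "norm u = 1" "\<And>v. norm v = 1 ==> B u u <= B v v" by auto
 show thesis
 proof (rule that)
  show "B u u > 0" using u(1) by (intro pos) auto
  fix v show "B u u * (norm v)\<^sup>2 <= B v v"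
  proof (cases "v = 0")
   case False
   have "B u u <= B ((1 / norm v) *\<^sub>R v) ((1 / norm v) *\<^sub>R v)" using False by (intro u) simp
   also have "... = B v v / (norm v)\<^sup>2" unfolding scale by (simp add: power_divide)
   finally show ?thesis using False by (simp add: field_simps)
  qed simp
 qed
qed

lemma norm_le_nrm: obtains K where "K > 0" "\<And>v. norm v <= K * nrm v"
proof -
 obtain ka where k: "ka > 0" "\<And>v. B v v >= ka * (norm v)\<^sup>2" using lower by blast
 show thesis
 proof (rule that[of "1 / sqrt ka"])
  fix v :: 'e
  have "sqrt ka * norm v = sqrt (ka * (norm v)\<^sup>2)" by (simp add: real_sqrt_mult)
  also have "... <= nrm v" using k(2) by simp
  finally show "norm v <= 1 / sqrt ka * nrm v" using k(1) by (simp add: field_simps)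
 qed (use k in auto)
qed

lemma nrm_le_norm: obtains K where "K > 0" "\<And>v. nrm v <= K * norm v"
proof -
 have "bounded_bilinear B" using bilinear by (simp add: bilinear_conv_bounded_bilinear)
 then obtain K where K: "K > 0" "\<And>v w. norm (B v w) <= norm v * norm w * K"
  using bounded_bilinear.pos_bounded by blast
 show thesis
 proof (rule that[of "sqrt K"])
  fix v :: 'e
  have "B v v <= (sqrt K * norm v)\<^sup>2"
   using K(2)[of v v] K(1) by (simp add: power_mult_distrib) (simp add: power2_eq_square mult_ac)
  thus "nrm v <= sqrt K * norm v" using K(1) by (simp add: real_le_lsqrt)
 qed (use K in auto)
qed

end

text \<open>Turns closeness of the finitely many matrix entries, which is what continuity of a
  metric tensor provides, into closeness of the quadratic forms uniformly in
  \<open>v\<close>.\<close>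

lemma scalar_product_perturb:
 fixes B B' :: "'e::euclidean_space => 'e => real"
 assumes "bilinear B" "bilinear B'" and ep: "ep >= 0"
  and "\<And>b b'. b \<in> Basis ==> b' \<in> Basis ==> \<bar>B b b' - B' b b'\<bar> <= ep"
 shows "\<bar>B v v - B' v v\<bar> <= ep * (DIM('e))\<^sup>2 * (norm v)\<^sup>2"
proof -
 have "\<bar>B v v - B' v v\<bar> = \<bar>\<Sum>(b, b')\<in>Basis \<times> Basis. (v \<bullet> b) * (v \<bullet> b') * (B b b' - B' b b')\<bar>"
  unfolding bilinear_expand[OF assms(1), of v v] bilinear_expand[OF assms(2), of v v]
  by (simp add: sum_subtractf[symmetric] split_def right_diff_distrib)
 also have "... <= (\<Sum>z\<in>Basis \<times> Basis. \<bar>case z of (b, b') => (v \<bullet> b) * (v \<bullet> b') * (B b b' - B' b b')\<bar>)"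
  by (rule sum_abs)
 also have "... <= (\<Sum>z\<in>(Basis::'e set) \<times> (Basis::'e set). norm v * norm v * ep)"
 proof (rule sum_mono)
  fix z :: "'e \<times> 'e" assume "z \<in> Basis \<times> Basis"
  then obtain b b' where z: "z = (b, b')" and b: "b \<in> Basis" "b' \<in> Basis" by blast
  have "\<bar>(v \<bullet> b) * (v \<bullet> b') * (B b b' - B' b b')\<bar> <= norm v * norm v * ep"
   unfolding abs_mult using assms(4)[OF b] Basis_le_norm[OF b(1), of v] Basis_le_norm[OF b(2), of v] ep
   by (intro mult_mono) auto
  thus "\<bar>case z of (b, b') => (v \<bullet> b) * (v \<bullet> b') * (B b b' - B' b b')\<bar> <= norm v * norm v * ep"
   by (simp add: z)
 qed
 also have "... = ep * (DIM('e))\<^sup>2 * (norm v)\<^sup>2"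
  by (simp add: split_def power2_eq_square)
 finally show ?thesis .
qed

section \<open>Curves and the Riemannian distance\<close>

locale riemannian_atlas =
 fixes A :: "('a::t2_space, 'e::euclidean_space) chart set" and G :: "('a, 'e) metric_tensor"
 assumes atlas: "smooth_atlas A" and metric: "riemannian_metric A G"
begin

lemma ex_chart: obtains c where "c \<in> A" "x \<in> fst c"
 using atlas unfolding smooth_atlas_def by blast

context
 fixes c assumes c: "c \<in> A"
begin

lemma open_chart: "open (fst c)" "open (snd c ` fst c)"
 using atlas c unfolding smooth_atlas_def is_chart_def by blast+

lemma chart_homeomorphism: "homeomorphism (fst c) (snd c ` fst c) (snd c) (chart_inv c)"
proof -
 obtain \<psi> where \<psi>: "homeomorphism (fst c) (snd c ` fst c) (snd c) \<psi>"
  using atlas c unfolding smooth_atlas_def is_chart_def by blast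
 have "inj_on (snd c) (fst c)" using \<psi> by (metis homeomorphism_def inj_on_inverseI)
 hence "\<psi> p = chart_inv c p" if "p \<in> snd c ` fst c" for p
  using that \<psi> unfolding chart_inv_def homeomorphism_def by (auto simp: inv_into_f_f)
 thus ?thesis using homeomorphism_cong[OF \<psi>] by auto
qed

lemma chart_inv_chart [simp]: "x \<in> fst c ==> chart_inv c (snd c x) = x"
 using chart_homeomorphism by (simp add: homeomorphism_def)

lemma chart_chart_inv [simp]: "p \<in> snd c ` fst c ==> snd c (chart_inv c p) = p"
 using chart_homeomorphism unfolding homeomorphism_def by blast

lemma chart_inv_in [simp]: "p \<in> snd c ` fst c ==> chart_inv c p \<in> fst c"
 using chart_homeomorphism unfolding homeomorphism_def by blast

lemma continuous_chart: "continuous_on (fst c) (snd c)" "continuous_on (snd c ` fst c) (chart_inv c)"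
 using chart_homeomorphism by (auto simp: homeomorphism_def)

lemma open_chart_image: "open U ==> U \<subseteq> fst c ==> open (snd c ` U)"
 using homeomorphism_imp_open_map[OF chart_homeomorphism, of U] open_chart
 by (simp add: openin_open_eq image_mono)

lemma open_chart_vimage: "open P ==> open {x \<in> fst c. snd c x \<in> P}"
proof -
 assume P: "open P"
 have "open (snd c -` P \<inter> fst c)"
  using continuous_on_open_vimage[OF open_chart(1), of "snd c"] continuous_chart(1) P by blast
 moreover have "snd c -` P \<inter> fst c = {x \<in> fst c. snd c x \<in> P}" by blast
 ultimately show ?thesis by simp
qed

lemma scalar_product: "x \<in> fst c ==> scalar_product (G c x)"
 using metric c unfolding riemannian_metric_def by unfold_locales blast+

lemma continuous_metric: "continuous_on (snd c ` fst c) (%p. G c (chart_inv c p) v w)"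
proof -
 have "smooth_on (snd c ` fst c) (%p. G c (chart_inv c p) v w)"
  using metric c unfolding riemannian_metric_def by blast
 hence "Ck_on 0 (snd c ` fst c) (%p. G c (chart_inv c p) v w)" unfolding smooth_on_def by blast
 thus ?thesis by simp
qed

end

lemma transition_C1:
 assumes "c \<in> A" "d \<in> A"
 shows "Ck_on 1 (snd c ` (fst c \<inter> fst d)) (snd d \<circ> chart_inv c)"
 using atlas assms unfolding smooth_atlas_def smooth_on_def by blast

lemma transition_has_derivative:
 assumes "c \<in> A" "d \<in> A" "x \<in> fst c" "x \<in> fst d"
 shows "((snd d \<circ> chart_inv c) has_derivative deriv_in_charts c d id x) (at (snd c x))"
proof -
 have "(snd d \<circ> chart_inv c) differentiable at (snd c x)"
  using transition_C1[OF assms(1,2)] assms(3,4) unfolding Ck_on_1_iff by blast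
 thus ?thesis by (simp add: deriv_in_charts_def frechet_derivative_works)
qed

lemma metric_change:
 assumes "c \<in> A" "d \<in> A" "x \<in> fst c" "x \<in> fst d"
 shows "tangent_norm G d x (deriv_in_charts c d id x v) = tangent_norm G c x v"
 using metric assms unfolding riemannian_metric_def tangent_norm_def by simp

text \<open>The local tool for lengths: on a small coordinate ball the metric tensor may be frozen
  at \<open>y\<close> at the cost of a factor 2.\<close>

lemma metric_comparison:
 assumes c: "c \<in> A" "y \<in> fst c"
 obtains rh where "rh > 0" "cball (snd c y) rh \<subseteq> snd c ` fst c"
  "\<And>p v. p \<in> cball (snd c y) rh ==> tangent_norm G c (chart_inv c p) v <= 2 * tangent_norm G c y v"
  "\<And>p v. p \<in> cball (snd c y) rh ==> tangent_norm G c y v <= 2 * tangent_norm G c (chart_inv c p) v"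
proof -
 interpret s: scalar_product "G c y" using scalar_product c by blast
 obtain ka where k: "ka > 0" "\<And>v. G c y v v >= ka * (norm v)\<^sup>2" using s.lower by blast
 let ?p = "snd c y"
 have y: "?p \<in> snd c ` fst c" using c by blast
 \<comment> \<open>The factor \<open>DIM('e)\<^sup>2\<close> of the perturbation lemma cancels, and
   by the choice of \<open>ka\<close> the deviation is at most half of
   \<open>G c y v v\<close>.\<close>
 define ep where "ep = ka / (2 * (DIM('e))\<^sup>2)"
 have e: "ep > 0" using k(1) by (simp add: ep_def)
 have "\<exists>d>0. \<forall>p\<in>snd c ` fst c. dist p ?p < d --> \<bar>G c (chart_inv c p) b b' - G c y b b'\<bar> < ep" for b b'
  using continuous_metric[OF c(1), of b b', unfolded continuous_on_iff dist_real_def, rule_format, OF y e] c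
  by simp
 then obtain d where d: "\<And>b b'. d b b' > (0::real)"
  "\<And>b b' p. p \<in> snd c ` fst c ==> dist p ?p < d b b' ==> \<bar>G c (chart_inv c p) b b' - G c y b b'\<bar> < ep"
  by metis
 obtain r where r: "r > 0" "cball ?p r \<subseteq> snd c ` fst c"
  using open_contains_cball open_chart(2)[OF c(1)] y by metis
 define rh where "rh = min r (Min ((%(b, b'). d b b') ` (Basis \<times> Basis)) / 2)"
 have fin: "finite ((%(b, b'). d b b') ` (Basis \<times> Basis))" by simp
 have rh: "rh > 0" using r(1) d(1) fin by (auto simp: rh_def)
 have dle: "rh < d b b'" if "b \<in> Basis" "b' \<in> Basis" for b b'
 proof -
  have "Min ((%(b, b'). d b b') ` (Basis \<times> Basis)) <= d b b'"
   using that fin by (intro Min_le) auto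
  moreover have "rh <= Min ((%(b, b'). d b b') ` (Basis \<times> Basis)) / 2" unfolding rh_def by (rule min.cobounded2)
  ultimately show ?thesis using d(1)[of b b'] by linarith
 qed
 have sub: "cball ?p rh \<subseteq> snd c ` fst c" using r(2) by (auto simp: rh_def)
 have close: "\<bar>G c (chart_inv c p) v v - G c y v v\<bar> <= ka / 2 * (norm v)\<^sup>2" if p: "p \<in> cball ?p rh" for p v
 proof -
  have pc: "p \<in> snd c ` fst c" using sub p by blast
  interpret s': scalar_product "G c (chart_inv c p)" using scalar_product[OF c(1)] chart_inv_in[OF c(1) pc] by blast
  have "\<bar>G c (chart_inv c p) v v - G c y v v\<bar> <= ep * (DIM('e))\<^sup>2 * (norm v)\<^sup>2"
  proof (rule scalar_product_perturb[OF s'.bilinear s.bilinear])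
   fix b b' :: 'e assume b: "b \<in> Basis" "b' \<in> Basis"
   have "dist p ?p < d b b'" using p dle[OF b] by (simp add: dist_commute)
   thus "\<bar>G c (chart_inv c p) b b' - G c y b b'\<bar> <= ep" using d(2)[OF pc, of b b'] by simp
  qed (use e in simp)
  thus ?thesis by (simp add: ep_def)
 qed
 show thesis
 proof (rule that[OF rh sub])
  fix p v assume p: "p \<in> cball ?p rh"
  have 1: "\<bar>G c (chart_inv c p) v v - G c y v v\<bar> <= G c y v v / 2"
   using close[OF p, of v] k(2)[of v] by (simp add: mult.commute)
  have "G c (chart_inv c p) v v <= 4 * G c y v v" using 1 s.nonneg[of v] by linarith
  moreover have "G c y v v <= 4 * G c (chart_inv c p) v v" using 1 s.nonneg[of v] by linarith
  ultimately have "G c (chart_inv c p) v v <= 2\<^sup>2 * G c y v v" "G c y v v <= 2\<^sup>2 * G c (chart_inv c p) v v"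
   by simp_all
  hence "sqrt (G c (chart_inv c p) v v) <= sqrt (2\<^sup>2 * G c y v v)"
   "sqrt (G c y v v) <= sqrt (2\<^sup>2 * G c (chart_inv c p) v v)" using real_sqrt_le_mono by blast+
  thus "tangent_norm G c (chart_inv c p) v <= 2 * tangent_norm G c y v"
   "tangent_norm G c y v <= 2 * tangent_norm G c (chart_inv c p) v"
   by (simp_all add: tangent_norm_def real_sqrt_mult)
 qed
qed

lemma C1_curve_has_derivative:
 assumes "C1_curve A ga" "c \<in> A" "ga t \<in> fst c"
 shows "((snd c \<circ> ga) has_vector_derivative vector_derivative (snd c \<circ> ga) (at t)) (at t)"
proof -
 have "(snd c \<circ> ga) differentiable at t"
  using assms unfolding C1_curve_def C1_differentiable_on_eq by blast
 thus ?thesis by (simp add: vector_derivative_works)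
qed

lemma C1_curve_open: "C1_curve A ga ==> open U ==> open (ga -` U)"
 unfolding C1_curve_def using open_vimage by blast

text \<open>The chart in \<open>curve_speed\<close> is chosen by \<open>SOME\<close>; invariance of
  the metric under change of coordinates allows any other chart around the point to be used
  instead.\<close>

lemma curve_speed_chart:
 assumes ga: "C1_curve A ga" and c: "c \<in> A" "ga t \<in> fst c"
 shows "curve_speed A G ga t = tangent_norm G c (ga t) (vector_derivative (snd c \<circ> ga) (at t))"
proof -
 define d where "d = (SOME c. c \<in> A \<and> ga t \<in> fst c)"
 have d: "d \<in> A" "ga t \<in> fst d"
  using someI[of "%c. c \<in> A \<and> ga t \<in> fst c", OF conjI[OF c]] unfolding d_def by auto
 let ?v = "vector_derivative (snd c \<circ> ga) (at t)"
 have "(((snd d \<circ> chart_inv c) \<circ> (snd c \<circ> ga)) has_vector_derivative deriv_in_charts c d id (ga t) ?v) (at t)"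
  using vector_derivative_diff_chain_within[of "snd c \<circ> ga" ?v t UNIV "snd d \<circ> chart_inv c"]
   C1_curve_has_derivative[OF ga c] transition_has_derivative[OF c(1) d(1) c(2) d(2)]
  by (simp add: has_derivative_at_withinI)
 hence "((snd d \<circ> ga) has_vector_derivative deriv_in_charts c d id (ga t) ?v) (at t)"
 proof (rule has_vector_derivative_transform_within_open)
  show "open (ga -` fst c)" "t \<in> ga -` fst c" using C1_curve_open[OF ga] open_chart c by auto
 qed (use c in auto)
 hence "vector_derivative (snd d \<circ> ga) (at t) = deriv_in_charts c d id (ga t) ?v"
  by (rule vector_derivative_at)
 thus ?thesis
  using metric_change[OF c(1) d(1) c(2) d(2)] by (simp add: curve_speed_def d_def[symmetric])
qed

lemma curve_speed_nonneg: "C1_curve A ga ==> curve_speed A G ga t >= 0"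
proof -
 assume ga: "C1_curve A ga"
 obtain c where c: "c \<in> A" "ga t \<in> fst c" using ex_chart by metis
 interpret s: scalar_product "G c (ga t)" using scalar_product c by blast
 show ?thesis using curve_speed_chart[OF ga c] s.nonneg by (simp add: tangent_norm_def)
qed

text \<open>Guarantees that lengths are genuine integrals. Near \<open>t\<close> the speed is read
  in one fixed chart, with the metric expanded into its entries, since only these are known to be
  continuous.\<close>

lemma continuous_curve_speed:
 assumes ga: "C1_curve A ga"
 shows "continuous_on UNIV (curve_speed A G ga)"
proof -
 have "isCont (curve_speed A G ga) t" for t
 proof -
  obtain c where c: "c \<in> A" "ga t \<in> fst c" using ex_chart by metis
  let ?S = "ga -` fst c"
  have S: "open ?S" "t \<in> ?S" using C1_curve_open[OF ga] open_chart c by auto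
  let ?v = "%t. vector_derivative (snd c \<circ> ga) (at t)"
  have v: "continuous_on ?S ?v"
   using ga c(1) unfolding C1_curve_def C1_differentiable_on_eq by blast
  have g: "continuous_on ?S ga" using ga unfolding C1_curve_def by (blast intro: continuous_on_subset)
  have m: "continuous_on ?S (%t. G c (ga t) b b')" for b b'
  proof -
   have "continuous_on ?S (%t. G c (chart_inv c (snd c (ga t))) b b')"
    by (rule continuous_on_compose2[OF continuous_metric[OF c(1)]
      continuous_on_compose2[OF continuous_chart(1)[OF c(1)] g]]) auto
   thus ?thesis by (rule continuous_on_eq) (use c in auto)
  qed
  have "continuous_on ?S (%t. sqrt (\<Sum>z\<in>Basis \<times> Basis. (?v t \<bullet> fst z) * (?v t \<bullet> snd z) * G c (ga t) (fst z) (snd z)))"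
   by (intro continuous_intros v m)
  moreover have "curve_speed A G ga t = sqrt (\<Sum>z\<in>Basis \<times> Basis. (?v t \<bullet> fst z) * (?v t \<bullet> snd z) * G c (ga t) (fst z) (snd z))"
   if "t \<in> ?S" for t
  proof -
   interpret s: scalar_product "G c (ga t)" using scalar_product c that by blast
   show ?thesis
    using curve_speed_chart[OF ga c(1)] that bilinear_expand[OF s.bilinear, of "?v t" "?v t"]
    by (simp add: tangent_norm_def split_def)
  qed
  ultimately have "continuous_on ?S (curve_speed A G ga)" by (subst continuous_on_cong[OF refl]) auto
  thus ?thesis using S continuous_on_eq_continuous_at by blast
 qed
 thus ?thesis by (simp add: continuous_at_imp_continuous_on)
qed

lemma curve_length_mono:
 assumes ga: "C1_curve A ga" and s: "0 <= s" "s <= 1"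
 shows "integral {0..s} (curve_speed A G ga) <= integral {0..1} (curve_speed A G ga)"
 using s by (intro integral_subset_le integrable_continuous_interval continuous_on_subset[OF continuous_curve_speed[OF ga]])
   (auto simp: curve_speed_nonneg[OF ga])

lemma curve_length_nonneg: "C1_curve A ga ==> integral {0..s} (curve_speed A G ga) >= 0"
 by (intro integral_nonneg integrable_continuous_interval continuous_on_subset[OF continuous_curve_speed])
   (auto simp: curve_speed_nonneg)

end

subsection \<open>A spline\<close>

text \<open>A \<open>C1\<close> transition from 0 to 1, constant outside the unit interval: the
  second derivative is 4 on the first half and -4 on the second half. Segments parametrised by it
  are \<open>C1\<close> on the whole line and rest at both ends, so they can be
  concatenated.\<close>

definition spline :: "real => real" where
 "spline t = 2 * (max 0 t)\<^sup>2 - 4 * (max 0 (t - 1/2))\<^sup>2 + 2 * (max 0 (t - 1))\<^sup>2"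

definition spline' :: "real => real" where
 "spline' t = 4 * max 0 t - 8 * max 0 (t - 1/2) + 4 * max 0 (t - 1)"

lemma max_square_has_derivative: "((%t. (max 0 t)\<^sup>2) has_real_derivative 2 * max 0 t) (at (t::real))"
proof -
 consider "t < 0" | "t > 0" | "t = 0" by linarith
 thus ?thesis
 proof cases
  case 1
  have "((%t::real. 0) has_real_derivative 2 * max 0 t) (at t)" using 1 by simp
  thus ?thesis
   by (rule has_field_derivative_transform_within_open[where S="{..<0}"]) (use 1 in auto)
 next
  case 2
  have "((%t::real. t\<^sup>2) has_real_derivative 2 * max 0 t) (at t)"
   using 2 by (auto intro!: derivative_eq_intros)
  thus ?thesis
   by (rule has_field_derivative_transform_within_open[where S="{0<..}"]) (use 2 in auto)
 next
  case 3
  have "((%h::real. (max 0 h)\<^sup>2 / h) \<longlongrightarrow> 0) (at 0)"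
  proof (rule Lim_null_comparison)
   show "\<forall>\<^sub>F h in at 0. norm ((max 0 h)\<^sup>2 / h) <= \<bar>h :: real\<bar>"
    by (rule always_eventually) (auto simp: max_def power2_eq_square)
   show "((%h::real. \<bar>h\<bar>) \<longlongrightarrow> 0) (at 0)" by (intro tendsto_eq_intros | simp)+
  qed
  thus ?thesis unfolding DERIV_def 3 by simp
 qed
qed

lemma spline_has_derivative: "(spline has_real_derivative spline' t) (at t)"
proof -
 have shift: "((%t. (max 0 (t - a))\<^sup>2) has_real_derivative 2 * max 0 (t - a)) (at t)" for a :: real
 proof -
  have "((%t. t - a) has_real_derivative 1) (at t)" by (auto intro!: derivative_eq_intros)
  from DERIV_chain2[OF max_square_has_derivative this] show ?thesis by simp
 qed
 have "((%t. 2 * (max 0 t)\<^sup>2 - 4 * (max 0 (t - 1/2))\<^sup>2 + 2 * (max 0 (t - 1))\<^sup>2) has_real_derivative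
   2 * (2 * max 0 t) - 4 * (2 * max 0 (t - 1/2)) + 2 * (2 * max 0 (t - 1))) (at t)"
  by (intro DERIV_add DERIV_diff DERIV_cmult shift max_square_has_derivative)
 thus ?thesis
  unfolding spline_def[abs_def] spline'_def by simp
qed

lemma spline_0: "t <= 0 ==> spline t = 0"
 by (simp add: spline_def max_def)

lemma spline_1: "t >= 1 ==> spline t = 1"
 by (simp add: spline_def max_absorb2) (simp add: power2_eq_square algebra_simps)

lemma spline'_nonneg: "spline' t >= 0"
 unfolding spline'_def by (simp add: max_def; linarith)

lemma continuous_spline': "continuous_on UNIV spline'"
 unfolding spline'_def[abs_def] by (intro continuous_intros)

lemma spline_mono: "s <= t ==> spline s <= spline t"
proof (erule DERIV_nonneg_imp_nondecreasing)
 show "\<exists>y. (spline has_real_derivative y) (at x) \<and> 0 <= y" for x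
  using spline_has_derivative[of x] spline'_nonneg[of x] by blast
qed

lemma spline_range: "0 <= spline t" "spline t <= 1"
 using spline_mono[of "min 0 t" t] spline_mono[of t "max 1 t"] spline_0[of "min 0 t"] spline_1[of "max 1 t"]
 by simp_all

lemma spline'_integral: "(spline' has_integral 1) {0..1}"
 using fundamental_theorem_of_calculus[of 0 1 spline spline'] spline_has_derivative
 by (simp add: spline_0 spline_1 has_real_derivative_iff_has_vector_derivative has_vector_derivative_at_within)

lemma Ck_on_1_compose:
 fixes f :: "'b::euclidean_space => 'c::real_normed_vector"
 assumes f: "Ck_on 1 S f" and \<sigma>: "\<And>t. t \<in> W ==> (\<sigma> has_vector_derivative \<sigma>' t) (at t)"
  and \<sigma>': "continuous_on W \<sigma>'" and sub: "\<sigma> ` W \<subseteq> S"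
 shows "(f \<circ> \<sigma>) C1_differentiable_on W"
  and "t \<in> W ==> ((f \<circ> \<sigma>) has_vector_derivative frechet_derivative f (at (\<sigma> t)) (\<sigma>' t)) (at t)"
proof -
 have D: "(f has_derivative frechet_derivative f (at (\<sigma> t))) (at (\<sigma> t))" if "t \<in> W" for t
  using f sub that frechet_derivative_works unfolding Ck_on_1_iff by blast
 show *: "((f \<circ> \<sigma>) has_vector_derivative frechet_derivative f (at (\<sigma> t)) (\<sigma>' t)) (at t)" if "t \<in> W" for t
  using vector_derivative_diff_chain_within[of \<sigma> "\<sigma>' t" t UNIV f] \<sigma>[OF that] D[OF that]
  by (simp add: has_derivative_at_withinI)
 have \<sigma>c: "continuous_on W \<sigma>"
  using \<sigma> has_vector_derivative_continuous by (intro continuous_at_imp_continuous_on) blast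
 \<comment> \<open>\<open>Ck_on\<close> controls the derivative in fixed directions only, so the
   varying direction \<open>\<sigma>' t\<close> is expanded in the basis.\<close>
 have "continuous_on W (%t. \<Sum>b\<in>Basis. (\<sigma>' t \<bullet> b) *\<^sub>R frechet_derivative f (at (\<sigma> t)) b)"
  using f sub unfolding Ck_on_1_iff
  by (intro continuous_intros \<sigma>' continuous_on_compose2[OF _ \<sigma>c, of S]) auto
 moreover have "(\<Sum>b\<in>Basis. (\<sigma>' t \<bullet> b) *\<^sub>R frechet_derivative f (at (\<sigma> t)) b) = frechet_derivative f (at (\<sigma> t)) (\<sigma>' t)"
  if "t \<in> W" for t
 proof -
  have lin: "linear (frechet_derivative f (at (\<sigma> t)))" using D[OF that] by (rule has_derivative_linear)
  show ?thesis
   using linear_sum[OF lin, of "%b. (\<sigma>' t \<bullet> b) *\<^sub>R b" Basis]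
   by (simp add: euclidean_representation linear_scale[OF lin])
 qed
 ultimately have "continuous_on W (%t. frechet_derivative f (at (\<sigma> t)) (\<sigma>' t))"
  by (subst (asm) continuous_on_cong[OF refl]) auto
 thus "(f \<circ> \<sigma>) C1_differentiable_on W"
  unfolding C1_differentiable_on_def
  by (intro exI[of _ "%t. frechet_derivative f (at (\<sigma> t)) (\<sigma>' t)"]) (simp add: *)
qed

lemma C1_curve_local:
 fixes A :: "('a::t2_space, 'e::euclidean_space) chart set"
 assumes "\<And>t. \<exists>bb W. C1_curve A bb \<and> open W \<and> t \<in> W \<and> (\<forall>s\<in>W. ga s = bb s)"
 shows "C1_curve A ga"
 unfolding C1_curve_def
proof (intro conjI ballI)
 have "isCont ga t" for t
 proof -
  obtain bb W where bb: "C1_curve A bb" "open W" "t \<in> W" "\<And>s. s \<in> W ==> ga s = bb s" using assms by blast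
  have "isCont bb t" using bb(1) unfolding C1_curve_def by (simp add: continuous_on_eq_continuous_at)
  moreover have "\<forall>\<^sub>F s in nhds t. ga s = bb s"
   using bb(2-4) eventually_nhds by blast
  ultimately show ?thesis by (simp add: isCont_cong)
 qed
 thus "continuous_on UNIV ga" by (simp add: continuous_at_imp_continuous_on)
 fix c assume c: "c \<in> A"
 let ?S = "ga -` fst c"
 let ?D = "%t. vector_derivative (snd c \<circ> ga) (at t)"
 have "((snd c \<circ> ga) has_vector_derivative ?D t) (at t) \<and> continuous (at t within ?S) ?D" if t: "t \<in> ?S" for t
 proof -
  obtain bb W where bb: "C1_curve A bb" "open W" "t \<in> W" "\<And>s. s \<in> W ==> ga s = bb s" using assms by blast
  have C1: "(snd c \<circ> bb) C1_differentiable_on (bb -` fst c)" using bb(1) c unfolding C1_curve_def by blast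
  let ?D' = "%t. vector_derivative (snd c \<circ> bb) (at t)"
  have eq: "((snd c \<circ> ga) has_vector_derivative ?D' s) (at s)" if s: "s \<in> W" "ga s \<in> fst c" for s
  proof -
   have "(snd c \<circ> bb) differentiable at s" using C1 s bb(4) unfolding C1_differentiable_on_eq by auto
   hence "((snd c \<circ> bb) has_vector_derivative ?D' s) (at s)" by (simp add: vector_derivative_works)
   thus ?thesis
    by (rule has_vector_derivative_transform_within_open[OF _ bb(2) s(1)]) (simp add: bb(4))
  qed
  have DD: "?D s = ?D' s" if "s \<in> W" "ga s \<in> fst c" for s
   using eq[OF that] by (rule vector_derivative_at)
  have "continuous_on (bb -` fst c) ?D'" using C1 unfolding C1_differentiable_on_eq by blast
  hence "continuous (at t within bb -` fst c) ?D'"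
   using t bb(3,4) by (auto simp: continuous_on_eq_continuous_within)
  hence "continuous (at t within ?S \<inter> W) ?D'"
   by (rule continuous_within_subset) (use bb(4) in auto)
  hence "(?D' \<longlongrightarrow> ?D t) (at t within ?S \<inter> W)"
   using DD[OF bb(3)] t by (simp add: continuous_within)
  hence "(?D \<longlongrightarrow> ?D t) (at t within ?S \<inter> W)"
   by (rule Lim_transform_within[where d=1]) (auto simp: DD)
  moreover have "at t within ?S = at t within ?S \<inter> W"
   by (rule at_within_nhd[OF bb(3,2)]) auto
  ultimately have "continuous (at t within ?S) ?D" by (simp add: continuous_within)
  thus ?thesis using eq[OF bb(3)] DD[OF bb(3)] t by simp
 qed
 hence "(\<forall>t\<in>?S. ((snd c \<circ> ga) has_vector_derivative ?D t) (at t)) \<and> continuous_on ?S ?D"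
  unfolding continuous_on_eq_continuous_within by blast
 thus "(snd c \<circ> ga) C1_differentiable_on ?S"
  unfolding C1_differentiable_on_def by (rule exI[where x = ?D])
qed


section \<open>Comparison of the Riemannian distance with coordinates\<close>

context riemannian_atlas
begin

lemma chart_curve:
 assumes c: "c \<in> A" and \<sigma>: "\<And>t. (\<sigma> has_vector_derivative \<sigma>' t) (at t)"
  and \<sigma>': "continuous_on UNIV \<sigma>'" and sub: "range \<sigma> \<subseteq> snd c ` fst c"
 shows "C1_curve A (chart_inv c \<circ> \<sigma>)"
  and "curve_speed A G (chart_inv c \<circ> \<sigma>) t = tangent_norm G c (chart_inv c (\<sigma> t)) (\<sigma>' t)"
proof -
 have \<sigma>c: "continuous_on UNIV \<sigma>"
  using \<sigma> has_vector_derivative_continuous by (intro continuous_at_imp_continuous_on) blast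
 have in_c: "chart_inv c (\<sigma> t) \<in> fst c" for t using sub by (intro chart_inv_in[OF c]) auto
 have inv: "snd c (chart_inv c (\<sigma> t)) = \<sigma> t" for t using sub by (intro chart_chart_inv[OF c]) auto
 show C: "C1_curve A (chart_inv c \<circ> \<sigma>)"
  unfolding C1_curve_def
 proof (intro conjI ballI)
  show "continuous_on UNIV (chart_inv c \<circ> \<sigma>)"
   by (intro continuous_on_compose \<sigma>c continuous_on_subset[OF continuous_chart(2)[OF c] sub])
  fix d assume d: "d \<in> A"
  let ?W = "(chart_inv c \<circ> \<sigma>) -` fst d"
  have "((snd d \<circ> chart_inv c) \<circ> \<sigma>) C1_differentiable_on ?W"
  proof (rule Ck_on_1_compose(1)[OF transition_C1[OF c d] \<sigma>])
   show "continuous_on ?W \<sigma>'" using \<sigma>' by (rule continuous_on_subset) simp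
   show "\<sigma> ` ?W \<subseteq> snd c ` (fst c \<inter> fst d)"
   proof (clarsimp)
    fix t assume t: "chart_inv c (\<sigma> t) \<in> fst d"
    show "\<sigma> t \<in> snd c ` (fst c \<inter> fst d)"
     using t in_c[of t] inv[of t, symmetric] by blast
   qed
  qed
  thus "(snd d \<circ> (chart_inv c \<circ> \<sigma>)) C1_differentiable_on ?W" by (simp add: comp_assoc)
 qed
 have "snd c \<circ> (chart_inv c \<circ> \<sigma>) = \<sigma>" by (simp add: fun_eq_iff inv)
 thus "curve_speed A G (chart_inv c \<circ> \<sigma>) t = tangent_norm G c (chart_inv c (\<sigma> t)) (\<sigma>' t)"
  using curve_speed_chart[OF C c, of t] in_c[of t] vector_derivative_at[OF \<sigma>[of t]] by simp
qed

lemma riemannian_dist_le: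
 assumes "C1_curve A ga"
 shows "riemannian_dist A G (ga 0) (ga 1) <= integral {0..1} (curve_speed A G ga)"
 unfolding riemannian_dist_def
proof (rule cInf_lower)
 show "integral {0..1} (curve_speed A G ga) \<in>
   {integral {0..1} (curve_speed A G bb) |bb. C1_curve A bb \<and> bb 0 = ga 0 \<and> bb 1 = ga 1}"
  using assms by blast
 show "bdd_below {integral {0..1} (curve_speed A G bb) |bb. C1_curve A bb \<and> bb 0 = ga 0 \<and> bb 1 = ga 1}"
  by (rule bdd_belowI[of _ 0]) (use curve_length_nonneg in blast)
qed

text \<open>The curve \<open>ga\<close> witnesses that the set of lengths is nonempty; the infimum
  of the empty set would carry no information.\<close>

lemma riemannian_dist_ge:
 assumes "C1_curve A ga" "ga 0 = x" "ga 1 = y"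
  and "\<And>bb. C1_curve A bb ==> bb 0 = x ==> bb 1 = y ==> L <= integral {0..1} (curve_speed A G bb)"
 shows "L <= riemannian_dist A G x y"
 unfolding riemannian_dist_def
 by (rule cInf_greatest) (use assms in blast)+

lemma segment_curve:
 assumes c: "c \<in> A" and P: "convex P" "P \<subseteq> snd c ` fst c" and pq: "p \<in> P" "q \<in> P"
 defines "ga \<equiv> chart_inv c \<circ> (%t. p + spline t *\<^sub>R (q - p))"
 shows "C1_curve A ga"
  and "curve_speed A G ga t = tangent_norm G c (ga t) (spline' t *\<^sub>R (q - p))"
  and "snd c (ga t) \<in> P"
  and "t <= 0 ==> ga t = chart_inv c p" and "t >= 1 ==> ga t = chart_inv c q"
proof -
 let ?\<sigma> = "%t. p + spline t *\<^sub>R (q - p)"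
 have in_P: "?\<sigma> t \<in> P" for t
  using convexD_alt[OF P(1) pq spline_range[of t]] by (simp add: algebra_simps)
 have d: "(?\<sigma> has_vector_derivative spline' t *\<^sub>R (q - p)) (at t)" for t
  using spline_has_derivative[of t]
  by (auto intro!: derivative_eq_intros has_vector_derivative_scaleR simp: has_real_derivative_iff_has_vector_derivative)
 have cont: "continuous_on UNIV (%t. spline' t *\<^sub>R (q - p))" by (intro continuous_intros continuous_spline')
 have sub: "range ?\<sigma> \<subseteq> snd c ` fst c" using in_P P(2) by blast
 show "C1_curve A ga" "curve_speed A G ga t = tangent_norm G c (ga t) (spline' t *\<^sub>R (q - p))"
  unfolding ga_def using chart_curve(1)[OF c d cont sub] chart_curve(2)[OF c d cont sub, of t] by simp_all
 have "?\<sigma> t \<in> snd c ` fst c" using sub by blast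
 thus "snd c (ga t) \<in> P" using in_P[of t] c by (simp add: ga_def)
 show "t <= 0 ==> ga t = chart_inv c p" "t >= 1 ==> ga t = chart_inv c q"
  by (simp_all add: ga_def spline_0 spline_1)
qed

lemma riemannian_dist_chart_le:
 assumes c: "c \<in> A" "y \<in> fst c" and P: "convex P" "P \<subseteq> snd c ` fst c" "p \<in> P" "q \<in> P"
  and le: "\<And>u v. u \<in> P ==> tangent_norm G c (chart_inv c u) v <= 2 * tangent_norm G c y v"
 shows "riemannian_dist A G (chart_inv c p) (chart_inv c q) <= 2 * tangent_norm G c y (q - p)"
proof -
 interpret s: scalar_product "G c y" using scalar_product c by blast
 define ga where "ga = chart_inv c \<circ> (%t. p + spline t *\<^sub>R (q - p))"
 note ga = segment_curve[OF c(1) P, folded ga_def]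
 have in_P: "snd c (ga t) \<in> P" for t by (rule ga(3))
 have "ga t = chart_inv c (snd c (ga t))" for t
 proof -
  have "p + spline t *\<^sub>R (q - p) \<in> P"
   using convexD_alt[OF P(1,3,4) spline_range[of t]] by (simp add: algebra_simps)
  hence "p + spline t *\<^sub>R (q - p) \<in> snd c ` fst c" using P(2) by blast
  thus ?thesis using c by (simp add: ga_def)
 qed
 hence speed: "curve_speed A G ga t <= spline' t * (2 * tangent_norm G c y (q - p))" for t
  using le[OF in_P, of t "spline' t *\<^sub>R (q - p)"] ga(2)[of t] s.nrm_scale[of "spline' t" "q - p"] spline'_nonneg[of t]
  by (simp add: tangent_norm_def mult_ac)
 have "((%t. spline' t * (2 * tangent_norm G c y (q - p))) has_integral 1 * (2 * tangent_norm G c y (q - p))) {0..1}"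
  by (rule has_integral_mult_left[OF spline'_integral])
 hence "integral {0..1} (curve_speed A G ga) <= 1 * (2 * tangent_norm G c y (q - p))"
  using speed by (intro has_integral_le[OF integrable_integral])
   (auto intro: integrable_continuous_interval continuous_on_subset[OF continuous_curve_speed[OF ga(1)]])
 thus ?thesis
  using riemannian_dist_le[OF ga(1)] ga(4)[of 0] ga(5)[of 1] by simp
qed

text \<open>The displacement \<open>w\<close> is paired with the velocity: integrating
  \<open>G c y (?v t) w\<close> and applying the Cauchy-Schwarz inequality gives the squared norm of
  \<open>w\<close> on one side and its norm times the length on the other, and one factor is divided
  out.\<close>

lemma curve_length_ge:
 assumes ga: "C1_curve A ga" and c: "c \<in> A" "y \<in> fst c" and s: "0 <= s"
  and in_c: "\<And>t. 0 <= t ==> t <= s ==> ga t \<in> fst c"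
  and le: "\<And>t v. 0 <= t ==> t <= s ==> tangent_norm G c y v <= 2 * tangent_norm G c (ga t) v"
 shows "tangent_norm G c y (snd c (ga s) - snd c (ga 0)) <= 2 * integral {0..s} (curve_speed A G ga)"
proof -
 interpret s: scalar_product "G c y" using scalar_product c by blast
 define w where "w = snd c (ga s) - snd c (ga 0)"
 let ?v = "%t. vector_derivative (snd c \<circ> ga) (at t)"
 have bl: "bounded_linear (%u. G c y u w)"
  using s.bilinear by (simp add: bilinear_def linear_conv_bounded_linear)
 have "((%t. G c y (snd c (ga t)) w) has_vector_derivative G c y (?v t) w) (at t within {0..s})"
  if "t \<in> {0..s}" for t
  using bounded_linear.has_vector_derivative[OF bl C1_curve_has_derivative[OF ga c(1)]] in_c that
  by (auto intro: has_vector_derivative_at_within)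
 hence "((%t. G c y (?v t) w) has_integral G c y (snd c (ga s)) w - G c y (snd c (ga 0)) w) {0..s}"
  by (rule fundamental_theorem_of_calculus[OF s])
 moreover have "G c y (snd c (ga s)) w - G c y (snd c (ga 0)) w = G c y w w"
  by (simp add: w_def bilinear_lsub[OF s.bilinear])
 ultimately have I: "((%t. G c y (?v t) w) has_integral G c y w w) {0..s}" by simp
 have J: "((%t. curve_speed A G ga t * (2 * s.nrm w)) has_integral integral {0..s} (curve_speed A G ga) * (2 * s.nrm w)) {0..s}"
  by (intro has_integral_mult_left integrable_integral integrable_continuous_interval
    continuous_on_subset[OF continuous_curve_speed[OF ga]]) simp
 have "G c y (?v t) w <= curve_speed A G ga t * (2 * s.nrm w)" if t: "t \<in> {0..s}" for t
 proof -
  have "G c y (?v t) w <= s.nrm (?v t) * s.nrm w" using s.cauchy_schwarz[of "?v t" w] by simp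
  also have "... <= 2 * curve_speed A G ga t * s.nrm w"
   using le[of t "?v t"] t curve_speed_chart[OF ga c(1), of t] in_c[of t] s.nonneg[of w]
   by (intro mult_right_mono) (auto simp: tangent_norm_def)
  finally show ?thesis by (simp add: mult_ac)
 qed
 hence "G c y w w <= integral {0..s} (curve_speed A G ga) * (2 * s.nrm w)"
  by (rule has_integral_le[OF I J])
 moreover have "G c y w w = s.nrm w * s.nrm w" using s.nonneg[of w] by simp
 ultimately have *: "s.nrm w * s.nrm w <= (2 * integral {0..s} (curve_speed A G ga)) * s.nrm w"
  by (simp only: mult_ac)
 have "s.nrm w <= 2 * integral {0..s} (curve_speed A G ga)"
 proof (cases "s.nrm w > 0")
  case True
  show ?thesis using mult_right_le_imp_le[OF * True] .
 next
  case False
  thus ?thesis using curve_length_nonneg[OF ga, of s] by linarith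
 qed
 thus ?thesis by (simp add: tangent_norm_def w_def)
qed


text \<open>A curve that leaves a coordinate ball has to cross the shell between the radii
  \<open>r\<close> and \<open>rh\<close>. This bounds its length from below, whatever it does
  outside the chart.\<close>

lemma curve_length_exit:
 assumes ga: "C1_curve A ga" and c: "c \<in> A" "y \<in> fst c"
  and rh: "cball (snd c y) rh \<subseteq> snd c ` fst c"
   "\<And>p v. p \<in> cball (snd c y) rh ==> tangent_norm G c y v <= 2 * tangent_norm G c (chart_inv c p) v"
  and K: "K > 0" "\<And>v. norm v <= K * tangent_norm G c y v"
  and r: "r < rh" and start: "ga 0 \<in> fst c" "dist (snd c y) (snd c (ga 0)) <= r"
  and exit: "0 <= T" "T <= 1" "\<not> (ga T \<in> fst c \<and> snd c (ga T) \<in> ball (snd c y) rh)"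
 shows "rh - r <= 4 * K * integral {0..1} (curve_speed A G ga)"
proof -
 let ?U = "{x \<in> fst c. snd c x \<in> ball (snd c y) rh}"
 have cont: "continuous_on UNIV ga" using ga unfolding C1_curve_def by blast
 have "open ?U" using open_chart_vimage[OF c(1) open_ball] by blast
 hence "closed (ga -` (- ?U))" using cont by (intro closed_vimage) auto
 hence "compact ({0..1} \<inter> ga -` (- ?U))" by (intro compact_Int_closed) auto
 moreover have "T \<in> {0..1} \<inter> ga -` (- ?U)" using exit by auto
 ultimately obtain t0 where t0: "t0 \<in> {0..1}" "ga t0 \<notin> ?U"
  and first: "\<And>t. t \<in> {0..1} ==> ga t \<notin> ?U ==> t0 <= t"
  using compact_attains_inf[of "{0..1} \<inter> ga -` (- ?U)"] by blast
 have "ga 0 \<in> ?U" using start r by auto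
 hence t0_pos: "t0 > 0" using t0 by (metis atLeastAtMost_iff less_eq_real_def)
 have inU: "ga t \<in> ?U" if "0 <= t" "t < t0" for t using first[of t] that t0(1) by force
 define r3 where "r3 = (rh + r) / 2"
 have r3: "r < r3" "r3 < rh" using r by (auto simp: r3_def)
 \<comment> \<open>At the exit time \<open>t0\<close> the curve may be outside the chart, where
   coordinates say nothing. But had it stayed in the compact ball of radius \<open>r3\<close> up to
   \<open>t0\<close>, it would still be there at \<open>t0\<close>; so it exceeds \<open>r3\<close>
   earlier. Taking the midpoint for \<open>r3\<close> costs a factor 2.\<close>
 have "\<exists>t. 0 <= t \<and> t < t0 \<and> dist (snd c y) (snd c (ga t)) > r3"
 proof (rule ccontr)
  assume neg: "\<not> ?thesis"
  let ?C = "chart_inv c ` cball (snd c y) r3"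
  have sub: "cball (snd c y) r3 \<subseteq> snd c ` fst c" using rh(1) r3 by auto
  have "compact ?C"
   by (intro compact_continuous_image continuous_on_subset[OF continuous_chart(2)[OF c(1)] sub]) auto
  hence cl: "closed (ga -` ?C)" using cont by (intro closed_vimage compact_imp_closed)
  have "{0..<t0} \<subseteq> ga -` ?C"
  proof
   fix t assume t: "t \<in> {0..<t0}"
   hence "ga t \<in> fst c" "snd c (ga t) \<in> cball (snd c y) r3" using inU[of t] neg by (auto simp: not_less)
   thus "t \<in> ga -` ?C" using chart_inv_chart[OF c(1), of "ga t"] by (metis imageI vimage_eq)
  qed
  hence "closure {0..<t0} \<subseteq> ga -` ?C" using cl by (rule closure_minimal)
  moreover have "t0 \<in> closure {0..<t0}" using t0_pos by simp
  ultimately have "t0 \<in> ga -` ?C" by blast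
  then obtain p where p: "p \<in> cball (snd c y) r3" "ga t0 = chart_inv c p" by auto
  hence "p \<in> snd c ` fst c" using sub by blast
  hence "ga t0 \<in> ?U" using p r3 c by auto
  thus False using t0(2) by blast
 qed
 then obtain t where t: "0 <= t" "t < t0" "dist (snd c y) (snd c (ga t)) > r3" by blast
 have "tangent_norm G c y (snd c (ga t) - snd c (ga 0)) <= 2 * integral {0..t} (curve_speed A G ga)"
 proof (rule curve_length_ge[OF ga c t(1)])
  fix s assume s: "0 <= s" "s <= t"
  thus s_in: "ga s \<in> fst c" using inU[of s] t by auto
  have "snd c (ga s) \<in> cball (snd c y) rh" using inU[of s] t s by auto
  thus "tangent_norm G c y v <= 2 * tangent_norm G c (ga s) v" for v
   using rh(2)[of "snd c (ga s)" v] s_in c(1) by simp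
 qed
 also have "... <= 2 * integral {0..1} (curve_speed A G ga)"
  using curve_length_mono[OF ga t(1)] t(2) t0(1) by simp
 finally have "norm (snd c (ga t) - snd c (ga 0)) <= K * (2 * integral {0..1} (curve_speed A G ga))"
  using K order_trans mult_left_mono less_imp_le by meson
 moreover have "r3 - r <= norm (snd c (ga t) - snd c (ga 0))"
  using t(3) start(2) dist_triangle[of "snd c y" "snd c (ga t)" "snd c (ga 0)"] by (simp add: dist_norm norm_minus_commute)
 ultimately show ?thesis by (simp add: r3_def)
qed

lemma tangent_norm_bounds:
 assumes c: "c \<in> A" "y \<in> fst c"
 obtains K where "K > 0" "\<And>v. norm v <= K * tangent_norm G c y v" "\<And>v. tangent_norm G c y v <= K * norm v"
proof -
 interpret s: scalar_product "G c y" using scalar_product c by blast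
 obtain K1 K2 where K: "K1 > 0" "\<And>v. norm v <= K1 * s.nrm v" "K2 > 0" "\<And>v. s.nrm v <= K2 * norm v"
  using s.norm_le_nrm s.nrm_le_norm by metis
 have "norm v <= max K1 K2 * s.nrm v" "s.nrm v <= max K1 K2 * norm v" for v
  using K(2,4)[of v] mult_right_mono[of K1 "max K1 K2" "s.nrm v"] mult_right_mono[of K2 "max K1 K2" "norm v"] s.nonneg[of v]
  by auto
 thus thesis using that[of "max K1 K2"] K by (simp add: tangent_norm_def)
qed

lemma riemannian_dist_local:
 assumes c: "c \<in> A" "y \<in> fst c"
 obtains r where "r > 0" "cball (snd c y) r \<subseteq> snd c ` fst c"
  "\<And>p q. p \<in> ball (snd c y) r ==> q \<in> ball (snd c y) r ==>
    tangent_norm G c y (q - p) <= 2 * riemannian_dist A G (chart_inv c p) (chart_inv c q)"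
  "\<And>p q. p \<in> ball (snd c y) r ==> q \<in> ball (snd c y) r ==>
    riemannian_dist A G (chart_inv c p) (chart_inv c q) <= 2 * tangent_norm G c y (q - p)"
proof -
 obtain rh where rh: "rh > 0" "cball (snd c y) rh \<subseteq> snd c ` fst c"
  "\<And>p v. p \<in> cball (snd c y) rh ==> tangent_norm G c (chart_inv c p) v <= 2 * tangent_norm G c y v"
  "\<And>p v. p \<in> cball (snd c y) rh ==> tangent_norm G c y v <= 2 * tangent_norm G c (chart_inv c p) v"
  using metric_comparison[OF c] by blast
 obtain K where K: "K > 0" "\<And>v. norm v <= K * tangent_norm G c y v" "\<And>v. tangent_norm G c y v <= K * norm v"
  using tangent_norm_bounds[OF c] by blast
 \<comment> \<open>The norm of \<open>q - p\<close> is at most \<open>2 * K * r\<close>; the second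
   term makes this less than what a curve leaving the ball of radius \<open>rh\<close> must have as
   length, up to the factor 2.\<close>
 define r where "r = min (rh / 2) (rh / (8 * K * K))"
 have r: "r > 0" "r <= rh / 2" "r <= rh / (8 * K * K)" using rh K by (auto simp: r_def)
 have sub: "ball (snd c y) r \<subseteq> snd c ` fst c" using rh(2) r by auto
 show thesis
 proof (rule that[OF r(1)])
  show "cball (snd c y) r \<subseteq> snd c ` fst c" using rh r by auto
  fix p q assume pq: "p \<in> ball (snd c y) r" "q \<in> ball (snd c y) r"
  show "riemannian_dist A G (chart_inv c p) (chart_inv c q) <= 2 * tangent_norm G c y (q - p)"
   using rh(3) r by (intro riemannian_dist_chart_le[OF c convex_ball sub pq]) auto
  define ga where "ga = chart_inv c \<circ> (%t. p + spline t *\<^sub>R (q - p))"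
  note seg = segment_curve[OF c(1) convex_ball sub pq, folded ga_def]
  have pqc: "p \<in> snd c ` fst c" "q \<in> snd c ` fst c" using pq sub by auto
  have "tangent_norm G c y (q - p) / 2 <= riemannian_dist A G (chart_inv c p) (chart_inv c q)"
  proof (rule riemannian_dist_ge[OF seg(1)])
   show "ga 0 = chart_inv c p" "ga 1 = chart_inv c q" using seg(4)[of 0] seg(5)[of 1] by auto
   fix bb assume bb: "C1_curve A bb" "bb 0 = chart_inv c p" "bb 1 = chart_inv c q"
   show "tangent_norm G c y (q - p) / 2 <= integral {0..1} (curve_speed A G bb)"
   proof (cases "\<forall>t\<in>{0..1}. bb t \<in> fst c \<and> snd c (bb t) \<in> ball (snd c y) rh")
    case True
    have "tangent_norm G c y (snd c (bb 1) - snd c (bb 0)) <= 2 * integral {0..1} (curve_speed A G bb)"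
    proof (rule curve_length_ge[OF bb(1) c])
     fix s :: real assume s: "0 <= s" "s <= 1"
     thus in_c: "bb s \<in> fst c" using True by auto
     have "snd c (bb s) \<in> cball (snd c y) rh" using True s by force
     thus "tangent_norm G c y v <= 2 * tangent_norm G c (bb s) v" for v
      using rh(4)[of "snd c (bb s)" v] in_c c(1) by simp
    qed simp
    thus ?thesis using bb pqc c by simp
   next
    case False
    then obtain T where T: "0 <= T" "T <= 1" "\<not> (bb T \<in> fst c \<and> snd c (bb T) \<in> ball (snd c y) rh)" by auto
    have "rh - r <= 4 * K * integral {0..1} (curve_speed A G bb)"
     using bb pqc c pq r rh by (intro curve_length_exit[OF bb(1) c rh(2,4) K(1,2) _ _ _ T]) auto
    hence 1: "rh / 2 <= 4 * K * integral {0..1} (curve_speed A G bb)" using r by simp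
    have "norm (q - p) <= 2 * r"
     using pq dist_triangle3[of q p "snd c y"] by (simp add: dist_norm)
    hence "tangent_norm G c y (q - p) <= K * (2 * r)" using K(1) K(3)[of "q - p"] by (meson mult_left_mono less_imp_le order_trans)
    also have "... <= rh / (4 * K)" using r(3) K(1) by (simp add: field_simps)
    also have "... <= 2 * integral {0..1} (curve_speed A G bb)" using 1 K(1) by (simp add: field_simps)
    finally show ?thesis by simp
   qed
  qed
  thus "tangent_norm G c y (q - p) <= 2 * riemannian_dist A G (chart_inv c p) (chart_inv c q)" by simp
 qed
qed

text \<open>Resting at both ends makes the relation transitive for \<open>C1\<close> curves. The
  notion is needed because the distance of two points joined by no curve is an infimum over the
  empty set.\<close>

definition connectable :: "'a => 'a => bool" where
 "connectable x z \<longleftrightarrow> (\<exists>ga. C1_curve A ga \<and> (\<forall>t\<le>0. ga t = x) \<and> (\<forall>t\<ge>1. ga t = z))"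

text \<open>Small distance to a point near \<open>y\<close> forces the other point into the chart.
  In this way statements about \<open>d\<close> are moved into coordinates without knowing
  beforehand that both points lie in one chart.\<close>

lemma riemannian_dist_escape:
 assumes c: "c \<in> A" "y \<in> fst c" and r: "r > 0"
 obtains r' rh where "r' > 0" "rh > 0"
  "\<And>x z. x \<in> fst c ==> snd c x \<in> ball (snd c y) r' ==> connectable x z ==> riemannian_dist A G x z < rh ==>
    z \<in> fst c \<and> snd c z \<in> ball (snd c y) r"
proof -
 obtain rh0 where rh0: "rh0 > 0" "cball (snd c y) rh0 \<subseteq> snd c ` fst c"
  "\<And>p v. p \<in> cball (snd c y) rh0 ==> tangent_norm G c (chart_inv c p) v <= 2 * tangent_norm G c y v"
  "\<And>p v. p \<in> cball (snd c y) rh0 ==> tangent_norm G c y v <= 2 * tangent_norm G c (chart_inv c p) v"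
  using metric_comparison[OF c] by blast
 obtain K where K: "K > 0" "\<And>v. norm v <= K * tangent_norm G c y v" "\<And>v. tangent_norm G c y v <= K * norm v"
  using tangent_norm_bounds[OF c] by blast
 define R where "R = min r rh0"
 have R: "R > 0" "R <= r" "R <= rh0" using r rh0 by (auto simp: R_def)
 show thesis
 proof (rule that[of "R / 2" "R / (8 * K)"])
  fix x z assume x: "x \<in> fst c" "snd c x \<in> ball (snd c y) (R / 2)" "connectable x z" "riemannian_dist A G x z < R / (8 * K)"
  show "z \<in> fst c \<and> snd c z \<in> ball (snd c y) r"
  proof (rule ccontr)
   assume z: "\<not> (z \<in> fst c \<and> snd c z \<in> ball (snd c y) r)"
   obtain ga where ga: "C1_curve A ga" "ga 0 = x" "ga 1 = z" using x(3) unfolding connectable_def by fastforce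
   have "R / (8 * K) <= riemannian_dist A G x z"
   proof (rule riemannian_dist_ge[OF ga])
    fix bb assume bb: "C1_curve A bb" "bb 0 = x" "bb 1 = z"
    have "R - R / 2 <= 4 * K * integral {0..1} (curve_speed A G bb)"
    proof (rule curve_length_exit[OF bb(1) c _ _ K(1,2), where T=1])
     show "\<not> (bb 1 \<in> fst c \<and> snd c (bb 1) \<in> ball (snd c y) R)" using z R bb by auto
    qed (use rh0 R x bb in auto)
    thus "R / (8 * K) <= integral {0..1} (curve_speed A G bb)" using K(1) by (simp add: field_simps)
   qed
   thus False using x(4) by simp
  qed
 qed (use R K in auto)
qed

lemma C1_curve_affine:
 assumes ga: "C1_curve A ga"
 shows "C1_curve A (%t. ga (a * t + b))"
 unfolding C1_curve_def
proof (intro conjI ballI)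
 show "continuous_on UNIV (%t. ga (a * t + b))"
  using ga continuous_on_compose2[of UNIV ga UNIV "%t. a * t + b"]
  unfolding C1_curve_def by (simp add: continuous_on_add continuous_on_mult_left)
 fix c assume c: "c \<in> A"
 let ?S = "ga -` fst c" and ?S' = "(%t. ga (a * t + b)) -` fst c"
 have "(snd c \<circ> ga) C1_differentiable_on ?S" using ga c unfolding C1_curve_def by blast
 then obtain D where "(\<forall>t\<in>?S. ((snd c \<circ> ga) has_vector_derivative D t) (at t)) \<and> continuous_on ?S D"
  unfolding C1_differentiable_on_def by (elim exE)
 hence D: "\<And>t. t \<in> ?S ==> ((snd c \<circ> ga) has_vector_derivative D t) (at t)" "continuous_on ?S D" by simp_all
 show "(snd c \<circ> (%t. ga (a * t + b))) C1_differentiable_on ?S'"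
  unfolding C1_differentiable_on_def
 proof (intro exI[of _ "%t. a *\<^sub>R D (a * t + b)"] conjI ballI)
  fix t assume t: "t \<in> ?S'"
  have "((%t. a * t + b) has_vector_derivative a) (at t)"
   by (auto intro!: derivative_eq_intros simp: has_real_derivative_iff_has_vector_derivative[symmetric])
  from vector_diff_chain_at[OF this, of "snd c \<circ> ga" "D (a * t + b)"]
  show "((snd c \<circ> (%t. ga (a * t + b))) has_vector_derivative a *\<^sub>R D (a * t + b)) (at t)"
   using D(1)[of "a * t + b"] t by (simp add: comp_def)
 next
  have "continuous_on ?S' (%t. a * t + b)" by (intro continuous_intros)
  hence "continuous_on ?S' (%t. D (a * t + b))" by (rule continuous_on_compose2[OF D(2)]) auto
  thus "continuous_on ?S' (%t. a *\<^sub>R D (a * t + b))" by (intro continuous_intros)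
 qed
qed

lemma connectable_sym: assumes "connectable x z" shows "connectable z x"
proof -
 obtain ga where ga: "C1_curve A ga" "\<forall>t\<le>0. ga t = x" "\<forall>t\<ge>1. ga t = z" using assms unfolding connectable_def by blast
 show ?thesis unfolding connectable_def
  by (rule exI[of _ "%t. ga (- 1 * t + 1)"]) (use ga C1_curve_affine[OF ga(1), of "-1" 1] in simp)
qed

lemma connectable_trans: assumes "connectable x z" "connectable z w" shows "connectable x w"
proof -
 obtain ga bb where ga: "C1_curve A ga" "\<forall>t\<le>0. ga t = x" "\<forall>t\<ge>1. ga t = z"
  and bb: "C1_curve A bb" "\<forall>t\<le>0. bb t = z" "\<forall>t\<ge>1. bb t = w" using assms unfolding connectable_def by blast
 \<comment> \<open>At triple speed the first curve rests at \<open>z\<close> from time 1/3 on and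
   the second one until time 2/3, so both descriptions agree on the overlap.\<close>
 define de where "de = (%t::real. if t < 1/2 then ga (3 * t + 0) else bb (3 * t + (- 2)))"
 have "C1_curve A de"
 proof (rule C1_curve_local)
  fix t :: real
  consider "t < 2/3" | "t > 1/3" by linarith
  thus "\<exists>bb W. C1_curve A bb \<and> open W \<and> t \<in> W \<and> (\<forall>s\<in>W. de s = bb s)"
  proof cases
   case 1
   have "\<forall>s\<in>{..<2/3}. de s = ga (3 * s + 0)" using ga bb by (auto simp: de_def)
   thus ?thesis using C1_curve_affine[OF ga(1)] 1 open_lessThan lessThan_iff by blast
  next
   case 2
   have "\<forall>s\<in>{1/3<..}. de s = bb (3 * s + (- 2))" using ga bb by (auto simp: de_def)
   thus ?thesis using C1_curve_affine[OF bb(1)] 2 open_greaterThan greaterThan_iff by blast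
  qed
 qed
 thus ?thesis unfolding connectable_def
  by (intro exI[of _ de]) (use ga bb in \<open>auto simp: de_def\<close>)
qed

lemma connectable_local:
 obtains U where "open U" "x \<in> U" "\<And>z. z \<in> U ==> connectable x z"
proof -
 obtain c where c: "c \<in> A" "x \<in> fst c" using ex_chart by metis
 obtain r where r: "r > 0" "ball (snd c x) r \<subseteq> snd c ` fst c"
  using openE[OF open_chart(2)[OF c(1)], of "snd c x"] c(2) by blast
 show thesis
 proof (rule that)
  show "open {z \<in> fst c. snd c z \<in> ball (snd c x) r}" using open_chart_vimage[OF c(1)] by blast
  fix z assume z: "z \<in> {z \<in> fst c. snd c z \<in> ball (snd c x) r}"
  define ga where "ga = chart_inv c \<circ> (%t. snd c x + spline t *\<^sub>R (snd c z - snd c x))"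
  have "snd c x \<in> ball (snd c x) r" "snd c z \<in> ball (snd c x) r" using r z by auto
  note seg = segment_curve[OF c(1) convex_ball r(2) this, folded ga_def]
  show "connectable x z" unfolding connectable_def
   by (rule exI[of _ ga]) (use seg(1,4,5) c z in auto)
 qed (use c r in auto)
qed

text \<open>The points connectable to \<open>x\<close> form an open set with open
  complement.\<close>

lemma connectable_connected:
 assumes S: "connected S" "x \<in> S" "z \<in> S"
 shows "connectable x z"
proof -
 let ?C = "{z. connectable x z}"
 have "open ?C"
 proof (subst open_subopen, clarify)
  fix z assume z: "connectable x z"
  obtain U where U: "open U" "z \<in> U" "\<And>w. w \<in> U ==> connectable z w" using connectable_local[of z] by blast
  thus "\<exists>T. open T \<and> z \<in> T \<and> T \<subseteq> ?C" using connectable_trans[OF z] by blast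
 qed
 moreover have "open (- ?C)"
 proof (subst open_subopen, rule ballI)
  fix z assume z: "z \<in> - ?C"
  obtain U where U: "open U" "z \<in> U" "\<And>w. w \<in> U ==> connectable z w" using connectable_local[of z] by blast
  hence "U \<subseteq> - ?C" using connectable_trans connectable_sym z by blast
  thus "\<exists>T. open T \<and> z \<in> T \<and> T \<subseteq> - ?C" using U by blast
 qed
 moreover have "connectable x x" using connectable_local[of x] by blast
 ultimately show ?thesis
  using S connectedD[OF S(1), of ?C "- ?C"] by blast
qed

end

section \<open>The flow in local coordinates\<close>

text \<open>Makes local statements uniform over a compact set. One number \<open>e\<close> stands
  for all constants of a statement, as a radius and as \<open>1 / e\<close> for a bound;
  monotonicity in \<open>e\<close> then lets the minimum over a finite subcover work.\<close>

lemma compact_uniform: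
 assumes S: "compact S"
  and loc: "\<And>x. x \<in> S ==> \<exists>U e. open U \<and> x \<in> U \<and> 0 < e \<and> (\<forall>y\<in>U \<inter> S. P y e)"
  and mono: "\<And>y e e'. P y e ==> 0 < e' ==> e' <= e ==> P y e'"
 shows "\<exists>e>0::real. \<forall>y\<in>S. P y e"
proof -
 obtain U e where Ue: "\<And>x. x \<in> S ==> open (U x) \<and> x \<in> U x \<and> 0 < e x \<and> (\<forall>y\<in>U x \<inter> S. P y (e x))"
  using loc by metis
 obtain F where F: "F \<subseteq> S" "finite F" "S \<subseteq> (\<Union>x\<in>F. U x)"
  by (rule compactE_image[OF S, of S U]) (use Ue in auto)
 define e0 where "e0 = Min (insert 1 (e ` F))"
 have "e0 > 0" using F Ue by (auto simp: e0_def)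
 moreover have "P y e0" if y: "y \<in> S" for y
 proof -
  obtain x where x: "x \<in> F" "y \<in> U x" using F y by blast
  have "e0 <= e x" using F x by (simp add: e0_def)
  thus ?thesis using mono[of y "e x" e0] Ue[of x] x F y \<open>e0 > 0\<close> by blast
 qed
 ultimately show ?thesis by blast
qed

locale basic_flow = riemannian_atlas A G
 for A :: "('a::t2_space, 'e::euclidean_space) chart set" and G :: "('a, 'e) metric_tensor" +
 fixes T :: "real => 'a => 'a" and X :: "'a set"
 assumes compact_UNIV: "compact (UNIV :: 'a set)" and flow: "C1_flow A T" and basic: "basic_set A G T X"
begin

abbreviation d :: "'a => 'a => real" where "d \<equiv> riemannian_dist A G"

lemma T_0 [simp]: "T 0 x = x"
 using flow by (simp add: C1_flow_def)

lemma T_add: "T (s + t) x = T s (T t x)"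
 using flow by (simp add: C1_flow_def)

lemma T_inverse [simp]: "T (- t) (T t x) = x" "T t (T (- t) x) = x"
 by (simp_all add: T_add[symmetric])

lemma continuous_T: "continuous_on UNIV (%(t, x). T t x)"
 using flow by (simp add: C1_flow_def)

lemma continuous_T_compose:
 "continuous_on S u ==> continuous_on S g ==> continuous_on S (%y. T (u y) (g y))"
 using continuous_on_compose2[OF continuous_T, of S "%y. (u y, g y)"] by (simp add: continuous_on_Pair)

lemma compact_X: "compact X"
 using basic compact_UNIV closed_Int_compact[of X UNIV] unfolding basic_set_def hyperbolic_set_def by simp

lemma T_image_X: "T t ` X = X"
 using basic unfolding basic_set_def hyperbolic_set_def flow_invariant_def by simp

lemma T_in_X [simp]: "x \<in> X ==> T t x \<in> X"
 using T_image_X by blast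

text \<open>\<open>X\<close> lies in the closure of a single orbit, which is connected in the
  manifold. The connecting curves are allowed to leave \<open>X\<close>.\<close>

lemma connectable_X: assumes "x \<in> X" "z \<in> X" shows "connectable x z"
proof -
 obtain x0 where x0: "X \<subseteq> closure (range (%t. T t x0))"
  using basic unfolding basic_set_def topologically_transitive_on_def by (elim conjE bexE)
 have "connected (range (%t. T t x0))"
  by (intro connected_continuous_image continuous_T_compose continuous_intros connected_UNIV)
 hence "connected (closure (range (%t. T t x0)))" by (rule connected_imp_connected_closure)
 thus ?thesis using connectable_connected assms x0 by blast
qed

definition dom :: "('a, 'e) chart => ('a, 'e) chart => (real \<times> 'e) set" where
 "dom c c' = {(t, p). p \<in> snd c ` fst c \<and> T t (chart_inv c p) \<in> fst c'}"

definition flow_map :: "('a, 'e) chart => ('a, 'e) chart => real \<times> 'e => 'e" where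
 "flow_map c c' = (%(t, p). snd c' (T t (chart_inv c p)))"

text \<open>The derivative in time and space together, because small time shifts have to be weighed
  against small displacements.\<close>

definition flow_deriv :: "('a, 'e) chart => ('a, 'e) chart => real => 'a => real \<times> 'e => 'e" where
 "flow_deriv c c' t x = frechet_derivative (flow_map c c') (at (t, snd c x))"

lemma flow_map_C1: "c \<in> A ==> c' \<in> A ==> Ck_on 1 (dom c c') (flow_map c c')"
 using flow unfolding C1_flow_def dom_def flow_map_def by blast

lemma open_dom: assumes "c \<in> A" "c' \<in> A" shows "open (dom c c')"
proof -
 have "continuous_on (UNIV \<times> snd c ` fst c) (%z. T (fst z) (chart_inv c (snd z)))"
  by (intro continuous_T_compose continuous_on_compose2[OF continuous_chart(2)[OF assms(1)]] continuous_intros) auto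
 hence "open ((%z. T (fst z) (chart_inv c (snd z))) -` fst c' \<inter> (UNIV \<times> snd c ` fst c))"
  using open_chart[OF assms(1)] open_chart[OF assms(2)] by (intro continuous_on_open_vimage[THEN iffD1, rule_format]) (auto intro: open_Times)
 moreover have "(%z. T (fst z) (chart_inv c (snd z))) -` fst c' \<inter> (UNIV \<times> snd c ` fst c) = dom c c'"
  by (auto simp: dom_def)
 ultimately show ?thesis by simp
qed

context
 fixes c c' t x assumes c: "c \<in> A" "c' \<in> A" "x \<in> fst c" "T t x \<in> fst c'"
begin

lemma in_dom: "(t, snd c x) \<in> dom c c'"
 using c by (simp add: dom_def)

lemma flow_map_at: "flow_map c c' (t, snd c x) = snd c' (T t x)"
 using c by (simp add: flow_map_def)

lemma flow_has_derivative: "(flow_map c c' has_derivative flow_deriv c c' t x) (at (t, snd c x))"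
 using flow_map_C1[OF c(1,2)] in_dom unfolding flow_deriv_def Ck_on_1_iff
 by (metis frechet_derivative_works)

lemma linear_flow_deriv: "linear (flow_deriv c c' t x)"
 using flow_has_derivative by (rule has_derivative_linear)

lemma flow_strict:
 assumes "e > 0"
 obtains de where "de > 0"
  "\<And>s p. \<bar>s - t\<bar> < de ==> p \<in> ball (snd c x) de ==> (s, p) \<in> dom c c'"
  "\<And>s p s' p'. \<bar>s - t\<bar> < de ==> \<bar>s' - t\<bar> < de ==> p \<in> ball (snd c x) de ==> p' \<in> ball (snd c x) de ==>
    norm (flow_map c c' (s, p) - flow_map c c' (s', p') - flow_deriv c c' t x (s - s', p - p'))
     <= e * (\<bar>s - s'\<bar> + norm (p - p'))"
proof -
 obtain de where de: "de > 0" "ball (t, snd c x) de \<subseteq> dom c c'"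
  "\<And>y z. y \<in> ball (t, snd c x) de ==> z \<in> ball (t, snd c x) de ==>
    norm (flow_map c c' y - flow_map c c' z - flow_deriv c c' t x (y - z)) <= e * norm (y - z)"
  using Ck_on_1_strictly_differentiable[OF flow_map_C1[OF c(1,2)] open_dom[OF c(1,2)] in_dom assms]
  unfolding flow_deriv_def by blast
 have np: "norm (a, b) <= \<bar>a\<bar> + norm b" for a :: real and b :: 'e
  using sqrt_sum_squares_le_sum_abs[of a "norm b"] by (simp add: norm_Pair)
 have in_ball: "(s, p) \<in> ball (t, snd c x) de" if "\<bar>s - t\<bar> < de / 2" "p \<in> ball (snd c x) (de / 2)" for s p
  using that np[of "t - s" "snd c x - p"] by (simp add: dist_norm abs_minus_commute)
 show thesis
 proof (rule that[of "de / 2"])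
  fix s p s' p' assume a: "\<bar>s - t\<bar> < de / 2" "\<bar>s' - t\<bar> < de / 2" "p \<in> ball (snd c x) (de / 2)" "p' \<in> ball (snd c x) (de / 2)"
  have "norm (flow_map c c' (s, p) - flow_map c c' (s', p') - flow_deriv c c' t x ((s, p) - (s', p')))
    <= e * norm ((s, p) - (s', p'))"
   using a in_ball by (intro de(3)) auto
  also have "... <= e * (\<bar>s - s'\<bar> + norm (p - p'))" using np[of "s - s'" "p - p'"] assms by simp
  finally show "norm (flow_map c c' (s, p) - flow_map c c' (s', p') - flow_deriv c c' t x (s - s', p - p'))
     <= e * (\<bar>s - s'\<bar> + norm (p - p'))" by simp
 qed (use de in_ball in auto)
qed

lemma deriv_in_charts_eq: "deriv_in_charts c c' (T t) x v = flow_deriv c c' t x (0, v)"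
proof -
 have "((%p. (t, p)) has_derivative (%v. (0, v))) (at (snd c x))"
  by (intro has_derivative_Pair has_derivative_const has_derivative_ident)
 from has_derivative_compose[OF this flow_has_derivative]
 have "((%p. flow_map c c' (t, p)) has_derivative (%v. flow_deriv c c' t x (0, v))) (at (snd c x))" .
 moreover have "(%p. flow_map c c' (t, p)) = snd c' \<circ> T t \<circ> chart_inv c"
  by (simp add: flow_map_def fun_eq_iff)
 ultimately show ?thesis
  unfolding deriv_in_charts_def by (metis frechet_derivative_at)
qed

end

lemma generator_eq:
 assumes c: "c \<in> A" "x \<in> fst c"
 shows "generator T c x = flow_deriv c c 0 x (1, 0)"
  and "((%t. snd c (T t x)) has_vector_derivative generator T c x) (at 0)"
proof -
 have "((%t. (t, snd c x)) has_derivative (%h. (h, 0))) (at 0)"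
  by (intro has_derivative_Pair has_derivative_const has_derivative_ident)
 from has_derivative_compose[OF this, of "flow_map c c" "flow_deriv c c 0 x"]
 have *: "((%t. flow_map c c (t, snd c x)) has_derivative (%h. flow_deriv c c 0 x (h, 0))) (at 0)"
  using flow_has_derivative[of c c x 0] c by simp
 have lin: "linear (flow_deriv c c 0 x)" using linear_flow_deriv[of c c x 0] c by simp
 have "(%h. flow_deriv c c 0 x (h, 0)) = (%h. h *\<^sub>R flow_deriv c c 0 x (1, 0))"
 proof (rule ext)
  fix h :: real
  have "(h, 0) = h *\<^sub>R (1 :: real, 0 :: 'e)" by simp
  thus "flow_deriv c c 0 x (h, 0) = h *\<^sub>R flow_deriv c c 0 x (1, 0)"
   by (simp only: linear_scale[OF lin])
 qed
 moreover have "(%t. flow_map c c (t, snd c x)) = (%t. snd c (T t x))"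
  using c by (simp add: flow_map_def)
 ultimately have "((%t. snd c (T t x)) has_vector_derivative flow_deriv c c 0 x (1, 0)) (at 0)"
  using * unfolding has_vector_derivative_def by metis
 moreover from this show "generator T c x = flow_deriv c c 0 x (1, 0)"
  unfolding generator_def by (rule vector_derivative_at)
 ultimately show "((%t. snd c (T t x)) has_vector_derivative generator T c x) (at 0)" by simp
qed

lemma open_orbit_vimage: "open U ==> open ((%t. T t x) -` U)"
 by (intro open_vimage continuous_T_compose continuous_intros)

text \<open>A zero of the generator propagates along the orbit by the chain rule, so the orbit is
  locally constant in charts and hence constant; a basic set contains no fixed points.\<close>

lemma generator_nonzero:
 assumes x: "x \<in> X" and c: "c \<in> A" "x \<in> fst c"
 shows "generator T c x ~= 0"
proof
 assume z: "generator T c x = 0"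
 have loc: "\<exists>U. open U \<and> t \<in> U \<and> (\<forall>s\<in>U. T s x = T t x)" for t
 proof -
  obtain c' where c': "c' \<in> A" "T t x \<in> fst c'" using ex_chart by metis
  let ?W = "(%s. T s x) -` fst c'"
  have W: "open ?W" "t \<in> ?W" using open_orbit_vimage open_chart c' by auto
  obtain e where e: "e > 0" "ball t e \<subseteq> ?W" by (rule openE[OF W])
  have d0: "((%s. snd c' (T s x)) has_vector_derivative 0) (at s)" if s: "s \<in> ?W" for s
  proof -
   have cs: "c \<in> A" "c' \<in> A" "x \<in> fst c" "T s x \<in> fst c'" using c c' s by auto
   have "((%h. (s, snd c (T h x))) has_vector_derivative (0, 0)) (at 0)"
    using generator_eq(2)[OF c] z
    by (intro has_vector_derivative_Pair has_vector_derivative_const) simp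
   moreover have "(flow_map c c' has_derivative flow_deriv c c' s x) (at (s, snd c (T 0 x)))"
    using flow_has_derivative[OF cs] by simp
   ultimately have "((flow_map c c' \<circ> (%h. (s, snd c (T h x)))) has_vector_derivative flow_deriv c c' s x (0, 0)) (at 0)"
    using vector_derivative_diff_chain_within[of "%h. (s, snd c (T h x))" "(0,0)" 0 UNIV "flow_map c c'" "flow_deriv c c' s x"]
    by (simp add: has_derivative_at_withinI)
   moreover have "flow_deriv c c' s x (0, 0) = 0" using linear_0[OF linear_flow_deriv[OF cs]] by (simp add: zero_prod_def)
   ultimately have "((flow_map c c' \<circ> (%h. (s, snd c (T h x)))) has_vector_derivative 0) (at 0)" by simp
   hence 1: "((%h. snd c' (T (s + h) x)) has_vector_derivative 0) (at 0)"
   proof (rule has_vector_derivative_transform_within_open)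
    show "open ((%t. T t x) -` fst c)" "0 \<in> (%t. T t x) -` fst c"
     using open_orbit_vimage open_chart c by auto
   qed (use c in \<open>auto simp: flow_map_def T_add\<close>)
   have "((%r. r - s) has_vector_derivative 1) (at s)"
    by (auto intro!: derivative_eq_intros simp: has_real_derivative_iff_has_vector_derivative[symmetric])
   from vector_diff_chain_at[OF this, of "%h. snd c' (T (s + h) x)" 0] 1
   show ?thesis by (simp add: comp_def)
  qed
  have same: "snd c' (T s x) = snd c' (T t x)" if s: "s \<in> ball t e" for s
  proof -
   have "\<exists>k. \<forall>s\<in>ball t e. snd c' (T s x) = k"
   proof (rule has_derivative_zero_constant[OF convex_ball])
    fix u assume "u \<in> ball t e"
    hence "u \<in> ?W" using e(2) by (rule subsetD[rotated])
    hence "((%s. snd c' (T s x)) has_vector_derivative 0) (at u within ball t e)"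
     by (rule has_vector_derivative_at_within[OF d0])
    thus "((%s. snd c' (T s x)) has_derivative (%h. 0)) (at u within ball t e)"
     by (simp add: has_vector_derivative_def)
   qed
   then obtain k where k: "\<forall>s\<in>ball t e. snd c' (T s x) = k" by (elim exE)
   have "t \<in> ball t e" using e(1) by simp
   thus ?thesis using k s by metis
  qed
  have eq: "T s x = T t x" if s: "s \<in> ball t e" for s
  proof -
   have "T s x \<in> fst c'" using e(2) s by auto
   hence "T s x = chart_inv c' (snd c' (T s x))" using c' by simp
   also have "... = T t x" unfolding same[OF s] using c' by simp
   finally show ?thesis .
  qed
  show ?thesis
   by (intro exI[of _ "ball t e"] conjI ballI open_ball eq) (simp_all add: e(1))
 qed
 have "T 0 x = T t x" for t
 proof (rule connected_local_const[OF connected_UNIV UNIV_I UNIV_I], rule ballI)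
  fix t
  obtain U where U: "open U" "t \<in> U" "\<forall>s\<in>U. T s x = T t x" using loc[of t] by (elim exE conjE)
  have "\<forall>\<^sub>F s in at t. s \<in> U" using U(1,2) by (rule eventually_at_in_open')
  thus "\<forall>\<^sub>F s in at t. T t x = T s x"
   by (rule eventually_mono) (rule U(3)[rule_format, symmetric])
 qed
 moreover have "\<not> fixed_point T x" using basic x by (simp add: basic_set_def)
 ultimately show False by (metis T_0 fixed_point_def)
qed

end

section \<open>Uniform local estimates on the basic set\<close>

context basic_flow
begin

text \<open>
 That the comparison with the Riemannian norm at \<open>x0\<close> has the absolute constant 2 matters when it
 is applied along a whole orbit.
\<close>

definition coords :: "('a, 'e) chart => 'a => real => real => bool" where
 "coords c x0 r0 K \<longleftrightarrow> r0 > 0 \<and> K > 0 \<and> cball (snd c x0) r0 \<subseteq> snd c ` fst c \<and>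
  (\<forall>x z. x \<in> fst c --> z \<in> fst c --> snd c x \<in> ball (snd c x0) r0 --> snd c z \<in> ball (snd c x0) r0 -->
    norm (snd c z - snd c x) <= K * d x z \<and> tangent_norm G c x0 (snd c z - snd c x) <= 2 * d x z \<and>
    d x z <= K * norm (snd c z - snd c x) \<and> d x z <= 2 * tangent_norm G c x0 (snd c z - snd c x)) \<and>
  (\<forall>r>0. \<exists>V rh. open V \<and> x0 \<in> V \<and> V \<subseteq> fst c \<and> rh > 0 \<and> (\<forall>x\<in>V. snd c x \<in> ball (snd c x0) r) \<and>
    (\<forall>x\<in>V \<inter> X. \<forall>z\<in>X. d x z < rh --> z \<in> fst c \<and> snd c z \<in> ball (snd c x0) r))"

lemma coordsD:
 assumes "coords c x0 r0 K"
 shows "r0 > 0" "K > 0" "cball (snd c x0) r0 \<subseteq> snd c ` fst c"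
 using assms by (simp_all add: coords_def)

lemma coords_lip:
 assumes "coords c x0 r0 K" "x \<in> fst c" "z \<in> fst c" "snd c x \<in> ball (snd c x0) r0" "snd c z \<in> ball (snd c x0) r0"
 shows "norm (snd c z - snd c x) <= K * d x z" "tangent_norm G c x0 (snd c z - snd c x) <= 2 * d x z"
  "d x z <= K * norm (snd c z - snd c x)" "d x z <= 2 * tangent_norm G c x0 (snd c z - snd c x)"
  "0 <= d x z"
proof -
 show 1: "norm (snd c z - snd c x) <= K * d x z" "tangent_norm G c x0 (snd c z - snd c x) <= 2 * d x z"
  "d x z <= K * norm (snd c z - snd c x)" "d x z <= 2 * tangent_norm G c x0 (snd c z - snd c x)"
  using assms unfolding coords_def by simp_all
 have "0 <= K * d x z" using 1(1) norm_ge_zero order_trans by blast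
 thus "0 <= d x z" using coordsD(2)[OF assms(1)] by (simp add: zero_le_mult_iff)
qed

lemma coords_nbhd:
 assumes "coords c x0 r0 K" "r > 0"
 obtains V rh where "open V" "x0 \<in> V" "V \<subseteq> fst c" "rh > 0" "\<forall>x\<in>V. snd c x \<in> ball (snd c x0) r"
  "\<forall>x\<in>V \<inter> X. \<forall>z\<in>X. d x z < rh --> z \<in> fst c \<and> snd c z \<in> ball (snd c x0) r"
 using assms unfolding coords_def by (elim conjE) (drule spec, drule mp, assumption, elim exE conjE, rule that)

lemma local_coords:
 assumes c: "c \<in> A" "x0 \<in> fst c" and x0: "x0 \<in> X"
 obtains r0 K where "coords c x0 r0 K"
proof -
 obtain r0 where r0: "r0 > 0" "cball (snd c x0) r0 \<subseteq> snd c ` fst c"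
  "\<And>p q. p \<in> ball (snd c x0) r0 ==> q \<in> ball (snd c x0) r0 ==>
    tangent_norm G c x0 (q - p) <= 2 * d (chart_inv c p) (chart_inv c q)"
  "\<And>p q. p \<in> ball (snd c x0) r0 ==> q \<in> ball (snd c x0) r0 ==>
    d (chart_inv c p) (chart_inv c q) <= 2 * tangent_norm G c x0 (q - p)"
  using riemannian_dist_local[OF c] by blast
 obtain K where K: "K > 0" "\<And>v. norm v <= K * tangent_norm G c x0 v" "\<And>v. tangent_norm G c x0 v <= K * norm v"
  using tangent_norm_bounds[OF c] by blast
 show thesis
 proof (rule that, unfold coords_def, intro conjI allI impI)
  show "r0 > 0" "2 * K > 0" "cball (snd c x0) r0 \<subseteq> snd c ` fst c" using K r0 by simp_all
  fix x z assume xz: "x \<in> fst c" "z \<in> fst c" "snd c x \<in> ball (snd c x0) r0" "snd c z \<in> ball (snd c x0) r0"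
  let ?v = "snd c z - snd c x"
  have 1: "tangent_norm G c x0 ?v <= 2 * d x z" "d x z <= 2 * tangent_norm G c x0 ?v"
   using r0(3)[OF xz(3,4)] r0(4)[OF xz(3,4)] xz(1,2) c(1) by simp_all
  have "norm ?v <= K * (2 * d x z)" using K(2)[of ?v] 1(1) K(1) by (meson mult_left_mono less_imp_le order_trans)
  moreover have "d x z <= 2 * (K * norm ?v)" using 1(2) K(3)[of ?v] by linarith
  ultimately show "norm ?v <= 2 * K * d x z" "tangent_norm G c x0 ?v <= 2 * d x z"
    "d x z <= 2 * K * norm ?v" "d x z <= 2 * tangent_norm G c x0 ?v" using 1 by (simp_all add: mult_ac)
 next
  fix r :: real assume r: "r > 0"
  obtain r' rh where r': "r' > 0" "rh > 0"
   "\<And>x z. x \<in> fst c ==> snd c x \<in> ball (snd c x0) r' ==> connectable x z ==> d x z < rh ==>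
     z \<in> fst c \<and> snd c z \<in> ball (snd c x0) r" using riemannian_dist_escape[OF c r] by metis
  let ?V = "{x \<in> fst c. snd c x \<in> ball (snd c x0) (min r r')}"
  have "open ?V" by (rule open_chart_vimage[OF c(1) open_ball])
  moreover have "x0 \<in> ?V" "?V \<subseteq> fst c" "\<forall>x\<in>?V. snd c x \<in> ball (snd c x0) r" using c r r' by auto
  moreover have "\<forall>x\<in>?V \<inter> X. \<forall>z\<in>X. d x z < rh --> z \<in> fst c \<and> snd c z \<in> ball (snd c x0) r"
   using r'(3) connectable_X by auto
  ultimately show "\<exists>V rh. open V \<and> x0 \<in> V \<and> V \<subseteq> fst c \<and> rh > 0 \<and> (\<forall>x\<in>V. snd c x \<in> ball (snd c x0) r) \<and>
    (\<forall>x\<in>V \<inter> X. \<forall>z\<in>X. d x z < rh --> z \<in> fst c \<and> snd c z \<in> ball (snd c x0) r)"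
   using r'(2) by blast
 qed
qed

lemma d_refl [simp]: assumes "x \<in> X" shows "d x x = 0"
proof -
 obtain c where c: "c \<in> A" "x \<in> fst c" using ex_chart by metis
 obtain r0 K where rK: "coords c x r0 K" using local_coords[OF c assms] by blast
 have x: "snd c x \<in> ball (snd c x) r0" using coordsD(1)[OF rK] by simp
 show ?thesis using coords_lip(3,5)[OF rK c(2) c(2) x x] by simp
qed

text \<open>Points close to \<open>x\<close> lie in one chart, where \<open>d\<close> is comparable
  to the norm. The common base point of the two distances and the constant \<open>1 / e\<close> are
  the price of using charts in place of concatenated curves.\<close>

lemma d_quasi_triangle:
 "\<exists>e>0. \<forall>x\<in>X. \<forall>y\<in>X. \<forall>z\<in>X. d x y < e --> d x z < e --> 0 <= d y z \<and> d y z <= (1 / e) * (d x y + d x z)"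
proof -
 let ?P = "%x e. \<forall>y\<in>X. \<forall>z\<in>X. d x y < e --> d x z < e -->
  0 <= d x y \<and> 0 <= d x z \<and> 0 <= d y z \<and> d y z <= (1 / e) * (d x y + d x z)"
 have "\<exists>e>0. \<forall>x\<in>X. ?P x e"
 proof (rule compact_uniform[OF compact_X])
  fix x0 assume x0: "x0 \<in> X"
  obtain c where c: "c \<in> A" "x0 \<in> fst c" using ex_chart by metis
  obtain r0 K where co: "coords c x0 r0 K" using local_coords[OF c x0] by blast
  note rK = coordsD[OF co]
  obtain V rh where V: "open V" "x0 \<in> V" "V \<subseteq> fst c" "rh > 0" "\<forall>x\<in>V. snd c x \<in> ball (snd c x0) r0"
   "\<forall>x\<in>V \<inter> X. \<forall>z\<in>X. d x z < rh --> z \<in> fst c \<and> snd c z \<in> ball (snd c x0) r0"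
   by (rule coords_nbhd[OF co rK(1)])
  define e where "e = min rh (1 / (K * K))"
  have e: "e > 0" "e <= rh" "K * K <= 1 / e" using V rK by (auto simp: e_def min_def field_simps)
  have "?P x e" if x: "x \<in> V \<inter> X" for x
  proof (intro ballI impI)
   fix y z assume yz: "y \<in> X" "z \<in> X" "d x y < e" "d x z < e"
   have yc: "y \<in> fst c" "snd c y \<in> ball (snd c x0) r0" and zc: "z \<in> fst c" "snd c z \<in> ball (snd c x0) r0"
    using V(6) x yz e(2) by force+
   have xc: "x \<in> fst c" "snd c x \<in> ball (snd c x0) r0" using V(3,5) x by blast+
   note xy = coords_lip[OF co xc(1) yc(1) xc(2) yc(2)] and xz = coords_lip[OF co xc(1) zc(1) xc(2) zc(2)]
    and yz' = coords_lip[OF co yc(1) zc(1) yc(2) zc(2)]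
   have nn: "0 <= d x y" "0 <= d x z" "0 <= d y z"
    using xy(5) xz(5) yz'(5) .
   have "d y z <= K * norm (snd c z - snd c y)" by (rule yz'(3))
   also have "... <= K * (norm (snd c z - snd c x) + norm (snd c y - snd c x))"
    using norm_triangle_ineq4[of "snd c z - snd c x" "snd c y - snd c x"] rK(2) by simp
   also have "... <= K * (K * d x z + K * d x y)" using xy(1) xz(1) rK(2) by (intro mult_left_mono add_mono) auto
   also have "... = (K * K) * (d x y + d x z)" by (simp add: algebra_simps)
   also have "... <= (1 / e) * (d x y + d x z)" using e nn by (intro mult_right_mono) auto
   finally show "0 <= d x y \<and> 0 <= d x z \<and> 0 <= d y z \<and> d y z <= (1 / e) * (d x y + d x z)" using nn by simp
  qed
  thus "\<exists>U e. open U \<and> x0 \<in> U \<and> 0 < e \<and> (\<forall>x\<in>U \<inter> X. ?P x e)" using V(1,2) e(1) by blast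
 next
  fix x e e' assume P: "?P x e" and e': "0 < e'" "e' <= e"
  show "?P x e'"
  proof (intro ballI impI)
   fix y z assume yz: "y \<in> X" "z \<in> X" "d x y < e'" "d x z < e'"
   have *: "0 <= d x y \<and> 0 <= d x z \<and> 0 <= d y z \<and> d y z <= (1 / e) * (d x y + d x z)" using P yz e' by auto
   hence "(1 / e) * (d x y + d x z) <= (1 / e') * (d x y + d x z)"
    using e' by (intro mult_right_mono divide_left_mono) auto
   thus "0 <= d x y \<and> 0 <= d x z \<and> 0 <= d y z \<and> d y z <= (1 / e') * (d x y + d x z)" using * by linarith
  qed
 qed
 then obtain e where "e > 0" "\<forall>x\<in>X. ?P x e" by (elim exE conjE)
 thus ?thesis by (intro exI[of _ e]) simp
qed

lemma flow_lipschitz_chart: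
 assumes c: "c \<in> A" "c' \<in> A" "x \<in> fst c" "T t x \<in> fst c'" and r: "r > 0"
 obtains de M where "de > 0" "M > 0"
  "\<And>s p. \<bar>s - t\<bar> < de ==> p \<in> ball (snd c x) de ==>
    p \<in> snd c ` fst c \<and> T s (chart_inv c p) \<in> fst c' \<and> snd c' (T s (chart_inv c p)) \<in> ball (snd c' (T t x)) r"
  "\<And>s p s' p'. \<bar>s - t\<bar> < de ==> \<bar>s' - t\<bar> < de ==> p \<in> ball (snd c x) de ==> p' \<in> ball (snd c x) de ==>
    norm (snd c' (T s (chart_inv c p)) - snd c' (T s' (chart_inv c p'))) <= M * (\<bar>s - s'\<bar> + norm (p - p'))"
proof -
 obtain de where de: "de > 0"
  "\<And>s p. \<bar>s - t\<bar> < de ==> p \<in> ball (snd c x) de ==> (s, p) \<in> dom c c'"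
  "\<And>s p s' p'. \<bar>s - t\<bar> < de ==> \<bar>s' - t\<bar> < de ==> p \<in> ball (snd c x) de ==> p' \<in> ball (snd c x) de ==>
    norm (flow_map c c' (s, p) - flow_map c c' (s', p') - flow_deriv c c' t x (s - s', p - p'))
     <= 1 * (\<bar>s - s'\<bar> + norm (p - p'))"
  using flow_strict[OF c, of 1] by (metis zero_less_one)
 have "bounded_linear (flow_deriv c c' t x)" using flow_has_derivative[OF c] by (rule has_derivative_bounded_linear)
 then obtain L where L: "L > 0" "\<And>v. norm (flow_deriv c c' t x v) <= norm v * L"
  using bounded_linear.pos_bounded by blast
 define M where "M = 1 + L"
 define de' where "de' = min de (r / (3 * M))"
 have M: "M > 0" using L by (simp add: M_def)
 have de': "de' > 0" "de' <= de" "de' <= r / (3 * M)" using de(1) r M by (auto simp: de'_def)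
 have lip: "norm (flow_map c c' (s, p) - flow_map c c' (s', p')) <= M * (\<bar>s - s'\<bar> + norm (p - p'))"
  if "\<bar>s - t\<bar> < de'" "\<bar>s' - t\<bar> < de'" "p \<in> ball (snd c x) de'" "p' \<in> ball (snd c x) de'" for s s' p p'
 proof -
  let ?v = "(s - s', p - p')" and ?u = "flow_map c c' (s, p) - flow_map c c' (s', p')"
  have "norm (?u - flow_deriv c c' t x ?v) <= 1 * (\<bar>s - s'\<bar> + norm (p - p'))"
   using that de'(2) by (intro de(3)) auto
  moreover have "norm (flow_deriv c c' t x ?v) <= L * (\<bar>s - s'\<bar> + norm (p - p'))"
  proof -
   have "norm ?v <= \<bar>s - s'\<bar> + norm (p - p')"
    using sqrt_sum_squares_le_sum_abs[of "s - s'" "norm (p - p')"] by (simp add: norm_Pair)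
   hence "norm ?v * L <= (\<bar>s - s'\<bar> + norm (p - p')) * L" using L(1) by (intro mult_right_mono) auto
   thus ?thesis using L(2)[of ?v] by (simp add: mult.commute)
  qed
  moreover have "norm ?u <= norm (?u - flow_deriv c c' t x ?v) + norm (flow_deriv c c' t x ?v)"
   by (metis diff_add_cancel norm_triangle_ineq)
  ultimately show ?thesis by (simp add: M_def algebra_simps)
 qed
 show thesis
 proof (rule that[OF de'(1) M])
  fix s p assume sp: "\<bar>s - t\<bar> < de'" "p \<in> ball (snd c x) de'"
  have dm: "(s, p) \<in> dom c c'" using sp de'(2) by (intro de(2)) auto
  have "norm (flow_map c c' (s, p) - flow_map c c' (t, snd c x)) <= M * (\<bar>s - t\<bar> + norm (p - snd c x))"
   using sp de'(1) by (intro lip) auto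
  also have "... <= M * (de' + de')"
   using sp M by (intro mult_left_mono add_mono) (auto simp: dist_norm norm_minus_commute)
  also have "... < r" using de'(3) M r by (simp add: field_simps)
  finally have "snd c' (T s (chart_inv c p)) \<in> ball (snd c' (T t x)) r"
   using flow_map_at[OF c] by (simp add: flow_map_def dist_norm norm_minus_commute)
  thus "p \<in> snd c ` fst c \<and> T s (chart_inv c p) \<in> fst c' \<and> snd c' (T s (chart_inv c p)) \<in> ball (snd c' (T t x)) r"
   using dm by (simp add: dom_def)
 next
  fix s p s' p' assume "\<bar>s - t\<bar> < de'" "\<bar>s' - t\<bar> < de'" "p \<in> ball (snd c x) de'" "p' \<in> ball (snd c x) de'"
  thus "norm (snd c' (T s (chart_inv c p)) - snd c' (T s' (chart_inv c p'))) <= M * (\<bar>s - s'\<bar> + norm (p - p'))"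
   using lip by (simp add: flow_map_def)
 qed
qed

text \<open>Local Lipschitz bounds in charts, made uniform over the compact product of the time
  interval and \<open>X\<close>. The two times may differ, since orbits will be compared after time
  shifts.\<close>

lemma flow_lipschitz:
 "\<exists>e>0. \<forall>x\<in>X. \<forall>z\<in>X. \<forall>t\<in>{-1..1}. \<forall>s. d x z < e --> \<bar>s - t\<bar> < e -->
   d (T t x) (T s z) <= (1 / e) * (d x z + \<bar>s - t\<bar>)"
proof -
 let ?P = "%(t, x) e. \<forall>z\<in>X. \<forall>s. d x z < e --> \<bar>s - t\<bar> < e -->
   0 <= d x z \<and> d (T t x) (T s z) <= (1 / e) * (d x z + \<bar>s - t\<bar>)"
 have "\<exists>e>0. \<forall>y\<in>{-1..1} \<times> X. ?P y e"
 proof (rule compact_uniform)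
  show "compact ({-1..1::real} \<times> X)" by (intro compact_Times compact_X) auto
  fix y :: "real \<times> 'a" assume "y \<in> {-1..1} \<times> X"
  then obtain t0 x0 where y: "y = (t0, x0)" and x0: "x0 \<in> X" by auto
  obtain c where c: "c \<in> A" "x0 \<in> fst c" using ex_chart by metis
  obtain c' where c': "c' \<in> A" "T t0 x0 \<in> fst c'" using ex_chart by metis
  obtain r1 K1 where co1: "coords c x0 r1 K1" using local_coords[OF c x0] by blast
  obtain r2 K2 where co2: "coords c' (T t0 x0) r2 K2" using local_coords[OF c' T_in_X[OF x0]] by blast
  note rK1 = coordsD[OF co1] and rK2 = coordsD[OF co2]
  obtain de M where de: "de > 0" "M > 0"
   "\<And>s p. \<bar>s - t0\<bar> < de ==> p \<in> ball (snd c x0) de ==>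
     p \<in> snd c ` fst c \<and> T s (chart_inv c p) \<in> fst c' \<and> snd c' (T s (chart_inv c p)) \<in> ball (snd c' (T t0 x0)) r2"
   "\<And>s p s' p'. \<bar>s - t0\<bar> < de ==> \<bar>s' - t0\<bar> < de ==> p \<in> ball (snd c x0) de ==> p' \<in> ball (snd c x0) de ==>
     norm (snd c' (T s (chart_inv c p)) - snd c' (T s' (chart_inv c p'))) <= M * (\<bar>s - s'\<bar> + norm (p - p'))"
   using flow_lipschitz_chart[OF c(1) c'(1) c(2) c'(2) rK2(1)] by blast
  have "min r1 de > 0" using rK1 de by simp
  then obtain V rh where V: "open V" "x0 \<in> V" "V \<subseteq> fst c" "rh > 0" "\<forall>x\<in>V. snd c x \<in> ball (snd c x0) (min r1 de)"
   "\<forall>x\<in>V \<inter> X. \<forall>z\<in>X. d x z < rh --> z \<in> fst c \<and> snd c z \<in> ball (snd c x0) (min r1 de)"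
   by (rule coords_nbhd[OF co1])
  define N where "N = K2 * (M * (1 + K1))"
  have N: "N > 0" using rK1 rK2 de(2) by (simp add: N_def)
  define e where "e = min (min rh (de / 2)) (1 / N)"
  have e: "e > 0" "e <= rh" "e <= de / 2" "e <= 1 / N" using V(4) de(1) N by (simp_all add: e_def min.coboundedI1)
  hence e4: "N <= 1 / e" using N by (simp add: field_simps)
  have P: "?P (t, x) e" if tx: "(t, x) \<in> ({t0 - de/2 <..< t0 + de/2} \<times> V) \<inter> ({-1..1} \<times> X)" for t x
  proof (simp only: prod.case, intro ballI allI impI)
   fix z s assume z: "z \<in> X" "d x z < e" and s: "\<bar>s - t\<bar> < e"
   have x: "x \<in> V \<inter> X" and "t0 - de / 2 < t" "t < t0 + de / 2" using tx by auto
   hence t: "\<bar>t - t0\<bar> < de / 2" by linarith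
   have t': "\<bar>t - t0\<bar> < de" and s': "\<bar>s - t0\<bar> < de" using t s e(3) by linarith+
   have zc: "z \<in> fst c" "snd c z \<in> ball (snd c x0) r1" "snd c z \<in> ball (snd c x0) de"
    using V(6) x z e(2) by force+
   have xc: "x \<in> fst c" "snd c x \<in> ball (snd c x0) r1" "snd c x \<in> ball (snd c x0) de" using V(3,5) x by auto
   note xz = coords_lip[OF co1 xc(1) zc(1) xc(2) zc(2)]
   have nn: "0 <= d x z" by (rule xz(5))
   have tx': "T t x \<in> fst c'" "snd c' (T t x) \<in> ball (snd c' (T t0 x0)) r2"
    and sz': "T s z \<in> fst c'" "snd c' (T s z) \<in> ball (snd c' (T t0 x0)) r2"
    using de(3)[OF t' xc(3)] de(3)[OF s' zc(3)] xc(1) zc(1) c(1) by simp_all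
   have "d (T t x) (T s z) <= K2 * norm (snd c' (T s z) - snd c' (T t x))"
    by (rule coords_lip(3)[OF co2 tx'(1) sz'(1) tx'(2) sz'(2)])
   also have "... <= K2 * (M * (\<bar>s - t\<bar> + norm (snd c z - snd c x)))"
    using de(4)[OF s' t' zc(3) xc(3)] xc(1) zc(1) c(1) rK2 by simp
   also have "... <= K2 * (M * ((1 + K1) * (d x z + \<bar>s - t\<bar>)))"
   proof -
    have "\<bar>s - t\<bar> + norm (snd c z - snd c x) <= (1 + K1) * (d x z + \<bar>s - t\<bar>)"
     using xz(1) nn rK1(2) by (simp add: algebra_simps add_increasing)
    thus ?thesis using rK2 de(2) by simp
   qed
   also have "... = N * (d x z + \<bar>s - t\<bar>)" by (simp add: N_def mult_ac)
   also have "... <= (1 / e) * (d x z + \<bar>s - t\<bar>)" using e4 nn by (intro mult_right_mono) auto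
   finally show "0 <= d x z \<and> d (T t x) (T s z) <= (1 / e) * (d x z + \<bar>s - t\<bar>)" using nn by simp
  qed
  have "\<forall>w\<in>({t0 - de/2 <..< t0 + de/2} \<times> V) \<inter> ({-1..1} \<times> X). ?P w e"
  proof (rule ballI)
   fix w assume w: "w \<in> ({t0 - de/2 <..< t0 + de/2} \<times> V) \<inter> ({-1..1} \<times> X)"
   obtain t x where "w = (t, x)" by (rule prod.exhaust)
   with w show "?P w e" by (simp only: P)
  qed
  moreover have "open ({t0 - de/2 <..< t0 + de/2} \<times> V)" "y \<in> {t0 - de/2 <..< t0 + de/2} \<times> V"
   using V(1,2) de(1) y by (auto intro: open_Times)
  ultimately show "\<exists>U e. open U \<and> y \<in> U \<and> 0 < e \<and> (\<forall>w\<in>U \<inter> ({-1..1} \<times> X). ?P w e)" using e(1) by blast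
 next
  fix y e e' assume P: "?P y e" and e': "0 < e'" "e' <= e"
  obtain t x where y: "y = (t, x)" by fastforce
  have P: "0 <= d x z \<and> d (T t x) (T s z) <= (1 / e) * (d x z + \<bar>s - t\<bar>)" if "z \<in> X" "d x z < e" "\<bar>s - t\<bar> < e" for z s
   using P that unfolding y by simp
  show "?P y e'" unfolding y prod.case
  proof (intro ballI allI impI)
   fix z s assume z: "z \<in> X" "d x z < e'" "\<bar>s - t\<bar> < e'"
   have *: "0 <= d x z \<and> d (T t x) (T s z) <= (1 / e) * (d x z + \<bar>s - t\<bar>)" using z e' by (intro P) auto
   hence "(1 / e) * (d x z + \<bar>s - t\<bar>) <= (1 / e') * (d x z + \<bar>s - t\<bar>)"
    using e' by (intro mult_right_mono divide_left_mono) auto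
   thus "0 <= d x z \<and> d (T t x) (T s z) <= (1 / e') * (d x z + \<bar>s - t\<bar>)" using * by linarith
  qed
 qed
 then obtain e where e: "e > 0" "\<forall>y\<in>{-1..1} \<times> X. ?P y e" by (elim exE conjE)
 show ?thesis
 proof (intro exI[of _ e] conjI ballI allI impI)
  fix x z t s assume a: "x \<in> X" "z \<in> X" "t \<in> {-1..1}" "d x z < e" "\<bar>s - t\<bar> < e"
  hence "(t, x) \<in> {-1..1} \<times> X" by simp
  from bspec[OF e(2) this, unfolded prod.case, rule_format, OF a(2,4,5)]
  show "d (T t x) (T s z) <= (1 / e) * (d x z + \<bar>s - t\<bar>)" by (rule conjunct2)
 qed (rule e(1))
qed


text \<open>The generator does not vanish, so flowing for a small time \<open>a\<close> moves a
  point by at least a fixed multiple of \<open>|a|\<close>. Consequently two time shifts that bring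
  an orbit close to the same point are close to each other.\<close>

lemma time_shift_bound:
 "\<exists>e>0. \<forall>x\<in>X. \<forall>y\<in>X. \<forall>a. d x y < e --> d x (T a y) < e --> \<bar>a\<bar> < e -->
   \<bar>a\<bar> <= (1 / e) * (d x y + d x (T a y))"
proof -
 let ?P = "%x e. \<forall>y\<in>X. \<forall>a. d x y < e --> d x (T a y) < e --> \<bar>a\<bar> < e -->
   0 <= d x y + d x (T a y) \<and> \<bar>a\<bar> <= (1 / e) * (d x y + d x (T a y))"
 have "\<exists>e>0. \<forall>x\<in>X. ?P x e"
 proof (rule compact_uniform[OF compact_X])
  fix x0 assume x0: "x0 \<in> X"
  obtain c where c: "c \<in> A" "x0 \<in> fst c" using ex_chart by metis
  hence c0: "T 0 x0 \<in> fst c" by simp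
  let ?g = "generator T c x0"
  have g: "norm ?g > 0" using generator_nonzero[OF x0 c] by simp
  obtain r0 K where co: "coords c x0 r0 K" using local_coords[OF c x0] by blast
  note rK = coordsD[OF co]
  \<comment> \<open>The error \<open>norm ?g / 2\<close> leaves half of the displacement
    \<open>a *\<^sub>R ?g\<close>.\<close>
  obtain de where de: "de > 0"
   "\<And>s p s' p'. \<bar>s - 0\<bar> < de ==> \<bar>s' - 0\<bar> < de ==> p \<in> ball (snd c x0) de ==> p' \<in> ball (snd c x0) de ==>
     norm (flow_map c c (s, p) - flow_map c c (s', p') - flow_deriv c c 0 x0 (s - s', p - p'))
     <= (norm ?g / 2) * (\<bar>s - s'\<bar> + norm (p - p'))"
   using flow_strict[OF c(1) c(1) c(2) c0, of "norm ?g / 2"] g by (metis half_gt_zero)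
  have "min r0 de > 0" using rK de by simp
  then obtain V rh where V: "open V" "x0 \<in> V" "V \<subseteq> fst c" "rh > 0" "\<forall>x\<in>V. snd c x \<in> ball (snd c x0) (min r0 de)"
   "\<forall>x\<in>V \<inter> X. \<forall>z\<in>X. d x z < rh --> z \<in> fst c \<and> snd c z \<in> ball (snd c x0) (min r0 de)"
   by (rule coords_nbhd[OF co])
  define N where "N = 2 * K / norm ?g"
  have N: "N > 0" using rK g by (simp add: N_def)
  define e where "e = min (min rh de) (1 / N)"
  have e: "e > 0" "e <= rh" "e <= de" "e <= 1 / N" using V(4) de(1) N by (simp_all add: e_def min.coboundedI1)
  hence e4: "N <= 1 / e" using N by (simp add: field_simps)
  have "?P x e" if x: "x \<in> V \<inter> X" for x
  proof (intro ballI allI impI)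
   fix y a assume y: "y \<in> X" "d x y < e" "d x (T a y) < e" "\<bar>a\<bar> < e"
   have yc: "y \<in> fst c" "snd c y \<in> ball (snd c x0) r0" "snd c y \<in> ball (snd c x0) de"
    using V(6) x y(1,2) e(2) by force+
   have yc': "T a y \<in> fst c" "snd c (T a y) \<in> ball (snd c x0) r0"
    using V(6) x T_in_X[OF y(1)] y(3) e(2) by force+
   have xc: "x \<in> fst c" "snd c x \<in> ball (snd c x0) r0" using V(3,5) x by auto
   note xy = coords_lip[OF co xc(1) yc(1) xc(2) yc(2)] and xy' = coords_lip[OF co xc(1) yc'(1) xc(2) yc'(2)]
   have lin: "linear (flow_deriv c c 0 x0)" by (rule linear_flow_deriv[OF c(1) c(1) c(2) c0])
   have "flow_deriv c c 0 x0 (a, 0) = a *\<^sub>R ?g"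
   proof -
    have "(a, 0) = a *\<^sub>R (1 :: real, 0 :: 'e)" by simp
    thus ?thesis unfolding generator_eq(1)[OF c] by (simp only: linear_scale[OF lin])
   qed
   hence 1: "norm (snd c (T a y) - snd c y - a *\<^sub>R ?g) <= norm ?g / 2 * \<bar>a\<bar>"
    using de(2)[of a 0 "snd c y" "snd c y"] y(4) e(3) de(1) yc c(1) by (simp add: flow_map_def)
   have "norm (a *\<^sub>R ?g) <= norm (snd c (T a y) - snd c y) + norm (snd c (T a y) - snd c y - a *\<^sub>R ?g)"
    using norm_triangle_ineq4[of "snd c (T a y) - snd c y" "snd c (T a y) - snd c y - a *\<^sub>R ?g"] by simp
   moreover have "norm (snd c (T a y) - snd c y) <= norm (snd c (T a y) - snd c x) + norm (snd c y - snd c x)"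
    using norm_triangle_ineq4[of "snd c (T a y) - snd c x" "snd c y - snd c x"] by simp
   ultimately have "\<bar>a\<bar> * norm ?g / 2 <= K * d x (T a y) + K * d x y"
    using 1 xy(1) xy'(1) by (simp add: mult.commute)
   hence "\<bar>a\<bar> <= N * (d x y + d x (T a y))" using g by (simp add: N_def field_simps)
   also have "... <= (1 / e) * (d x y + d x (T a y))" using e4 xy(5) xy'(5) by (intro mult_right_mono) auto
   finally show "0 <= d x y + d x (T a y) \<and> \<bar>a\<bar> <= (1 / e) * (d x y + d x (T a y))" using xy(5) xy'(5) by simp
  qed
  thus "\<exists>U e. open U \<and> x0 \<in> U \<and> 0 < e \<and> (\<forall>x\<in>U \<inter> X. ?P x e)" using V(1,2) e(1) by blast
 next
  fix x e e' assume P: "?P x e" and e': "0 < e'" "e' <= e"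
  show "?P x e'"
  proof (intro ballI allI impI)
   fix y a assume y: "y \<in> X" "d x y < e'" "d x (T a y) < e'" "\<bar>a\<bar> < e'"
   have *: "0 <= d x y + d x (T a y) \<and> \<bar>a\<bar> <= (1 / e) * (d x y + d x (T a y))" using P y e' by auto
   hence "(1 / e) * (d x y + d x (T a y)) <= (1 / e') * (d x y + d x (T a y))"
    using e' by (intro mult_right_mono divide_left_mono) auto
   thus "0 <= d x y + d x (T a y) \<and> \<bar>a\<bar> <= (1 / e') * (d x y + d x (T a y))" using * by linarith
  qed
 qed
 then obtain e where "e > 0" "\<forall>x\<in>X. ?P x e" by (elim exE conjE)
 thus ?thesis by (intro exI[of _ e]) simp
qed

section \<open>Growth of tangent vectors and the neutral direction\<close>

lemma deriv_in_charts_inverse: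
 assumes c: "c \<in> A" "c' \<in> A" "x \<in> fst c" "T t x \<in> fst c'"
 shows "deriv_in_charts c' c (T (- t)) (T t x) (deriv_in_charts c c' (T t) x v) = v"
proof -
 have c2: "c' \<in> A" "c \<in> A" "T t x \<in> fst c'" "T (- t) (T t x) \<in> fst c" using c by simp_all
 have D1: "((%p. flow_map c c' (t, p)) has_derivative deriv_in_charts c c' (T t) x) (at (snd c x))"
 proof -
  have "((%p. (t, p)) has_derivative (%v. (0, v))) (at (snd c x))"
   by (intro has_derivative_Pair has_derivative_const has_derivative_ident)
  from has_derivative_compose[OF this flow_has_derivative[OF c]] show ?thesis
   by (simp add: deriv_in_charts_eq[OF c, abs_def])
 qed
 have D2: "((%p. flow_map c' c (- t, p)) has_derivative deriv_in_charts c' c (T (- t)) (T t x)) (at (flow_map c c' (t, snd c x)))"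
 proof -
  have "((%p. (- t, p)) has_derivative (%v. (0, v))) (at (snd c' (T t x)))"
   by (intro has_derivative_Pair has_derivative_const has_derivative_ident)
  from has_derivative_compose[OF this flow_has_derivative[OF c2]] show ?thesis
   by (simp add: deriv_in_charts_eq[OF c2, abs_def] flow_map_at[OF c])
 qed
 have "((%p. flow_map c' c (- t, flow_map c c' (t, p))) has_derivative
   (%v. deriv_in_charts c' c (T (- t)) (T t x) (deriv_in_charts c c' (T t) x v))) (at (snd c x))"
  by (rule has_derivative_compose[OF D1 D2])
 moreover have "((%p. flow_map c' c (- t, flow_map c c' (t, p))) has_derivative (%v. v)) (at (snd c x))"
 proof (rule has_derivative_transform_within_open[OF has_derivative_ident])
  have "continuous_on (snd c ` fst c) (%p. T t (chart_inv c p))"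
   by (intro continuous_T_compose continuous_intros continuous_chart(2)[OF c(1)])
  thus "open ((%p. T t (chart_inv c p)) -` fst c' \<inter> snd c ` fst c)"
   using continuous_on_open_vimage open_chart[OF c(1)] open_chart[OF c(2)] by blast
  show "snd c x \<in> (%p. T t (chart_inv c p)) -` fst c' \<inter> snd c ` fst c" using c by auto
  show "p = flow_map c' c (- t, flow_map c c' (t, p))" if "p \<in> (%p. T t (chart_inv c p)) -` fst c' \<inter> snd c ` fst c" for p
   using that c by (auto simp: flow_map_def)
 qed
 ultimately show ?thesis using has_derivative_unique by metis
qed

lemma tangent_norm_triangle:
 assumes "c \<in> A" "x \<in> fst c"
 shows "tangent_norm G c x (v + w) <= tangent_norm G c x v + tangent_norm G c x w"
  and "tangent_norm G c x (r *\<^sub>R v) = \<bar>r\<bar> * tangent_norm G c x v"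
  and "0 <= tangent_norm G c x v" and "tangent_norm G c x v = 0 \<longleftrightarrow> v = 0"
  and "continuous_on UNIV (tangent_norm G c x)"
proof -
 interpret s: scalar_product "G c x" using scalar_product[OF assms] .
 show "tangent_norm G c x (v + w) <= tangent_norm G c x v + tangent_norm G c x w"
  "tangent_norm G c x (r *\<^sub>R v) = \<bar>r\<bar> * tangent_norm G c x v"
  using s.nrm_triangle s.nrm_scale by (simp_all add: tangent_norm_def)
 show "0 <= tangent_norm G c x v" "tangent_norm G c x v = 0 \<longleftrightarrow> v = 0"
  using s.nonneg[of v] s.pos[of v] by (cases "v = 0"; simp add: tangent_norm_def)+
 show "continuous_on UNIV (tangent_norm G c x)"
  unfolding tangent_norm_def[abs_def] by (intro continuous_intros s.cont)
qed

text \<open>The derivative of \<open>T t\<close> maps the velocity of the orbit at \<open>x\<close>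
  to its velocity at \<open>T t x\<close>, whose norm is at most twice the Lipschitz constant of the
  flow in time. The bound depends neither on \<open>t\<close> nor on the charts.\<close>

lemma generator_transport_bound:
 obtains C where "\<And>x t c c'. x \<in> X ==> c \<in> A ==> c' \<in> A ==> x \<in> fst c ==> T t x \<in> fst c' ==>
  tangent_norm G c' (T t x) (deriv_in_charts c c' (T t) x (generator T c x)) <= C"
proof -
 obtain e where e: "e > 0" "\<forall>x\<in>X. \<forall>z\<in>X. \<forall>t\<in>{-1..1}. \<forall>s. d x z < e --> \<bar>s - t\<bar> < e -->
   d (T t x) (T s z) <= (1 / e) * (d x z + \<bar>s - t\<bar>)" using flow_lipschitz by (elim exE conjE)
 show thesis
 proof (rule that[of "2 / e"])
  fix x t c c' assume x: "x \<in> X" and c: "c \<in> A" "c' \<in> A" "x \<in> fst c" "T t x \<in> fst c'"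
  let ?y = "T t x" and ?D = "deriv_in_charts c c' (T t) x (generator T c x)"
  let ?g = "%r. snd c' (T t (T r x))"
  obtain r0 K where co: "coords c' ?y r0 K" using local_coords[OF c(2,4) T_in_X[OF x]] by blast
  obtain V rh where V: "open V" "?y \<in> V" "V \<subseteq> fst c'" "rh > 0" "\<forall>x\<in>V. snd c' x \<in> ball (snd c' ?y) r0"
   "\<forall>x\<in>V \<inter> X. \<forall>z\<in>X. d x z < rh --> z \<in> fst c' \<and> snd c' z \<in> ball (snd c' ?y) r0"
   by (rule coords_nbhd[OF co coordsD(1)[OF co]])
  have "((%h. (t, snd c (T h x))) has_vector_derivative (0, generator T c x)) (at 0)"
   using generator_eq(2)[OF c(1,3)] by (intro has_vector_derivative_Pair has_vector_derivative_const)
  moreover have "(flow_map c c' has_derivative flow_deriv c c' t x) (at (t, snd c (T 0 x)))"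
   using flow_has_derivative[OF c] by simp
  ultimately have "((flow_map c c' \<circ> (%h. (t, snd c (T h x)))) has_vector_derivative ?D) (at 0)"
   using vector_derivative_diff_chain_within[of "%h. (t, snd c (T h x))" "(0, generator T c x)" 0 UNIV "flow_map c c'" "flow_deriv c c' t x"]
   by (simp add: has_derivative_at_withinI deriv_in_charts_eq[OF c])
  hence "(?g has_vector_derivative ?D) (at 0)"
  proof (rule has_vector_derivative_transform_within_open)
   show "open ((%t. T t x) -` fst c)" "0 \<in> (%t. T t x) -` fst c"
    using open_orbit_vimage open_chart c by auto
  qed (use c in \<open>auto simp: flow_map_def\<close>)
  hence lim: "((%h. (?g h - ?g 0) /\<^sub>R h) \<longlongrightarrow> ?D) (at 0)"
  proof -
   have "((%h. norm (?g h - ?g 0 - h *\<^sub>R ?D) / norm h) \<longlongrightarrow> 0) (at 0)"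
    using \<open>(?g has_vector_derivative ?D) (at 0)\<close> unfolding has_vector_derivative_def has_derivative_at by simp
   moreover have "\<forall>\<^sub>F h::real in at 0. norm (?g h - ?g 0 - h *\<^sub>R ?D) / norm h = norm ((?g h - ?g 0) /\<^sub>R h - ?D)"
   proof (rule eventually_mono)
    show "\<forall>\<^sub>F h::real in at 0. h ~= 0" by (simp add: eventually_at_filter)
    fix h :: real assume "h ~= 0"
    hence "(?g h - ?g 0) /\<^sub>R h - ?D = (?g h - ?g 0 - h *\<^sub>R ?D) /\<^sub>R h" by (simp add: scaleR_diff_right)
    thus "norm (?g h - ?g 0 - h *\<^sub>R ?D) / norm h = norm ((?g h - ?g 0) /\<^sub>R h - ?D)"
     by (simp add: divide_inverse mult.commute)
   qed
   ultimately have "((%h. norm ((?g h - ?g 0) /\<^sub>R h - ?D)) \<longlongrightarrow> 0) (at 0)"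
    by (rule Lim_transform_eventually)
   thus ?thesis by (simp add: tendsto_norm_zero_iff LIM_zero_iff)
  qed
  have "((%h. tangent_norm G c' ?y ((?g h - ?g 0) /\<^sub>R h)) \<longlongrightarrow> tangent_norm G c' ?y ?D) (at 0)"
   by (rule continuous_on_tendsto_compose[OF tangent_norm_triangle(5)[OF c(2,4)] lim]) auto
  moreover have "\<forall>\<^sub>F h in at 0. tangent_norm G c' ?y ((?g h - ?g 0) /\<^sub>R h) <= 2 / e"
  proof -
   have "open ((%h. T h ?y) -` V)" "0 \<in> (%h. T h ?y) -` V" using open_orbit_vimage[OF V(1)] V(2) by auto
   hence "\<forall>\<^sub>F h in at 0. T h ?y \<in> V" using eventually_at_in_open' by fastforce
   moreover have "\<forall>\<^sub>F h in at 0. \<bar>h\<bar> < e" using e(1) unfolding eventually_at by (intro exI[of _ e]) (auto simp: dist_real_def)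
   moreover have "\<forall>\<^sub>F h::real in at 0. h ~= 0" by (simp add: eventually_at_filter)
   ultimately show ?thesis
   proof eventually_elim
    case (elim h)
    have eq: "T t (T h x) = T h ?y" by (simp add: T_add[symmetric] add.commute)
    have h: "T h ?y \<in> fst c'" "snd c' (T h ?y) \<in> ball (snd c' ?y) r0" "snd c' ?y \<in> ball (snd c' ?y) r0"
     using elim(1) V(3,5) coordsD(1)[OF co] by auto
    have "tangent_norm G c' ?y (?g h - ?g 0) <= 2 * d ?y (T h ?y)"
     using coords_lip(2)[OF co c(4) h(1) h(3) h(2)] eq by simp
    also have "... <= 2 * ((1 / e) * \<bar>h\<bar>)"
     using e(2)[rule_format, of ?y ?y 0 h] T_in_X[OF x] elim(2) e(1) by simp
    finally have "\<bar>inverse h\<bar> * tangent_norm G c' ?y (?g h - ?g 0) <= \<bar>inverse h\<bar> * (2 * ((1 / e) * \<bar>h\<bar>))"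
     by (intro mult_left_mono) auto
    also have "... = 2 / e" using elim(3) by (simp add: abs_inverse)
    finally show ?case by (simp only: tangent_norm_triangle(2)[OF c(2,4)])
   qed
  qed
  ultimately show "tangent_norm G c' ?y ?D <= 2 / e"
   by (intro tendsto_upperbound) auto
 qed
qed

lemma hyperbolic_splitting:
 obtains Es Eu where
  "\<And>c x v. c \<in> A ==> x \<in> X ==> x \<in> fst c ==> \<exists>al. \<exists>vs\<in>Es c x. \<exists>vu\<in>Eu c x. v = al *\<^sub>R generator T c x + vs + vu"
  "deriv_invariant A T X Es" "deriv_invariant A T X Eu"
  "exp_contracted A G T 1 X Es" "exp_contracted A G T (-1) X Eu"
proof -
 have "hyperbolic_set A G T X" using basic by (simp add: basic_set_def)
 then obtain Es Eu where E: "deriv_invariant A T X Es" "deriv_invariant A T X Eu"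
  "\<forall>c\<in>A. \<forall>x\<in>X \<inter> fst c. \<forall>v. \<exists>!w. w \<in> span {generator T c x} \<times> Es c x \<times> Eu c x \<and> v = fst w + fst (snd w) + snd (snd w)"
  "exp_contracted A G T 1 X Es" "exp_contracted A G T (-1) X Eu"
  unfolding hyperbolic_set_def by (elim conjE exE)
 show thesis
 proof (rule that[OF _ E(1,2,4,5)])
  fix c x v assume c: "c \<in> A" "x \<in> X" "x \<in> fst c"
  have "x \<in> X \<inter> fst c" using c by blast
  from ex1_implies_ex[OF E(3)[rule_format, OF c(1) this, of v]]
  obtain w where w: "w \<in> span {generator T c x} \<times> Es c x \<times> Eu c x" "v = fst w + fst (snd w) + snd (snd w)"
   by (elim exE conjE)
  hence "fst w \<in> range (%k. k *\<^sub>R generator T c x)" by (simp add: mem_Times_iff span_singleton)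
  then obtain al where "fst w = al *\<^sub>R generator T c x" by (elim rangeE)
  thus "\<exists>al. \<exists>vs\<in>Es c x. \<exists>vu\<in>Eu c x. v = al *\<^sub>R generator T c x + vs + vu"
   using w by (intro exI[of _ al] bexI[of _ "fst (snd w)"] bexI[of _ "snd (snd w)"]) auto
 qed
qed

text \<open>The vector \<open>u\<close> is carried for time \<open>n\<close> against the direction
  of contraction, where its norm is at most linear in \<open>n\<close>, and then back: the factor
  \<open>exp (- th * real n)\<close> beats the linear growth. \<open>ep = 1\<close> is the stable
  case, tested in the past, and \<open>ep = -1\<close> the unstable case, tested in the
  future.\<close>

lemma subexponential_orbit_vanishes:
 fixes ep :: real and u :: 'e
 assumes con: "exp_contracted A G T ep X E" and inv: "deriv_invariant A T X E" and eps: "ep \<in> {1, -1}"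
  and x: "x \<in> X" "c \<in> A" "x \<in> fst c" and u: "u \<in> E c x"
  and bd: "\<And>n c'. c' \<in> A ==> T (- ep * real n) x \<in> fst c' ==>
   tangent_norm G c' (T (- ep * real n) x) (deriv_in_charts c c' (T (- ep * real n)) x u) <= B * (1 + real n)"
 shows "u = 0"
proof -
 obtain C th where C: "C > 0" "th > 0"
  "\<forall>t\<ge>0. \<forall>c\<in>A. \<forall>c'\<in>A. \<forall>x\<in>X. x \<in> fst c --> T (ep * t) x \<in> fst c' --> (\<forall>v\<in>E c x.
    tangent_norm G c' (T (ep * t) x) (deriv_in_charts c c' (T (ep * t)) x v) <= C * exp (- th * t) * tangent_norm G c x v)"
  using con unfolding exp_contracted_def by (elim exE conjE)
 have le: "tangent_norm G c x u <= C * exp (- th * real n) * (B * (1 + real n))" for n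
 proof -
  let ?t = "- ep * real n"
  let ?y = "T ?t x"
  have mt: "- ?t = ep * real n" by simp
  obtain c' where c': "c' \<in> A" "?y \<in> fst c'" using ex_chart by metis
  let ?w = "deriv_in_charts c c' (T ?t) x u"
  have "?w \<in> deriv_in_charts c c' (T ?t) x ` E c x" using u by (rule imageI)
  also have "... = E c' ?y" using inv[unfolded deriv_invariant_def, rule_format, OF x(2) c'(1) x(1,3) c'(2)] .
  finally have w: "?w \<in> E c' ?y" .
  have ret: "T (ep * real n) ?y = x" using T_inverse(1)[of ?t x] by (simp only: mt)
  have "tangent_norm G c (T (ep * real n) ?y) (deriv_in_charts c' c (T (ep * real n)) ?y ?w)
    <= C * exp (- th * real n) * tangent_norm G c' ?y ?w"
   by (rule C(3)[rule_format]) (use c' w x ret in \<open>simp_all only: of_nat_0_le_iff T_in_X\<close>)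
  moreover have "deriv_in_charts c' c (T (ep * real n)) ?y ?w = u"
   using deriv_in_charts_inverse[OF x(2) c'(1) x(3) c'(2), of u] by (simp only: mt)
  ultimately have "tangent_norm G c x u <= C * exp (- th * real n) * tangent_norm G c' ?y ?w" by (simp only: ret)
  also have "... <= C * exp (- th * real n) * (B * (1 + real n))"
   using bd[OF c'] C(1) by (intro mult_left_mono) auto
  finally show ?thesis .
 qed
 have "(%n. C * exp (- th * real n) * (B * (1 + real n))) \<longlonglongrightarrow> 0"
  using C(2) by real_asymp
 hence "tangent_norm G c x u <= 0"
  by (rule LIMSEQ_le_const) (use le in auto)
 thus ?thesis using tangent_norm_triangle(3,4)[OF x(2,3), of u] by (simp add: order_antisym)
qed


lemma linear_deriv_in_charts:
 assumes c: "c \<in> A" "c' \<in> A" "x \<in> fst c" "T t x \<in> fst c'"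
 shows "linear (deriv_in_charts c c' (T t) x)"
proof -
 have "linear (%v::'e. (0::real, v))" by (rule linearI) auto
 from linear_compose[OF this linear_flow_deriv[OF c]] show ?thesis
  by (simp add: comp_def deriv_in_charts_eq[OF c, abs_def])
qed

text \<open>In the direction of time against which \<open>u\<close> is contracted, the component
  \<open>w\<close> is contracted and the neutral component stays bounded; so \<open>u\<close>
  inherits the linear growth bound of \<open>v\<close>.\<close>

lemma hyperbolic_component_vanishes:
 fixes ep :: real
 assumes con: "exp_contracted A G T ep X E" "exp_contracted A G T (- ep) X E'"
  and inv: "deriv_invariant A T X E" and eps: "ep \<in> {1, -1}"
  and x: "x \<in> X" "c \<in> A" "x \<in> fst c" and u: "u \<in> E c x" and w: "w \<in> E' c x"
  and v: "v = al *\<^sub>R generator T c x + (w + u)"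
  and bd: "\<And>n c'. c' \<in> A ==> T (- ep * real n) x \<in> fst c' ==>
   tangent_norm G c' (T (- ep * real n) x) (deriv_in_charts c c' (T (- ep * real n)) x v) <= B * (1 + real n)"
 shows "u = 0"
proof -
 obtain C where C: "\<And>x t c c'. x \<in> X ==> c \<in> A ==> c' \<in> A ==> x \<in> fst c ==> T t x \<in> fst c' ==>
  tangent_norm G c' (T t x) (deriv_in_charts c c' (T t) x (generator T c x)) <= C"
  using generator_transport_bound by blast
 obtain C' th where C': "C' > 0" "th > 0"
  "\<forall>t\<ge>0. \<forall>c\<in>A. \<forall>c'\<in>A. \<forall>x\<in>X. x \<in> fst c --> T (- ep * t) x \<in> fst c' --> (\<forall>v\<in>E' c x.
    tangent_norm G c' (T (- ep * t) x) (deriv_in_charts c c' (T (- ep * t)) x v) <= C' * exp (- th * t) * tangent_norm G c x v)"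
  using con(2) unfolding exp_contracted_def by (elim exE conjE)
 show ?thesis
 proof (rule subexponential_orbit_vanishes[OF con(1) inv eps x u, where B = "B + \<bar>al\<bar> * C + C' * tangent_norm G c x w"])
  fix n c' assume c': "c' \<in> A" "T (- ep * real n) x \<in> fst c'"
  let ?t = "- ep * real n"
  let ?D = "deriv_in_charts c c' (T ?t) x" and ?N = "tangent_norm G c' (T ?t x)"
  have lin: "linear ?D" by (rule linear_deriv_in_charts[OF x(2) c'(1) x(3) c'(2)])
  note tri = tangent_norm_triangle[OF c']
  have 1: "?N (?D w) <= C' * tangent_norm G c x w"
  proof -
   have "?N (?D w) <= C' * exp (- th * real n) * tangent_norm G c x w"
    using C'(3)[rule_format, OF of_nat_0_le_iff x(2) c'(1) x(1,3) c'(2) w] .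
   also have "... <= C' * 1 * tangent_norm G c x w"
    using C' tangent_norm_triangle(3)[OF x(2,3)] by (intro mult_right_mono mult_left_mono) auto
   finally show ?thesis by simp
  qed
  have "u = v + (- al) *\<^sub>R generator T c x + (-1) *\<^sub>R w" by (simp add: v)
  hence "?D u = ?D v + (- al) *\<^sub>R ?D (generator T c x) + (-1) *\<^sub>R ?D w"
   by (simp only: linear_add[OF lin] linear_scale[OF lin])
  hence "?N (?D u) <= ?N (?D v + (- al) *\<^sub>R ?D (generator T c x)) + ?N ((-1) *\<^sub>R ?D w)"
   using tri(1) by metis
  also have "... <= ?N (?D v) + ?N ((- al) *\<^sub>R ?D (generator T c x)) + ?N ((-1) *\<^sub>R ?D w)"
   by (intro add_right_mono tri(1))
  also have "... = ?N (?D v) + \<bar>al\<bar> * ?N (?D (generator T c x)) + ?N (?D w)" by (simp only: tri(2)) simp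
  also have "... <= B * (1 + real n) + \<bar>al\<bar> * C + C' * tangent_norm G c x w"
   by (intro add_mono mult_left_mono bd[OF c'] C[OF x(1,2) c'(1) x(3) c'(2)] 1) simp
  also have "... <= (B + \<bar>al\<bar> * C + C' * tangent_norm G c x w) * (1 + real n)"
  proof -
   have "0 <= C" using order_trans[OF tri(3) C[OF x(1,2) c'(1) x(3) c'(2)]] .
   hence "0 <= \<bar>al\<bar> * C + C' * tangent_norm G c x w"
    using C'(1) tangent_norm_triangle(3)[OF x(2,3)] by simp
   hence "0 <= (\<bar>al\<bar> * C + C' * tangent_norm G c x w) * real n" by simp
   thus ?thesis by (simp add: algebra_simps)
  qed
  finally show "?N (?D u) <= (B + \<bar>al\<bar> * C + C' * tangent_norm G c x w) * (1 + real n)" .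
 qed
qed

lemma subexponential_vector_is_neutral:
 assumes x: "x \<in> X" "c \<in> A" "x \<in> fst c"
  and bd: "\<And>(i::int) c'. c' \<in> A ==> T i x \<in> fst c' ==>
   tangent_norm G c' (T i x) (deriv_in_charts c c' (T i) x v) <= B * (1 + \<bar>real_of_int i\<bar>)"
 shows "\<exists>al. v = al *\<^sub>R generator T c x"
proof -
 obtain Es Eu where split: "\<And>c x v. c \<in> A ==> x \<in> X ==> x \<in> fst c ==>
   \<exists>al. \<exists>vs\<in>Es c x. \<exists>vu\<in>Eu c x. v = al *\<^sub>R generator T c x + vs + vu"
  and inv: "deriv_invariant A T X Es" "deriv_invariant A T X Eu"
  and con: "exp_contracted A G T 1 X Es" "exp_contracted A G T (-1) X Eu"
  using hyperbolic_splitting by blast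
 obtain al vs vu where v: "vs \<in> Es c x" "vu \<in> Eu c x" "v = al *\<^sub>R generator T c x + vs + vu"
  using split[OF x(2,1,3), of v] by (elim exE bexE)
 have "vu = 0"
 proof (rule hyperbolic_component_vanishes[where ep = "-1" and E = Eu and E' = Es and u = vu and w = vs,
    OF con(2) _ inv(2) _ x v(2) v(1)])
  show "exp_contracted A G T (- (-1)) X Es" "-1 \<in> {1, -1 :: real}" using con by simp_all
  show "v = al *\<^sub>R generator T c x + (vs + vu)" using v(3) by (simp add: add.assoc)
  fix n c' assume "c' \<in> A" "T (- (- 1) * real n) x \<in> fst c'"
  thus "tangent_norm G c' (T (- (- 1) * real n) x) (deriv_in_charts c c' (T (- (- 1) * real n)) x v) <= B * (1 + real n)"
   using bd[of c' "int n"] by simp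
 qed
 moreover have "vs = 0"
 proof (rule hyperbolic_component_vanishes[where ep = 1 and E = Es and E' = Eu and u = vs and w = vu,
    OF con(1) con(2) inv(1) _ x v(1) v(2)])
  show "1 \<in> {1, -1 :: real}" by simp
  show "v = al *\<^sub>R generator T c x + (vu + vs)" using v(3) by (simp add: add_ac)
  fix n c' assume "c' \<in> A" "T (- 1 * real n) x \<in> fst c'"
  thus "tangent_norm G c' (T (- 1 * real n) x) (deriv_in_charts c c' (T (- 1 * real n)) x v) <= B * (1 + real n)"
   using bd[of c' "- int n"] by simp
 qed
 ultimately show ?thesis using v(3) by auto
qed

text \<open>
 Otherwise a blow-up would give a tangent vector which grows at most linearly in both time
 directions without being a multiple of the generator.
\<close>

lemma orbit_contraction:
 assumes B: "B > 0"
 shows "\<exists>e>0. \<forall>x\<in>X. \<forall>z\<in>X. \<forall>et. 0 < et --> et <= e -->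
  (\<forall>i::int. \<bar>real_of_int i\<bar> <= 1 / e --> d (T i x) (T i z) <= B * et * (1 + \<bar>real_of_int i\<bar>)) -->
  (\<exists>r. \<bar>r\<bar> <= et / e \<and> d x (T r z) <= et / 2)"
proof (rule compact_uniform[OF compact_X])
 let ?P = "%x e. \<forall>z\<in>X. \<forall>et. 0 < et --> et <= e -->
  (\<forall>i::int. \<bar>real_of_int i\<bar> <= 1 / e --> d (T i x) (T i z) <= B * et * (1 + \<bar>real_of_int i\<bar>)) -->
  (\<exists>r. \<bar>r\<bar> <= et / e \<and> d x (T r z) <= et / 2)"
 fix x0 assume x0: "x0 \<in> X"
 obtain c where c: "c \<in> A" "x0 \<in> fst c" using ex_chart by metis
 let ?g = "generator T c x0"
 obtain r0 K where co: "coords c x0 r0 K" using local_coords[OF c x0] by blast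
 note rK = coordsD[OF co]
 show "\<exists>U e. open U \<and> x0 \<in> U \<and> 0 < e \<and> (\<forall>x\<in>U \<inter> X. ?P x e)"
 \<comment> \<open>Failure at \<open>x0\<close> for all \<open>e = 1 / (k + 1)\<close> yields pairs
   \<open>x k\<close>, \<open>z k\<close> near \<open>x0\<close> whose orbits deviate at most
   linearly on the scale \<open>et k\<close> for times up to \<open>k + 1\<close>, although no short
   time shift brings them within \<open>et k / 2\<close>.\<close>
 proof (rule ccontr)
  assume neg: "\<not> ?thesis"
  define U where "U = (%k::nat. {x \<in> fst c. snd c x \<in> ball (snd c x0) (1 / (k + 1))})"
  have "\<exists>x z et. x \<in> U k \<and> x \<in> X \<and> z \<in> X \<and> 0 < et \<and> et <= 1 / (real k + 1) \<and>
    (\<forall>i::int. \<bar>real_of_int i\<bar> <= real k + 1 --> d (T i x) (T i z) <= B * et * (1 + \<bar>real_of_int i\<bar>)) \<and>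
    (\<forall>r. \<bar>r\<bar> <= et * (real k + 1) --> \<not> d x (T r z) <= et / 2)" for k
  proof -
   have "open (U k)" unfolding U_def by (rule open_chart_vimage[OF c(1) open_ball])
   moreover have "x0 \<in> U k" "0 < 1 / (real k + 1)" unfolding U_def using c by auto
   ultimately have "\<not> (\<forall>x\<in>U k \<inter> X. ?P x (1 / (real k + 1)))" using neg by blast
   then obtain x z et where *: "x \<in> U k \<inter> X" "z \<in> X" "0 < et" "et <= 1 / (real k + 1)"
    "\<forall>i::int. \<bar>real_of_int i\<bar> <= 1 / (1 / (real k + 1)) --> d (T i x) (T i z) <= B * et * (1 + \<bar>real_of_int i\<bar>)"
    "\<not> (\<exists>r. \<bar>r\<bar> <= et / (1 / (real k + 1)) \<and> d x (T r z) <= et / 2)"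
    unfolding Ball_def not_all not_imp by (elim exE conjE)
   have "1 / (1 / (real k + 1)) = real k + 1" "et / (1 / (real k + 1)) = et * (real k + 1)" by simp_all
   with * show ?thesis by (intro exI[of _ x] exI[of _ z] exI[of _ et]) simp
  qed
  then obtain x z et where xz: "\<And>k. x k \<in> U k" "\<And>k. x k \<in> X" "\<And>k. z k \<in> X" "\<And>k. 0 < et k" "\<And>k. et k <= 1 / (real k + 1)"
    and close: "\<And>k i. \<bar>real_of_int i\<bar> <= real k + 1 ==> d (T i (x k)) (T i (z k)) <= B * et k * (1 + \<bar>real_of_int i\<bar>)"
    and far: "\<And>k r. \<bar>r\<bar> <= et k * (real k + 1) ==> \<not> d (x k) (T r (z k)) <= et k / 2"
   by metis
  have et0: "et \<longlonglongrightarrow> 0"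
  proof (rule Lim_null_comparison)
   show "\<forall>\<^sub>F k in sequentially. norm (et k) <= 1 / (real k + 1)"
    using xz(4,5) by (intro always_eventually) (simp add: abs_of_pos)
  qed real_asymp
  have xc: "x k \<in> fst c" "dist (snd c x0) (snd c (x k)) < 1 / (real k + 1)" for k using xz(1)[of k] by (auto simp: U_def)
  have x_near: "\<forall>\<^sub>F k in sequentially. snd c (x k) \<in> ball (snd c x0) r" if "r > 0" for r
  proof -
   have "(%k. 1 / (real k + 1)) \<longlonglongrightarrow> 0" by real_asymp
   hence "\<forall>\<^sub>F k in sequentially. 1 / (real k + 1) < r" using that by (rule order_tendstoD)
   thus ?thesis by (rule eventually_mono) (use xc(2) less_trans in auto)
  qed
  have z_near: "\<forall>\<^sub>F k in sequentially. z k \<in> fst c \<and> snd c (z k) \<in> ball (snd c x0) r" if r: "r > 0" for r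
  proof -
   obtain V rh where V: "open V" "x0 \<in> V" "V \<subseteq> fst c" "rh > 0" "\<forall>x\<in>V. snd c x \<in> ball (snd c x0) r"
    "\<forall>x\<in>V \<inter> X. \<forall>z\<in>X. d x z < rh --> z \<in> fst c \<and> snd c z \<in> ball (snd c x0) r" by (rule coords_nbhd[OF co r])
   have "open (snd c ` V)" by (rule open_chart_image[OF c(1) V(1,3)])
   then obtain de where de: "de > 0" "ball (snd c x0) de \<subseteq> snd c ` V" using V(2) openE by blast
   have "(%k. B * et k * (1 + 0)) \<longlonglongrightarrow> B * 0 * (1 + 0)" by (intro tendsto_intros et0)
   hence "\<forall>\<^sub>F k in sequentially. B * et k * (1 + 0) < rh" using V(4) by (intro order_tendstoD) auto
   with x_near[OF de(1)] show ?thesis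
   proof eventually_elim
    case (elim k)
    have "snd c (x k) \<in> snd c ` V" using elim(1) de(2) by blast
    then obtain y where y: "y \<in> V" "snd c (x k) = snd c y" by blast
    have "x k = chart_inv c (snd c (x k))" using xc(1)[of k] c(1) by simp
    also have "... = y" using y V(3) c(1) by auto
    finally have "x k \<in> V \<inter> X" using y(1) xz(2)[of k] by simp
    moreover have "d (x k) (z k) < rh" using close[of 0 k] elim(2) by simp
    ultimately show ?case using V(6) xz(3)[of k] by blast
   qed
  qed
  \<comment> \<open>The blow-up: displacements rescaled by \<open>et k\<close>, bounded by the case
    \<open>i = 0\<close> of \<open>close\<close>.\<close>
  define w where "w = (%k. (1 / et k) *\<^sub>R (snd c (z k) - snd c (x k)))"
  have etw: "snd c (z k) - snd c (x k) = et k *\<^sub>R w k" for k using xz(4)[of k] by (simp add: w_def)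
  have w_bd: "\<forall>\<^sub>F k in sequentially. norm (w k) <= K * B"
   using x_near[OF rK(1)] z_near[OF rK(1)]
  proof eventually_elim
   case (elim k)
   have "norm (snd c (z k) - snd c (x k)) <= K * d (x k) (z k)"
    using coords_lip(1)[OF co xc(1)[of k] _ elim(1)] elim(2) by blast
   also have "... <= K * (B * et k)" using close[of 0 k] rK(2) by simp
   finally have "et k * norm (w k) <= et k * (K * B)" unfolding etw using xz(4)[of k] by (simp add: mult_ac)
   thus ?case using xz(4)[of k] by simp
  qed
  \<comment> \<open>The bound holds only eventually; the cut-off puts the whole sequence into a
    compact ball.\<close>
  define w' where "w' = (%k. if norm (w k) <= K * B then w k else 0)"
  have "\<forall>k. w' k \<in> cball 0 (K * B)" using rK(2) B by (auto simp: w'_def)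
  then obtain v s where s: "strict_mono s" "(w' \<circ> s) \<longlonglongrightarrow> v"
   using compact_cball[of "0::'e" "K * B"] unfolding compact_def by blast
  have ev_s: "\<forall>\<^sub>F k in sequentially. Q (s k)" if "\<forall>\<^sub>F k in sequentially. Q k" for Q
   using eventually_subseq[OF s(1) that] .
  have ws: "(%k. w (s k)) \<longlonglongrightarrow> v"
   by (rule Lim_transform_eventually[OF s(2)], rule eventually_mono[OF ev_s[OF w_bd]]) (simp add: w'_def)
  have bound: "tangent_norm G c' (T i x0) (deriv_in_charts c c' (T i) x0 v) <= 2 * B * (1 + \<bar>real_of_int i\<bar>)"
   if c': "c' \<in> A" "T i x0 \<in> fst c'" for i :: int and c'
  proof -
   let ?y = "T i x0" and ?N = "tangent_norm G c' (T i x0)"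
   let ?L = "flow_deriv c c' i x0"
   let ?u = "%k. (1 / et k) *\<^sub>R (snd c' (T i (z k)) - snd c' (T i (x k)))"
   note cc = c(1) c'(1) c(2) c'(2)
   obtain r1 K1 where co1: "coords c' ?y r1 K1" using local_coords[OF c' T_in_X[OF x0]] by blast
   obtain de where de: "de > 0"
    "\<And>s p. \<bar>s - real_of_int i\<bar> < de ==> p \<in> ball (snd c x0) de ==>
      p \<in> snd c ` fst c \<and> T s (chart_inv c p) \<in> fst c' \<and> snd c' (T s (chart_inv c p)) \<in> ball (snd c' ?y) r1"
    using flow_lipschitz_chart[OF cc coordsD(1)[OF co1]] by metis
   \<comment> \<open>Both points move with \<open>k\<close>, so differentiability at
     \<open>x0\<close> would not suffice; the linearisation has to be strict.\<close>
   have lim0: "(%k. ?u k - ?L (0, w k)) \<longlonglongrightarrow> 0"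
   proof (rule tendstoI)
    fix ep :: real assume ep: "ep > 0"
    define ep' where "ep' = ep / (2 * (K * B))"
    have ep': "ep' > 0" using ep rK(2) B by (simp add: ep'_def)
    obtain de' where de': "de' > 0"
     "\<And>s p s' p'. \<bar>s - real_of_int i\<bar> < de' ==> \<bar>s' - real_of_int i\<bar> < de' ==> p \<in> ball (snd c x0) de' ==> p' \<in> ball (snd c x0) de' ==>
      norm (flow_map c c' (s, p) - flow_map c c' (s', p') - ?L (s - s', p - p')) <= ep' * (\<bar>s - s'\<bar> + norm (p - p'))"
     using flow_strict[OF cc ep'] by metis
    show "\<forall>\<^sub>F k in sequentially. dist (?u k - ?L (0, w k)) 0 < ep"
     using x_near[OF de'(1)] z_near[OF de'(1)] w_bd
    proof eventually_elim
     case (elim k)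
     have lin: "linear ?L" by (rule linear_flow_deriv[OF cc])
     have "norm (snd c' (T i (z k)) - snd c' (T i (x k)) - ?L (0, snd c (z k) - snd c (x k))) <= ep' * norm (snd c (z k) - snd c (x k))"
      using de'(2)[of i i "snd c (z k)" "snd c (x k)"] elim de'(1) xc(1)[of k] c(1) by (simp add: flow_map_def)
     moreover have "?L (0, snd c (z k) - snd c (x k)) = et k *\<^sub>R ?L (0, w k)"
      unfolding etw by (simp flip: linear_scale[OF lin])
     moreover have "snd c' (T i (z k)) - snd c' (T i (x k)) = et k *\<^sub>R ?u k" using xz(4)[of k] by simp
     ultimately have "norm (et k *\<^sub>R (?u k - ?L (0, w k))) <= ep' * (et k * norm (w k))"
      using xz(4)[of k] by (simp add: scaleR_diff_right etw)
     hence "et k * norm (?u k - ?L (0, w k)) <= et k * (ep' * norm (w k))" using xz(4)[of k] by (simp add: mult_ac)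
     hence "norm (?u k - ?L (0, w k)) <= ep' * norm (w k)" using xz(4)[of k] by simp
     also have "... <= ep' * (K * B)" using elim(3) ep' by simp
     also have "... < ep" using ep rK(2) B by (simp add: ep'_def)
     finally show ?case by simp
    qed
   qed
   have bl: "bounded_linear ?L" using flow_has_derivative[OF cc] by (rule has_derivative_bounded_linear)
   have "(%k. (0 :: real, w (s k))) \<longlonglongrightarrow> (0, v)" by (intro tendsto_Pair tendsto_const ws)
   hence "(%k. ?L (0, w (s k))) \<longlonglongrightarrow> ?L (0, v)" by (rule bounded_linear.tendsto[OF bl])
   moreover have "(%k. ?u (s k) - ?L (0, w (s k))) \<longlonglongrightarrow> 0"
    using LIMSEQ_subseq_LIMSEQ[OF lim0 s(1)] by (simp add: comp_def)
   ultimately have "(%k. ?L (0, w (s k)) + (?u (s k) - ?L (0, w (s k)))) \<longlonglongrightarrow> ?L (0, v) + 0" by (rule tendsto_add)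
   hence "(%k. ?u (s k)) \<longlonglongrightarrow> ?L (0, v)" by simp
   hence "(%k. ?N (?u (s k))) \<longlonglongrightarrow> ?N (?L (0, v))"
    by (rule continuous_on_tendsto_compose[OF tangent_norm_triangle(5)[OF c']]) auto
   moreover have "\<forall>\<^sub>F k in sequentially. ?N (?u k) <= 2 * B * (1 + \<bar>real_of_int i\<bar>)"
    using x_near[OF de(1)] z_near[OF de(1)] eventually_ge_at_top[of "nat \<lceil>\<bar>real_of_int i\<bar>\<rceil>"]
   proof eventually_elim
    case (elim k)
    have X: "T i (x k) \<in> fst c'" "snd c' (T i (x k)) \<in> ball (snd c' ?y) r1"
     using de(2)[of i "snd c (x k)"] elim(1) de(1) xc(1)[of k] c(1) by auto
    have Z: "T i (z k) \<in> fst c'" "snd c' (T i (z k)) \<in> ball (snd c' ?y) r1"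
     using de(2)[of i "snd c (z k)"] elim(2) de(1) c(1) by auto
    have "?N (snd c' (T i (z k)) - snd c' (T i (x k))) <= 2 * d (T i (x k)) (T i (z k))"
     by (rule coords_lip(2)[OF co1 X(1) Z(1) X(2) Z(2)])
    also have "... <= 2 * (B * et k * (1 + \<bar>real_of_int i\<bar>))" using close[of i k] elim(3) by simp
    finally have "(1 / et k) * ?N (snd c' (T i (z k)) - snd c' (T i (x k))) <= (1 / et k) * (2 * (B * et k * (1 + \<bar>real_of_int i\<bar>)))"
     using xz(4)[of k] by (intro mult_left_mono) (auto simp: less_imp_le)
    also have "... = 2 * B * (1 + \<bar>real_of_int i\<bar>)" using xz(4)[of k] by simp
    finally show ?case using xz(4)[of k] by (simp only: tangent_norm_triangle(2)[OF c']) simp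
   qed
   hence "\<forall>\<^sub>F k in sequentially. ?N (?u (s k)) <= 2 * B * (1 + \<bar>real_of_int i\<bar>)" by (rule ev_s)
   ultimately have "?N (?L (0, v)) <= 2 * B * (1 + \<bar>real_of_int i\<bar>)" by (rule tendsto_upperbound) simp
   thus ?thesis by (simp add: deriv_in_charts_eq[OF cc])
  qed
  \<comment> \<open>The limit displacement is neutral, so a time shift by \<open>- al * et k\<close>
    almost cancels it. Linearisation and convergence of \<open>w\<close> then cost
    \<open>1 / 4\<close> each, which gives the factor 1/2 of the claim.\<close>
  obtain al where al: "v = al *\<^sub>R ?g"
   using subexponential_vector_is_neutral[OF x0 c bound] by blast
  have c0: "T 0 x0 \<in> fst c" using c by simp
  let ?L = "flow_deriv c c 0 x0"
  obtain ep where ep: "ep > 0" "K * (ep * \<bar>al\<bar>) < 1 / 4"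
  proof (rule that[of "1 / (8 * K * (\<bar>al\<bar> + 1))"])
   have "K * (1 / (8 * K * (\<bar>al\<bar> + 1)) * \<bar>al\<bar>) = \<bar>al\<bar> / (8 * (\<bar>al\<bar> + 1))" using rK(2) by simp
   also have "... < 1 / 4"
   proof -
    have "a / (8 * (a + 1)) < 1 / 4" if "a >= 0" for a :: real using that by (simp add: divide_less_eq)
    thus ?thesis by simp
   qed
   finally show "K * (1 / (8 * K * (\<bar>al\<bar> + 1)) * \<bar>al\<bar>) < 1 / 4" .
   have "\<bar>al\<bar> + 1 > 0" by linarith
   thus "1 / (8 * K * (\<bar>al\<bar> + 1)) > 0" using rK(2) by simp
  qed
  obtain de where de: "de > 0"
   "\<And>s p s' p'. \<bar>s - 0\<bar> < de ==> \<bar>s' - 0\<bar> < de ==> p \<in> ball (snd c x0) de ==> p' \<in> ball (snd c x0) de ==>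
     norm (flow_map c c (s, p) - flow_map c c (s', p') - ?L (s - s', p - p')) <= ep * (\<bar>s - s'\<bar> + norm (p - p'))"
   using flow_strict[OF c(1) c(1) c(2) c0 ep(1)] by metis
  obtain de1 where de1: "de1 > 0"
    "\<And>s p. \<bar>s - 0\<bar> < de1 ==> p \<in> ball (snd c x0) de1 ==>
      p \<in> snd c ` fst c \<and> T s (chart_inv c p) \<in> fst c \<and> snd c (T s (chart_inv c p)) \<in> ball (snd c (T 0 x0)) r0"
   using flow_lipschitz_chart[OF c(1) c(1) c(2) c0 rK(1)] by metis
  have "(%k. \<bar>al\<bar> * et k) \<longlonglongrightarrow> \<bar>al\<bar> * 0" by (intro tendsto_intros et0)
  hence small: "\<forall>\<^sub>F k in sequentially. \<bar>al\<bar> * et k < r" if "r > 0" for r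
   using that by (intro order_tendstoD) auto
  have "\<forall>\<^sub>F k in sequentially. dist (w (s k)) v < 1 / (4 * K)" using ws rK(2) by (intro tendstoD) auto
  moreover have "\<forall>\<^sub>F k in sequentially. k >= nat \<lceil>\<bar>al\<bar>\<rceil>" by (rule eventually_ge_at_top)
  ultimately have "\<forall>\<^sub>F k in sequentially. False"
   using ev_s[OF x_near[OF de(1)]] ev_s[OF z_near[OF de(1)]] ev_s[OF x_near[OF rK(1)]] ev_s[OF z_near[OF de1(1)]]
    ev_s[OF small[OF de(1)]] ev_s[OF small[OF de1(1)]] ev_s[OF eventually_ge_at_top[of "nat \<lceil>\<bar>al\<bar>\<rceil>"]]
  proof eventually_elim
   case (elim j)
   define k where "k = s j"
   note elim = elim[folded k_def]
   define r where "r = - al * et k"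
   have r: "\<bar>r\<bar> < de" "\<bar>r\<bar> < de1" "\<bar>r\<bar> = \<bar>al\<bar> * et k" using elim(7,8) xz(4)[of k] by (auto simp: r_def abs_mult)
   have zc: "z k \<in> fst c" using elim(4) by blast
   have zr: "T r (z k) \<in> fst c" "snd c (T r (z k)) \<in> ball (snd c x0) r0"
    using de1(2)[of r "snd c (z k)"] r(2) elim(6) c(1) by auto
   have lin: "linear ?L" by (rule linear_flow_deriv[OF c(1) c(1) c(2) c0])
   have "?L (r, 0) = r *\<^sub>R ?g"
   proof -
    have "(r, 0) = r *\<^sub>R (1 :: real, 0 :: 'e)" by simp
    thus ?thesis unfolding generator_eq(1)[OF c] by (simp only: linear_scale[OF lin])
   qed
   hence 1: "norm (snd c (T r (z k)) - snd c (z k) - r *\<^sub>R ?g) <= ep * \<bar>r\<bar>"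
    using de(2)[of r 0 "snd c (z k)" "snd c (z k)"] r(1) de(1) elim(4) c(1) by (simp add: flow_map_def)
   have E: "snd c (T r (z k)) - snd c (x k) = (snd c (T r (z k)) - snd c (z k) - r *\<^sub>R ?g) + et k *\<^sub>R (w k - v)"
    using etw[of k] by (simp add: al r_def algebra_simps)
   have "norm (snd c (T r (z k)) - snd c (x k)) <= ep * \<bar>r\<bar> + norm (et k *\<^sub>R (w k - v))"
    unfolding E by (rule norm_triangle_mono[OF 1 order_refl])
   also have "... <= ep * (\<bar>al\<bar> * et k) + et k * (1 / (4 * K))"
    using elim(1) xz(4)[of k] mult_left_mono[of "norm (w k - v)" "1 / (4 * K)" "et k"] by (simp add: r(3) dist_norm)
   finally have 2: "norm (snd c (T r (z k)) - snd c (x k)) <= ep * (\<bar>al\<bar> * et k) + et k * (1 / (4 * K))" .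
   have "d (x k) (T r (z k)) <= K * norm (snd c (T r (z k)) - snd c (x k))"
    by (rule coords_lip(3)[OF co xc(1) zr(1) elim(5) zr(2)])
   also have "... <= K * (ep * (\<bar>al\<bar> * et k) + et k * (1 / (4 * K)))" using 2 rK(2) by simp
   also have "... = (K * (ep * \<bar>al\<bar>) + 1 / 4) * et k" using rK(2) by (simp add: algebra_simps)
   also have "... <= (1 / 4 + 1 / 4) * et k" using ep(2) xz(4)[of k] by (intro mult_right_mono) auto
   finally have "d (x k) (T r (z k)) <= et k / 2" by simp
   moreover have "\<bar>r\<bar> <= et k * (real k + 1)"
   proof -
    have "\<bar>al\<bar> <= real k + 1" using elim(9) by linarith
    hence "et k * \<bar>al\<bar> <= et k * (real k + 1)" using xz(4)[of k] by simp
    thus ?thesis using r(3) by (simp add: mult.commute)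
   qed
   ultimately show ?case using far by blast
  qed
  thus False by simp
 qed
next
 fix x e e' assume P: "\<forall>z\<in>X. \<forall>et. 0 < et --> et <= e -->
  (\<forall>i::int. \<bar>real_of_int i\<bar> <= 1 / e --> d (T i x) (T i z) <= B * et * (1 + \<bar>real_of_int i\<bar>)) -->
  (\<exists>r. \<bar>r\<bar> <= et / e \<and> d x (T r z) <= et / 2)" and e': "0 < e'" "e' <= e"
 have le: "1 / e <= 1 / e'" using e' by (simp add: frac_le)
 show "\<forall>z\<in>X. \<forall>et. 0 < et --> et <= e' -->
  (\<forall>i::int. \<bar>real_of_int i\<bar> <= 1 / e' --> d (T i x) (T i z) <= B * et * (1 + \<bar>real_of_int i\<bar>)) -->
  (\<exists>r. \<bar>r\<bar> <= et / e' \<and> d x (T r z) <= et / 2)"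
 proof (intro ballI allI impI)
  fix z et assume z: "z \<in> X" and et: "0 < et" "et <= e'"
   and i: "\<forall>i::int. \<bar>real_of_int i\<bar> <= 1 / e' --> d (T i x) (T i z) <= B * et * (1 + \<bar>real_of_int i\<bar>)"
  have "et <= e" using et e' by linarith
  moreover have "\<forall>i::int. \<bar>real_of_int i\<bar> <= 1 / e --> d (T i x) (T i z) <= B * et * (1 + \<bar>real_of_int i\<bar>)"
   using i le order_trans by blast
  ultimately obtain r where r: "\<bar>r\<bar> <= et / e" "d x (T r z) <= et / 2" using P z et(1) by blast
  have "et / e <= et / e'" using e' et(1) by (simp add: frac_le)
  thus "\<exists>r. \<bar>r\<bar> <= et / e' \<and> d x (T r z) <= et / 2" using r by (intro exI[of _ r]) auto
 qed
qed


text \<open>Hoelder continuity refers to \<open>d\<close>, continuity to the topology of the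
  manifold; the link is the upper bound for \<open>d\<close> in a chart.\<close>

lemma hoelder_continuous:
 assumes f: "hoelder_on d X f"
 shows "continuous_on X f"
proof -
 obtain al C where al: "0 < al" "\<forall>x\<in>X. \<forall>y\<in>X. \<bar>f x - f y\<bar> <= C * d x y powr al"
  using f unfolding hoelder_on_def by (elim exE conjE)
 have "(f \<longlongrightarrow> f x0) (at x0 within X)" if x0: "x0 \<in> X" for x0
 proof (rule tendstoI)
  fix e :: real assume e: "e > 0"
  obtain c where c: "c \<in> A" "x0 \<in> fst c" using ex_chart by metis
  obtain r0 K where co: "coords c x0 r0 K" using local_coords[OF c x0] by blast
  note rK = coordsD[OF co]
  have "((%t. \<bar>C\<bar> * (K * t) powr al) \<longlongrightarrow> \<bar>C\<bar> * (K * 0) powr al) (at_right 0)"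
   by (intro tendsto_intros tendsto_powr2) (use al(1) rK(2) in \<open>auto simp: eventually_at_filter\<close>)
  hence "((%t. \<bar>C\<bar> * (K * t) powr al) \<longlongrightarrow> 0) (at_right 0)" using al(1) by simp
  hence "\<forall>\<^sub>F t in at_right 0. \<bar>C\<bar> * (K * t) powr al < e" using e by (rule order_tendstoD)
  then obtain t where t: "t > 0" "\<bar>C\<bar> * (K * t) powr al < e"
   unfolding eventually_at_right_field using dense by metis
  have "open {x \<in> fst c. snd c x \<in> ball (snd c x0) (min r0 t)}" (is "open ?U")
   by (rule open_chart_vimage[OF c(1) open_ball])
  moreover have "x0 \<in> ?U" using c rK t(1) by auto
  moreover have "dist (f x) (f x0) < e" if x: "x \<in> ?U" "x \<in> X" for x
  proof -
   have xs: "x \<in> fst c" "snd c x \<in> ball (snd c x0) r0" "snd c x0 \<in> ball (snd c x0) r0" using x rK(1) by auto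
   note l = coords_lip[OF co c(2) xs(1,3,2)]
   have "norm (snd c x - snd c x0) <= t" using x by (simp add: dist_norm norm_minus_commute)
   hence le: "d x0 x <= K * t" using l(3) rK(2) by (meson mult_left_mono less_imp_le order_trans)
   have "\<bar>f x0 - f x\<bar> <= C * d x0 x powr al" using al(2) x0 x(2) by blast
   also have "... <= \<bar>C\<bar> * d x0 x powr al" by (intro mult_right_mono) auto
   also have "... <= \<bar>C\<bar> * (K * t) powr al" using le l(5) al(1) by (intro mult_left_mono powr_mono2) auto
   finally show ?thesis using t(2) by (simp add: dist_real_def abs_minus_commute)
  qed
  ultimately show "\<forall>\<^sub>F x in at x0 within X. dist (f x) (f x0) < e"
   unfolding eventually_at_topological by blast
 qed
 thus ?thesis unfolding continuous_on_def by blast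
qed

lemma common_constants:
 obtains e K where "0 < e" "e <= 1" "1 <= K"
  "\<And>x y z. x \<in> X ==> y \<in> X ==> z \<in> X ==> d x y < e ==> d x z < e ==> 0 <= d y z \<and> d y z <= K * (d x y + d x z)"
  "\<And>x z t s. x \<in> X ==> z \<in> X ==> t \<in> {-1..1} ==> d x z < e ==> \<bar>s - t\<bar> < e ==>
    d (T t x) (T s z) <= K * (d x z + \<bar>s - t\<bar>)"
  "\<And>x y a. x \<in> X ==> y \<in> X ==> d x y < e ==> d x (T a y) < e ==> \<bar>a\<bar> < e ==> \<bar>a\<bar> <= K * (d x y + d x (T a y))"
proof -
 obtain e1 where e1: "e1 > 0" "\<forall>x\<in>X. \<forall>y\<in>X. \<forall>z\<in>X. d x y < e1 --> d x z < e1 --> 0 <= d y z \<and> d y z <= (1 / e1) * (d x y + d x z)"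
  using d_quasi_triangle by (elim exE conjE)
 obtain e2 where e2: "e2 > 0" "\<forall>x\<in>X. \<forall>z\<in>X. \<forall>t\<in>{-1..1}. \<forall>s. d x z < e2 --> \<bar>s - t\<bar> < e2 -->
   d (T t x) (T s z) <= (1 / e2) * (d x z + \<bar>s - t\<bar>)" using flow_lipschitz by (elim exE conjE)
 obtain e3 where e3: "e3 > 0" "\<forall>x\<in>X. \<forall>y\<in>X. \<forall>a. d x y < e3 --> d x (T a y) < e3 --> \<bar>a\<bar> < e3 -->
   \<bar>a\<bar> <= (1 / e3) * (d x y + d x (T a y))" using time_shift_bound by (elim exE conjE)
 define e where "e = Min {1, e1, e2, e3}"
 define K where "K = Max {1, 1 / e1, 1 / e2, 1 / e3}"
 have e: "0 < e" "e <= 1" "e <= e1" "e <= e2" "e <= e3" using e1(1) e2(1) e3(1) by (auto simp: e_def)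
 have K: "1 <= K" "1 / e1 <= K" "1 / e2 <= K" "1 / e3 <= K" by (simp_all add: K_def)
 have nn: "0 <= d x y" if "x \<in> X" "y \<in> X" "d x y < e" for x y
 proof -
  have "d x x < e1" "d x y < e1" using that e e1(1) by simp_all
  from e1(2)[rule_format, OF that(1,1,2) this] show ?thesis by (rule conjunct1)
 qed
 show thesis
 proof (rule that[OF e(1,2) K(1)])
  fix x y z assume a: "x \<in> X" "y \<in> X" "z \<in> X" "d x y < e" "d x z < e"
  have b: "d x y < e1" "d x z < e1" using a e by linarith+
  have "(1 / e1) * (d x y + d x z) <= K * (d x y + d x z)"
   using nn[OF a(1,2,4)] nn[OF a(1,3,5)] K by (intro mult_right_mono) auto
  thus "0 <= d y z \<and> d y z <= K * (d x y + d x z)" using e1(2)[rule_format, OF a(1-3) b] by linarith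
 next
  fix x z t s assume a: "x \<in> X" "z \<in> X" "t \<in> {-1..1}" "d x z < e" "\<bar>s - t\<bar> < e"
  have b: "d x z < e2" "\<bar>s - t\<bar> < e2" using a e by linarith+
  have "(1 / e2) * (d x z + \<bar>s - t\<bar>) <= K * (d x z + \<bar>s - t\<bar>)"
   using nn[OF a(1,2,4)] K by (intro mult_right_mono) auto
  thus "d (T t x) (T s z) <= K * (d x z + \<bar>s - t\<bar>)" using e2(2)[rule_format, OF a(1-3) b] by linarith
 next
  fix x y a' assume a: "x \<in> X" "y \<in> X" "d x y < e" "d x (T a' y) < e" "\<bar>a'\<bar> < e"
  have b: "d x y < e3" "d x (T a' y) < e3" "\<bar>a'\<bar> < e3" using a e by linarith+
  have "(1 / e3) * (d x y + d x (T a' y)) <= K * (d x y + d x (T a' y))"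
   using nn[OF a(1,2,3)] nn[OF a(1) T_in_X[OF a(2)] a(4)] K by (intro mult_right_mono) auto
  thus "\<bar>a'\<bar> <= K * (d x y + d x (T a' y))" using e3(2)[rule_format, OF a(1,2) b] by linarith
 qed
qed

lemma T_T: "T u (T v y) = T (v + u) y"
 by (simp add: T_add[symmetric] add.commute)

text \<open>\<open>orbit_contraction\<close> is applied at every integer time and iterated. Each
  round halves the distance to the shifted orbit but needs \<open>N\<close> further steps on both
  sides, so at time \<open>s\<close> about \<open>min s (n - s) / N\<close> rounds are possible.
  This is the exponential rate from both ends, with \<open>q ^ N = 1 / 2\<close>.\<close>

lemma orbit_synchronisation:
 obtains ep C q where "ep > 0" "C > 0" "0 < q" "q < (1::real)"
  "\<And>x z (n::nat). x \<in> X ==> z \<in> X ==> (\<And>s::nat. s <= n ==> d (T s x) (T s z) <= ep) ==>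
   \<exists>r. (\<forall>s\<le>n. \<bar>r s\<bar> <= 1) \<and> (\<forall>s<n. \<bar>r (Suc s) - r s\<bar> <= C * (q ^ s + q ^ (n - s))) \<and>
     (\<forall>s\<le>n. \<forall>u\<in>{0..1}. d (T (s + u) x) (T (s + u + r s) z) <= C * (q ^ s + q ^ (n - s)))"
proof -
 obtain e K where e: "0 < e" "e <= 1" "1 <= K"
  and Q: "\<And>x y z. x \<in> X ==> y \<in> X ==> z \<in> X ==> d x y < e ==> d x z < e ==> 0 <= d y z \<and> d y z <= K * (d x y + d x z)"
  and L: "\<And>x z t s. x \<in> X ==> z \<in> X ==> t \<in> {-1..1} ==> d x z < e ==> \<bar>s - t\<bar> < e ==>
    d (T t x) (T s z) <= K * (d x z + \<bar>s - t\<bar>)"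
  and S: "\<And>x y a. x \<in> X ==> y \<in> X ==> d x y < e ==> d x (T a y) < e ==> \<bar>a\<bar> < e ==> \<bar>a\<bar> <= K * (d x y + d x (T a y))"
  using common_constants by blast
 \<comment> \<open>Shifts at consecutive times differ by at most \<open>K' * et'\<close>, hence by a
   linear amount over \<open>i\<close> steps. \<open>B\<close> is the slope of the resulting
   deviation, and this is why \<open>orbit_contraction\<close> has to tolerate linear
   growth.\<close>
 define K' where "K' = K * (K + 1)"
 have K': "K' > 0" using e(3) by (simp add: K'_def)
 define B where "B = K * (1 + K')"
 have B: "B > 0" using e(3) K' by (simp add: B_def)
 obtain eo where eo: "eo > 0" "\<forall>x\<in>X. \<forall>z\<in>X. \<forall>et. 0 < et --> et <= eo -->
  (\<forall>i::int. \<bar>real_of_int i\<bar> <= 1 / eo --> d (T i x) (T i z) <= B * et * (1 + \<bar>real_of_int i\<bar>)) -->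
  (\<exists>r. \<bar>r\<bar> <= et / eo \<and> d x (T r z) <= et / 2)" using orbit_contraction[OF B] by (elim exE conjE)
 define C0 where "C0 = 1 / eo"
 define N where "N = nat \<lceil>1 / eo\<rceil> + 1"
 have C0: "C0 > 0" using eo(1) by (simp add: C0_def)
 have N: "N > 0" "1 / eo <= real N" by (auto simp: N_def) linarith
 \<comment> \<open>The last condition keeps the differences of shifts, at most
   \<open>4 * C0 * et\<close>, in the range where the bound on time shifts applies.\<close>
 obtain et where et: "et > 0" "et <= eo" "K * et <= e / 2" "C0 * et <= e / 8"
 proof (rule that[of "min eo (min (e / (2 * K)) (e / (8 * C0)))"])
  let ?et = "min eo (min (e / (2 * K)) (e / (8 * C0)))"
  show "?et > 0" "?et <= eo" using eo(1) e C0 by auto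
  have "K * ?et <= K * (e / (2 * K))" "C0 * ?et <= C0 * (e / (8 * C0))" using e(3) C0 by (intro mult_left_mono; simp)+
  thus "K * ?et <= e / 2" "C0 * ?et <= e / 8" using e(3) C0 by simp_all
 qed
 have "1 * et <= K * et" using e(3) et(1) by (intro mult_right_mono) auto
 hence ete: "et < e" using et(3) e(1) by linarith
 define q where "q = root N (1 / 2)"
 have q: "0 < q" "q < 1" using N(1) by (auto simp: q_def)
 have qN: "q ^ N = 1 / 2" using N(1) by (simp add: q_def real_root_pow_pos)
 define C where "C = 2 * (K + K') * (2 * et)"
 have C: "C > 0" using e K' et by (simp add: C_def)
 show thesis
 proof (rule that[OF et(1) C q])
  fix x z and n :: nat assume x: "x \<in> X" and z: "z \<in> X" and close: "\<And>s::nat. s <= n ==> d (T s x) (T s z) <= et"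
  have shift: "\<bar>r' - r\<bar> <= K * (K * et1 + et2)"
   if r: "\<bar>r\<bar> <= 2 * C0 * et" "\<bar>r'\<bar> <= 2 * C0 * et" and le: "et1 <= et" "et2 <= et"
    and d1: "d (T j x) (T (j + r) z) <= et1" and d2: "d (T (j + 1) x) (T (j + 1 + r') z) <= et2" for r r' et1 et2 j
  proof -
   have "d (T 1 (T j x)) (T 1 (T (j + r) z)) <= K * (d (T j x) (T (j + r) z) + \<bar>1 - 1\<bar>)"
    using x z d1 le(1) ete e(1) by (intro L) auto
   also have "... <= K * et1" using d1 e(3) by simp
   finally have 1: "d (T (j + 1) x) (T (j + 1 + r) z) <= K * et1" by (simp add: T_T add_ac)
   have "K * et1 <= K * et" using le(1) e(3) by simp
   hence small: "K * et1 < e" using et(3) e(1) by linarith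
   have eq: "T (r' - r) (T (j + 1 + r) z) = T (j + 1 + r') z" by (simp add: T_T algebra_simps)
   have "\<bar>r' - r\<bar> <= K * (d (T (j + 1) x) (T (j + 1 + r) z) + d (T (j + 1) x) (T (r' - r) (T (j + 1 + r) z)))"
   proof (rule S)
    show "\<bar>r' - r\<bar> < e" using r et(4) e(1) by linarith
    show "d (T (j + 1) x) (T (j + 1 + r) z) < e" using 1 small by linarith
    show "d (T (j + 1) x) (T (r' - r) (T (j + 1 + r) z)) < e" unfolding eq using d2 le(2) ete by linarith
   qed (use x z in simp_all)
   also have "... <= K * (K * et1 + et2)" unfolding eq using 1 d2 e(3) by (intro mult_left_mono add_mono) auto
   finally show ?thesis .
  qed
  \<comment> \<open>Induction on the number \<open>k\<close> of rounds. The corrections of the shift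
    form a geometric series, whence the total bound \<open>2 * C0 * et\<close>.\<close>
  have claim: "\<forall>s::int. int (k * N) <= s --> s <= int n - int (k * N) -->
    (\<exists>r::real. \<bar>r\<bar> <= 2 * C0 * et * (1 - 1 / 2 ^ k) \<and> d (T s x) (T (s + r) z) <= et / 2 ^ k)" for k
  proof (induction k)
   case 0
   show ?case
   proof (intro allI impI)
    fix s :: int assume "int (0 * N) <= s" "s <= int n - int (0 * N)"
    thus "\<exists>r::real. \<bar>r\<bar> <= 2 * C0 * et * (1 - 1 / 2 ^ 0) \<and> d (T s x) (T (s + r) z) <= et / 2 ^ 0"
     using close[of "nat s"] by (intro exI[of _ 0]) simp
   qed
  next
   case (Suc k)
   define et' where "et' = et / 2 ^ k"
   have et': "0 < et'" "et' <= et" using et(1) by (auto simp: et'_def divide_le_eq mult_left_le)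
   define R where "R = 2 * C0 * et * (1 - 1 / 2 ^ k)"
   have R: "R <= 2 * C0 * et" using C0 et(1) by (simp add: R_def mult_left_le)
   obtain r :: "int => real" where r: "\<And>s::int. int (k * N) <= s ==> s <= int n - int (k * N) ==> \<bar>r s\<bar> <= R \<and> d (T s x) (T (s + r s) z) <= et'"
    using Suc.IH unfolding R_def[symmetric] et'_def[symmetric] by metis
   have adj: "\<bar>r (j + 1) - r j\<bar> <= K' * et'" if "int (k * N) <= j" "j + 1 <= int n - int (k * N)" for j
    using shift[of "r j" "r (j + 1)" et' et' j] r[of j] r[of "j + 1"] that R et'(2)
    by (simp add: K'_def algebra_simps)
   show ?case
   proof (intro allI impI)
    fix s :: int assume s: "int (Suc k * N) <= s" "s <= int n - int (Suc k * N)"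
    have s0: "int (k * N) <= s" "s <= int n - int (k * N)" using s by simp_all
    have up: "\<bar>r (s + int i) - r s\<bar> <= real i * (K' * et')" if "i <= N" for i using that
    proof (induction i)
     case (Suc i)
     have "\<bar>r (s + int i + 1) - r (s + int i)\<bar> <= K' * et'" using s Suc.prems by (intro adj) simp_all
     thus ?case using Suc by (simp add: algebra_simps)
    qed simp
    have down: "\<bar>r (s - int i) - r s\<bar> <= real i * (K' * et')" if "i <= N" for i using that
    proof (induction i)
     case (Suc i)
     have "\<bar>r (s - int (Suc i) + 1) - r (s - int (Suc i))\<bar> <= K' * et'" using s Suc.prems by (intro adj) simp_all
     thus ?case using Suc by (simp add: algebra_simps)
    qed simp
    have close': "d (T i (T s x)) (T i (T (s + r s) z)) <= B * et' * (1 + \<bar>real_of_int i\<bar>)" if i: "\<bar>real_of_int i\<bar> <= 1 / eo" for i :: int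
    proof -
     have iN: "\<bar>i\<bar> <= int N" using i N(2) by linarith
     have rng: "int (k * N) <= s + i" "s + i <= int n - int (k * N)" using s iN by (auto simp: algebra_simps)
     have dr: "\<bar>r (s + i) - r s\<bar> <= \<bar>real_of_int i\<bar> * (K' * et')"
      using up[of "nat i"] down[of "nat (- i)"] iN by (cases "i >= 0") auto
     let ?a = "r s - r (s + i)"
     have a: "\<bar>?a\<bar> < e" using r[OF s0] r[OF rng] R et(4) e(1) by linarith
     have "d (T 0 (T (s + i) x)) (T ?a (T (s + i + r (s + i)) z))
       <= K * (d (T (s + i) x) (T (s + i + r (s + i)) z) + \<bar>?a - 0\<bar>)"
      using x z a r[OF rng] et'(2) ete by (intro L) auto
     also have "... <= K * (et' + \<bar>real_of_int i\<bar> * (K' * et'))"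
      using r[OF rng] dr e(3) by (intro mult_left_mono add_mono) (auto simp: abs_minus_commute)
     also have "... <= B * et' * (1 + \<bar>real_of_int i\<bar>)"
      using e(3) K' et'(1) by (simp add: B_def algebra_simps)
     finally show ?thesis by (simp add: T_T add_ac)
    qed
    have "T s x \<in> X" "T (s + r s) z \<in> X" using x z by simp_all
    from eo(2)[rule_format, OF this et'(1) _ close'] et'(2) et(2)
    obtain a where a: "\<bar>a\<bar> <= et' / eo" "d (T s x) (T a (T (s + r s) z)) <= et' / 2" by auto
    have "\<bar>r s + a\<bar> <= R + C0 * et'" using abs_triangle_ineq[of "r s" a] r[OF s0] a(1) by (simp add: C0_def)
    also have "... = 2 * C0 * et * (1 - 1 / 2 ^ Suc k)" by (simp add: R_def et'_def field_simps)
    finally show "\<exists>r::real. \<bar>r\<bar> <= 2 * C0 * et * (1 - 1 / 2 ^ Suc k) \<and> d (T s x) (T (s + r) z) <= et / 2 ^ Suc k"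
     using a(2) by (intro exI[of _ "r s + a"]) (simp add: T_T et'_def add_ac)
   qed
  qed
  \<comment> \<open>The number of rounds that fit between \<open>s\<close> and the nearer
    end.\<close>
  define ka where "ka = (%s. min s (n - s) div N)"
  have "\<exists>r::real. \<bar>r\<bar> <= 2 * C0 * et \<and> d (T s x) (T (s + r) z) <= et / 2 ^ ka s" if s: "s <= n" for s
  proof -
   have le: "ka s * N <= min s (n - s)" unfolding ka_def by (rule div_times_less_eq_dividend)
   hence "int (ka s * N) <= int s" "int s <= int n - int (ka s * N)" using s by linarith+
   from claim[rule_format, OF this, unfolded of_int_of_nat_eq]
   obtain r where r: "\<bar>r\<bar> <= 2 * C0 * et * (1 - 1 / 2 ^ ka s)" "d (T (real s) x) (T (real s + r) z) <= et / 2 ^ ka s"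
    by (elim exE conjE)
   have "2 * C0 * et * (1 - 1 / 2 ^ ka s) <= 2 * C0 * et" using C0 et(1) by (simp add: mult_left_le)
   thus ?thesis using r by (intro exI[of _ r]) simp
  qed
  then obtain r :: "nat => real" where r: "\<And>s. s <= n ==> \<bar>r s\<bar> <= 2 * C0 * et" "\<And>s. s <= n ==> d (T (real s) x) (T (real s + r s) z) <= et / 2 ^ ka s"
   by metis
  have kaq: "1 / 2 ^ ka s <= 2 * (q ^ s + q ^ (n - s))" for s
  proof -
   let ?m = "min s (n - s)"
   have "?m <= ka s * N + N" unfolding ka_def using N(1) by (metis add.commute div_mult_mod_eq less_imp_le mod_less_divisor nat_add_left_cancel_le)
   hence "q ^ (ka s * N + N) <= q ^ ?m" using q by (intro power_decreasing) auto
   moreover have "q ^ (ka s * N + N) = (1 / 2) ^ ka s * (1 / 2)" by (simp add: power_add power_mult qN mult.commute[of "ka s"])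
   moreover have "q ^ ?m <= q ^ s + q ^ (n - s)" using q by (simp add: min_def)
   ultimately show ?thesis by (simp add: power_one_over)
  qed
  define h where "h = (%s. q ^ s + q ^ (n - s))"
  have h0: "h s >= 0" for s using q by (simp add: h_def)
  have dh: "et / 2 ^ ka s <= 2 * et * h s" for s
   using mult_left_mono[OF kaq, of et s] et(1) by (simp add: h_def algebra_simps)
  have det: "et / 2 ^ ka s <= et" for s using et(1) by (simp add: divide_le_eq mult_left_le)
  have "q ^ N <= q ^ 1" using q N(1) by (intro power_decreasing) auto
  hence q2: "1 <= 2 * q" by (simp add: qN)
  have hSuc: "h (Suc s) <= 2 * h s" if "s < n" for s
  proof -
   have "q ^ (n - s) = q * q ^ (n - Suc s)" using that by (metis Suc_diff_Suc power_Suc)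
   hence "q ^ (n - Suc s) <= 2 * q ^ (n - s)" using mult_right_mono[OF q2, of "q ^ (n - Suc s)"] q by simp
   moreover have "q ^ Suc s <= 2 * q ^ s" using q by (simp add: mult_right_mono)
   ultimately show ?thesis by (simp add: h_def)
  qed
  show "\<exists>r. (\<forall>s\<le>n. \<bar>r s\<bar> <= 1) \<and> (\<forall>s<n. \<bar>r (Suc s) - r s\<bar> <= C * (q ^ s + q ^ (n - s))) \<and>
     (\<forall>s\<le>n. \<forall>u\<in>{0..1}. d (T (s + u) x) (T (s + u + r s) z) <= C * (q ^ s + q ^ (n - s)))"
  proof (rule exI[of _ r], intro conjI allI impI ballI)
   fix s assume s: "s <= n"
   have "2 * C0 * et <= 1" using et(4) e(2) by linarith
   thus "\<bar>r s\<bar> <= 1" using r(1)[OF s] by linarith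
   fix u :: real assume u: "u \<in> {0..1}"
   have "d (T u (T s x)) (T u (T (s + r s) z)) <= K * (d (T s x) (T (s + r s) z) + \<bar>u - u\<bar>)"
   proof (rule L)
    show "d (T s x) (T (s + r s) z) < e" using r(2)[OF s] det[of s] ete by linarith
   qed (use x z u e(1) in auto)
   also have "... <= K * (2 * et * h s)" using r(2)[OF s] dh[of s] e(3) by (intro mult_left_mono) auto
   also have "... = (4 * et * (K / 2)) * h s" by simp
   also have "... <= C * h s"
    unfolding C_def using et(1) e(3) K' h0 by (intro mult_right_mono) (auto simp: algebra_simps add_increasing2)
   finally show "d (T (s + u) x) (T (s + u + r s) z) <= C * (q ^ s + q ^ (n - s))"
    by (simp add: T_T h_def add_ac)
  next
   fix s assume s: "s < n"
   have "\<bar>r (Suc s) - r s\<bar> <= K * (K * (et / 2 ^ ka s) + et / 2 ^ ka (Suc s))"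
    using r(1)[of s] r(1)[of "Suc s"] r(2)[of s] r(2)[of "Suc s"] s det
    by (intro shift[of _ _ _ _ "real s"]) (auto simp: add_ac)
   also have "... <= K * (K * (2 * et * h s) + 2 * et * (2 * h s))"
   proof -
    have "2 * et * h (Suc s) <= 2 * et * (2 * h s)" using hSuc[OF s] et(1) by simp
    hence "et / 2 ^ ka (Suc s) <= 2 * et * (2 * h s)" using dh[of "Suc s"] by linarith
    thus ?thesis using dh[of s] e(3) by (intro mult_left_mono add_mono) auto
   qed
   also have "... = (2 * et * (K * (K + 2))) * h s" by (simp add: algebra_simps)
   also have "... <= C * h s"
   proof (rule mult_right_mono[OF _ h0])
    have "K * (K + 2) <= 2 * (K + K')" using e(3) mult_mono[of 1 K 1 K] by (simp add: K'_def algebra_simps)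
    thus "2 * et * (K * (K + 2)) <= C" using mult_left_mono[of "K * (K + 2)" "2 * (K + K')" "2 * et"] et(1)
     by (simp add: C_def algebra_simps)
   qed
   finally show "\<bar>r (Suc s) - r s\<bar> <= C * (q ^ s + q ^ (n - s))" by (simp add: h_def)
  qed
 qed
qed

end

lemma sum_geometric_both_ends:
 assumes p: "0 < p" "p < (1::real)"
 shows "(\<Sum>s<n. p ^ s + p ^ (n - s)) <= 2 / (1 - p)"
proof -
 have 1: "(\<Sum>s<n. p ^ s) <= 1 / (1 - p)"
  using p by (simp add: sum_gp_strict divide_right_mono)
 have "(\<Sum>s<n. p ^ (n - s)) = (\<Sum>s<n. p * p ^ (n - Suc s))"
  by (rule sum.cong) (auto simp flip: power_Suc simp: Suc_diff_Suc)
 also have "... = (\<Sum>s<n. p * p ^ s)" by (rule sum.nat_diff_reindex)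
 also have "... <= (\<Sum>s<n. p ^ s)" using p by (intro sum_mono) (simp add: mult_left_le_one_le)
 finally have "(\<Sum>s<n. p ^ (n - s)) <= 1 / (1 - p)" using 1 by linarith
 thus ?thesis using 1 by (simp add: sum.distrib)
qed

context basic_flow
begin

lemma d_nonneg: assumes "x \<in> X" "z \<in> X" shows "0 <= d x z"
proof -
 obtain ga where ga: "C1_curve A ga" "\<forall>t\<le>0. ga t = x" "\<forall>t\<ge>1. ga t = z"
  using connectable_X[OF assms] unfolding connectable_def by (elim exE conjE)
 show ?thesis
  by (rule riemannian_dist_ge[OF ga(1)]) (use ga curve_length_nonneg in auto)
qed

lemma continuous_on_orbit: "continuous_on X f ==> x \<in> X ==> continuous_on S (%t. f (T t x))"
 by (rule continuous_on_compose2[of X f]) (auto intro!: continuous_T_compose continuous_intros)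

lemma bounded_on_X:
 assumes "continuous_on X (f :: 'a => real)"
 obtains M where "M > 0" "\<And>x. x \<in> X ==> \<bar>f x\<bar> <= M"
proof -
 have "bounded (f ` X)" using assms compact_X by (intro compact_imp_bounded compact_continuous_image)
 thus thesis using that unfolding bounded_pos by auto
qed

text \<open>Over a unit of time the integrals along \<open>x\<close> and along the shifted orbit of
  \<open>z\<close> differ, by Hoelder continuity, by a term that decays geometrically from both
  ends. The shift itself changes by such amounts, and the shifts at the two ends cost at most
  \<open>2 * M\<close>. No bound depends on \<open>n\<close>.\<close>

lemma birkhoff_integral_variation:
 assumes hoelder: "hoelder_on d X f"
 obtains ep C where "ep > 0" "C > 0"
  "\<And>x z (n::nat). x \<in> X ==> z \<in> X ==> (\<And>s. s <= n ==> d (T (real s) x) (T (real s) z) <= ep) ==>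
   \<bar>birkhoff_integral T f (real n) x - birkhoff_integral T f (real n) z\<bar> <= C"
proof -
 obtain al Cf where al: "0 < al" "\<forall>x\<in>X. \<forall>y\<in>X. \<bar>f x - f y\<bar> <= Cf * d x y powr al"
  using hoelder unfolding hoelder_on_def by (elim exE conjE)
 have cont: "continuous_on X f" by (rule hoelder_continuous[OF hoelder])
 obtain M where M: "M > 0" "\<And>x. x \<in> X ==> \<bar>f x\<bar> <= M" using bounded_on_X[OF cont] by blast
 obtain ep C q where ep: "ep > 0" and C: "C > 0" and q: "0 < q" "q < (1::real)"
  and sync: "\<And>x z (n::nat). x \<in> X ==> z \<in> X ==> (\<And>s::nat. s <= n ==> d (T s x) (T s z) <= ep) ==>
   \<exists>r. (\<forall>s\<le>n. \<bar>r s\<bar> <= 1) \<and> (\<forall>s<n. \<bar>r (Suc s) - r s\<bar> <= C * (q ^ s + q ^ (n - s))) \<and>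
     (\<forall>s\<le>n. \<forall>u\<in>{0..1}. d (T (s + u) x) (T (s + u + r s) z) <= C * (q ^ s + q ^ (n - s)))"
  using orbit_synchronisation by blast
 define p where "p = q powr al"
 have p: "0 < p" "p < 1" using q al(1) powr_less_mono2[of al q 1] by (auto simp: p_def)
 define D where "D = \<bar>Cf\<bar> * (2 * C) powr al"
 define c where "c = D * (2 / (1 - p)) + M * C * (2 / (1 - q)) + 2 * M"
 have D: "D >= 0" by (simp add: D_def)
 have c: "c > 0" using p q C M(1) D by (simp add: c_def add_nonneg_pos)
 show thesis
 proof (rule that[OF ep c])
  fix x z and n :: nat assume x: "x \<in> X" and z: "z \<in> X" and close: "\<And>s::nat. s <= n ==> d (T s x) (T s z) <= ep"
  have "\<exists>r. (\<forall>s\<le>n. \<bar>r s\<bar> <= 1) \<and> (\<forall>s<n. \<bar>r (Suc s) - r s\<bar> <= C * (q ^ s + q ^ (n - s))) \<and>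
     (\<forall>s\<le>n. \<forall>u\<in>{0..1}. d (T (s + u) x) (T (s + u + r s) z) <= C * (q ^ s + q ^ (n - s)))"
   by (rule sync[OF x z close])
  then obtain r where r: "\<forall>s\<le>n. \<bar>r s\<bar> <= 1" "\<forall>s<n. \<bar>r (Suc s) - r s\<bar> <= C * (q ^ s + q ^ (n - s))"
   "\<forall>s\<le>n. \<forall>u\<in>{0..1}. d (T (s + u) x) (T (s + u + r s) z) <= C * (q ^ s + q ^ (n - s))"
   by (elim exE conjE)
  \<comment> \<open>The primitive starts at -2 because shifted times may be as small as -1, where it
    still has to be differentiable.\<close>
  define H where "H = (%y t. integral {-2..t} (%u. f (T u y)))"
  have H': "(H y has_real_derivative f (T t y)) (at t)" if y: "y \<in> X" and t: "t > -2" for y t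
  proof -
   have "(H y has_real_derivative f (T t y)) (at t within {-2..t+1})"
    unfolding H_def using t by (intro integral_has_real_derivative continuous_on_orbit[OF cont y]) auto
   thus ?thesis using t by (simp add: at_within_Icc_at)
  qed
  have HL: "\<bar>H y t - H y t'\<bar> <= M * \<bar>t - t'\<bar>" if y: "y \<in> X" and t: "t \<in> {-2<..}" "t' \<in> {-2<..}" for y t t'
   using field_differentiable_bound[of "{-2<..}" "H y" "%u. f (T u y)" M t t'] H'[OF y] M(2)[OF T_in_X[OF y]] t
   by (auto intro: has_field_derivative_at_within)
  have HI: "birkhoff_integral T f n y = H y n - H y 0" if y: "y \<in> X" for y
   using Henstock_Kurzweil_Integration.integral_combine[of "-2" 0 "real n" "%u. f (T u y)"]
    integrable_continuous_interval[OF continuous_on_orbit[OF cont y]]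
   by (simp add: H_def birkhoff_integral_def)
  have step: "\<bar>(H x (real s + 1) - H x s) - (H z (real s + 1 + r s) - H z (real s + r s))\<bar> <= D * (p ^ s + p ^ (n - s))" if s: "s < n" for s
  proof -
   let ?b = "D * (p ^ s + p ^ (n - s))"
   have rs: "\<bar>r s\<bar> <= 1" using r(1) s by simp
   have "\<bar>(H x (real s + 1) - H z (real s + 1 + r s)) - (H x (real s + 0) - H z (real s + 0 + r s))\<bar> <= ?b * \<bar>1 - 0\<bar>"
   proof (rule field_differentiable_bound[of "{0..1}" "%u. H x (s + u) - H z (s + u + r s)"
      "%u. f (T (s + u) x) - f (T (s + u + r s) z)" ?b 1 0, unfolded real_norm_def])
    fix u :: real assume u: "u \<in> {0..1}"
    have "((%u. H x (s + u)) has_real_derivative f (T (s + u) x) * 1) (at u)"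
     using u by (intro DERIV_chain2[OF H'[OF x]]) (auto intro!: derivative_eq_intros)
    moreover have "((%u. H z (s + u + r s)) has_real_derivative f (T (s + u + r s) z) * 1) (at u)"
     using u rs by (intro DERIV_chain2[OF H'[OF z]]) (auto intro!: derivative_eq_intros)
    ultimately have "((%u. H x (s + u) - H z (s + u + r s)) has_real_derivative
      f (T (s + u) x) * 1 - f (T (s + u + r s) z) * 1) (at u)" by (rule DERIV_diff)
    thus "((%u. H x (s + u) - H z (s + u + r s)) has_real_derivative f (T (s + u) x) - f (T (s + u + r s) z)) (at u within {0..1})"
     by (simp add: has_field_derivative_at_within)
    let ?m = "max (q ^ s) (q ^ (n - s))"
    have "\<bar>f (T (s + u) x) - f (T (s + u + r s) z)\<bar> <= Cf * d (T (s + u) x) (T (s + u + r s) z) powr al"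
     using al(2) x z by simp
    also have "... <= \<bar>Cf\<bar> * d (T (s + u) x) (T (s + u + r s) z) powr al" by (intro mult_right_mono) auto
    also have "... <= \<bar>Cf\<bar> * (2 * C * ?m) powr al"
    proof (intro mult_left_mono powr_mono2)
     have "d (T (s + u) x) (T (s + u + r s) z) <= C * (q ^ s + q ^ (n - s))" using r(3) s u by simp
     also have "... <= C * (?m + ?m)" using C by (intro mult_left_mono add_mono) auto
     finally show "d (T (s + u) x) (T (s + u + r s) z) <= 2 * C * ?m" by simp
    qed (use al(1) d_nonneg x z in auto)
    also have "... = D * ?m powr al" using C q by (simp add: D_def powr_mult)
    also have "... <= ?b"
    proof (rule mult_left_mono[OF _ D])
     have "(q ^ k) powr al = p ^ k" for k :: nat using q by (simp add: p_def powr_realpow[symmetric] powr_powr mult.commute)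
     thus "?m powr al <= p ^ s + p ^ (n - s)" using p by (simp add: max_def)
    qed
    finally show "\<bar>f (T (s + u) x) - f (T (s + u + r s) z)\<bar> <= ?b" .
   qed auto
   thus ?thesis by (simp add: algebra_simps)
  qed
  have jump: "\<bar>H z (Suc s + r s) - H z (Suc s + r (Suc s))\<bar> <= M * C * (q ^ s + q ^ (n - s))" if s: "s < n" for s
  proof -
   have "\<bar>r s\<bar> <= 1" "\<bar>r (Suc s)\<bar> <= 1" using r(1) s by simp_all
   hence "\<bar>H z (Suc s + r s) - H z (Suc s + r (Suc s))\<bar> <= M * \<bar>(Suc s + r s) - (Suc s + r (Suc s))\<bar>" using z by (intro HL) auto
   also have "... <= M * (C * (q ^ s + q ^ (n - s)))" using r(2) s M(1) by (intro mult_left_mono) (auto simp: abs_minus_commute)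
   finally show ?thesis by simp
  qed
  have tele: "(\<Sum>s<n. H y (Suc s + g (Suc s)) - H y (s + g s)) = H y (n + g n) - H y (g 0)" for y and g :: "nat => real"
   using sum_lessThan_telescope[of "%s. H y (s + g s)" n] by simp
  \<comment> \<open>Telescoping separates the comparison over unit intervals from the jumps between
    successive shifts.\<close>
  let ?L = "(H x n - H x 0) - (H z (n + r n) - H z (r 0))"
  have "?L =
    (\<Sum>s<n. (H x (real s + 1) - H x (real s)) - (H z (real s + 1 + r s) - H z (real s + r s))) + (\<Sum>s<n. H z (Suc s + r s) - H z (Suc s + r (Suc s)))"
   using tele[of x "%_. 0"] tele[of z r] by (simp add: sum_subtractf sum.distrib add_ac)
  hence "\<bar>?L\<bar> <= \<bar>\<Sum>s<n. (H x (real s + 1) - H x (real s)) - (H z (real s + 1 + r s) - H z (real s + r s))\<bar>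
    + \<bar>\<Sum>s<n. H z (Suc s + r s) - H z (Suc s + r (Suc s))\<bar>" by simp
  also have "... <= (\<Sum>s<n. D * (p ^ s + p ^ (n - s))) + (\<Sum>s<n. M * C * (q ^ s + q ^ (n - s)))"
   by (intro add_mono order_trans[OF sum_abs] sum_mono) (use step jump in auto)
  also have "... <= D * (2 / (1 - p)) + M * C * (2 / (1 - q))"
  proof (rule add_mono)
   show "(\<Sum>s<n. D * (p ^ s + p ^ (n - s))) <= D * (2 / (1 - p))"
    unfolding sum_distrib_left[symmetric, of D] by (rule mult_left_mono[OF sum_geometric_both_ends[OF p] D])
   have MC: "0 <= M * C" using M(1) C by simp
   show "(\<Sum>s<n. M * C * (q ^ s + q ^ (n - s))) <= M * C * (2 / (1 - q))"
    unfolding sum_distrib_left[symmetric, of "M * C"] by (rule mult_left_mono[OF sum_geometric_both_ends[OF q] MC])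
  qed
  finally have 1: "\<bar>?L\<bar> <= D * (2 / (1 - p)) + M * C * (2 / (1 - q))" .
  have "\<bar>H z (n + r n) - H z n\<bar> <= M * \<bar>(n + r n) - n\<bar>" "\<bar>H z (r 0) - H z 0\<bar> <= M * \<bar>r 0 - 0\<bar>"
   using z r(1)[rule_format, of 0] r(1)[rule_format, of n] by (intro HL; auto)+
  moreover have "M * \<bar>(n + r n) - n\<bar> <= M * 1" "M * \<bar>r 0 - 0\<bar> <= M * 1"
   using r(1)[rule_format, of 0] r(1)[rule_format, of n] M(1) by (intro mult_left_mono; simp)+
  ultimately show "\<bar>birkhoff_integral T f n x - birkhoff_integral T f n z\<bar> <= c"
   unfolding HI[OF x] HI[OF z] c_def using 1 by linarith
 qed
qed

end

section \<open>Gibbs measures\<close>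

locale gibbs_flow = basic_flow A G T X
 for A :: "('a::t2_space, 'e::euclidean_space) chart set" and G :: "('a, 'e) metric_tensor"
  and T :: "real => 'a => 'a" and X :: "'a set" +
 fixes \<phi> :: "'a => real" and m :: "'a measure"
 assumes \<phi>: "hoelder_on d X \<phi>" and gibbs: "gibbs_measure d T X \<phi> m"
begin

sublocale prob_space m
 using gibbs by (simp add: gibbs_measure_def)

lemma sets_m: "sets m = sets (restrict_space borel X)"
 using gibbs by (simp add: gibbs_measure_def)

lemma space_m: "space m = X"
 using sets_eq_imp_space_eq[OF sets_m] by (simp add: space_restrict_space)

lemma distr_T: "distr m m (T t) = m"
 using gibbs by (simp add: gibbs_measure_def)

lemma measurable_continuous: "continuous_on X g ==> (g :: 'a => real) \<in> borel_measurable m"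
 unfolding measurable_cong_sets[OF sets_m refl] by (rule borel_measurable_continuous_on_restrict)

lemma measurable_T [measurable]: "T t \<in> measurable m m"
proof -
 have "continuous_on X (T t)" by (intro continuous_T_compose[of X "%_. t" "%x. x"] continuous_intros)
 hence "T t \<in> measurable (restrict_space borel X) borel" by (rule borel_measurable_continuous_on_restrict)
 hence "T t \<in> measurable (restrict_space borel X) (restrict_space borel X)"
  by (rule measurable_restrict_space2[rotated]) (auto simp: space_restrict_space)
 thus ?thesis unfolding measurable_cong_sets[OF sets_m sets_m] .
qed

lemma integral_T: "g \<in> borel_measurable m ==> (\<integral>x. g (T t x) \<partial>m) = (\<integral>x. (g x :: real) \<partial>m)"
 using integral_distr[OF measurable_T, of g t] by (simp add: distr_T)

lemma measure_T: "S \<in> sets m ==> measure m {x \<in> X. T t x \<in> S} = measure m S"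
 using measure_distr[OF measurable_T, of S t] by (simp add: distr_T space_m vimage_def Int_def conj_commute)

text \<open>A Bowen ball over an arbitrary time interval, which may reach into the past; gluing
  orbits needs two-sided windows.\<close>

definition nb :: "real => real => real => 'a => 'a set" where
 "nb ep a b x = {y \<in> X. \<forall>u\<in>{a..b}. d (T u x) (T u y) < ep}"

lemma nb_bowen_ball: "nb ep a b x = {y \<in> X. T a y \<in> bowen_ball d T X (T a x) ep (b - a)}"
proof -
 have "(\<forall>u\<in>{a..b}. d (T u x) (T u y) < ep) \<longleftrightarrow> (\<forall>s\<in>{0..b - a}. d (T s (T a x)) (T s (T a y)) < ep)" for y
 proof safe
  fix s assume *: "\<forall>u\<in>{a..b}. d (T u x) (T u y) < ep" "s \<in> {0..b - a}"
  show "d (T s (T a x)) (T s (T a y)) < ep" using *(1)[rule_format, of "a + s"] *(2) by (simp add: T_T)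
 next
  fix u assume *: "\<forall>s\<in>{0..b - a}. d (T s (T a x)) (T s (T a y)) < ep" "u \<in> {a..b}"
  show "d (T u x) (T u y) < ep" using *(1)[rule_format, of "u - a"] *(2) by (simp add: T_T)
 qed
 thus ?thesis by (auto simp: nb_def bowen_ball_def)
qed

lemma continuous_\<phi>: "continuous_on X \<phi>"
 by (rule hoelder_continuous[OF \<phi>])

lemma orbit_integral_shift:
 assumes "continuous_on X (g :: 'a => real)" "x \<in> X"
 shows "integral {a..b} (%s. g (T s x)) = integral {0..b - a} (%s. g (T s (T a x)))"
proof -
 have "((%s. g (T s x)) has_integral integral {a..b} (%s. g (T s x))) {0 + a..(b - a) + a}"
  using integrable_integral[OF integrable_continuous_interval[OF continuous_on_orbit[OF assms]]] by simp
 hence "(((%s. g (T s x)) \<circ> (+) a) has_integral integral {a..b} (%s. g (T s x))) {0..b - a}"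
  by (simp only: has_integral_shift_Icc_real)
 thus ?thesis by (simp add: comp_def T_T integral_unique)
qed

text \<open>The Gibbs property asserts only that some \<open>P\<close> exists; one value is fixed
  once and for all so that weights become a function.\<close>

definition pressure :: real where
 "pressure = (SOME P. \<exists>ep0>0. \<forall>ep. 0 < ep \<and> ep < ep0 -->
    (\<exists>C>0. \<forall>x\<in>X. \<forall>t\<ge>0.
      exp (birkhoff_integral T \<phi> t x - P * t) / C <= measure m (bowen_ball d T X x ep t) \<and>
      measure m (bowen_ball d T X x ep t) <= C * exp (birkhoff_integral T \<phi> t x - P * t)))"

definition weight :: "real => real => 'a => real" where
 "weight a b x = exp (integral {a..b} (%s. \<phi> (T s x)) - pressure * (b - a))"

lemma weight_pos: "weight a b x > 0"
 by (simp add: weight_def)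

lemma weight_mult: "x \<in> X ==> a <= b ==> b <= c ==> weight a c x = weight a b x * weight b c x"
 using Henstock_Kurzweil_Integration.integral_combine[of a b c "%s. \<phi> (T s x)"]
  integrable_continuous_interval[OF continuous_on_orbit[OF continuous_\<phi>]]
 by (simp add: weight_def exp_add[symmetric] algebra_simps)

lemma weight_shift: "x \<in> X ==> weight a b (T t x) = weight (a + t) (b + t) x"
 using orbit_integral_shift[OF continuous_\<phi>, of "T t x" a b] orbit_integral_shift[OF continuous_\<phi>, of x "a + t" "b + t"]
 by (simp add: weight_def T_T add.commute)

lemma gibbs_nb:
 obtains ep0 where "ep0 > 0"
  "\<And>ep. 0 < ep ==> ep < ep0 ==> \<exists>C\<ge>1. \<forall>x\<in>X. \<forall>a b. a <= b --> nb ep a b x \<in> sets m \<and>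
    weight a b x <= C * measure m (nb ep a b x) \<and> measure m (nb ep a b x) <= C * weight a b x"
proof -
 have "\<exists>P. \<exists>ep0>0. \<forall>ep. 0 < ep \<and> ep < ep0 -->
    (\<exists>C>0. \<forall>x\<in>X. \<forall>t\<ge>0.
      exp (birkhoff_integral T \<phi> t x - P * t) / C <= measure m (bowen_ball d T X x ep t) \<and>
      measure m (bowen_ball d T X x ep t) <= C * exp (birkhoff_integral T \<phi> t x - P * t))"
  using gibbs unfolding gibbs_measure_def by (elim conjE)
 from someI_ex[OF this, folded pressure_def]
 obtain ep0 where ep0: "ep0 > 0" "\<forall>ep. 0 < ep \<and> ep < ep0 --> (\<exists>C>0. \<forall>x\<in>X. \<forall>t\<ge>0.
      exp (birkhoff_integral T \<phi> t x - pressure * t) / C <= measure m (bowen_ball d T X x ep t) \<and>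
      measure m (bowen_ball d T X x ep t) <= C * exp (birkhoff_integral T \<phi> t x - pressure * t))"
  by (elim exE conjE)
 show thesis
 proof (rule that[OF ep0(1)])
  fix ep :: real assume "0 < ep" "ep < ep0"
  then obtain C where C: "C > 0" "\<forall>x\<in>X. \<forall>t\<ge>0.
      exp (birkhoff_integral T \<phi> t x - pressure * t) / C <= measure m (bowen_ball d T X x ep t) \<and>
      measure m (bowen_ball d T X x ep t) <= C * exp (birkhoff_integral T \<phi> t x - pressure * t)"
   using ep0(2) by meson
  have "nb ep a b x \<in> sets m \<and> weight a b x <= max 1 C * measure m (nb ep a b x) \<and>
    measure m (nb ep a b x) <= max 1 C * weight a b x" if x: "x \<in> X" and ab: "a <= b" for x a b
  proof -
   let ?B = "bowen_ball d T X (T a x) ep (b - a)"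
   have w: "exp (birkhoff_integral T \<phi> (b - a) (T a x) - pressure * (b - a)) = weight a b x"
    using orbit_integral_shift[OF continuous_\<phi> x, of a b] by (simp add: weight_def birkhoff_integral_def)
   have 1: "weight a b x / C <= measure m ?B" "measure m ?B <= C * weight a b x"
    using C(2)[rule_format, OF T_in_X[OF x, of a], of "b - a"] ab unfolding w by simp_all
   have "measure m ?B > 0" using 1(1) C(1) weight_pos[of a b x] by (metis divide_pos_pos less_le_trans)
   \<comment> \<open>Sets outside \<open>sets m\<close> have measure 0, so the positive lower Gibbs
     bound shows that Bowen balls are measurable.\<close>
   hence B: "?B \<in> sets m" using measure_notin_sets by force
   have "nb ep a b x = T a -` ?B \<inter> space m" by (auto simp: nb_bowen_ball space_m)
   hence S: "nb ep a b x \<in> sets m" using measurable_sets[OF measurable_T B] by simp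
   have "measure m (nb ep a b x) = measure m ?B" unfolding nb_bowen_ball by (rule measure_T[OF B])
   moreover have "C * measure m ?B <= max 1 C * measure m ?B" "C * weight a b x <= max 1 C * weight a b x"
    using weight_pos[of a b x] by (intro mult_right_mono; simp)+
   ultimately show ?thesis using 1 C(1) S by (simp add: field_simps)
  qed
  thus "\<exists>C\<ge>1. \<forall>x\<in>X. \<forall>a b. a <= b --> nb ep a b x \<in> sets m \<and>
    weight a b x <= C * measure m (nb ep a b x) \<and> measure m (nb ep a b x) <= C * weight a b x"
   by (intro exI[of _ "max 1 C"]) simp
 qed
qed

text \<open>Symmetry of \<open>d\<close> is replaced by an estimate too, so closeness is accepted in
  either order. This is what makes the scales below composable.\<close>

lemma uniform_structure:
 assumes "ep > 0"
 obtains de where "0 < de" "de <= ep"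
  "\<And>x y z. x \<in> X ==> y \<in> X ==> z \<in> X ==> d x y < de \<or> d y x < de ==> d y z < de \<or> d z y < de ==> d x z < ep"
proof -
 obtain e K where e: "0 < e" "e <= 1" "1 <= K"
  and Q: "\<And>x y z. x \<in> X ==> y \<in> X ==> z \<in> X ==> d x y < e ==> d x z < e ==> 0 <= d y z \<and> d y z <= K * (d x y + d x z)"
  using common_constants by metis
 define de where "de = min e ep / (4 * K * K)"
 have KK: "1 * 1 <= K * K" using e(3) by (intro mult_mono) auto
 have de: "0 < de" using e assms by (simp add: de_def)
 have 4: "4 * (K * K * de) = min e ep" using e(3) by (simp add: de_def)
 have le: "de <= K * K * de" using KK de by simp
 have le2: "K * de <= K * K * de" using e(3) de by simp
 have small: "de < e" "K * de < e" "de <= ep" using 4 le le2 e(1) de assms by linarith+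
 have sym: "d y x < K * K * de + de" "d y x <= K * de" if "x \<in> X" "y \<in> X" "d x y < de \<or> d y x < de" for x y
 proof -
  have "d y x <= K * de"
  proof (cases "d x y < de")
   case True
   hence "d y x <= K * (d x y + d x x)" using Q[of x y x] that small e by simp
   also have "... <= K * de" using that True e by simp
   finally show ?thesis .
  next
   case False
   hence "d y x < de" using that(3) by blast
   moreover have "1 * de <= K * de" using e(3) de by (intro mult_right_mono) auto
   ultimately show ?thesis by linarith
  qed
  thus "d y x <= K * de" "d y x < K * K * de + de" using le2 de by linarith+
 qed
 show thesis
 proof (rule that[OF de small(3)])
  fix x y z assume a: "x \<in> X" "y \<in> X" "z \<in> X" "d x y < de \<or> d y x < de" "d y z < de \<or> d z y < de"
  have 1: "d y x <= K * de" "d y z <= K * de" using sym(2)[of x y] sym(2)[of z y] a by auto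
  hence "d x z <= K * (d y x + d y z)" using Q[of y x z] a small by simp
  also have "... <= K * (K * de + K * de)" using 1 e(3) by (intro mult_left_mono add_mono) auto
  also have "... < ep" using 4 e de assms by (simp add: algebra_simps)
  finally show "d x z < ep" .
 qed
qed

end

text \<open>Passing from one scale to the preceding one replaces the triangle inequality.\<close>

locale gibbs_scales = gibbs_flow A G T X \<phi> m
 for A :: "('a::t2_space, 'e::euclidean_space) chart set" and G :: "('a, 'e) metric_tensor"
  and T :: "real => 'a => 'a" and X :: "'a set" and \<phi> :: "'a => real" and m :: "'a measure" +
 fixes lev :: "nat => real" and C :: real
 assumes lev_pos: "lev i > 0" and lev_Suc: "lev (Suc i) <= lev i"
  and lev_chain: "x \<in> X ==> y \<in> X ==> z \<in> X ==> d x y < lev (Suc i) \<or> d y x < lev (Suc i) ==>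
   d y z < lev (Suc i) \<or> d z y < lev (Suc i) ==> d x z < lev i"
  and C1: "1 <= C"
  and nb_sets: "i <= 4 ==> x \<in> X ==> a <= b ==> nb (lev i) a b x \<in> sets m"
  and weight_le: "i <= 4 ==> x \<in> X ==> a <= b ==> weight a b x <= C * measure m (nb (lev i) a b x)"
  and le_weight: "i <= 4 ==> x \<in> X ==> a <= b ==> measure m (nb (lev i) a b x) <= C * weight a b x"

lemma (in gibbs_flow) ex_scales:
 assumes "ep > 0"
 obtains lev C where "gibbs_scales A G T X \<phi> m lev C" "lev 0 <= ep"
proof -
 obtain ep0 where ep0: "ep0 > 0" and Gi:
  "\<And>ep. 0 < ep ==> ep < ep0 ==> \<exists>C\<ge>1. \<forall>x\<in>X. \<forall>a b. a <= b --> nb ep a b x \<in> sets m \<and>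
    weight a b x <= C * measure m (nb ep a b x) \<and> measure m (nb ep a b x) <= C * weight a b x"
  using gibbs_nb by blast
 have "\<forall>e. \<exists>de. 0 < e --> 0 < de \<and> de <= e \<and> (\<forall>x\<in>X. \<forall>y\<in>X. \<forall>z\<in>X.
   (d x y < de \<or> d y x < de) --> (d y z < de \<or> d z y < de) --> d x z < e)"
 proof (rule allI)
  fix e :: real
  show "\<exists>de. 0 < e --> 0 < de \<and> de <= e \<and> (\<forall>x\<in>X. \<forall>y\<in>X. \<forall>z\<in>X.
   (d x y < de \<or> d y x < de) --> (d y z < de \<or> d z y < de) --> d x z < e)"
  proof (cases "0 < e")
   case True
   then obtain de where "0 < de" "de <= e"
    "\<And>x y z. x \<in> X ==> y \<in> X ==> z \<in> X ==> d x y < de \<or> d y x < de ==> d y z < de \<or> d z y < de ==> d x z < e"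
    using uniform_structure by blast
   thus ?thesis by (intro exI[of _ de]) auto
  qed auto
 qed
 then obtain U where U: "\<forall>e. 0 < e --> 0 < U e \<and> U e <= e \<and> (\<forall>x\<in>X. \<forall>y\<in>X. \<forall>z\<in>X.
   (d x y < U e \<or> d y x < U e) --> (d y z < U e \<or> d z y < U e) --> d x z < e)"
  by (drule_tac choice, elim exE)
 define lev where "lev = rec_nat (min ep (ep0 / 2)) (%_. U)"
 have lev0: "lev 0 = min ep (ep0 / 2)" and levS: "lev (Suc i) = U (lev i)" for i by (simp_all add: lev_def)
 have pos: "lev i > 0" for i by (induction i) (use assms ep0 U lev0 levS in auto)
 have dec: "lev (Suc i) <= lev i" for i using U pos[of i] levS by simp
 have le0: "lev i <= lev 0" for i by (induction i) (use dec order_trans in auto)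
 have "lev 0 <= ep0 / 2" unfolding lev0 by (rule min.cobounded2)
 hence lt: "lev i < ep0" for i using ep0 le0[of i] by linarith
 obtain C where C: "\<And>i. C i >= 1 \<and> (\<forall>x\<in>X. \<forall>a b. a <= b --> nb (lev i) a b x \<in> sets m \<and>
    weight a b x <= C i * measure m (nb (lev i) a b x) \<and> measure m (nb (lev i) a b x) <= C i * weight a b x)"
  using Gi[OF pos lt] by metis
 \<comment> \<open>The levels 0 to 4 suffice below: 0 for points of the same cell, 1 and 2 for the
   sandwich of cells between balls, 3 and 4 for gluing. A finite range allows a common
   constant.\<close>
 define C' where "C' = Max (C ` {..4})"
 have C': "C i <= C'" if "i <= 4" for i using that by (auto simp: C'_def)
 have "gibbs_scales A G T X \<phi> m lev C'"
 proof unfold_locales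
  fix i x a b assume i: "i <= (4::nat)" and x: "x \<in> X" and ab: "(a::real) <= b"
  have *: "nb (lev i) a b x \<in> sets m" "weight a b x <= C i * measure m (nb (lev i) a b x)"
   "measure m (nb (lev i) a b x) <= C i * weight a b x" using C[of i] x ab by auto
  have **: "C i * measure m (nb (lev i) a b x) <= C' * measure m (nb (lev i) a b x)"
   "C i * weight a b x <= C' * weight a b x" using C'[OF i] weight_pos[of a b x] by (intro mult_right_mono; simp)+
  show "nb (lev i) a b x \<in> sets m" "weight a b x <= C' * measure m (nb (lev i) a b x)"
   "measure m (nb (lev i) a b x) <= C' * weight a b x" using * ** by linarith+
 next
  fix x y z i assume "x \<in> X" "y \<in> X" "z \<in> X" "d x y < lev (Suc i) \<or> d y x < lev (Suc i)" "d y z < lev (Suc i) \<or> d z y < lev (Suc i)"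
  thus "d x z < lev i" using U pos[of i] unfolding levS by blast
 qed (use pos dec C[of 0] C'[of 0] in auto)
 thus thesis using that lev0 by simp
qed

section \<open>Cells and the quasi-Bernoulli bound\<close>

context gibbs_scales
begin

lemma lev_mono: "i <= j ==> lev j <= lev i"
 by (rule lift_Suc_antimono_le[of lev]) (use lev_Suc in auto)

lemma nb_self: "x \<in> X ==> x \<in> nb (lev i) a b x"
 using lev_pos by (simp add: nb_def)

lemma nb_subset: "i <= j ==> a <= a' ==> b' <= b ==> nb (lev j) a b x \<subseteq> nb (lev i) a' b' x"
proof
 fix y assume ij: "i <= j" "a <= a'" "b' <= b" and y: "y \<in> nb (lev j) a b x"
 have "d (T u x) (T u y) < lev i" if "u \<in> {a'..b'}" for u
 proof -
  have "u \<in> {a..b}" using that ij by simp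
  hence "d (T u x) (T u y) < lev j" using y by (simp add: nb_def)
  thus ?thesis using lev_mono[OF ij(1)] by linarith
 qed
 thus "y \<in> nb (lev i) a' b' x" using y by (simp add: nb_def)
qed

lemma nb_in_X: "y \<in> nb ep a b x ==> y \<in> X"
 by (simp add: nb_def)

lemma nb_chain:
 assumes x: "x \<in> X" "y \<in> X" "z \<in> X"
  and "y \<in> nb (lev (Suc i)) a b x \<or> x \<in> nb (lev (Suc i)) a b y"
  and "z \<in> nb (lev (Suc i)) a b y \<or> y \<in> nb (lev (Suc i)) a b z"
 shows "z \<in> nb (lev i) a b x"
proof -
 have "d (T u x) (T u z) < lev i" if u: "u \<in> {a..b}" for u
 proof (rule lev_chain[OF T_in_X[OF x(1)] T_in_X[OF x(2)] T_in_X[OF x(3)]])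
  show "d (T u x) (T u y) < lev (Suc i) \<or> d (T u y) (T u x) < lev (Suc i)" using assms(4) u by (auto simp: nb_def)
  show "d (T u y) (T u z) < lev (Suc i) \<or> d (T u z) (T u y) < lev (Suc i)" using assms(5) u by (auto simp: nb_def)
 qed
 thus ?thesis using x by (simp add: nb_def)
qed

text \<open>Bounded distortion follows from the Gibbs property alone: the ball around one point lies
  in the ball around the other one at the preceding scale, and both measures are comparable to the
  weights.\<close>

lemma weight_distortion:
 assumes i: "i <= 3" and x: "x \<in> X" and y: "y \<in> nb (lev (Suc i)) a b x" and ab: "a <= b"
 shows "weight a b y <= C\<^sup>2 * weight a b x" "weight a b x <= C\<^sup>2 * weight a b y"
proof -
 have yX: "y \<in> X" using y by (rule nb_in_X)
 have *: "weight a b u <= C\<^sup>2 * weight a b v" if u: "u \<in> X" "v \<in> X" and uv: "u \<in> nb (lev (Suc i)) a b v \<or> v \<in> nb (lev (Suc i)) a b u" for u v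
 proof -
  have "nb (lev (Suc i)) a b u \<subseteq> nb (lev i) a b v"
   using nb_chain[OF u(2,1) _ uv] nb_in_X by blast
  hence "measure m (nb (lev (Suc i)) a b u) <= measure m (nb (lev i) a b v)"
   using i u ab by (intro finite_measure_mono nb_sets) auto
  hence "C * measure m (nb (lev (Suc i)) a b u) <= C * (C * weight a b v)"
   using le_weight[of i v a b] i u ab C1 by (intro mult_left_mono) auto
  thus ?thesis using weight_le[of "Suc i" u a b] i u ab by (simp add: power2_eq_square mult.assoc)
 qed
 show "weight a b y <= C\<^sup>2 * weight a b x" "weight a b x <= C\<^sup>2 * weight a b y"
  using *[OF yX x] *[OF x yX] y by blast+
qed

lemma weight_lower: obtains w where "w > 0" "\<And>x. x \<in> X ==> w <= weight a b x"
proof -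
 obtain M where M: "M > 0" "\<And>x. x \<in> X ==> \<bar>\<phi> x\<bar> <= M" using bounded_on_X[OF continuous_\<phi>] by blast
 show thesis
 proof (rule that[of "exp (- (M * \<bar>b - a\<bar>) - pressure * (b - a))"])
  fix x assume x: "x \<in> X"
  have "norm (integral (cbox a b) (%s. \<phi> (T s x))) <= M * measure lborel (cbox a b)"
   using M x by (intro integrable_bound[OF less_imp_le] integrable_continuous continuous_on_orbit[OF continuous_\<phi>]) auto
  also have "... <= M * \<bar>b - a\<bar>" using M(1) by (intro mult_left_mono; cases "a <= b") auto
  finally have "- (M * \<bar>b - a\<bar>) <= integral {a..b} (%s. \<phi> (T s x))" by simp
  thus "exp (- (M * \<bar>b - a\<bar>) - pressure * (b - a)) <= weight a b x" by (simp add: weight_def)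
 qed simp
qed

text \<open>A covering argument of Vitali type. For a fixed time interval the measures of balls are
  bounded below, so disjoint families have bounded size and one of maximal size exists; a point
  whose ball met none of its balls could be added.\<close>

lemma maximal_disjoint_balls:
 assumes W: "W \<subseteq> X" and i: "i <= 3" and ab: "a <= b"
 obtains F where "finite F" "F \<subseteq> W" "disjoint_family_on (nb (lev (Suc i)) a b) F"
  "\<And>p. p \<in> W ==> \<exists>x\<in>F. p \<in> nb (lev i) a b x"
proof -
 let ?N = "nb (lev (Suc i)) a b"
 let ?P = "%F. finite F \<and> F \<subseteq> W \<and> disjoint_family_on ?N F"
 obtain w where w: "w > 0" "\<And>x. x \<in> X ==> w <= weight a b x" using weight_lower by blast
 have bd: "card F <= nat \<lceil>C / w\<rceil>" if F: "?P F" for F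
 proof -
  have "real (card F) * (w / C) = (\<Sum>x\<in>F. w / C)" by simp
  also have "... <= (\<Sum>x\<in>F. measure m (?N x))"
  proof (rule sum_mono)
   fix x assume "x \<in> F"
   hence "x \<in> X" using F W by blast
   hence "w <= C * measure m (?N x)" using w(2)[of x] weight_le[of "Suc i" x a b] i ab by linarith
   thus "w / C <= measure m (?N x)" using C1 by (simp add: field_simps)
  qed
  also have "... = measure m (\<Union>x\<in>F. ?N x)"
   using F W i ab by (intro finite_measure_finite_Union[symmetric]) (auto intro!: nb_sets)
  also have "... <= 1" by (rule prob_le_1)
  finally have "real (card F) <= C / w" using w(1) C1 by (simp add: field_simps)
  thus ?thesis by linarith
 qed
 have P0: "?P {}" by (simp add: disjoint_family_on_def)
 have "\<forall>F. ?P F --> card F < Suc (nat \<lceil>C / w\<rceil>)" using bd by (intro allI impI) (simp add: less_Suc_eq_le)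
 from ex_has_greatest_nat[of ?P, OF P0 this]
 obtain F where F: "?P F" and "\<forall>F'. ?P F' --> card F' <= card F" by (elim exE conjE) (rule that, simp_all)
 hence max: "card F' <= card F" if "?P F'" for F' using that by (elim allE) (rule mp)
 show thesis
 proof (rule that)
  show "finite F" "F \<subseteq> W" "disjoint_family_on ?N F" using F by auto
  fix p assume p: "p \<in> W"
  show "\<exists>x\<in>F. p \<in> nb (lev i) a b x"
  proof (rule ccontr)
   assume neg: "\<not> ?thesis"
   have "p \<notin> F" using neg nb_self[of p i a b] p W by blast
   moreover have "?N p \<inter> ?N x = {}" if x: "x \<in> F" for x
   proof (rule ccontr)
    assume "?N p \<inter> ?N x ~= {}"
    then obtain y where y: "y \<in> ?N p" "y \<in> ?N x" by blast
    have "p \<in> nb (lev i) a b x"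
     using nb_chain[of x y p i a b] x p W F y nb_in_X[OF y(1)] by blast
    thus False using neg x by blast
   qed
   ultimately have "?P (insert p F)" using F p unfolding disjoint_family_on_def by (auto simp: Int_commute)
   hence "card (insert p F) <= card F" by (rule max)
   thus False using \<open>p \<notin> F\<close> F by simp
  qed
 qed
qed

lemma ex_cells:
 "\<exists>ka :: 'a => nat. \<exists>k. (\<forall>p\<in>X. ka p < k) \<and> ka \<in> measurable m (count_space UNIV) \<and>
  (\<forall>p\<in>X. \<exists>x\<in>X. nb (lev 2) 0 (real n) x \<subseteq> {q \<in> X. ka q = ka p} \<and> {q \<in> X. ka q = ka p} \<subseteq> nb (lev 1) 0 (real n) x)"
proof -
 let ?N = "%i. nb (lev i) 0 (real n)"
 obtain F where F: "finite F" "F \<subseteq> X" "disjoint_family_on (?N 2) F" "\<And>p. p \<in> X ==> \<exists>x\<in>F. p \<in> ?N 1 x"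
  using maximal_disjoint_balls[of X 1 0 "real n"] by (auto simp: numeral_2_eq_2)
 obtain g where g: "bij_betw g {0..<card F} F" using ex_bij_betw_nat_finite[OF F(1)] by blast
 define k where "k = card F"
 \<comment> \<open>A small ball of the family together with those points of the corresponding larger
   ball that lie in no small ball. Thus small balls are never cut, and taking the least index makes
   the cells disjoint.\<close>
 define D where "D = (%i. if i < k then ?N 2 (g i) \<union> (?N 1 (g i) - (\<Union>x\<in>F. ?N 2 x)) else {})"
 define ka where "ka = (%p. LEAST i. p \<in> D i)"
 have gF: "g i \<in> F" if "i < k" for i using that g by (auto simp: k_def bij_betw_def)
 have g_surj: "\<exists>i<k. x = g i" if "x \<in> F" for x
 proof -
  have "x \<in> g ` {0..<card F}" using that bij_betw_imp_surj_on[OF g] by simp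
  thus ?thesis by (auto simp: k_def)
 qed
 have gX: "g i \<in> X" if "i < k" for i using gF[OF that] F(2) by blast
 have D_meas: "D i \<in> sets m" for i
  using F(1,2) gX by (auto simp: D_def intro!: sets.Un sets.Diff sets.finite_UN nb_sets)
 have D_sub: "D i \<subseteq> ?N 1 (g i)" for i using nb_subset[of 1 2 0 0 "real n" "real n" "g i"] by (auto simp: D_def)
 have ex: "\<exists>i<k. p \<in> D i" if p: "p \<in> X" for p
 proof (cases "\<exists>x\<in>F. p \<in> ?N 2 x")
  case True
  then obtain i where "i < k" "p \<in> ?N 2 (g i)" using g_surj by blast
  thus ?thesis by (auto simp: D_def)
 next
  case False
  obtain x where x: "x \<in> F" "p \<in> ?N 1 x" using F(4)[OF p] by blast
  then obtain i where i: "i < k" "x = g i" using g_surj by blast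
  have "p \<in> D i" using False x i by (auto simp: D_def)
  thus ?thesis using i(1) by blast
 qed
 have kaD: "p \<in> D (ka p)" if "p \<in> X" for p using ex[OF that] unfolding ka_def by (metis LeastI)
 have kak: "ka p < k" if "p \<in> X" for p using kaD[OF that] by (auto simp: D_def split: if_splits)
 have uniq: "ka p = i" if p: "p \<in> ?N 2 (g i)" and i: "i < k" for p i
 proof -
  have pX: "p \<in> X" using p by (rule nb_in_X)
  have "p \<in> D (ka p)" "ka p < k" using kaD[OF pX] kak[OF pX] by auto
  hence "p \<in> ?N 2 (g (ka p))" using p gF[OF i] by (auto simp: D_def)
  hence "g (ka p) = g i" using p F(3) gF[OF i] gF[OF kak[OF pX]] unfolding disjoint_family_on_def by blast
  thus ?thesis using g i kak[OF pX] unfolding bij_betw_def inj_on_def k_def by auto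
 qed
 show ?thesis
 proof (intro exI conjI)
  show "\<forall>p\<in>X. ka p < k" using kak by blast
  have "Measurable.pred m (%x. x \<in> D i)" for i using D_meas[of i] by simp
  thus "ka \<in> measurable m (count_space UNIV)" unfolding ka_def by (rule measurable_Least)
  show "\<forall>p\<in>X. \<exists>x\<in>X. ?N 2 x \<subseteq> {q \<in> X. ka q = ka p} \<and> {q \<in> X. ka q = ka p} \<subseteq> ?N 1 x"
  proof
   fix p assume p: "p \<in> X"
   have "?N 2 (g (ka p)) \<subseteq> {q \<in> X. ka q = ka p}" using uniq[OF _ kak[OF p]] nb_in_X by blast
   moreover have "{q \<in> X. ka q = ka p} \<subseteq> ?N 1 (g (ka p))" using kaD D_sub by fastforce
   ultimately show "\<exists>x\<in>X. ?N 2 x \<subseteq> {q \<in> X. ka q = ka p} \<and> {q \<in> X. ka q = ka p} \<subseteq> ?N 1 x" using gX[OF kak[OF p]] by blast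
  qed
 qed
qed

definition cell :: "nat => 'a => nat" where
 "cell n = (SOME ka. \<exists>k. (\<forall>p\<in>X. ka p < k) \<and> ka \<in> measurable m (count_space UNIV) \<and>
  (\<forall>p\<in>X. \<exists>x\<in>X. nb (lev 2) 0 (real n) x \<subseteq> {q \<in> X. ka q = ka p} \<and> {q \<in> X. ka q = ka p} \<subseteq> nb (lev 1) 0 (real n) x))"

lemma cell:
 shows cell_finite: "\<exists>k. \<forall>p\<in>X. cell n p < k" and cell_measurable [measurable]: "cell n \<in> measurable m (count_space UNIV)"
  and cell_sandwich: "p \<in> X ==> \<exists>x\<in>X. nb (lev 2) 0 (real n) x \<subseteq> {q \<in> X. cell n q = cell n p} \<and>
   {q \<in> X. cell n q = cell n p} \<subseteq> nb (lev 1) 0 (real n) x"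
 using someI_ex[OF ex_cells[of n], folded cell_def] by blast+

lemma cell_near: "p \<in> X ==> q \<in> X ==> cell n p = cell n q ==> q \<in> nb (lev 0) 0 (real n) p"
 using cell_sandwich[of p n] nb_chain[of p _ q 0 0 "real n"] by (auto simp: One_nat_def)

lemma weight_prod:
 assumes z: "z \<in> X" and a: "mono (a :: nat => nat)"
 shows "weight (a 0) (a n) z = (\<Prod>j<n. weight (a j) (a (Suc j)) z)"
proof (induction n)
 case 0
 thus ?case by (simp add: weight_def)
next
 case (Suc n)
 have "a 0 <= a n" "a n <= a (Suc n)" using a by (simp_all add: monoD)
 thus ?case using Suc weight_mult[OF z, of "a 0" "a n" "a (Suc n)"] by simp
qed

text \<open>If some \<open>z\<close> realises the itinerary, all points with this itinerary lie in
  one Bowen ball around \<open>z\<close>, of measure at most \<open>C\<close> times its weight.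
  Weights are multiplicative in time, and the factor of each block is at most \<open>C ^ 4\<close>
  times the measure of its cell.\<close>

lemma quasi_bernoulli:
 assumes a: "mono (a :: nat => nat)"
 shows "measure m {p \<in> X. \<forall>j<n. cell (a (Suc j) - a j) (T (a j) p) = x j}
  <= (C ^ 5) ^ n * (\<Prod>j<n. measure m {p \<in> X. cell (a (Suc j) - a j) p = x j})"
proof (cases "n = 0 \<or> {p \<in> X. \<forall>j<n. cell (a (Suc j) - a j) (T (a j) p) = x j} = {}")
 case True
 have nn: "0 <= (C ^ 5) ^ n * (\<Prod>j<n. measure m {p \<in> X. cell (a (Suc j) - a j) p = x j})"
  using C1 by (intro mult_nonneg_nonneg prod_nonneg) auto
 from True show ?thesis
 proof
  assume "n = 0" thus ?thesis by (simp add: prob_le_1)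
 next
  assume e: "{p \<in> X. \<forall>j<n. cell (a (Suc j) - a j) (T (a j) p) = x j} = {}"
  show ?thesis unfolding e using nn by simp
 qed
next
 case False
 then obtain z where z: "z \<in> X" "\<And>j. j < n ==> cell (a (Suc j) - a j) (T (a j) z) = x j" and n: "n > 0" by auto
 let ?S = "{p \<in> X. \<forall>j<n. cell (a (Suc j) - a j) (T (a j) p) = x j}"
 have a_le: "a j <= a (Suc j)" for j using a by (simp add: monoD)
 have step: "weight (a j) (a (Suc j)) z <= C ^ 4 * measure m {p \<in> X. cell (a (Suc j) - a j) p = x j}" if j: "j < n" for j
 proof -
  let ?l = "a (Suc j) - a j" and ?y = "T (a j) z"
  have y: "?y \<in> X" using z by simp
  obtain c where c: "c \<in> X" "nb (lev 2) 0 (real ?l) c \<subseteq> {q \<in> X. cell ?l q = cell ?l ?y}"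
   "{q \<in> X. cell ?l q = cell ?l ?y} \<subseteq> nb (lev 1) 0 (real ?l) c" using cell_sandwich[OF y] by blast
  have "weight (a j) (a (Suc j)) z = weight 0 (real ?l) ?y"
   using weight_shift[OF z(1), of 0 "real ?l" "real (a j)"] a_le[of j] by simp
  also have "... <= C\<^sup>2 * weight 0 (real ?l) c"
   using weight_distortion(1)[of 0 c ?y 0 "real ?l"] c y by (auto simp: One_nat_def)
  also have "... <= C\<^sup>2 * (C * measure m (nb (lev 2) 0 (real ?l) c))"
   using weight_le[of 2 c 0 "real ?l"] c C1 by (intro mult_left_mono) auto
  also have "... <= C\<^sup>2 * (C * measure m {q \<in> X. cell ?l q = cell ?l ?y})"
  proof -
   have "{q \<in> space m. cell ?l q = cell ?l ?y} \<in> sets m" by measurable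
   hence "measure m (nb (lev 2) 0 (real ?l) c) <= measure m {q \<in> X. cell ?l q = cell ?l ?y}"
    by (intro finite_measure_mono c) (simp add: space_m)
   thus ?thesis using C1 by (intro mult_left_mono) auto
  qed
  also have "... <= C ^ 4 * measure m {q \<in> X. cell ?l q = x j}"
  proof -
   have "C\<^sup>2 * C = C ^ 3" "C ^ 3 <= C ^ 4" using C1 by (auto simp: power_numeral_reduce intro: power_increasing)
   thus ?thesis using z(2)[OF j] by (simp add: mult.assoc[symmetric] mult_right_mono)
  qed
  finally show ?thesis .
 qed
 have "?S \<subseteq> nb (lev 0) (a 0) (a n) z"
 proof
  fix p assume p: "p \<in> ?S"
  have "d (T u z) (T u p) < lev 0" if u: "u \<in> {real (a 0)..real (a n)}" for u
  proof -
   have "\<exists>j<n. u \<in> {real (a j)..real (a (Suc j))}" using u n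
   proof (induction n)
    case (Suc n)
    thus ?case by (cases "n = 0 \<or> u > real (a n)") (force intro: less_SucI)+
   qed simp
   then obtain j where j: "j < n" "u \<in> {real (a j)..real (a (Suc j))}" by blast
   have "T (a j) p \<in> nb (lev 0) 0 (real (a (Suc j) - a j)) (T (a j) z)"
    using p z j by (intro cell_near) auto
   hence "d (T (u - a j) (T (a j) z)) (T (u - a j) (T (a j) p)) < lev 0" using j a_le[of j] by (auto simp: nb_def)
   thus ?thesis by (simp add: T_T)
  qed
  thus "p \<in> nb (lev 0) (a 0) (a n) z" using p by (simp add: nb_def)
 qed
 moreover have a0n: "a 0 <= a n" using a by (simp add: monoD)
 ultimately have "measure m ?S <= measure m (nb (lev 0) (a 0) (a n) z)"
  using z by (intro finite_measure_mono nb_sets) auto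
 also have "... <= C * weight (a 0) (a n) z" using z a0n by (intro le_weight) auto
 also have "... = C * (\<Prod>j<n. weight (a j) (a (Suc j)) z)" using weight_prod[OF z(1) a] by simp
 \<comment> \<open>The single factor \<open>C\<close> of the long ball is enlarged to
   \<open>C ^ n\<close> to obtain a pure power, which is why \<open>n = 0\<close> is treated
   apart.\<close>
 also have "... <= C ^ n * (\<Prod>j<n. C ^ 4 * measure m {p \<in> X. cell (a (Suc j) - a j) p = x j})"
  using C1 n step less_imp_le[OF weight_pos] by (intro mult_mono prod_mono prod_nonneg self_le_power) auto
 also have "... = (C ^ 5) ^ n * (\<Prod>j<n. measure m {p \<in> X. cell (a (Suc j) - a j) p = x j})"
  by (simp add: prod.distrib power_mult[symmetric] power_add[symmetric] mult.assoc[symmetric] algebra_simps)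
 finally show ?thesis .
qed

end

section \<open>Ergodicity\<close>

context basic_flow
begin

lemma d_small_nbhd:
 assumes x: "x \<in> X" and de: "de > 0"
 obtains U where "open U" "x \<in> U" "\<And>y. y \<in> U ==> y \<in> X ==> d x y < de"
proof -
 obtain c where c: "c \<in> A" "x \<in> fst c" using ex_chart by metis
 obtain r0 K where co: "coords c x r0 K" using local_coords[OF c x] by blast
 note rK = coordsD[OF co]
 let ?U = "{y \<in> fst c. snd c y \<in> ball (snd c x) (min r0 (de / K))}"
 show thesis
 proof (rule that)
  show "open ?U" by (rule open_chart_vimage[OF c(1) open_ball])
  show "x \<in> ?U" using c rK de by auto
  fix y assume y: "y \<in> ?U" "y \<in> X"
  have ys: "y \<in> fst c" "snd c y \<in> ball (snd c x) r0" "snd c x \<in> ball (snd c x) r0" using y rK(1) by auto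
  have "d x y <= K * norm (snd c y - snd c x)" by (rule coords_lip(3)[OF co c(2) ys(1,3,2)])
  also have "... < K * (de / K)" using y rK(2) by (intro mult_strict_left_mono) (auto simp: dist_norm norm_minus_commute)
  finally show "d x y < de" using rK(2) by simp
 qed
qed

lemma orbit_equicontinuous:
 "ep > 0 ==> \<exists>de>0. \<forall>x\<in>X. \<forall>y\<in>X. d x y < de --> (\<forall>u. \<bar>u\<bar> <= real n --> d (T u x) (T u y) < ep)"
proof (induction n arbitrary: ep)
 case 0
 thus ?case by (intro exI[of _ ep]) simp
next
 case (Suc n)
 obtain e K where e: "0 < e" "e <= 1" "1 <= K"
  and L: "\<And>x z t s. x \<in> X ==> z \<in> X ==> t \<in> {-1..1} ==> d x z < e ==> \<bar>s - t\<bar> < e ==>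
    d (T t x) (T s z) <= K * (d x z + \<bar>s - t\<bar>)" using common_constants by metis
 have "min e (ep / K) > 0" using e Suc.prems by simp
 from Suc.IH[OF this] obtain de where de: "de > 0"
  "\<forall>x\<in>X. \<forall>y\<in>X. d x y < de --> (\<forall>u. \<bar>u\<bar> <= real n --> d (T u x) (T u y) < min e (ep / K))" by (elim exE conjE)
 show ?case
 proof (intro exI[of _ de] conjI ballI impI allI)
  fix x y u assume xy: "x \<in> X" "y \<in> X" "d x y < de" and u: "\<bar>u\<bar> <= real (Suc n)"
  obtain v t where v: "\<bar>v\<bar> <= real n" "t \<in> {-1..1}" "u = v + t"
  proof (cases "\<bar>u\<bar> <= real n")
   case False
   show ?thesis by (rule that[of "sgn u * real n" "u - sgn u * real n"]) (use u False in \<open>auto simp: sgn_if\<close>)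
  qed (rule that[of u 0], auto)
  have 1: "d (T v x) (T v y) < min e (ep / K)" using de(2) xy v(1) by blast
  hence "d (T t (T v x)) (T t (T v y)) <= K * (d (T v x) (T v y) + \<bar>t - t\<bar>)"
   using xy v(2) e(1) by (intro L) auto
  also have "... < K * (ep / K)" using 1 e(3) by (intro mult_strict_left_mono) auto
  finally show "d (T u x) (T u y) < ep" using e(3) v(3) by (simp add: T_T)
 qed (rule de(1))
qed

text \<open>The dense orbit visits \<open>U\<close> and \<open>V\<close>, but perhaps in the wrong
  order. A periodic point close to it makes the same passage, and adding multiples of its period
  makes the time as large as desired.\<close>

lemma connecting_orbit:
 assumes U: "open U" "x \<in> U" "x \<in> X" and V: "open V" "y \<in> V" "y \<in> X"
 obtains z L where "z \<in> U" "z \<in> X" "T L z \<in> V" "L >= L0"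
proof -
 obtain x0 where x0: "x0 \<in> X" "X \<subseteq> closure (range (%t. T t x0))"
  using basic unfolding basic_set_def topologically_transitive_on_def by (elim conjE bexE)
 have meet: "\<exists>t. T t x0 \<in> S" if S: "open S" "w \<in> S" "w \<in> X" for S w
 proof -
  have "S \<inter> closure (range (%t. T t x0)) ~= {}" using S(2,3) x0(2) by blast
  hence "S \<inter> range (%t. T t x0) ~= {}" using open_Int_closure_eq_empty[OF S(1)] by simp
  thus ?thesis by blast
 qed
 obtain s where s: "T s x0 \<in> U" using meet[OF U] by blast
 obtain t where t: "T t x0 \<in> V" using meet[OF V] by blast
 let ?U = "U \<inter> T (t - s) -` V"
 have "continuous_on UNIV (T (t - s))" by (intro continuous_T_compose[of UNIV "%_. t - s" "%x. x"] continuous_intros)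
 hence "open (T (t - s) -` V)" by (intro open_vimage V(1))
 hence oU: "open ?U" by (intro open_Int U(1))
 have "T s x0 \<in> ?U" using s t by (simp add: T_T)
 moreover have "periodic_points_dense T X" using basic unfolding basic_set_def by (elim conjE)
 ultimately have "?U \<inter> closure {x \<in> X. \<exists>t>0. T t x = x} ~= {}"
  using x0(1) T_in_X unfolding periodic_points_dense_def by blast
 hence "?U \<inter> {x \<in> X. \<exists>t>0. T t x = x} ~= {}" using open_Int_closure_eq_empty[OF oU] by simp
 then obtain p ta where p: "p \<in> ?U" "p \<in> X" "ta > 0" "T ta p = p" by blast
 have per: "T (real k * ta) p = p" for k
 proof (induction k)
  case (Suc k)
  have "T (real (Suc k) * ta) p = T (real k * ta) (T ta p)" by (simp add: T_T algebra_simps)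
  thus ?case using Suc p(4) by simp
 qed simp
 obtain k :: nat where k: "(L0 - (t - s)) / ta <= real k" using real_arch_simple by blast
 show thesis
 proof (rule that[of p "t - s + real k * ta"])
  show "p \<in> U" "p \<in> X" using p by auto
  have "T (t - s + real k * ta) p = T (t - s) (T (real k * ta) p)" by (simp add: T_T add.commute)
  thus "T (t - s + real k * ta) p \<in> V" using per p(1) by simp
  have "L0 - (t - s) <= real k * ta" using k p(3) by (simp add: divide_le_eq)
  thus "L0 <= t - s + real k * ta" by linarith
 qed
qed

end

section \<open>Gluing orbits\<close>

context gibbs_scales
begin

lemma connecting_balls:
 assumes x: "x \<in> X" and y: "y \<in> X"
 obtains z L where "z \<in> nb (lev i) (- N) N x" "T L z \<in> nb (lev i) (- N) N y" "L >= L0"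
proof -
 have nbhd: "\<exists>U. open U \<and> w \<in> U \<and> (\<forall>q\<in>U. q \<in> X --> q \<in> nb (lev i) (- N) N w)" if w: "w \<in> X" for w
 proof -
  obtain n :: nat where n: "N <= real n" using real_arch_simple by blast
  obtain de where de: "de > 0" "\<forall>x\<in>X. \<forall>y\<in>X. d x y < de --> (\<forall>u. \<bar>u\<bar> <= real n --> d (T u x) (T u y) < lev i)"
   using orbit_equicontinuous[OF lev_pos] by blast
  obtain U where U: "open U" "w \<in> U" "\<And>q. q \<in> U ==> q \<in> X ==> d w q < de" using d_small_nbhd[OF w de(1)] by blast
  have "q \<in> nb (lev i) (- N) N w" if q: "q \<in> U" "q \<in> X" for q
  proof -
   have "\<forall>u. \<bar>u\<bar> <= real n --> d (T u w) (T u q) < lev i" using de(2) w q(2) U(3)[OF q] by blast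
   moreover have "\<bar>u\<bar> <= real n" if "u \<in> {- N..N}" for u using that n by auto
   ultimately show ?thesis using q(2) by (auto simp: nb_def)
  qed
  thus ?thesis using U(1,2) by blast
 qed
 obtain U where U: "open U" "x \<in> U" "\<forall>q\<in>U. q \<in> X --> q \<in> nb (lev i) (- N) N x" using nbhd[OF x] by blast
 obtain V where V: "open V" "y \<in> V" "\<forall>q\<in>V. q \<in> X --> q \<in> nb (lev i) (- N) N y" using nbhd[OF y] by blast
 obtain z L where z: "z \<in> U" "z \<in> X" "T L z \<in> V" "L >= L0" by (rule connecting_orbit[OF U(1,2) x V(1,2) y])
 show thesis by (rule that[OF _ _ z(4)]) (use z U(3) V(3) T_in_X in blast)+
qed

text \<open>Pigeonhole: the small balls are disjoint and carry a total mass of at least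
  \<open>ga / C\<^sup>2\<close>, so in one of them the share of \<open>B\<close> does not exceed the
  average share.\<close>

lemma ball_selection:
 assumes F: "finite F" "F \<subseteq> X" "disjoint_family_on (nb (lev 2) a b) F" and ab: "a <= b"
  and P: "P \<in> sets m" "P \<subseteq> (\<Union>x\<in>F. nb (lev 1) a b x)" "ga <= measure m P" and ga: "ga > 0"
  and B: "B \<in> sets m" "measure m (B \<inter> (\<Union>x\<in>F. nb (lev 2) a b x)) <= bb"
 obtains x where "x \<in> F" "measure m (nb (lev 2) a b x \<inter> B) <= C\<^sup>2 * bb / ga * measure m (nb (lev 2) a b x)"
proof -
 let ?N = "nb (lev 2) a b"
 have N: "?N x \<in> sets m" if "x \<in> F" for x using that F ab by (intro nb_sets) auto
 have "ga <= measure m (\<Union>x\<in>F. nb (lev 1) a b x)"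
  using P F ab nb_sets[of 1] by (intro order_trans[OF P(3)] finite_measure_mono sets.finite_UN) auto
 also have "... <= (\<Sum>x\<in>F. measure m (nb (lev 1) a b x))"
  using F ab nb_sets[of 1] by (intro finite_measure_subadditive_finite) auto
 also have "... <= (\<Sum>x\<in>F. C\<^sup>2 * measure m (?N x))"
 proof (rule sum_mono)
  fix x assume "x \<in> F"
  hence x: "x \<in> X" using F by blast
  have "measure m (nb (lev 1) a b x) <= C * weight a b x" using x ab by (intro le_weight) auto
  also have "... <= C * (C * measure m (?N x))" using x ab C1 by (intro mult_left_mono weight_le) auto
  finally show "measure m (nb (lev 1) a b x) <= C\<^sup>2 * measure m (?N x)" by (simp add: power2_eq_square)
 qed
 finally have sum: "ga <= C\<^sup>2 * (\<Sum>x\<in>F. measure m (?N x))" by (simp add: sum_distrib_left)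
 have bad: "(\<Sum>x\<in>F. measure m (?N x \<inter> B)) <= bb"
 proof -
  have "(\<Sum>x\<in>F. measure m (?N x \<inter> B)) = measure m (\<Union>x\<in>F. ?N x \<inter> B)"
   using F N B by (intro finite_measure_finite_Union[symmetric]) (auto simp: disjoint_family_on_def)
  also have "(\<Union>x\<in>F. ?N x \<inter> B) = B \<inter> (\<Union>x\<in>F. ?N x)" by blast
  finally show ?thesis using B(2) by simp
 qed
 have bb: "bb >= 0" using B(2) measure_nonneg order_trans by blast
 have "\<exists>x\<in>F. measure m (?N x \<inter> B) <= C\<^sup>2 * bb / ga * measure m (?N x)"
 proof (rule ccontr)
  assume neg: "\<not> ?thesis"
  have "F ~= {}" using sum ga by auto
  hence "(\<Sum>x\<in>F. C\<^sup>2 * bb / ga * measure m (?N x)) < (\<Sum>x\<in>F. measure m (?N x \<inter> B))"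
   using neg F(1) by (intro sum_strict_mono) auto
  also have "... <= bb" by (rule bad)
  finally have "bb / ga * (C\<^sup>2 * (\<Sum>x\<in>F. measure m (?N x))) < bb" by (simp add: sum_distrib_left mult_ac)
  moreover have "bb / ga * ga <= bb / ga * (C\<^sup>2 * (\<Sum>x\<in>F. measure m (?N x)))" using sum bb ga by (intro mult_left_mono) auto
  ultimately show False using ga by simp
 qed
 thus thesis using that by blast
qed

text \<open>All points of \<open>W\<close> follow \<open>z\<close> during \<open>{a'..b'}\<close>,
  so they are distinguished only during \<open>{a..b}\<close>. Balls over the long interval have
  weights that split, and the disjoint short balls around points of \<open>W\<close> fit into the
  part of \<open>B\<close> near \<open>x\<close>. The interval \<open>{a..b}\<close> may come before
  or after the other one.\<close>

lemma gluing_bound: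
 assumes ab: "a <= b" "a' <= b'" "lo <= hi" and split: "\<And>x. x \<in> X ==> weight lo hi x = weight a b x * weight a' b' x"
  and cover: "{lo..hi} \<subseteq> {a..b} \<union> {a'..b'}" and N: "N >= 0" "{- N..N} \<subseteq> {a..b}" "{- N..N} \<subseteq> S"
  and x: "x \<in> X" and z: "z \<in> nb (lev 4) (- N) N x"
  and S: "{a'..b'} \<subseteq> S" and W: "W \<in> sets m" "\<And>p u. p \<in> W ==> u \<in> S ==> d (T u z) (T u p) < lev 4"
  and B: "B \<in> sets m" "\<And>p. p \<in> W ==> nb (lev 4) a b p \<subseteq> B"
 shows "measure m W <= C ^ 4 * weight a' b' z * measure m (nb (lev 2) (- N) N x \<inter> B)"
proof -
 have WX: "W \<subseteq> X" using sets.sets_into_space[OF W(1)] by (simp add: space_m)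
 have zX: "z \<in> X" using z by (rule nb_in_X)
 have le43: "lev 4 <= lev 3" "lev 3 <= lev 2" by (simp_all add: lev_mono)
 obtain F where F: "finite F" "F \<subseteq> W" "disjoint_family_on (nb (lev (Suc 3)) a b) F" "\<And>p. p \<in> W ==> \<exists>y\<in>F. p \<in> nb (lev 3) a b y"
  using maximal_disjoint_balls[OF WX _ ab(1), of 3] by auto
 have S4: "Suc 3 = 4" by simp
 note F = F[unfolded S4]
 have FX: "y \<in> X" if "y \<in> F" for y using that F(2) WX by blast
 have J: "d (T u p) (T u q) < lev 3" if "p \<in> W" "q \<in> W" "u \<in> {a'..b'}" for p q u
 proof (rule lev_chain[of "T u p" "T u z" "T u q"])
  have uS: "u \<in> S" using that(3) S by blast
  show "d (T u p) (T u z) < lev (Suc 3) \<or> d (T u z) (T u p) < lev (Suc 3)" "d (T u z) (T u q) < lev (Suc 3) \<or> d (T u q) (T u z) < lev (Suc 3)"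
   unfolding S4 using W(2)[OF that(1) uS] W(2)[OF that(2) uS] by auto
 qed (use that WX zX in auto)
 have "W \<subseteq> (\<Union>y\<in>F. nb (lev 3) lo hi y)"
 proof
  fix p assume p: "p \<in> W"
  obtain y where y: "y \<in> F" "p \<in> nb (lev 3) a b y" using F(4)[OF p] by blast
  have "d (T u y) (T u p) < lev 3" if "u \<in> {lo..hi}" for u
  proof -
   have "u \<in> {a..b} \<or> u \<in> {a'..b'}" using that cover by blast
   thus ?thesis using y p F(2) J by (auto simp: nb_def)
  qed
  hence "p \<in> nb (lev 3) lo hi y" using p WX by (auto simp: nb_def)
  thus "p \<in> (\<Union>y\<in>F. nb (lev 3) lo hi y)" using y(1) by blast
 qed
 hence "measure m W <= measure m (\<Union>y\<in>F. nb (lev 3) lo hi y)"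
  using F FX ab nb_sets[of 3] by (intro finite_measure_mono sets.finite_UN) auto
 also have "... <= (\<Sum>y\<in>F. measure m (nb (lev 3) lo hi y))"
  using F FX ab nb_sets[of 3] by (intro finite_measure_subadditive_finite) auto
 also have "... <= (\<Sum>y\<in>F. C ^ 4 * weight a' b' z * measure m (nb (lev 4) a b y))"
 proof (rule sum_mono)
  fix y assume y: "y \<in> F"
  have yW: "y \<in> W" using y F(2) by blast
  have yz: "y \<in> nb (lev (Suc 3)) a' b' z" using W(2)[OF yW] S FX[OF y] by (auto simp: nb_def)
  have "measure m (nb (lev 3) lo hi y) <= C * weight lo hi y" using FX[OF y] ab by (intro le_weight) auto
  also have "... = C * (weight a b y * weight a' b' y)" using split[OF FX[OF y]] by simp
  also have "... <= C * ((C * measure m (nb (lev 4) a b y)) * (C\<^sup>2 * weight a' b' z))"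
   using C1 FX[OF y] ab weight_le[of 4 y a b] weight_distortion(1)[OF _ zX yz ab(2)] less_imp_le[OF weight_pos]
   by (intro mult_left_mono mult_mono) auto
  also have "... = C ^ 4 * weight a' b' z * measure m (nb (lev 4) a b y)" by (simp add: power_numeral_reduce mult_ac)
  finally show "measure m (nb (lev 3) lo hi y) <= C ^ 4 * weight a' b' z * measure m (nb (lev 4) a b y)" .
 qed
 also have "... = C ^ 4 * weight a' b' z * measure m (\<Union>y\<in>F. nb (lev 4) a b y)"
  using F FX ab nb_sets[of 4] by (subst finite_measure_finite_Union) (auto simp: sum_distrib_left)
 also have "... <= C ^ 4 * weight a' b' z * measure m (nb (lev 2) (- N) N x \<inter> B)"
 proof (intro mult_left_mono finite_measure_mono)
  show "nb (lev 2) (- N) N x \<inter> B \<in> sets m" using B nb_sets[of 2 x "- N" N] x N by auto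
  show "(\<Union>y\<in>F. nb (lev 4) a b y) \<subseteq> nb (lev 2) (- N) N x \<inter> B"
  proof safe
   fix y q assume y: "y \<in> F" and q: "q \<in> nb (lev 4) a b y"
   have yW: "y \<in> W" using y F(2) by blast
   show "q \<in> B" using B(2)[OF yW] q by blast
   have "y \<in> nb (lev (Suc 3)) (- N) N z" using W(2)[OF yW] N(3) FX[OF y] by (auto simp: nb_def)
   moreover have "z \<in> nb (lev (Suc 3)) (- N) N x" using z by simp
   ultimately have "y \<in> nb (lev 3) (- N) N x" using nb_chain[OF x zX FX[OF y]] by blast
   moreover have "q \<in> nb (lev 3) (- N) N y"
    using q N(2) le43 unfolding nb_def by (auto intro: order_less_le_trans)
   ultimately show "q \<in> nb (lev 2) (- N) N x"
    using nb_chain[OF x FX[OF y] nb_in_X[OF q], of 2 "- N" N] by simp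
  qed
 qed (use C1 less_imp_le[OF weight_pos] in auto)
 finally show ?thesis .
qed

end

context prob_space
begin

lemma integrable_bounded:
 "v \<in> borel_measurable M ==> (\<And>x. x \<in> space M ==> \<bar>v x\<bar> <= (B::real)) ==> integrable M v"
 by (rule integrable_const_bound[of _ B]) auto

text \<open>By the parallelogram law.\<close>

lemma near_minimal_deviation:
 assumes [measurable]: "a \<in> borel_measurable M" "b \<in> borel_measurable M"
  and bd: "\<And>x. x \<in> space M ==> \<bar>a x\<bar> <= 1" "\<And>x. x \<in> space M ==> \<bar>b x\<bar> <= 1"
  and E: "expectation (%x. (a x)\<^sup>2) <= de + ka" "expectation (%x. (b x)\<^sup>2) <= de + ka'"
  and mid: "de <= expectation (%x. ((a x + b x) / 2)\<^sup>2)" and c: "c > 0"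
 shows "prob {x \<in> space M. c <= \<bar>a x - b x\<bar>} <= 2 * (ka + ka') / c\<^sup>2"
proof -
 have i1: "integrable M (%x. (a x)\<^sup>2)" "integrable M (%x. (b x)\<^sup>2)"
  using bd by (intro integrable_bounded[of _ 1]; simp add: abs_square_le_1)+
 have sb: "\<bar>((a x + b x) / 2)\<^sup>2\<bar> <= 1" if "x \<in> space M" for x
  using bd(1)[OF that] bd(2)[OF that] by (simp add: abs_square_le_1)
 have i2: "integrable M (%x. ((a x + b x) / 2)\<^sup>2)"
  by (rule integrable_bounded[of _ 1]) (use sb in auto)
 have id: "(a x - b x)\<^sup>2 = 2 * (a x)\<^sup>2 + 2 * (b x)\<^sup>2 - 4 * ((a x + b x) / 2)\<^sup>2" for x
  by (simp add: power2_eq_square field_simps)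
 have iab: "integrable M (%x. (a x - b x)\<^sup>2)" unfolding id using i1 i2 by simp
 have "expectation (%x. (a x - b x)\<^sup>2) = 2 * expectation (%x. (a x)\<^sup>2) + 2 * expectation (%x. (b x)\<^sup>2) -
   4 * expectation (%x. ((a x + b x) / 2)\<^sup>2)" unfolding id using i1 i2 by simp
 hence le: "expectation (%x. (a x - b x)\<^sup>2) <= 2 * (ka + ka')" using E mid by (simp add: algebra_simps)
 have "{x \<in> space M. c <= \<bar>a x - b x\<bar>} = {x \<in> space M. c\<^sup>2 <= (a x - b x)\<^sup>2}"
  using c by (auto simp: abs_le_square_iff[symmetric])
 also have "prob ... <= expectation (%x. (a x - b x)\<^sup>2) / c\<^sup>2"
  using iab c by (intro integral_Markov_inequality_measure[where A = "{}"]) auto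
 also have "... <= 2 * (ka + ka') / c\<^sup>2" using le c by (intro divide_right_mono) auto
 finally show ?thesis .
qed

text \<open>Since \<open>|v| <= 1\<close> and the mean vanishes, the integral of
  \<open>v\<^sup>2\<close> is at most twice that of the positive part, which is at most
  \<open>de / 4\<close> plus the probability in question.\<close>

lemma centred_positive_part:
 assumes [measurable]: "v \<in> borel_measurable M" and bd: "\<And>x. x \<in> space M ==> \<bar>v x\<bar> <= 1"
  and E: "expectation v = 0" "de <= expectation (%x. (v x)\<^sup>2)" and de: "de > 0"
 shows "de / 4 <= prob {x \<in> space M. v x > de / 4}"
proof -
 let ?P = "{x \<in> space M. v x > de / 4}"
 have iv: "integrable M v" using bd by (intro integrable_bounded[of _ 1]) auto
 have le: "(v x)\<^sup>2 <= 2 * (de / 4 + indicator ?P x) - v x" if x: "x \<in> space M" for x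
 proof -
  have "(v x)\<^sup>2 = \<bar>v x\<bar> * \<bar>v x\<bar>" by (simp add: power2_eq_square)
  hence "(v x)\<^sup>2 <= \<bar>v x\<bar>" using mult_left_le[OF bd[OF x], of "\<bar>v x\<bar>"] by simp
  thus ?thesis using bd[OF x] de x by (cases "v x > de / 4") (auto simp: abs_if split: if_splits)
 qed
 have "de <= expectation (%x. 2 * (de / 4 + indicator ?P x) - v x)"
 proof (intro order_trans[OF E(2)] integral_mono le)
  show "integrable M (%x. (v x)\<^sup>2)" using bd by (intro integrable_bounded[of _ 1]) (auto simp: abs_square_le_1)
  show "integrable M (%x. 2 * (de / 4 + indicator ?P x) - v x)"
   using iv by (intro Bochner_Integration.integrable_diff integrable_mult_right Bochner_Integration.integrable_add integrable_const integrable_indicator_iff[THEN iffD2])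
    (auto simp: emeasure_eq_measure)
 qed
 also have "... = 2 * (de / 4 + prob ?P)"
 proof -
  have "integrable M (indicator ?P :: 'a => real)" by (simp add: integrable_indicator_iff emeasure_eq_measure)
  hence "expectation (%x. 2 * (de / 4 + indicator ?P x) - v x) = 2 * (de / 4 + expectation (indicator ?P)) - expectation v"
   using iv by (subst Bochner_Integration.integral_diff) (auto simp: prob_space)
  thus ?thesis using E(1) by simp
 qed
 finally show ?thesis by simp
qed

end

context gibbs_scales
begin

text \<open>Relative to the ball of \<open>z\<close>, the set \<open>W\<close> inherits the
  proportion \<open>et\<close> that \<open>B\<close> has near \<open>x\<close>, up to
  \<open>C ^ 8\<close>: the window \<open>{- N..N}\<close> is common to both balls and the weight of
  the remaining time cancels. Abstract intervals let the lemma serve for past and future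
  alike.\<close>

lemma gluing_fraction:
 assumes ab: "a <= b" "a' <= b'" "lo <= hi" and split: "\<And>x. x \<in> X ==> weight lo hi x = weight a b x * weight a' b' x"
  and cover: "{lo..hi} \<subseteq> {a..b} \<union> {a'..b'}" and N: "N >= 0" "{- N..N} \<subseteq> {a..b}" "{- N..N} \<subseteq> {s..s'}"
  and x: "x \<in> X" and z: "z \<in> nb (lev 4) (- N) N x"
  and S: "{a'..b'} \<subseteq> {s..s'}" "s <= s'" and zsplit: "weight s s' z = weight (- N) N z * weight a' b' z"
  and W: "W \<in> sets m" "W \<subseteq> nb (lev 4) s s' z"
  and B: "B \<in> sets m" "\<And>p. p \<in> W ==> nb (lev 4) a b p \<subseteq> B"
  and et: "measure m (nb (lev 2) (- N) N x \<inter> B) <= et * measure m (nb (lev 2) (- N) N x)" "et >= 0"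
 shows "measure m W <= C ^ 8 * et * measure m (nb (lev 4) s s' z)"
proof -
 have zX: "z \<in> X" using z by (rule nb_in_X)
 have W': "d (T u z) (T u p) < lev 4" if "p \<in> W" "u \<in> {s..s'}" for p u using W(2) that by (auto simp: nb_def)
 have z4: "z \<in> nb (lev (Suc 3)) (- N) N x" using z by simp
 have w0: "0 <= weight u v y" for u v y using weight_pos[of u v y] by simp
 have "measure m W <= C ^ 4 * weight a' b' z * measure m (nb (lev 2) (- N) N x \<inter> B)"
  by (rule gluing_bound[OF ab split cover N x z S(1) W(1) W' B])
 also have "... <= C ^ 4 * weight a' b' z * (et * (C * (C\<^sup>2 * weight (- N) N z)))"
 proof (rule mult_left_mono)
  have "measure m (nb (lev 2) (- N) N x) <= C * weight (- N) N x" using x N by (intro le_weight) auto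
  also have "... <= C * (C\<^sup>2 * weight (- N) N z)"
   using C1 N(1) weight_distortion(2)[OF _ x z4] by (intro mult_left_mono) auto
  finally show "measure m (nb (lev 2) (- N) N x \<inter> B) <= et * (C * (C\<^sup>2 * weight (- N) N z))"
   using et by (meson mult_left_mono order_trans)
 qed (use C1 w0 in auto)
 also have "... = C ^ 7 * et * weight s s' z" by (simp add: zsplit power_numeral_reduce mult_ac)
 also have "... <= C ^ 7 * et * (C * measure m (nb (lev 4) s s' z))"
  using C1 et(2) weight_le[of 4 z s s'] zX S(2) by (intro mult_left_mono) auto
 also have "... = C ^ 8 * et * measure m (nb (lev 4) s s' z)" by (simp add: power_numeral_reduce mult_ac)
 finally show ?thesis .
qed

lemma nb_shift: "T L p \<in> nb e a b (T L z) \<longleftrightarrow> p \<in> nb e (a + L) (b + L) z"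
proof -
 have "(\<forall>u\<in>{a..b}. d (T u (T L z)) (T u (T L p)) < e) \<longleftrightarrow> (\<forall>u\<in>{a + L..b + L}. d (T u z) (T u p) < e)"
 proof safe
  fix u assume *: "\<forall>u\<in>{a..b}. d (T u (T L z)) (T u (T L p)) < e" "u \<in> {a + L..b + L}"
  show "d (T u z) (T u p) < e" using *(1)[rule_format, of "u - L"] *(2) by (simp add: T_T)
 next
  fix u assume *: "\<forall>u\<in>{a + L..b + L}. d (T u z) (T u p) < e" "u \<in> {a..b}"
  show "d (T u (T L z)) (T u (T L p)) < e" using *(1)[rule_format, of "u + L"] *(2) by (simp add: T_T add.commute)
 qed
 moreover have "T L p \<in> X \<longleftrightarrow> p \<in> X" using T_in_X[of p L] T_in_X[of "T L p" "- L"] by (auto simp: T_T)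
 ultimately show ?thesis by (simp add: nb_def)
qed

text \<open>The substitute for a function of finitely many coordinates of a symbolic system: up to
  \<open>om\<close> the value is fixed by the orbit during \<open>{- N..N}\<close>.\<close>

definition determined :: "real => real => ('a => real) => bool" where
 "determined om N v \<longleftrightarrow> (\<forall>p\<in>X. \<forall>q\<in>nb (lev 0) (- N) N p. \<bar>v p - v q\<bar> <= om)"

lemma determinedD:
 assumes v: "determined om N v" and p: "p \<in> X" and q: "q \<in> nb (lev i) a b p" and N: "a <= t - N" "t + N <= b"
 shows "\<bar>v (T t p) - v (T t q)\<bar> <= om"
proof -
 have "q \<in> nb (lev 0) (- N + t) (N + t) p" using q nb_subset[of 0 i a "- N + t" "N + t" b p] N by auto
 hence "T t q \<in> nb (lev 0) (- N) N (T t p)" by (simp add: nb_shift)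
 thus ?thesis using v p by (simp add: determined_def)
qed


text \<open>The finite set \<open>F\<close> depends on \<open>v\<close> but not on \<open>B\<close>.
  This order of quantifiers is decisive: the orbits connecting points of two such sets, and lower
  bounds for the measures of their balls, can be fixed before a better minimiser is chosen.\<close>

lemma selection_family:
 assumes v: "v \<in> borel_measurable m" "\<And>x. x \<in> X ==> \<bar>v x\<bar> <= 1" "(\<integral>x. v x \<partial>m) = 0" "de <= (\<integral>x. (v x)\<^sup>2 \<partial>m)"
  and det: "determined om N v" "N >= 0" and de: "de > 0"
 obtains F where "finite F" "F \<subseteq> X"
  "\<And>B bb. B \<in> sets m ==> measure m (B \<inter> {x \<in> X. de / 4 - om <= v x}) <= bb ==>
    \<exists>x\<in>F. measure m (nb (lev 2) (- N) N x \<inter> B) <= 4 * C\<^sup>2 * bb / de * measure m (nb (lev 2) (- N) N x)"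
proof -
 note [measurable] = v(1)
 define P where "P = {x \<in> X. v x > de / 4}"
 have P: "P \<in> sets m" "P \<subseteq> X" unfolding P_def space_m[symmetric] by auto
 have mP: "de / 4 <= measure m P"
  using centred_positive_part[of v de] v de by (simp add: P_def space_m)
 obtain F where F: "finite F" "F \<subseteq> P" "disjoint_family_on (nb (lev (Suc 1)) (- N) N) F"
  "\<And>p. p \<in> P ==> \<exists>x\<in>F. p \<in> nb (lev 1) (- N) N x"
  using maximal_disjoint_balls[OF P(2), of 1 "- N" N] det(2) by auto
 have S1: "Suc 1 = 2" by simp
 note F = F[unfolded S1]
 have FX: "F \<subseteq> X" using F P by blast
 have cov: "P \<subseteq> (\<Union>x\<in>F. nb (lev 1) (- N) N x)" using F(4) by blast
 have pos: "(\<Union>x\<in>F. nb (lev 2) (- N) N x) \<subseteq> {x \<in> X. de / 4 - om <= v x}"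
 proof safe
  fix x p assume x: "x \<in> F" and p: "p \<in> nb (lev 2) (- N) N x"
  show "p \<in> X" using p by (rule nb_in_X)
  have "\<bar>v (T 0 x) - v (T 0 p)\<bar> <= om" using x FX by (intro determinedD[OF det(1) _ p]) auto
  moreover have "v x > de / 4" using x F(2) by (auto simp: P_def)
  ultimately show "de / 4 - om <= v p" by simp
 qed
 have meas: "{x \<in> X. de / 4 - om <= v x} \<in> sets m" unfolding space_m[symmetric] by measurable
 show thesis
 proof (rule that[OF F(1) FX])
  fix B bb assume B: "B \<in> sets m" and bb: "measure m (B \<inter> {x \<in> X. de / 4 - om <= v x}) <= bb"
  have "measure m (B \<inter> (\<Union>x\<in>F. nb (lev 2) (- N) N x)) <= measure m (B \<inter> {x \<in> X. de / 4 - om <= v x})"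
   using pos B meas by (intro finite_measure_mono) auto
  with bb have le: "measure m (B \<inter> (\<Union>x\<in>F. nb (lev 2) (- N) N x)) <= bb" by linarith
  have ab: "- N <= N" and de4: "de / 4 > 0" using det(2) de by auto
  obtain x where "x \<in> F" "measure m (nb (lev 2) (- N) N x \<inter> B) <= C\<^sup>2 * bb / (de / 4) * measure m (nb (lev 2) (- N) N x)"
   by (rule ball_selection[OF F(1) FX F(3) ab P(1) cov mP de4 B le])
  thus "\<exists>x\<in>F. measure m (nb (lev 2) (- N) N x \<inter> B) <= 4 * C\<^sup>2 * bb / de * measure m (nb (lev 2) (- N) N x)"
   by (intro bexI[of _ x]) (auto simp: mult_ac)
 qed
qed

text \<open>
 If the minimal \<open>L\<^sup>2\<close> norm were large, a near minimiser would be positive around some point \<open>x\<close> and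
 negative around some point \<open>y\<close>. A much better near minimiser has to follow these signs in the past of
 \<open>x\<close> and in the future of \<open>y\<close>. Gluing both along an orbit from \<open>x\<close> to \<open>y\<close> produces a set, of measure
 bounded below beforehand, on which two shifts of that minimiser differ, contrary to the parallelogram
 law.
\<close>

lemma small_average:
 assumes V: "\<And>v. v \<in> V ==> v \<in> borel_measurable m" "\<And>v x. v \<in> V ==> x \<in> X ==> \<bar>v x\<bar> <= 1"
   "\<And>v. v \<in> V ==> (\<integral>x. v x \<partial>m) = 0" "\<And>v. v \<in> V ==> \<exists>N\<ge>0. determined om N v"
  and shift: "\<And>v t. v \<in> V ==> (%x. v (T t x)) \<in> V"
  and mid: "\<And>v w. v \<in> V ==> w \<in> V ==> (%x. (v x + w x) / 2) \<in> V"
  and ne: "V ~= {}" and om: "om > 0"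
 shows "\<exists>v\<in>V. (\<integral>x. (v x)\<^sup>2 \<partial>m) <= 33 * om"
proof (rule ccontr)
 assume neg: "\<not> ?thesis"
 let ?E = "%v. \<integral>x. (v x)\<^sup>2 \<partial>m"
 define de where "de = Inf (?E ` V)"
 have bdd: "bdd_below (?E ` V)" by (intro bdd_belowI[of _ 0]) auto
 have de_le: "de <= ?E v" if "v \<in> V" for v unfolding de_def using that bdd by (intro cInf_lower) auto
 have "33 * om <= de" unfolding de_def using neg ne by (intro cInf_greatest) auto
 hence de: "de > 0" "om <= de / 32" using om by auto
 have near: "\<exists>v\<in>V. ?E v <= de + ka" if "ka > 0" for ka
  using cInf_lessD[of "?E ` V" "de + ka"] ne that by (auto simp: de_def intro: less_imp_le)
 have Eshift: "?E (%x. v (T t x)) = ?E v" if "v \<in> V" for v t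
  using integral_T[of "%x. (v x)\<^sup>2" t] V(1)[OF that] by simp
 have dev: "measure m {x \<in> X. c <= \<bar>v x - w x\<bar>} <= 2 * (ka + ka') / c\<^sup>2"
  if "v \<in> V" "w \<in> V" "?E v <= de + ka" "?E w <= de + ka'" "c > 0" for v w ka ka' c
  using near_minimal_deviation[of v w de ka ka' c] V that de_le[OF mid[OF that(1,2)]] by (simp add: space_m)
 \<comment> \<open>Chosen such that \<open>C ^ 8 * et <= 1 / 4\<close> for the \<open>et\<close>
   below.\<close>
 define ka where "ka = de ^ 3 / (8000 * C ^ 10)"
 have ka: "ka > 0" using de C1 by (simp add: ka_def)
 \<comment> \<open>On the selected balls \<open>v\<close> is at least \<open>de / 4 - om\<close>,
   hence at least \<open>7 * de / 32\<close>; a function that is at most \<open>de / 8\<close> there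
   deviates from it by at least \<open>3 * de / 32\<close>.\<close>
 define c where "c = 3 * de / 32"
 define et where "et = 4 * C\<^sup>2 * (4 * ka / c\<^sup>2) / de"
 have c: "c > 0" using de by (simp add: c_def)
 have et: "et >= 0" "C ^ 8 * et <= 1 / 4"
 proof -
  show "et >= 0" using ka de by (simp add: et_def)
  have "C ^ 8 * et = 16384 / 72000"
   using de C1 by (simp add: et_def ka_def c_def power_divide power_mult_distrib field_simps power_numeral_reduce)
  thus "C ^ 8 * et <= 1 / 4" by simp
 qed
 obtain v where v: "v \<in> V" "?E v <= de + ka" using near[OF ka] by blast
 obtain N where N: "N >= 0" "determined om N v" using V(4)[OF v(1)] by blast
 have N': "determined om N (%x. - v x)"
  using N(2) by (auto simp: determined_def abs_minus_commute)
 have "(\<integral>x. - v x \<partial>m) = 0" "de <= (\<integral>x. (- v x)\<^sup>2 \<partial>m)" using V(3)[OF v(1)] de_le[OF v(1)] by auto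
 note neg_v = this
 obtain F where F: "finite F" "F \<subseteq> X"
  "\<And>B bb. B \<in> sets m ==> measure m (B \<inter> {x \<in> X. de / 4 - om <= v x}) <= bb ==>
    \<exists>x\<in>F. measure m (nb (lev 2) (- N) N x \<inter> B) <= 4 * C\<^sup>2 * bb / de * measure m (nb (lev 2) (- N) N x)"
  using selection_family[OF V(1)[OF v(1)] V(2)[OF v(1)] V(3)[OF v(1)] de_le[OF v(1)] N(2,1) de(1)] by blast
 obtain F' where F': "finite F'" "F' \<subseteq> X"
  "\<And>B bb. B \<in> sets m ==> measure m (B \<inter> {x \<in> X. de / 4 - om <= - v x}) <= bb ==>
    \<exists>x\<in>F'. measure m (nb (lev 2) (- N) N x \<inter> B) <= 4 * C\<^sup>2 * bb / de * measure m (nb (lev 2) (- N) N x)"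
  using selection_family[OF borel_measurable_uminus[OF V(1)[OF v(1)]] _ neg_v N' N(1) de(1)] V(2)[OF v(1)] by auto
 have "\<exists>q. fst q \<in> nb (lev 4) (- N) N x \<and> T (snd q) (fst q) \<in> nb (lev 4) (- N) N y \<and> snd q >= 2 * N"
  if "x \<in> F" "y \<in> F'" for x y
 proof -
  have xy: "x \<in> X" "y \<in> X" using that F F' by auto
  obtain z L where "z \<in> nb (lev 4) (- N) N x" "T L z \<in> nb (lev 4) (- N) N y" "L >= 2 * N"
   by (rule connecting_balls[OF xy])
  thus ?thesis by (intro exI[of _ "(z, L)"]) auto
 qed
 then obtain q where q: "\<And>x y. x \<in> F ==> y \<in> F' ==>
   fst (q x y) \<in> nb (lev 4) (- N) N x \<and> T (snd (q x y)) (fst (q x y)) \<in> nb (lev 4) (- N) N y \<and> snd (q x y) >= 2 * N"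
  by metis
 define Z where "Z = (%x y. nb (lev 4) (- N) (snd (q x y) + N) (fst (q x y)))"
 have qX: "fst (q x y) \<in> X" if "x \<in> F" "y \<in> F'" for x y using q[OF that] nb_in_X by blast
 have Zs: "Z x y \<in> sets m" "measure m (Z x y) > 0" if "x \<in> F" "y \<in> F'" for x y
 proof -
  let ?z = "fst (q x y)" and ?b = "snd (q x y) + N"
  have b: "- N <= ?b" using q[OF that] N(1) by linarith
  show "Z x y \<in> sets m" unfolding Z_def using qX[OF that] b by (intro nb_sets) auto
  have "0 < C * measure m (Z x y)"
   using weight_pos[of "- N" ?b ?z] weight_le[of 4 ?z "- N" ?b] qX[OF that] b unfolding Z_def by auto
  thus "measure m (Z x y) > 0" using C1 by (simp add: zero_less_mult_iff)
 qed
 define c0 where "c0 = Min (insert 1 ((%(x, y). measure m (Z x y)) ` (F \<times> F')))"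
 have "c0 > 0" unfolding c0_def using F(1) F'(1) Zs(2) by (subst Min_gr_iff) auto
 have c0: "c0 <= measure m (Z x y)" if "x \<in> F" "y \<in> F'" for x y
  unfolding c0_def using F(1) F'(1) that by (intro Min_le) auto
 \<comment> \<open>The accuracy required of the second minimiser \<open>w\<close> depends on
   \<open>c0\<close>, thus on all possible connecting orbits, because only \<open>w\<close> decides
   which of them will be used.\<close>
 define ka' where "ka' = min ka (c0 * (2 * c)\<^sup>2 / 16)"
 have ka': "ka' > 0" "ka' <= ka" "ka' <= c0 * (2 * c)\<^sup>2 / 16" using ka \<open>c0 > 0\<close> c by (auto simp: ka'_def)
 obtain w where w: "w \<in> V" "?E w <= de + ka'" using near[OF ka'(1)] by blast
 note [measurable] = V(1)[OF w(1)] V(1)[OF v(1)]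
 obtain M where M: "M >= 0" "determined om M w" using V(4)[OF w(1)] by blast
 \<comment> \<open>Up to \<open>om\<close>, the value of \<open>w\<close> at
   \<open>T (- k) p\<close> depends on the times from \<open>- N - 2 * M\<close> to
   \<open>- N\<close>, just before the window of \<open>x\<close>; in the same way a shift by
   \<open>k\<close> leads just behind the window of \<open>y\<close>.\<close>
 define k where "k = N + M"
 have ws: "(%x. w (T t x)) \<in> V" "?E (%x. w (T t x)) <= de + ka'" for t
  using shift[OF w(1)] Eshift[OF w(1)] w(2) by auto
 have vw: "measure m {x \<in> X. c <= \<bar>v x - w (T t x)\<bar>} <= 4 * ka / c\<^sup>2" for t
 proof -
  have "2 * (ka + ka') / c\<^sup>2 <= 4 * ka / c\<^sup>2" using ka' by (intro divide_right_mono) auto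
  thus ?thesis using dev[OF v(1) ws(1)[of t] v(2) ws(2)[of t] c] by linarith
 qed
 have meas: "{x \<in> X. c <= \<bar>v x - w (T t x)\<bar>} \<in> sets m" for t unfolding space_m[symmetric] by measurable
 define B where "B = {x \<in> X. w (T (- k) x) <= de / 8}"
 define B' where "B' = {x \<in> X. w (T k x) >= - (de / 8)}"
 have Bs: "B \<in> sets m" "B' \<in> sets m" unfolding B_def B'_def space_m[symmetric] by measurable
 have "measure m (B \<inter> {x \<in> X. de / 4 - om <= v x}) <= measure m {x \<in> X. c <= \<bar>v x - w (T (- k) x)\<bar>}"
  using de(2) by (intro finite_measure_mono meas) (auto simp: B_def c_def abs_real_def)
 then obtain x where x: "x \<in> F" "measure m (nb (lev 2) (- N) N x \<inter> B) <= et * measure m (nb (lev 2) (- N) N x)"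
  using F(3)[OF Bs(1) order_trans[OF _ vw[of "- k"]]] unfolding et_def by blast
 have "measure m (B' \<inter> {x \<in> X. de / 4 - om <= - v x}) <= measure m {x \<in> X. c <= \<bar>v x - w (T k x)\<bar>}"
  using de(2) by (intro finite_measure_mono meas) (auto simp: B'_def c_def abs_real_def)
 then obtain y where y: "y \<in> F'" "measure m (nb (lev 2) (- N) N y \<inter> B') <= et * measure m (nb (lev 2) (- N) N y)"
  using F'(3)[OF Bs(2) order_trans[OF _ vw[of k]]] unfolding et_def by blast
 define z L where "z = fst (q x y)" and "L = snd (q x y)"
 have z: "z \<in> nb (lev 4) (- N) N x" "T L z \<in> nb (lev 4) (- N) N y" "L >= 2 * N" "z \<in> X"
  using q[OF x(1) y(1)] qX[OF x(1) y(1)] by (auto simp: z_def L_def)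
 let ?Z = "nb (lev 4) (- N) (L + N) z"
 have Z: "?Z \<in> sets m" "c0 <= measure m ?Z" using Zs(1)[OF x(1) y(1)] c0[OF x(1) y(1)] by (auto simp: Z_def z_def L_def)
 have ZX: "?Z \<subseteq> X" using nb_in_X by blast
 have xX: "x \<in> X" "y \<in> X" using x(1) y(1) F(2) F'(2) by auto
 define W where "W = {p \<in> ?Z. w (T (- k) p) <= de / 8 - om}"
 define W' where "W' = {p \<in> ?Z. w (T (L + k) p) >= - (de / 8) + om}"
 have setI: "{p \<in> S. P p} \<in> sets m" if "S \<in> sets m" "Measurable.pred m P" for S P
 proof -
  have "{p \<in> S. P p} = S \<inter> {p \<in> space m. P p}" using sets.sets_into_space[OF that(1)] by blast
  thus ?thesis using that by simp
 qed
 have Ws: "W \<in> sets m" "W' \<in> sets m" unfolding W_def W'_def by (intro setI Z; measurable)+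
 have mW: "measure m W <= measure m ?Z / 4"
 proof -
  have "measure m W <= C ^ 8 * et * measure m ?Z"
  proof (rule gluing_fraction[where a = "- N - 2 * M" and b = N and a' = N and b' = "L + N" and lo = "- N - 2 * M" and hi = "L + N"])
   show "weight (- N - 2 * M) (L + N) u = weight (- N - 2 * M) N u * weight N (L + N) u" if "u \<in> X" for u
    using that N M z by (intro weight_mult) auto
   show "weight (- N) (L + N) z = weight (- N) N z * weight N (L + N) z" using N z by (intro weight_mult) auto
   show "nb (lev 4) (- N - 2 * M) N p \<subseteq> B" if p: "p \<in> W" for p
   proof
    fix r assume r: "r \<in> nb (lev 4) (- N - 2 * M) N p"
    have "\<bar>w (T (- k) p) - w (T (- k) r)\<bar> <= om"
     using p ZX N M by (intro determinedD[OF M(2) _ r]) (auto simp: W_def k_def)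
    thus "r \<in> B" using p nb_in_X[OF r] by (auto simp: B_def W_def)
   qed
   show "W \<in> sets m" "B \<in> sets m" by (rule Ws Bs)+
  qed (use N M z x et(1) xX in \<open>auto simp: W_def\<close>)
  also have "... <= 1 / 4 * measure m ?Z" using et by (intro mult_right_mono) auto
  finally show ?thesis by simp
 qed
 have mW': "measure m W' <= measure m ?Z / 4"
 proof -
  \<comment> \<open>Translation by \<open>L\<close> moves the window of \<open>y\<close> to time 0,
    so that the same lemma applies with past and future exchanged.\<close>
  define U where "U = {p \<in> X. T (- L) p \<in> W'}"
  have U: "U \<in> sets m" unfolding U_def space_m[symmetric] using Ws(2) by measurable
  have ZL: "nb (lev 4) (- N - L) N (T L z) = {p \<in> X. T (- L) p \<in> ?Z}"
  proof -
   have "p \<in> nb (lev 4) (- N - L) N (T L z) \<longleftrightarrow> T (- L) p \<in> nb (lev 4) (- N) (L + N) z" if "p \<in> X" for p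
    using nb_shift[of L "T (- L) p" "lev 4" "- N - L" N z] by (simp add: T_T add.commute)
   thus ?thesis using nb_in_X by blast
  qed
  have "measure m U <= C ^ 8 * et * measure m (nb (lev 4) (- N - L) N (T L z))"
  proof (rule gluing_fraction[where a = "- N" and b = "N + 2 * M" and a' = "- N - L" and b' = "- N" and lo = "- N - L" and hi = "N + 2 * M"])
   show "weight (- N - L) (N + 2 * M) u = weight (- N) (N + 2 * M) u * weight (- N - L) (- N) u" if "u \<in> X" for u
    using that N M z weight_mult[of u "- N - L" "- N" "N + 2 * M"] by auto
   show "weight (- N - L) N (T L z) = weight (- N) N (T L z) * weight (- N - L) (- N) (T L z)"
    using N z weight_mult[of "T L z" "- N - L" "- N" N] by auto
   show "nb (lev 4) (- N) (N + 2 * M) p \<subseteq> B'" if p: "p \<in> U" for p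
   proof
    fix r assume r: "r \<in> nb (lev 4) (- N) (N + 2 * M) p"
    have "\<bar>w (T k p) - w (T k r)\<bar> <= om"
     using p ZX N M by (intro determinedD[OF M(2) _ r]) (auto simp: U_def k_def)
    moreover have "w (T k p) >= - (de / 8) + om" using p by (auto simp: U_def W'_def T_T add.commute)
    ultimately show "r \<in> B'" using nb_in_X[OF r] by (auto simp: B'_def)
   qed
   show "U \<subseteq> nb (lev 4) (- N - L) N (T L z)" unfolding ZL by (auto simp: U_def W'_def)
   show "U \<in> sets m" "B' \<in> sets m" by (rule U Bs)+
  qed (use N M z y et(1) xX in auto)
  also have "measure m (nb (lev 4) (- N - L) N (T L z)) = measure m ?Z" unfolding ZL by (rule measure_T[OF Z(1)])
  also have "measure m U = measure m W'" unfolding U_def by (rule measure_T[OF Ws(2)])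
  finally have "measure m W' <= C ^ 8 * et * measure m ?Z" .
  also have "... <= 1 / 4 * measure m ?Z" using et by (intro mult_right_mono) auto
  finally show ?thesis by simp
 qed
 let ?D = "{p \<in> X. 2 * c <= \<bar>w (T (- k) p) - w (T (L + k) p)\<bar>}"
 have Ds: "?D \<in> sets m" unfolding space_m[symmetric] by measurable
 have "measure m ?D <= 2 * (ka' + ka') / (2 * c)\<^sup>2" using c by (intro dev ws) auto
 also have "... <= c0 / 4" using ka'(3) c by (simp add: divide_le_eq)
 finally have mD: "measure m ?D <= c0 / 4" .
 \<comment> \<open>Outside \<open>W\<close> and \<open>W'\<close> the two shifts of \<open>w\<close>
   have opposite signs with a gap of at least \<open>2 * c\<close>. So three sets cover
   \<open>?Z\<close>, although together they have at most three quarters of its measure.\<close>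
 have "?Z \<subseteq> W \<union> W' \<union> ?D" using ZX de(2) by (auto simp: W_def W'_def c_def abs_real_def)
 hence "measure m ?Z <= measure m (W \<union> W' \<union> ?D)" using Ws Ds by (intro finite_measure_mono) auto
 also have "... <= measure m W + measure m W' + measure m ?D"
  using Ws Ds by (intro order_trans[OF measure_Un_le] add_right_mono measure_Un_le) auto
 finally have "measure m ?Z <= measure m ?Z / 4 + measure m ?Z / 4 + c0 / 4" using mW mW' mD by linarith
 thus False using Z(2) \<open>c0 > 0\<close> by linarith
qed

end

context prob_space
begin

lemma abs_expectation_prod_le:
 assumes [measurable]: "v \<in> borel_measurable M" "b \<in> borel_measurable M"
  and bd: "\<And>x. x \<in> space M ==> \<bar>v x\<bar> <= 1" "\<And>x. x \<in> space M ==> \<bar>b x\<bar> <= 1"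
 shows "\<bar>expectation (%x. v x * b x)\<bar> <= sqrt (expectation (%x. (v x)\<^sup>2))"
proof -
 have vb: "\<bar>v x * b x\<bar> <= \<bar>v x\<bar>" if "x \<in> space M" for x
  using mult_left_le[OF bd(2)[OF that], of "\<bar>v x\<bar>"] by (simp add: abs_mult)
 have i: "integrable M v" "integrable M (%x. v x * b x)" "integrable M (%x. (v x)\<^sup>2)"
  using bd vb by (auto intro!: integrable_bounded[of _ 1] order_trans[OF vb] simp: abs_square_le_1)
 have "\<bar>expectation (%x. v x * b x)\<bar> <= expectation (%x. \<bar>v x\<bar>)"
  using i vb by (intro order_trans[OF integral_abs_bound] integral_mono) auto
 also have "... <= sqrt (expectation (%x. (v x)\<^sup>2))"
 proof (rule real_le_rsqrt)
  have "variance (%x. \<bar>v x\<bar>) = expectation (%x. \<bar>v x\<bar>\<^sup>2) - (expectation (%x. \<bar>v x\<bar>))\<^sup>2"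
   using i by (intro variance_eq) auto
  thus "(expectation (%x. \<bar>v x\<bar>))\<^sup>2 <= expectation (%x. (v x)\<^sup>2)"
   using variance_positive[of "%x. \<bar>v x\<bar>"] by simp
 qed
 finally show ?thesis .
qed

end

section \<open>Decorrelation from ergodicity\<close>

context gibbs_scales
begin

lemma determined_shift:
 assumes "determined om N v" shows "determined om (N + \<bar>t\<bar>) (%x. v (T t x))"
proof -
 have "\<bar>v (T t p) - v (T t q)\<bar> <= om" if "p \<in> X" "q \<in> nb (lev 0) (- (N + \<bar>t\<bar>)) (N + \<bar>t\<bar>) p" for p q
  using that by (intro determinedD[OF assms _ that(2)]) auto
 thus ?thesis by (simp add: determined_def)
qed

lemma determined_mono: "determined om N v ==> N <= N' ==> determined om N' v"
 unfolding determined_def using nb_subset[of 0 0 "- N'" "- N" N N'] by fastforce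

text \<open>The functions whose correlations with \<open>b n\<close> behave asymptotically like
  those of \<open>u\<close> form a class closed under shifts, because \<open>b n\<close> is
  asymptotically invariant, and under midpoints. \<open>small_average\<close> finds a member of
  small norm, and the Cauchy-Schwarz inequality finishes.\<close>

lemma asymptotic_decorrelation:
 assumes u: "u \<in> borel_measurable m" "\<And>x. x \<in> X ==> \<bar>u x\<bar> <= 1" "(\<integral>x. u x \<partial>m) = 0"
   "determined om N u" "N >= 0" and om: "om > 0"
  and b: "\<And>n. b n \<in> borel_measurable m" "\<And>n x. x \<in> X ==> \<bar>b n x\<bar> <= 1"
   "\<And>t e. e > 0 ==> \<forall>\<^sub>F n in sequentially. \<forall>x\<in>X. \<bar>b n (T t x) - b n x\<bar> <= e"
  and e: "sqrt (33 * om) < e"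
 shows "\<forall>\<^sub>F n in sequentially. \<bar>\<integral>x. u x * b n x \<partial>m\<bar> <= e"
proof -
 define V where "V = {v. v \<in> borel_measurable m \<and> (\<forall>x\<in>X. \<bar>v x\<bar> <= 1) \<and> (\<integral>x. v x \<partial>m) = 0 \<and>
  (\<exists>N\<ge>0. determined om N v) \<and> (%n. (\<integral>x. v x * b n x \<partial>m) - (\<integral>x. u x * b n x \<partial>m)) \<longlonglongrightarrow> 0}"
 have VD: "v \<in> borel_measurable m" "\<And>x. x \<in> X ==> \<bar>v x\<bar> <= 1" "(\<integral>x. v x \<partial>m) = 0" "\<exists>N\<ge>0. determined om N v"
  "(%n. (\<integral>x. v x * b n x \<partial>m) - (\<integral>x. u x * b n x \<partial>m)) \<longlonglongrightarrow> 0" if "v \<in> V" for v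
  using that by (auto simp: V_def)
 have int: "integrable m v" if "v \<in> V" for v
  using VD[OF that] by (intro integrable_bounded[of _ 1]) (auto simp: space_m)
 have prod1: "\<bar>v * w\<bar> <= 1" if "\<bar>v\<bar> <= 1" "\<bar>w\<bar> <= 1" for v w :: real
  using mult_mono[OF that] by (simp add: abs_mult)
 have intb: "integrable m (%x. v x * b n (T t x))" if "v \<in> V" for v n t
  using VD(1,2)[OF that] b measurable_compose[OF measurable_T[of t] b(1)[of n]]
  by (intro integrable_bounded[of _ 1] borel_measurable_times prod1) (auto simp: space_m)
 have intb0: "integrable m (%x. v x * b n x)" if "v \<in> V" for v n
  using intb[OF that, of n 0] by simp
 have "u \<in> V" using u by (auto simp: V_def)
 have "\<exists>v\<in>V. (\<integral>x. (v x)\<^sup>2 \<partial>m) <= 33 * om"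
 proof (rule small_average)
  show "(%x. v (T t x)) \<in> V" if v: "v \<in> V" for v t
  proof -
   have 1: "(\<integral>x. v (T t x) \<partial>m) = 0" using integral_T[OF VD(1)[OF v]] VD(3)[OF v] by simp
   have 2: "\<exists>N\<ge>0. determined om N (%x. v (T t x))"
    using VD(4)[OF v] determined_shift[of om _ v t] by (meson abs_ge_zero add_nonneg_nonneg)
   have 3: "(%x. v (T t x)) \<in> borel_measurable m" using VD(1)[OF v] by measurable
   have eq: "(\<integral>x. v (T t x) * b n x \<partial>m) = (\<integral>x. v x * b n (T (- t) x) \<partial>m)" for n
    using integral_T[of "%x. v x * b n (T (- t) x)" t] intb[OF v, of n "- t"] by (simp add: T_T)
   have "(%n. (\<integral>x. v x * b n (T (- t) x) \<partial>m) - (\<integral>x. v x * b n x \<partial>m)) \<longlonglongrightarrow> 0"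
   proof (rule LIMSEQ_I)
    fix r :: real assume r: "r > 0"
    have "\<forall>\<^sub>F n in sequentially. norm ((\<integral>x. v x * b n (T (- t) x) \<partial>m) - (\<integral>x. v x * b n x \<partial>m) - 0) < r"
     using b(3)[OF half_gt_zero[OF r], of "- t"]
    proof eventually_elim
     case (elim n)
     have "(\<integral>x. v x * b n (T (- t) x) \<partial>m) - (\<integral>x. v x * b n x \<partial>m) = (\<integral>x. v x * b n (T (- t) x) - v x * b n x \<partial>m)"
      using intb[OF v, of n "- t"] intb0[OF v, of n] by simp
     moreover have "norm (\<integral>x. v x * b n (T (- t) x) - v x * b n x \<partial>m) <= (\<integral>x. r / 2 \<partial>m)"
     proof (intro order_trans[OF integral_norm_bound integral_mono])
      fix x assume "x \<in> space m"
      hence x: "x \<in> X" by (simp add: space_m)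
      have "norm (v x * b n (T (- t) x) - v x * b n x) = \<bar>v x\<bar> * \<bar>b n (T (- t) x) - b n x\<bar>"
       by (simp add: abs_mult[symmetric] right_diff_distrib)
      also have "... <= 1 * (r / 2)" using VD(2)[OF v x] elim x by (intro mult_mono) auto
      finally show "norm (v x * b n (T (- t) x) - v x * b n x) <= r / 2" by simp
     qed (use intb[OF v, of n "- t"] intb0[OF v, of n] in auto)
     ultimately show ?case using r by (simp add: prob_space)
    qed
    thus "\<exists>no. \<forall>n\<ge>no. norm ((\<integral>x. v x * b n (T (- t) x) \<partial>m) - (\<integral>x. v x * b n x \<partial>m) - 0) < r"
     by (simp add: eventually_sequentially)
   qed
   from tendsto_add[OF this VD(5)[OF v]] show ?thesis using 1 2 3 VD(2)[OF v] by (simp add: V_def eq)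
  qed
  show "(%x. (v x + w x) / 2) \<in> V" if v: "v \<in> V" and w: "w \<in> V" for v w
  proof -
   obtain N1 where N1: "N1 >= 0" "determined om N1 v" using VD(4)[OF v] by blast
   obtain N2 where N2: "N2 >= 0" "determined om N2 w" using VD(4)[OF w] by blast
   have "determined om (max N1 N2) v" "determined om (max N1 N2) w"
    using N1 N2 determined_mono[of om N1 v "max N1 N2"] determined_mono[of om N2 w "max N1 N2"] by auto
   moreover have half1: "\<bar>(p + q) / 2 - (p' + q') / 2\<bar> <= om" if "\<bar>p - p'\<bar> <= om" "\<bar>q - q'\<bar> <= om" for p q p' q' :: real
    using that unfolding abs_le_iff by (simp add: field_simps)
   ultimately have "determined om (max N1 N2) (%x. (v x + w x) / 2)"
    unfolding determined_def using half1 by blast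
   hence 1: "\<exists>N\<ge>0. determined om N (%x. (v x + w x) / 2)" using N1(1) by (intro exI[of _ "max N1 N2"]) auto
   have half2: "\<bar>(p + q) / 2\<bar> <= 1" if "\<bar>p\<bar> <= 1" "\<bar>q\<bar> <= 1" for p q :: real
    using that unfolding abs_le_iff by (simp add: field_simps)
   have 2: "\<forall>x\<in>X. \<bar>(v x + w x) / 2\<bar> <= 1" using VD(2)[OF v] VD(2)[OF w] half2 by blast
   have 3: "(\<integral>x. (v x + w x) / 2 \<partial>m) = 0" using int[OF v] int[OF w] VD(3)[OF v] VD(3)[OF w] by simp
   have eq: "(\<integral>x. (v x + w x) / 2 * b n x \<partial>m) = ((\<integral>x. v x * b n x \<partial>m) + (\<integral>x. w x * b n x \<partial>m)) / 2" for n
    using intb0[OF v, of n] intb0[OF w, of n] by (simp add: distrib_right)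
   have "(%n. (((\<integral>x. v x * b n x \<partial>m) - (\<integral>x. u x * b n x \<partial>m)) + ((\<integral>x. w x * b n x \<partial>m) - (\<integral>x. u x * b n x \<partial>m))) / 2) \<longlonglongrightarrow> (0 + 0) / 2"
    by (intro tendsto_intros VD(5) v w) simp
   moreover have "((p - r) + (q - r)) / 2 = (p + q) / 2 - r" for p q r :: real by (simp add: field_simps)
   ultimately have "(%n. ((\<integral>x. v x * b n x \<partial>m) + (\<integral>x. w x * b n x \<partial>m)) / 2 - (\<integral>x. u x * b n x \<partial>m)) \<longlonglongrightarrow> 0" by (simp only: add_0 div_0)
   hence "(%n. (\<integral>x. (v x + w x) / 2 * b n x \<partial>m) - (\<integral>x. u x * b n x \<partial>m)) \<longlonglongrightarrow> 0" unfolding eq .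
   moreover have "(%x. (v x + w x) / 2) \<in> borel_measurable m" using VD(1)[OF v] VD(1)[OF w] by measurable
   ultimately show ?thesis using 1 2 3 unfolding V_def by blast
  qed
  show "v \<in> borel_measurable m" "(\<integral>x. v x \<partial>m) = 0" "\<exists>N\<ge>0. determined om N v" if "v \<in> V" for v
   by (rule VD[OF that])+
  show "\<bar>v x\<bar> <= 1" if "v \<in> V" "x \<in> X" for v x by (rule VD(2)[OF that])
 qed (use \<open>u \<in> V\<close> om in auto)
 then obtain v where v: "v \<in> V" "(\<integral>x. (v x)\<^sup>2 \<partial>m) <= 33 * om" by blast
 have le: "\<bar>\<integral>x. v x * b n x \<partial>m\<bar> <= sqrt (33 * om)" for n
  by (rule order_trans[OF abs_expectation_prod_le real_sqrt_le_mono[OF v(2)]]) (use VD(1,2)[OF v(1)] b(1,2) in \<open>auto simp: space_m\<close>)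
 have "\<forall>\<^sub>F n in sequentially. dist ((\<integral>x. v x * b n x \<partial>m) - (\<integral>x. u x * b n x \<partial>m)) 0 < e - sqrt (33 * om)"
  using VD(5)[OF v(1)] e by (intro tendstoD) auto
 thus ?thesis
 proof eventually_elim
  case (elim n)
  thus ?case using le[of n] by (simp add: dist_real_def)
 qed
qed

end

section \<open>Quasi-independent block processes\<close>

text \<open>The flow is forgotten here: \<open>ta n\<close> is the time-\<open>n\<close> map,
  \<open>S n\<close> the Birkhoff integral, and the label \<open>cell n x\<close> determines all
  \<open>S i x\<close> with \<open>i <= n\<close> up to \<open>c\<close>. Tightness is what this
  locale retains of the central limit theorem.\<close>

locale quasi_independent = prob_space M
 for M :: "'a measure" +
 fixes ta :: "nat => 'a => 'a" and S :: "nat => 'a => real" and cell :: "nat => 'a => nat"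
  and K c B :: real
 assumes measurable_ta [measurable]: "ta n \<in> measurable M M"
  and distr_ta: "distr M M (ta n) = M"
  and ta_0: "x \<in> space M ==> ta 0 x = x"
  and ta_add: "x \<in> space M ==> ta (i + n) x = ta n (ta i x)"
  and measurable_S [measurable]: "S n \<in> borel_measurable M"
  and S_add: "x \<in> space M ==> S (i + n) x = S i x + S n (ta i x)"
  and S_bound: "x \<in> space M ==> \<bar>S n x\<bar> <= B * real n"
  and measurable_cell [measurable]: "cell n \<in> measurable M (count_space UNIV)"
  and cell_finite: "\<exists>k. \<forall>x\<in>space M. cell n x < k"
  and cell_S: "x \<in> space M ==> y \<in> space M ==> cell n x = cell n y ==> i <= n ==> \<bar>S i x - S i y\<bar> <= c"
  and quasi_bernoulli: "mono a ==> prob {x \<in> space M. \<forall>j<n. cell (a (Suc j) - a j) (ta (a j) x) = l j}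
   <= K ^ n * (\<Prod>j<n. prob {x \<in> space M. cell (a (Suc j) - a j) x = l j})"
  and K1: "1 <= K"
  and tight: "e > 0 ==> \<exists>t. \<forall>n\<ge>1. prob {x \<in> space M. t * sqrt (real n) < \<bar>S n x\<bar>} <= e"
begin

lemma ta_space: "x \<in> space M ==> ta n x \<in> space M"
 using measurable_space[OF measurable_ta] .

lemma integral_ta: "g \<in> borel_measurable M ==> (\<integral>x. g (ta n x) \<partial>M) = (\<integral>x. (g x :: real) \<partial>M)"
 using integral_distr[OF measurable_ta, of g n] by (simp add: distr_ta)

lemma prob_ta: "A \<in> sets M ==> prob {x \<in> space M. ta n x \<in> A} = prob A"
 using measure_distr[OF measurable_ta, of A n] by (simp add: distr_ta vimage_def Int_def conj_commute)

lemma B_nonneg: "0 <= B"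
proof -
 obtain x where "x \<in> space M" using not_empty by blast
 thus ?thesis using S_bound[of x 1] by simp
qed

lemma c_nonneg: "0 <= c"
proof -
 obtain x where "x \<in> space M" using not_empty by blast
 thus ?thesis using cell_S[of x x 0 0] by simp
qed

definition labels :: "nat => nat" where
 "labels n = (SOME k. \<forall>x\<in>space M. cell n x < k)"

lemma cell_less: "x \<in> space M ==> cell n x < labels n"
 using someI_ex[OF cell_finite[of n]] unfolding labels_def by blast

definition lp :: "nat => nat => real" where
 "lp n i = prob {x \<in> space M. cell n x = i}"

lemma expectation_finite_valued:
 assumes f: "f \<in> measurable M (count_space UNIV)" and Y: "finite Y" "\<And>x. x \<in> space M ==> f x \<in> Y"
 shows "expectation (%x. \<Phi> (f x)) = (\<Sum>y\<in>Y. \<Phi> y * prob {x \<in> space M. f x = y})"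
proof -
 have ms: "{x \<in> space M. f x = y} \<in> sets M" for y using f by measurable
 have "expectation (%x. \<Phi> (f x)) = expectation (%x. \<Sum>y\<in>Y. \<Phi> y * indicator {x \<in> space M. f x = y} x)"
 proof (rule Bochner_Integration.integral_cong[OF refl])
  fix x assume x: "x \<in> space M"
  have "(\<Sum>y\<in>Y. \<Phi> y * indicator {x \<in> space M. f x = y} x) = (\<Sum>y\<in>Y. if y = f x then \<Phi> y else 0)"
   using x by (intro sum.cong) (auto simp: indicator_def)
  thus "\<Phi> (f x) = (\<Sum>y\<in>Y. \<Phi> y * indicator {x \<in> space M. f x = y} x)"
   using Y x by simp
 qed
 also have "... = (\<Sum>y\<in>Y. expectation (%x. \<Phi> y * indicator {x \<in> space M. f x = y} x))"
  using ms by (intro Bochner_Integration.integral_sum integrable_mult_right) (simp add: integrable_indicator_iff emeasure_eq_measure)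
 also have "... = (\<Sum>y\<in>Y. \<Phi> y * prob {x \<in> space M. f x = y})" using ms by (intro sum.cong) auto
 finally show ?thesis .
qed

lemma expectation_cell: "expectation (%x. h (cell n x)) = (\<Sum>i<labels n. h i * lp n i)"
 unfolding lp_def using cell_less by (intro expectation_finite_valued) auto

lemma quasi_bernoulli_product:
 assumes a: "mono a" and h: "\<And>j i. j < n ==> 0 <= h j i"
 shows "expectation (%x. \<Prod>j<n. h j (cell (a (Suc j) - a j) (ta (a j) x)))
  <= K ^ n * (\<Prod>j<n. expectation (%x. h j (cell (a (Suc j) - a j) x)))"
proof -
 let ?l = "%j. a (Suc j) - a j"
 define L where "L = (%x. restrict (%j. cell (?l j) (ta (a j) x)) {..<n})"
 define Y where "Y = PiE {..<n} (%j. {..<labels (?l j)})"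
 have Y: "finite Y" by (auto simp: Y_def intro: finite_PiE)
 have LY: "L x \<in> Y" if "x \<in> space M" for x
  using cell_less[OF ta_space[OF that]] by (auto simp: L_def Y_def)
 have eq: "{x \<in> space M. L x = y} = {x \<in> space M. \<forall>j<n. cell (?l j) (ta (a j) x) = y j}" if "y \<in> Y" for y
  using that by (auto simp: L_def Y_def fun_eq_iff restrict_def PiE_def extensional_def split: if_splits)
 have pre: "L -` A \<inter> space M \<in> sets M" for A
 proof -
  have "L -` A \<inter> space M = (\<Union>y\<in>Y \<inter> A. {x \<in> space M. L x = y})" using LY by blast
  also have "... \<in> sets M"
  proof (rule sets.finite_UN)
   fix y assume "y \<in> Y \<inter> A"
   hence y: "y \<in> Y" by simp
   show "{x \<in> space M. L x = y} \<in> sets M" unfolding eq[OF y] by measurable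
  qed (use Y in simp)
  finally show ?thesis .
 qed
 have L: "L \<in> measurable M (count_space UNIV)" by (rule measurableI) (use pre in auto)
 define \<Phi> where "\<Phi> = (%y. \<Prod>j<n. h j (y j))"
 have "expectation (%x. \<Prod>j<n. h j (cell (?l j) (ta (a j) x))) = expectation (%x. \<Phi> (L x))"
  by (intro Bochner_Integration.integral_cong) (auto simp: \<Phi>_def L_def intro!: prod.cong)
 also have "... = (\<Sum>y\<in>Y. \<Phi> y * prob {x \<in> space M. L x = y})"
  by (rule expectation_finite_valued[OF L Y LY])
 also have "... <= (\<Sum>y\<in>Y. \<Phi> y * (K ^ n * (\<Prod>j<n. lp (?l j) (y j))))"
  using quasi_bernoulli[OF a] h by (intro sum_mono mult_left_mono) (auto simp: eq lp_def \<Phi>_def intro!: prod_nonneg)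
 also have "... = K ^ n * (\<Sum>y\<in>Y. \<Prod>j<n. h j (y j) * lp (?l j) (y j))"
  by (simp add: \<Phi>_def prod.distrib sum_distrib_left mult_ac)
 also have "(\<Sum>y\<in>Y. \<Prod>j<n. h j (y j) * lp (?l j) (y j)) = (\<Prod>j<n. \<Sum>i<labels (?l j). h j i * lp (?l j) i)"
  unfolding Y_def by (rule prod_sum_PiE[symmetric]) auto
 also have "... = (\<Prod>j<n. expectation (%x. h j (cell (?l j) x)))" by (simp add: expectation_cell)
 finally show ?thesis .
qed

text \<open>Extends the bound from functions of labels to functions that are nearly constant on
  cells; the majorant \<open>H'\<close> has to contain the variation within a cell.\<close>

lemma product_bound:
 assumes a: "mono a" and H0: "\<And>j x. j < n ==> x \<in> space M ==> 0 <= H j x"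
  and le: "\<And>j x y. j < n ==> x \<in> space M ==> y \<in> space M ==>
   cell (a (Suc j) - a j) x = cell (a (Suc j) - a j) y ==> H j x <= H' j y"
  and int: "\<And>j. j < n ==> integrable M (H' j)"
 shows "expectation (%x. \<Prod>j<n. H j (ta (a j) x)) <= K ^ n * (\<Prod>j<n. expectation (H' j))"
proof -
 let ?l = "%j. a (Suc j) - a j"
 \<comment> \<open>The supremum over a cell is a function of the label and lies between
   \<open>H\<close> and \<open>H'\<close>.\<close>
 define h where "h = (%j i. if \<exists>x\<in>space M. cell (?l j) x = i then SUP x\<in>{x \<in> space M. cell (?l j) x = i}. H j x else 0)"
 have hx: "H j x <= h j (cell (?l j) x)" "h j (cell (?l j) x) <= H' j x" "0 <= h j i" if j: "j < n" and x: "x \<in> space M" for j x i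
 proof -
  have up: "H j y <= h j (cell (?l j) y)" if y: "y \<in> space M" for y
  proof -
   have "bdd_above (H j ` {u \<in> space M. cell (?l j) u = cell (?l j) y})"
    using le[OF j _ y] by (intro bdd_aboveI[of _ "H' j y"]) auto
   hence "H j y <= (SUP u\<in>{u \<in> space M. cell (?l j) u = cell (?l j) y}. H j u)" using y by (intro cSUP_upper) auto
   thus ?thesis using y unfolding h_def by auto
  qed
  show "H j x <= h j (cell (?l j) x)" by (rule up[OF x])
  have "(SUP u\<in>{u \<in> space M. cell (?l j) u = cell (?l j) x}. H j u) <= H' j x"
   using le[OF j _ x] x by (intro cSUP_least) auto
  thus "h j (cell (?l j) x) <= H' j x" using x unfolding h_def by auto
  show "0 <= h j i"
  proof (cases "\<exists>y\<in>space M. cell (?l j) y = i")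
   case True
   then obtain y where y: "y \<in> space M" "cell (?l j) y = i" by blast
   show ?thesis using up[OF y(1)] H0[OF j y(1)] y(2) by simp
  qed (auto simp: h_def)
 qed
 obtain x0 where x0: "x0 \<in> space M" using not_empty by blast
 have int_h: "integrable M (%x. h j (cell (?l j) x))" for j
 proof -
  have "finite ((%i. \<bar>h j i\<bar>) ` {..<labels (?l j)})" by simp
  hence "\<bar>h j (cell (?l j) x)\<bar> <= Max ((%i. \<bar>h j i\<bar>) ` {..<labels (?l j)})" if "x \<in> space M" for x
   using cell_less[OF that] by (intro Max_ge) auto
  thus ?thesis
   by (intro integrable_bounded[of _ "Max ((%i. \<bar>h j i\<bar>) ` {..<labels (?l j)})"] measurable_compose[OF measurable_cell]) auto
 qed
 define R where "R = (%j. \<Sum>i<labels (?l j). h j i)"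
 have hR: "h j (cell (?l j) x) <= R j" if "j < n" "x \<in> space M" for j x
  unfolding R_def using hx(3)[OF that(1) x0] cell_less[OF that(2)] by (intro member_le_sum) auto
 have "integrable M (%x. \<Prod>j<n. h j (cell (?l j) (ta (a j) x)))"
 proof (rule integrable_bounded)
  have "(%x. h j (cell (?l j) (ta (a j) x))) \<in> borel_measurable M" for j
   by (rule measurable_compose[OF measurable_compose[OF measurable_ta measurable_cell]]) auto
  thus "(%x. \<Prod>j<n. h j (cell (?l j) (ta (a j) x))) \<in> borel_measurable M" by measurable
  fix x assume x: "x \<in> space M"
  have "\<bar>\<Prod>j<n. h j (cell (?l j) (ta (a j) x))\<bar> = (\<Prod>j<n. h j (cell (?l j) (ta (a j) x)))"
   using hx(3)[OF _ x0] by (intro abs_of_nonneg prod_nonneg) auto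
  also have "... <= (\<Prod>j<n. R j)" using hx(3)[OF _ x0] hR[OF _ ta_space[OF x]] by (intro prod_mono) auto
  finally show "\<bar>\<Prod>j<n. h j (cell (?l j) (ta (a j) x))\<bar> <= (\<Prod>j<n. R j)" .
 qed
 hence "expectation (%x. \<Prod>j<n. H j (ta (a j) x)) <= expectation (%x. \<Prod>j<n. h j (cell (?l j) (ta (a j) x)))"
  using H0 hx(1) ta_space by (intro integral_mono') (auto intro!: prod_mono prod_nonneg simp: order_trans[OF H0 hx(1)])
 also have "... <= K ^ n * (\<Prod>j<n. expectation (%x. h j (cell (?l j) x)))"
  using hx(3)[OF _ x0] by (intro quasi_bernoulli_product a) auto
 also have "... <= K ^ n * (\<Prod>j<n. expectation (H' j))"
  using K1 hx(2) hx(3)[OF _ x0] int int_h by (intro mult_left_mono prod_mono conjI integral_mono) auto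
 finally show ?thesis .
qed

end

context quasi_independent
begin

lemma prob_two_cells:
 "prob {x \<in> space M. cell D x = i \<and> cell F (ta D x) = k} <= K\<^sup>2 * (lp D i * lp F k)"
proof -
 define a where "a = (%j::nat. if j = 0 then 0 else if j = 1 then D else D + F)"
 define l where "l = (%j::nat. if j = 0 then i else k)"
 have "mono a" by (auto simp: a_def intro!: monoI)
 from quasi_bernoulli[OF this, of 2 l]
 have "prob {x \<in> space M. \<forall>j<2. cell (a (Suc j) - a j) (ta (a j) x) = l j} <= K\<^sup>2 * (lp D i * lp F k)"
  by (simp add: a_def l_def lp_def numeral_2_eq_2)
 also have "{x \<in> space M. \<forall>j<2. cell (a (Suc j) - a j) (ta (a j) x) = l j} = {x \<in> space M. cell D x = i \<and> cell F (ta D x) = k}"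
  by (auto simp: a_def l_def numeral_2_eq_2 less_Suc_eq ta_0)
 finally show ?thesis .
qed

text \<open>Unlike the product bound this admits functions of past and future jointly, such as the
  square of a sum of products.\<close>

lemma two_cells_bound:
 assumes \<Phi>: "\<And>i k. 0 <= \<Phi> i k"
 shows "expectation (%x. \<Phi> (cell D x) (cell F (ta D x))) <= K\<^sup>2 * (\<Sum>i<labels D. \<Sum>k<labels F. \<Phi> i k * (lp D i * lp F k))"
proof -
 let ?f = "%x. (cell D x, cell F (ta D x))"
 have "?f \<in> measurable M (count_space UNIV \<Otimes>\<^sub>M count_space UNIV)" by measurable
 hence m: "?f \<in> measurable M (count_space UNIV)" by (simp add: pair_measure_countable)
 have "expectation (%x. \<Phi> (cell D x) (cell F (ta D x))) = expectation (%x. case_prod \<Phi> (?f x))" by simp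
 also have "... = (\<Sum>y\<in>{..<labels D} \<times> {..<labels F}. case_prod \<Phi> y * prob {x \<in> space M. ?f x = y})"
  by (rule expectation_finite_valued[OF m]) (auto intro: cell_less ta_space)
 also have "... <= (\<Sum>y\<in>{..<labels D} \<times> {..<labels F}. case_prod \<Phi> y * (K\<^sup>2 * (lp D (fst y) * lp F (snd y))))"
  using prob_two_cells \<Phi> by (intro sum_mono mult_left_mono) auto
 also have "... = K\<^sup>2 * (\<Sum>i<labels D. \<Sum>k<labels F. \<Phi> i k * (lp D i * lp F k))"
  by (simp add: sum.cartesian_product[symmetric] sum_distrib_left mult_ac case_prod_unfold) (simp add: sum.cartesian_product case_prod_unfold mult_ac)
 finally show ?thesis .
qed

section \<open>Moments of the block sums\<close>

lemma two_blocks_product: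
 assumes "\<And>x. x \<in> space M ==> 0 <= H x" "\<And>x. x \<in> space M ==> 0 <= I x"
  and "\<And>x y. x \<in> space M ==> y \<in> space M ==> cell D x = cell D y ==> H x <= H' y"
   "\<And>x y. x \<in> space M ==> y \<in> space M ==> cell F x = cell F y ==> I x <= I' y"
  and "integrable M H'" "integrable M I'"
 shows "expectation (%x. H x * I (ta D x)) <= K\<^sup>2 * (expectation H' * expectation I')"
proof -
 define a where "a = (%j::nat. if j = 0 then 0 else if j = 1 then D else D + F)"
 have "mono a" by (auto simp: a_def intro!: monoI)
 have sel: "P j" if "j < (2::nat)" "P 0" "P 1" for P j using that by (auto simp: less_2_cases_iff)
 have "expectation (%x. H x * I (ta D x)) = expectation (%x. \<Prod>j<2::nat. (if j = 0 then H else I) (ta (a j) x))"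
  by (intro Bochner_Integration.integral_cong) (auto simp: numeral_2_eq_2 a_def ta_0)
 also have "... <= K ^ 2 * (\<Prod>j<2::nat. expectation (if j = 0 then H' else I'))"
 proof (rule product_bound[OF \<open>mono a\<close>])
  fix j x assume "j < (2::nat)" "x \<in> space M"
  thus "0 <= (if j = 0 then H else I) x" using assms(1,2) by auto
 next
  fix j x y assume "j < (2::nat)" "x \<in> space M" "y \<in> space M" "cell (a (Suc j) - a j) x = cell (a (Suc j) - a j) y"
  thus "(if j = 0 then H else I) x <= (if j = 0 then H' else I') y"
   using assms(3)[of x y] assms(4)[of x y] by (auto simp: a_def less_2_cases_iff)
 qed (use assms(5,6) in auto)
 also have "... = K\<^sup>2 * (expectation H' * expectation I')" by (simp add: numeral_2_eq_2)
 finally show ?thesis .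
qed

lemma integrable_S: "integrable M (%x. \<bar>S n x\<bar> ^ p)"
proof (rule integrable_bounded)
 fix x assume "x \<in> space M"
 hence "\<bar>S n x\<bar> ^ p <= (B * real n) ^ p" by (intro power_mono S_bound) auto
 thus "\<bar>\<bar>S n x\<bar> ^ p\<bar> <= (B * real n) ^ p" by simp
qed measurable

lemma integrable_S': "integrable M (%x. \<bar>S n x\<bar>)" "integrable M (%x. (\<bar>S n x\<bar> + c)\<^sup>2)"
proof -
 show 1: "integrable M (%x. \<bar>S n x\<bar>)" using integrable_S[of n 1] by simp
 show "integrable M (%x. (\<bar>S n x\<bar> + c)\<^sup>2)"
  unfolding power2_sum using 1 integrable_S[of n 2] by simp
qed

text \<open>The mixed terms of the cube factorise up to \<open>K\<^sup>2\<close>; the summand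
  \<open>c\<close> pays for the variation of \<open>S\<close> within a cell.\<close>

lemma third_moment_step:
 "expectation (%x. \<bar>S (a + b) x\<bar> ^ 3) <= expectation (%x. \<bar>S a x\<bar> ^ 3) + expectation (%x. \<bar>S b x\<bar> ^ 3) +
  3 * K\<^sup>2 * (expectation (%x. (\<bar>S a x\<bar> + c)\<^sup>2) * expectation (%x. \<bar>S b x\<bar> + c) +
   expectation (%x. \<bar>S a x\<bar> + c) * expectation (%x. (\<bar>S b x\<bar> + c)\<^sup>2))"
proof -
 have vary: "\<bar>S n x\<bar> <= \<bar>S n y\<bar> + c" if "x \<in> space M" "y \<in> space M" "cell n x = cell n y" for n x y
  using cell_S[OF that le_refl] by linarith
 have vary2: "\<bar>S n x\<bar>\<^sup>2 <= (\<bar>S n y\<bar> + c)\<^sup>2" if "x \<in> space M" "y \<in> space M" "cell n x = cell n y" for n x y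
  by (rule power_mono[OF vary[OF that]]) simp
 have mean: "expectation (%x. \<bar>S b (ta a x)\<bar> ^ 3) = expectation (%x. \<bar>S b x\<bar> ^ 3)"
  by (rule integral_ta) measurable
 have bdS: "\<bar>S b (ta a x)\<bar> <= B * real b" if "x \<in> space M" for x using S_bound ta_space that by blast
 have i3: "integrable M (%x. \<bar>S b (ta a x)\<bar> ^ 3)"
 proof (rule integrable_bounded)
  fix x assume x: "x \<in> space M"
  have "\<bar>S b (ta a x)\<bar> ^ 3 <= (B * real b) ^ 3" by (intro power_mono bdS[OF x]) auto
  thus "\<bar>\<bar>S b (ta a x)\<bar> ^ 3\<bar> <= (B * real b) ^ 3" by simp
 qed measurable
 have i21: "integrable M (%x. \<bar>S a x\<bar> ^ p * \<bar>S b (ta a x)\<bar> ^ q)" for p q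
 proof (rule integrable_bounded)
  fix x assume x: "x \<in> space M"
  have "\<bar>S a x\<bar> ^ p * \<bar>S b (ta a x)\<bar> ^ q <= (B * real a) ^ p * (B * real b) ^ q"
   using B_nonneg by (intro mult_mono power_mono bdS[OF x] S_bound[OF x]) auto
  thus "\<bar>\<bar>S a x\<bar> ^ p * \<bar>S b (ta a x)\<bar> ^ q\<bar> <= (B * real a) ^ p * (B * real b) ^ q" by (simp add: abs_mult)
 qed measurable
 have pt: "\<bar>S (a + b) x\<bar> ^ 3 <= \<bar>S a x\<bar> ^ 3 + \<bar>S b (ta a x)\<bar> ^ 3 +
   3 * (\<bar>S a x\<bar>\<^sup>2 * \<bar>S b (ta a x)\<bar>) + 3 * (\<bar>S a x\<bar> * \<bar>S b (ta a x)\<bar>\<^sup>2)" if x: "x \<in> space M" for x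
 proof -
  have "\<bar>S (a + b) x\<bar> ^ 3 <= (\<bar>S a x\<bar> + \<bar>S b (ta a x)\<bar>) ^ 3" unfolding S_add[OF x] by (intro power_mono) auto
  moreover have "(p + q) ^ 3 = p ^ 3 + q ^ 3 + 3 * (p\<^sup>2 * q) + 3 * (p * q\<^sup>2)" for p q :: real
   by (simp add: power3_eq_cube power2_eq_square algebra_simps)
  ultimately show ?thesis by simp
 qed
 have "expectation (%x. \<bar>S (a + b) x\<bar> ^ 3) <= expectation (%x. \<bar>S a x\<bar> ^ 3 + \<bar>S b (ta a x)\<bar> ^ 3 +
   3 * (\<bar>S a x\<bar>\<^sup>2 * \<bar>S b (ta a x)\<bar>) + 3 * (\<bar>S a x\<bar> * \<bar>S b (ta a x)\<bar>\<^sup>2))"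
  using pt i3 i21[of 2 1] i21[of 1 2] integrable_S by (intro integral_mono) auto
 also have "... = expectation (%x. \<bar>S a x\<bar> ^ 3) + expectation (%x. \<bar>S b x\<bar> ^ 3) +
   3 * expectation (%x. \<bar>S a x\<bar>\<^sup>2 * \<bar>S b (ta a x)\<bar>) + 3 * expectation (%x. \<bar>S a x\<bar> * \<bar>S b (ta a x)\<bar>\<^sup>2)"
  using i3 i21[of 2 1] i21[of 1 2] integrable_S mean by simp
 also have "expectation (%x. \<bar>S a x\<bar>\<^sup>2 * \<bar>S b (ta a x)\<bar>) <= K\<^sup>2 * (expectation (%x. (\<bar>S a x\<bar> + c)\<^sup>2) * expectation (%x. \<bar>S b x\<bar> + c))"
  by (rule two_blocks_product[where F = b]) (use vary vary2 integrable_S' in auto)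
 also have "expectation (%x. \<bar>S a x\<bar> * \<bar>S b (ta a x)\<bar>\<^sup>2) <= K\<^sup>2 * (expectation (%x. \<bar>S a x\<bar> + c) * expectation (%x. (\<bar>S b x\<bar> + c)\<^sup>2))"
  by (rule two_blocks_product[where F = b]) (use vary vary2 integrable_S' in auto)
 finally show ?thesis by (simp add: algebra_simps)
qed

text \<open>Tightness improves the lower moments by a factor \<open>e\<close> over what the third
  moment gives: values below \<open>t * sqrt (real n)\<close> are small, values above it but below
  \<open>th * sqrt (real n)\<close> are rare, and the rest is paid by the third moment. With
  \<open>th = bb / e\<close> the last two contributions have equal bounds.\<close>

lemma low_moments:
 assumes e: "0 < e" "e <= 1" and bb: "bb > 0" and n: "n >= 1"
  and P: "prob {x \<in> space M. t * sqrt (real n) < \<bar>S n x\<bar>} <= e ^ 3" and t: "0 <= t" "t <= bb * e"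
  and M3: "expectation (%x. \<bar>S n x\<bar> ^ 3) <= bb ^ 3 * (real n * sqrt (real n))" and c: "c <= bb * e"
 shows "expectation (%x. \<bar>S n x\<bar> + c) <= 4 * bb * e * sqrt (real n)"
  and "expectation (%x. (\<bar>S n x\<bar> + c)\<^sup>2) <= 8 * bb\<^sup>2 * e * real n"
proof -
 define r where "r = sqrt (real n)"
 have r: "r >= 1" "r * r = real n" using n by (auto simp: r_def)
 have r0: "r > 0" using r by simp
 let ?P = "{x \<in> space M. t * r < \<bar>S n x\<bar>}"
 define th where "th = bb / e"
 have th: "th > 0" using bb e by (simp add: th_def)
 have Ps: "?P \<in> sets M" by measurable
 have iP: "integrable M (indicator ?P :: 'a => real)" using Ps by (simp add: integrable_indicator_iff emeasure_eq_measure)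
 have P': "prob ?P <= e ^ 3" using P by (simp add: r_def)
 have M3': "expectation (%x. \<bar>S n x\<bar> ^ 3) <= bb ^ 3 * r ^ 3" using M3 r by (simp add: r_def power3_eq_cube mult_ac)
 have "expectation (%x. \<bar>S n x\<bar>) <= expectation (%x. t * r + th * r * indicator ?P x + \<bar>S n x\<bar> ^ 3 / (th * r)\<^sup>2)"
 proof (rule integral_mono)
  fix x assume x: "x \<in> space M"
  have "s <= t * r + th * r * (if t * r < s then 1 else 0) + s ^ 3 / (th * r)\<^sup>2" if s: "s >= 0" for s
  proof (cases "s <= th * r")
   case True
   have "0 <= t * r" "0 <= s ^ 3 / (th * r)\<^sup>2" using s r0 t(1) by simp_all
   thus ?thesis using True by (cases "t * r < s"; simp only: if_True if_False simp_thms; linarith)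
  next
   case False
   hence "(th * r)\<^sup>2 <= s\<^sup>2" using th r0 by (intro power_mono) auto
   hence "s * (th * r)\<^sup>2 <= s ^ 3" using s mult_left_mono[of "(th * r)\<^sup>2" "s\<^sup>2" s] by (simp add: power2_eq_square power3_eq_cube)
   hence "s <= s ^ 3 / (th * r)\<^sup>2" using th r0 by (simp add: pos_le_divide_eq)
   thus ?thesis using th r0 t(1) by (auto intro!: add_increasing)
  qed
  note pw = this
  have ind: "indicator ?P x = (if t * r < \<bar>S n x\<bar> then 1 else 0 :: real)" using x by simp
  show "\<bar>S n x\<bar> <= t * r + th * r * indicator ?P x + \<bar>S n x\<bar> ^ 3 / (th * r)\<^sup>2"
   unfolding ind by (rule pw) simp
 qed (use integrable_S' integrable_S iP in auto)
 also have "... = t * r + th * r * prob ?P + expectation (%x. \<bar>S n x\<bar> ^ 3) / (th * r)\<^sup>2"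
  using integrable_S iP Ps by (simp add: prob_space)
 also have "... <= bb * e * r + th * r * e ^ 3 + bb ^ 3 * r ^ 3 / (th * r)\<^sup>2"
  using t P' M3' r0 th by (intro add_mono mult_mono divide_right_mono) auto
 also have "... = (bb * e + 2 * bb * e\<^sup>2) * r"
  using bb e r0 by (simp add: th_def field_simps power2_eq_square power3_eq_cube)
 finally have 1: "expectation (%x. \<bar>S n x\<bar>) <= (bb * e + 2 * bb * e\<^sup>2) * r" .
 have ee: "e\<^sup>2 <= e" using e by (simp add: power2_eq_square mult_left_le)
 have "2 * bb * e\<^sup>2 <= 2 * bb * e" using ee bb by (intro mult_left_mono) auto
 hence "(bb * e + 2 * bb * e\<^sup>2) * r <= (3 * bb * e) * r" using r0 by (intro mult_right_mono) auto
 moreover have "c <= bb * e * r" by (rule order_trans[OF c]) (use r(1) bb e in simp)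
 ultimately show "expectation (%x. \<bar>S n x\<bar> + c) <= 4 * bb * e * sqrt (real n)"
  using 1 integrable_S'(1)[of n] by (simp add: prob_space r_def[symmetric] algebra_simps)
 have "expectation (%x. \<bar>S n x\<bar>\<^sup>2) <= expectation (%x. (t * r)\<^sup>2 + (th * r)\<^sup>2 * indicator ?P x + \<bar>S n x\<bar> ^ 3 / (th * r))"
 proof (rule integral_mono)
  fix x assume x: "x \<in> space M"
  have "s\<^sup>2 <= (t * r)\<^sup>2 + (th * r)\<^sup>2 * (if t * r < s then 1 else 0) + s ^ 3 / (th * r)" if s: "s >= 0" for s
  proof -
   have nn: "0 <= (t * r)\<^sup>2" "0 <= (th * r)\<^sup>2" "0 <= s ^ 3 / (th * r)" using s th r0 by simp_all
   consider "s <= t * r" | "t * r < s" "s <= th * r" | "th * r < s" by linarith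
   thus ?thesis
   proof cases
    case 1
    hence "s\<^sup>2 <= (t * r)\<^sup>2" using s by (intro power_mono) auto
    thus ?thesis using nn by (cases "t * r < s"; simp only: if_True if_False simp_thms; linarith)
   next
    case 2
    hence "s\<^sup>2 <= (th * r)\<^sup>2" using s by (intro power_mono) auto
    thus ?thesis using nn 2 by (cases "t * r < s"; simp only: if_True if_False simp_thms; linarith)
   next
    case 3
    have "s\<^sup>2 * (th * r) <= s ^ 3" using s 3 mult_left_mono[of "th * r" s "s\<^sup>2"] by (simp add: power2_eq_square power3_eq_cube)
    hence "s\<^sup>2 <= s ^ 3 / (th * r)" using th r0 by (simp add: pos_le_divide_eq)
    thus ?thesis using nn by (cases "t * r < s"; simp only: if_True if_False simp_thms; linarith)
   qed
  qed
  note pw = this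
  have ind: "indicator ?P x = (if t * r < \<bar>S n x\<bar> then 1 else 0 :: real)" using x by simp
  show "\<bar>S n x\<bar>\<^sup>2 <= (t * r)\<^sup>2 + (th * r)\<^sup>2 * indicator ?P x + \<bar>S n x\<bar> ^ 3 / (th * r)"
   unfolding ind by (rule pw) simp
 qed (use integrable_S integrable_S[of n 2] iP in auto)
 also have "... = (t * r)\<^sup>2 + (th * r)\<^sup>2 * prob ?P + expectation (%x. \<bar>S n x\<bar> ^ 3) / (th * r)"
  using integrable_S iP Ps by (simp add: prob_space)
 also have "... <= (bb * e * r)\<^sup>2 + (th * r)\<^sup>2 * e ^ 3 + bb ^ 3 * r ^ 3 / (th * r)"
  using t P' M3' r0 th by (intro add_mono mult_mono divide_right_mono power_mono) auto
 also have "... = (bb\<^sup>2 * e\<^sup>2 + 2 * bb\<^sup>2 * e) * (r * r)"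
  using bb e r0 by (simp add: th_def field_simps power2_eq_square power3_eq_cube)
 also have "... <= (bb\<^sup>2 * e + 2 * bb\<^sup>2 * e) * (r * r)"
  using ee bb by (intro mult_right_mono add_mono mult_left_mono) auto
 finally have 2: "expectation (%x. \<bar>S n x\<bar>\<^sup>2) <= 3 * bb\<^sup>2 * e * real n" using r by (simp add: algebra_simps)
 have "expectation (%x. (\<bar>S n x\<bar> + c)\<^sup>2) <= expectation (%x. 2 * \<bar>S n x\<bar>\<^sup>2 + 2 * c\<^sup>2)"
 proof (rule integral_mono)
  fix x
  have "0 <= (\<bar>S n x\<bar> - c)\<^sup>2" by simp
  thus "(\<bar>S n x\<bar> + c)\<^sup>2 <= 2 * \<bar>S n x\<bar>\<^sup>2 + 2 * c\<^sup>2" by (simp add: power2_eq_square algebra_simps)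
 qed (use integrable_S[of n 2] integrable_S'(2) in auto)
 also have "... = 2 * expectation (%x. \<bar>S n x\<bar>\<^sup>2) + 2 * c\<^sup>2" using integrable_S[of n 2] by (simp add: prob_space)
 also have "... <= 2 * (3 * bb\<^sup>2 * e * real n) + 2 * (bb\<^sup>2 * e * real n)"
 proof -
  have "c\<^sup>2 <= (bb * e)\<^sup>2" using c c_nonneg by (intro power_mono) auto
  also have "... <= bb\<^sup>2 * e * real n"
   using ee n bb e mult_mono[of "e\<^sup>2" e 1 "real n"] by (simp add: power_mult_distrib mult.assoc mult_left_mono)
  finally show ?thesis using 2 by linarith
 qed
 finally show "expectation (%x. (\<bar>S n x\<bar> + c)\<^sup>2) <= 8 * bb\<^sup>2 * e * real n" by (simp add: mult_ac)
qed

text \<open>Induction by halving. The power 3/2 of \<open>n\<close> is strictly superadditive, so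
  the two halves use only 3/4 of the bound; the mixed terms, which carry \<open>K\<^sup>2\<close>,
  are made small by \<open>low_moments\<close>. Second moments with a linear bound would leave no
  room for them.\<close>

lemma third_moment: "\<exists>bb>0. \<forall>n\<ge>1. expectation (%x. \<bar>S n x\<bar> ^ 3) <= bb ^ 3 * (real n * sqrt (real n))"
proof -
 \<comment> \<open>The mixed terms then amount to \<open>96 * (e * K)\<^sup>2 = 96 / 484\<close> of
   the bound, less than the remaining quarter.\<close>
 define e where "e = 1 / (22 * K)"
 have e: "0 < e" "e <= 1" "e * K = 1 / 22" using K1 by (auto simp: e_def field_simps)
 obtain t0 where t0: "\<forall>n\<ge>1. prob {x \<in> space M. t0 * sqrt (real n) < \<bar>S n x\<bar>} <= e ^ 3"
  using tight[of "e ^ 3"] e by auto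
 define t where "t = max t0 0"
 have t: "prob {x \<in> space M. t * sqrt (real n) < \<bar>S n x\<bar>} <= e ^ 3" if "n >= 1" for n
 proof -
  have "t0 * sqrt (real n) <= t * sqrt (real n)" by (intro mult_right_mono) (auto simp: t_def)
  hence "prob {x \<in> space M. t * sqrt (real n) < \<bar>S n x\<bar>} <= prob {x \<in> space M. t0 * sqrt (real n) < \<bar>S n x\<bar>}"
   by (intro finite_measure_mono) auto
  thus ?thesis using t0 that by force
 qed
 define bb where "bb = 1 + t / e + c / e + 8 * B"
 have "t >= 0" by (simp add: t_def)
 hence pos: "0 <= t / e" "0 <= c / e" using e c_nonneg by auto
 have "bb > 0" "t / e <= bb" "c / e <= bb" "8 * B <= bb"
  using pos B_nonneg by (auto simp: bb_def)
 hence bb: "bb > 0" "t <= bb * e" "c <= bb * e" "8 * B <= bb"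
  using e(1) by (auto simp: pos_divide_le_eq)
 have "expectation (%x. \<bar>S n x\<bar> ^ 3) <= bb ^ 3 * (real n * sqrt (real n))" if "n >= 1" for n
  using that
 proof (induction n rule: less_induct)
  case (less n)
  show ?case
  \<comment> \<open>The larger half satisfies \<open>b <= 9 / 16 * n\<close> only from
    \<open>n = 8\<close> on; shorter times are covered by \<open>8 * B <= bb\<close>.\<close>
  proof (cases "n < 8")
   case True
   have "expectation (%x. \<bar>S n x\<bar> ^ 3) <= expectation (%x. bb ^ 3)"
   proof (rule integral_mono[OF integrable_S])
    fix x assume x: "x \<in> space M"
    have "\<bar>S n x\<bar> <= B * real n" by (rule S_bound[OF x])
    also have "... <= B * 8" using True B_nonneg by (intro mult_left_mono) auto
    finally show "\<bar>S n x\<bar> ^ 3 <= bb ^ 3" using bb(4) by (intro power_mono) auto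
   qed simp
   also have "... = bb ^ 3 * 1" by (simp add: prob_space)
   also have "... <= bb ^ 3 * (real n * sqrt (real n))"
    using less.prems bb(1) mult_mono[of 1 "real n" 1 "sqrt (real n)"] by (intro mult_left_mono) auto
   finally show ?thesis .
  next
   case False
   define a b where "a = n div 2" and "b = n - n div 2"
   have ab: "a + b = n" "1 <= a" "a < n" "1 <= b" "b < n" "a <= b" "2 * b <= n + 1" using False by (auto simp: a_def b_def)
   note Ma = less.IH[OF ab(3,2)] and Mb = less.IH[OF ab(5,4)]
   note La = low_moments[OF e(1,2) bb(1) ab(2) t[OF ab(2)] \<open>t >= 0\<close> bb(2) Ma bb(3)]
   note Lb = low_moments[OF e(1,2) bb(1) ab(4) t[OF ab(4)] \<open>t >= 0\<close> bb(2) Mb bb(3)]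
   have nn: "0 <= expectation (%x. \<bar>S k x\<bar> + c)" for k using c_nonneg by (intro integral_nonneg_AE) auto
   let ?n = "real n" and ?r = "sqrt (real n)" and ?a = "real a" and ?b = "real b"
   have rr: "?b * sqrt ?b + ?a * sqrt ?a <= 3 / 4 * (?n * ?r)"
   proof -
    have nr: "?n = ?a + ?b" using ab(1) by linarith
    have "sqrt ?a <= sqrt ?b" using ab by simp
    hence "?b * sqrt ?b + ?a * sqrt ?a <= ?b * sqrt ?b + ?a * sqrt ?b" by (intro add_left_mono mult_left_mono) auto
    also have "... = ?n * sqrt ?b" unfolding nr by (simp add: algebra_simps)
    also have "... <= ?n * (3 / 4 * ?r)"
    proof (intro mult_left_mono)
     have "2 * ?b <= ?n + 1" "8 <= ?n" using ab(7) False by linarith+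
     hence "?b <= (3 / 4)\<^sup>2 * ?n" by (simp add: power2_eq_square)
     hence "sqrt ?b <= sqrt ((3 / 4)\<^sup>2 * ?n)" by simp
     thus "sqrt ?b <= 3 / 4 * ?r" by (simp add: real_sqrt_mult)
    qed simp
    finally show ?thesis by simp
   qed
   have rb: "sqrt ?a <= ?r" "sqrt ?b <= ?r" using ab by auto
   have "expectation (%x. \<bar>S n x\<bar> ^ 3) <= bb ^ 3 * (?a * sqrt ?a) + bb ^ 3 * (?b * sqrt ?b) +
     3 * K\<^sup>2 * ((8 * bb\<^sup>2 * e * ?a) * (4 * bb * e * sqrt ?b) + (4 * bb * e * sqrt ?a) * (8 * bb\<^sup>2 * e * ?b))"
   proof -
    have g1: "expectation (%x. (\<bar>S a x\<bar> + c)\<^sup>2) * expectation (%x. \<bar>S b x\<bar> + c) <= (8 * bb\<^sup>2 * e * ?a) * (4 * bb * e * sqrt ?b)"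
     by (rule mult_mono[OF La(2) Lb(1)]) (use nn bb(1) e(1) in auto)
    have g2: "expectation (%x. \<bar>S a x\<bar> + c) * expectation (%x. (\<bar>S b x\<bar> + c)\<^sup>2) <= (4 * bb * e * sqrt ?a) * (8 * bb\<^sup>2 * e * ?b)"
     by (rule mult_mono[OF La(1) Lb(2)]) (use bb(1) e(1) in auto)
    have "0 <= 3 * K\<^sup>2" by simp
    from order_trans[OF third_moment_step[of a b] add_mono[OF add_mono[OF Ma Mb] mult_left_mono[OF add_mono[OF g1 g2] this]]]
    show ?thesis unfolding ab(1) .
   qed
   also have "... <= bb ^ 3 * (?a * sqrt ?a) + bb ^ 3 * (?b * sqrt ?b) +
     3 * K\<^sup>2 * ((8 * bb\<^sup>2 * e * ?a) * (4 * bb * e * ?r) + (4 * bb * e * ?r) * (8 * bb\<^sup>2 * e * ?b))"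
    using rb bb(1) e(1) by (intro add_mono mult_left_mono mult_mono) auto
   also have "... = bb ^ 3 * (?b * sqrt ?b + ?a * sqrt ?a) + 96 * (e * K)\<^sup>2 * bb ^ 3 * ((?a + ?b) * ?r)"
    by (simp add: power2_eq_square power3_eq_cube algebra_simps)
   also have "... <= bb ^ 3 * (3 / 4 * (?n * ?r)) + 96 * (e * K)\<^sup>2 * bb ^ 3 * (?n * ?r)"
    using rr bb(1) ab(1) by (intro add_mono mult_left_mono) (auto simp flip: of_nat_add)
   also have "... = (3 / 4 + 96 / 484) * (bb ^ 3 * (?n * ?r))" unfolding e(3) by (simp add: power2_eq_square field_simps)
   also have "... <= 1 * (bb ^ 3 * (?n * ?r))" using bb(1) by (intro mult_right_mono) auto
   finally show ?thesis by simp
  qed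
 qed
 thus ?thesis using bb(1) by blast
qed

lemma first_moment:
 obtains A where "A > 0" "\<And>n. expectation (%x. \<bar>S n x\<bar>) <= A * sqrt (real n)"
proof -
 obtain bb where bb: "bb > 0" "\<And>n. n >= 1 ==> expectation (%x. \<bar>S n x\<bar> ^ 3) <= bb ^ 3 * (real n * sqrt (real n))"
  using third_moment by blast
 show thesis
 proof (rule that)
  show "1 + bb ^ 3 > 0" using bb(1) by (simp add: add_pos_pos)
  fix n
  show "expectation (%x. \<bar>S n x\<bar>) <= (1 + bb ^ 3) * sqrt (real n)"
  proof (cases "n = 0")
   case True
   have "expectation (%x. \<bar>S n x\<bar>) = expectation (%x. 0)"
    using S_bound[of _ 0] True by (intro Bochner_Integration.integral_cong) auto
   thus ?thesis using True by simp
  next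
   case False
   have "expectation (%x. \<bar>S n x\<bar>) <= expectation (%x. sqrt (real n) + \<bar>S n x\<bar> ^ 3 / real n)"
   proof (rule integral_mono)
    fix x
    have "s <= sqrt (real n) + s ^ 3 / real n" if s: "s >= 0" for s
    proof (cases "s <= sqrt (real n)")
     case False
     hence "(sqrt (real n))\<^sup>2 <= s\<^sup>2" by (intro power_mono) auto
     hence "s * real n <= s ^ 3" using s mult_left_mono[of "real n" "s\<^sup>2" s] by (simp add: power2_eq_square power3_eq_cube)
     hence "s <= s ^ 3 / real n" using \<open>n ~= 0\<close> by (simp add: pos_le_divide_eq)
     thus ?thesis by (simp add: add_increasing)
    qed (simp add: add_increasing2 s)
    thus "\<bar>S n x\<bar> <= sqrt (real n) + \<bar>S n x\<bar> ^ 3 / real n" by simp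
   qed (use integrable_S integrable_S' in auto)
   also have "... = sqrt (real n) + expectation (%x. \<bar>S n x\<bar> ^ 3) / real n" using integrable_S by (simp add: prob_space)
   also have "... <= sqrt (real n) + bb ^ 3 * (real n * sqrt (real n)) / real n"
    using bb(2)[of n] False by (intro add_left_mono divide_right_mono) auto
   also have "... = (1 + bb ^ 3) * sqrt (real n)" using False by (simp add: algebra_simps)
   finally show ?thesis .
  qed
 qed
qed

end

section \<open>Lipschitz test functions and mixing\<close>

locale lipschitz_function = quasi_independent M ta S cell K c B
 for M :: "'a measure" and ta S cell K c B +
 fixes g :: "real => real" and L mu :: real
 assumes g_range: "0 <= g u" "g u <= 1" and g_lip: "\<bar>g u - g v\<bar> <= L * \<bar>u - v\<bar>" and L_nonneg: "0 <= L"
  and mu: "0 <= mu" "mu <= 1"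
begin

definition bt :: "nat => 'a => real" where
 "bt n x = g (S n x / sqrt (real n)) - mu"

lemma measurable_g [measurable]: "g \<in> borel_measurable borel"
proof -
 have "continuous_on UNIV g"
 proof (rule continuous_onI)
  fix u e :: real assume e: "e > 0"
  show "\<exists>d>0. \<forall>v\<in>UNIV. dist v u < d --> dist (g v) (g u) <= e"
  proof (intro exI[of _ "e / (L + 1)"] conjI ballI impI)
   show "e / (L + 1) > 0" using e L_nonneg by simp
   fix v assume "dist v u < e / (L + 1)"
   hence "\<bar>v - u\<bar> * (L + 1) <= e" using L_nonneg by (simp add: dist_real_def pos_less_divide_eq)
   thus "dist (g v) (g u) <= e" using g_lip[of v u] by (simp add: dist_real_def algebra_simps)
  qed
 qed
 thus ?thesis by (rule borel_measurable_continuous_onI)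
qed

lemma measurable_bt [measurable]: "bt n \<in> borel_measurable M"
 unfolding bt_def by measurable

lemma bt_range: "- mu <= bt n x" "bt n x <= 1 - mu"
 using g_range by (auto simp: bt_def)

lemma bt_le_1: "\<bar>bt n x\<bar> <= 1"
 using bt_range[of n x] mu by linarith

lemma integrable_bt: "integrable M (bt n)"
 using bt_le_1 by (intro integrable_bounded[of _ 1]) auto

lemma abs_mult_le_1: "\<bar>u\<bar> <= 1 ==> \<bar>v\<bar> <= 1 ==> \<bar>u * v\<bar> <= (1::real)"
 using mult_mono[of "\<bar>u\<bar>" 1 "\<bar>v\<bar>" 1] by (simp add: abs_mult)

lemma integrable_bt_bt: "integrable M (%x. bt n (ta i x) * bt k (ta j x))"
 using bt_le_1 by (intro integrable_bounded[of _ 1] abs_mult_le_1) auto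

lemma bt_lip: "\<bar>bt n x - bt n y\<bar> <= L * \<bar>S n x - S n y\<bar> / sqrt (real n)"
proof -
 have "\<bar>bt n x - bt n y\<bar> <= L * \<bar>S n x / sqrt (real n) - S n y / sqrt (real n)\<bar>"
  using g_lip[of "S n x / sqrt (real n)" "S n y / sqrt (real n)"] by (simp add: bt_def)
 also have "... = L * \<bar>S n x - S n y\<bar> / sqrt (real n)" by (simp add: diff_divide_distrib[symmetric])
 finally show ?thesis .
qed

end

text \<open>The threshold for \<open>k\<close> may depend on \<open>n\<close>, as in the ergodic
  estimate from which the property will come; \<open>mixing\<close> removes this dependence.\<close>

locale lipschitz_test = lipschitz_function +
 assumes decorrelation: "e > 0 ==> \<exists>n0. \<forall>n\<ge>n0. \<forall>\<^sub>F k in sequentially. \<bar>expectation (%x. bt n x * bt k x)\<bar> <= e"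
begin

text \<open>
 If many pairs of adjacent blocks had covariance at least \<open>ka\<close>, take such pairs with rapidly
 growing lengths and align them at a common time. The square of the average of the products then has
 integral at least \<open>ka\<^sup>2\<close>; by quasi-independence past and future can be integrated separately, and the
 factors of the future are almost orthogonal.
\<close>

lemma mixing:
 assumes "ka > 0"
 shows "\<exists>n0. \<forall>a\<ge>n0. \<forall>b\<ge>n0. \<bar>expectation (%x. bt a x * bt b (ta a x))\<bar> <= ka"
proof (rule ccontr)
 assume neg: "\<not> ?thesis"
 let ?cov = "%a b. expectation (%x. bt a x * bt b (ta a x))"
 define ka' where "ka' = min ka 1"
 have ka': "0 < ka'" "ka' <= 1" "ka' <= ka" using assms by (auto simp: ka'_def)
 have "\<exists>a\<ge>n0. \<exists>b\<ge>n0. ka' < \<bar>?cov a b\<bar>" for n0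
  using neg ka'(3) by (meson not_le order_le_less_trans)
 then obtain pa pb where pair: "\<And>n. pa n >= n" "\<And>n. pb n >= n" "\<And>n. ka' < \<bar>?cov (pa n) (pb n)\<bar>" by metis
 \<comment> \<open>Prepares the final contradiction: the integral of the square is at least
   \<open>ka'\<^sup>2 / 4\<close>, but at most
   \<open>6 * K\<^sup>2 * ep = 6 * ka'\<^sup>2 / 32\<close>.\<close>
 define ep where "ep = ka'\<^sup>2 / (32 * K\<^sup>2)"
 have ep: "ep > 0" using ka' K1 by (simp add: ep_def)
 have epK: "K\<^sup>2 * ep = ka'\<^sup>2 / 32" using K1 by (simp add: ep_def)
 have "1 * ep <= K\<^sup>2 * ep" using K1 ep by (intro mult_right_mono) auto
 moreover have "ka'\<^sup>2 <= ka'" using ka' by (simp add: power2_eq_square mult_left_le)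
 ultimately have epka: "4 * ep <= ka'" using epK ka' by linarith
 obtain J :: nat where J0: "1 / (2 * ep) <= real J" using real_arch_simple by blast
 hence J: "J > 0" "1 / real J <= 2 * ep"
 proof -
  have "0 < 1 / (2 * ep)" using ep by simp
  hence "0 < real J" using J0 by linarith
  thus "J > 0" "1 / real J <= 2 * ep" using J0 ep by (auto simp: field_simps)
 qed
 obtain nd where nd: "\<And>n. n >= nd ==> \<forall>\<^sub>F k in sequentially. \<bar>expectation (%x. bt n x * bt k x)\<bar> <= 2 * ep"
  using decorrelation[of "2 * ep"] ep by auto
 hence "\<exists>N. \<forall>k\<ge>N. n >= nd --> \<bar>expectation (%x. bt n x * bt k x)\<bar> <= 2 * ep" for n
  unfolding eventually_sequentially by blast
 then obtain N where N: "\<And>n k. n >= nd ==> k >= N n ==> \<bar>expectation (%x. bt n x * bt k x)\<bar> <= 2 * ep" by metis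
 obtain nl :: nat where nl: "(2 * L * c / ep)\<^sup>2 + 1 <= real nl" using real_arch_simple by blast
 have small: "L * (2 * c) / sqrt (real n) <= ep" if n: "n >= nl" for n
 proof -
  have "(2 * L * c / ep)\<^sup>2 <= real n" "0 < real n" using nl n of_nat_mono[of nl n, where 'a = real] zero_le_power2[of "2 * L * c / ep"] by linarith+
  hence "2 * L * c / ep <= sqrt (real n)" by (simp add: real_le_rsqrt)
  thus ?thesis using ep \<open>0 < real n\<close> by (simp add: field_simps)
 qed
 \<comment> \<open>Each index is chosen beyond the threshold \<open>N\<close> of the preceding pair,
   from which on longer blocks are almost orthogonal to its future block.\<close>
 define r where "r = rec_nat (max nd nl) (%_ n. max n (N (pb n)))"
 have r0: "r 0 = max nd nl" and rS: "r (Suc j) = max (r j) (N (pb (r j)))" for j by (simp_all add: r_def)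
 have r_mono: "mono r" by (rule incseq_SucI) (simp add: rS)
 have r_ge: "r j >= nd" "r j >= nl" for j using monoD[OF r_mono, of 0 j] r0 by auto
 define A where "A = (%j. pa (r j))"
 define F where "F = (%j. pb (r j))"
 have A: "A j >= nl" and F: "F j >= nl" "F j >= nd" for j
  using pair(1)[of "r j"] pair(2)[of "r j"] r_ge[of j] by (auto simp: A_def F_def)
 have orth: "\<bar>expectation (%x. bt (F i) x * bt (F j) x)\<bar> <= 2 * ep" if ij: "i < j" for i j
 proof (rule N[OF F(2)])
  have "N (F i) <= r (Suc i)" by (simp add: rS F_def)
  also have "... <= r j" using ij by (intro monoD[OF r_mono]) simp
  also have "... <= F j" by (simp add: F_def pair)
  finally show "N (F i) <= F j" .
 qed
 \<comment> \<open>All pairs are joined at the common time \<open>D\<close>: the past block of pair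
   \<open>j\<close> consists of the last \<open>A j\<close> steps before \<open>D\<close>, its
   future block of the first \<open>F j\<close> steps after \<open>D\<close>.\<close>
 define D where "D = (\<Sum>j<J. A j)"
 define E where "E = (\<Sum>j<J. F j)"
 have DE: "A j <= D" "F j <= E" if "j < J" for j using that by (auto simp: D_def E_def intro!: member_le_sum)
 define past where "past = (%j x. bt (A j) (ta (D - A j) x))"
 define sg where "sg = (%j. sgn (?cov (A j) (F j)))"
 \<comment> \<open>Evaluation at one representative per cell turns the factors of past and future
   into exact functions of the labels.\<close>
 define rep where "rep = (%n i. if \<exists>x\<in>space M. cell n x = i then SOME x. x \<in> space M \<and> cell n x = i else SOME x. x \<in> space M)"
 have rep: "rep n i \<in> space M" for n i
 proof (cases "\<exists>x\<in>space M. cell n x = i")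
  case True
  hence "\<exists>x. x \<in> space M \<and> cell n x = i" by blast
  from someI_ex[OF this] show ?thesis using True by (simp add: rep_def)
 next
  case False
  have "\<exists>x. x \<in> space M" using not_empty by blast
  from someI_ex[OF this] show ?thesis unfolding rep_def if_not_P[OF False] .
 qed
 have rep_cell: "cell n (rep n (cell n x)) = cell n x" if x: "x \<in> space M" for n x
 proof -
  have ex: "\<exists>y\<in>space M. cell n y = cell n x" using x by blast
  hence "\<exists>y. y \<in> space M \<and> cell n y = cell n x" by blast
  from someI_ex[OF this] show ?thesis using ex by (simp add: rep_def)
 qed
 define a where "a = (%j i. past j (rep D i))"
 define b where "b = (%j i. bt (F j) (rep E i))"
 have past_le: "\<bar>past j x\<bar> <= 1" for j x by (simp add: past_def bt_le_1)
 have ab1: "\<bar>a j i\<bar> <= 1" "\<bar>b j i\<bar> <= 1" for j i by (simp_all add: a_def b_def past_le bt_le_1)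
 have a_near: "\<bar>a j (cell D x) - past j x\<bar> <= ep" if j: "j < J" and x: "x \<in> space M" for j x
 proof -
  let ?y = "rep D (cell D x)"
  have split: "S D u = S (D - A j) u + S (A j) (ta (D - A j) u)" if "u \<in> space M" for u
   using S_add[OF that, of "D - A j" "A j"] DE(1)[OF j] by simp
  have "\<bar>S D ?y - S D x\<bar> <= c" "\<bar>S (D - A j) ?y - S (D - A j) x\<bar> <= c"
   by (intro cell_S[OF rep x rep_cell[OF x]]; simp)+
  hence le: "\<bar>S (A j) (ta (D - A j) ?y) - S (A j) (ta (D - A j) x)\<bar> <= 2 * c"
   using split[OF x] split[OF rep] by (simp add: abs_le_iff)
  have "\<bar>a j (cell D x) - past j x\<bar> <= L * \<bar>S (A j) (ta (D - A j) ?y) - S (A j) (ta (D - A j) x)\<bar> / sqrt (real (A j))"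
   unfolding a_def past_def by (rule bt_lip)
  also have "... <= L * (2 * c) / sqrt (real (A j))" using le L_nonneg by (intro divide_right_mono mult_left_mono) auto
  also have "... <= ep" by (rule small[OF A])
  finally show ?thesis .
 qed
 have b_near: "\<bar>b j (cell E x) - bt (F j) x\<bar> <= ep" if j: "j < J" and x: "x \<in> space M" for j x
 proof -
  let ?y = "rep E (cell E x)"
  have "\<bar>S (F j) ?y - S (F j) x\<bar> <= c" by (rule cell_S[OF rep x rep_cell[OF x] DE(2)[OF j]])
  hence le: "\<bar>S (F j) ?y - S (F j) x\<bar> <= 2 * c" using c_nonneg by linarith
  have "\<bar>b j (cell E x) - bt (F j) x\<bar> <= L * \<bar>S (F j) ?y - S (F j) x\<bar> / sqrt (real (F j))"
   unfolding b_def by (rule bt_lip)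
  also have "... <= L * (2 * c) / sqrt (real (F j))" using le L_nonneg by (intro divide_right_mono mult_left_mono) auto
  also have "... <= ep" by (rule small[OF F(1)])
  finally show ?thesis .
 qed
 have prod_near: "\<bar>u * v - u' * v'\<bar> <= 2 * ep" if "\<bar>u - u'\<bar> <= ep" "\<bar>v - v'\<bar> <= ep" "\<bar>u\<bar> <= 1" "\<bar>v'\<bar> <= 1" for u v u' v' :: real
 proof -
  have "u * v - u' * v' = u * (v - v') + (u - u') * v'" by (simp add: algebra_simps)
  moreover have "\<bar>u * (v - v')\<bar> <= 1 * ep" "\<bar>(u - u') * v'\<bar> <= ep * 1"
   unfolding abs_mult using that ep by (intro mult_mono; simp)+
  ultimately show ?thesis by linarith
 qed
 define H where "H = (%i k. (\<Sum>j<J. sg j * a j i * b j k) / real J)"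
 have meas_label: "(%x. h (cell n x)) \<in> borel_measurable M" for h :: "nat => real" and n
  by (rule measurable_compose[OF measurable_cell]) simp
 have meas_label2: "(%x. h (cell n (ta D x))) \<in> borel_measurable M" for h :: "nat => real" and n
  by (rule measurable_compose[OF measurable_ta meas_label])
 have int_ab: "integrable M (%x. sg j * a j (cell D x) * b j (cell E (ta D x)))" for j
  unfolding mult.assoc using ab1
  by (intro integrable_mult_right integrable_bounded[of _ 1] abs_mult_le_1 borel_measurable_times meas_label meas_label2) auto
 have cov_low: "ka' - 2 * ep <= expectation (%x. sg j * a j (cell D x) * b j (cell E (ta D x)))" if j: "j < J" for j
 proof -
  have i: "integrable M (%x. past j x * bt (F j) (ta D x))"
   unfolding past_def by (rule integrable_bt_bt)
  have "expectation (%x. past j x * bt (F j) (ta D x)) = expectation (%x. bt (A j) (ta (D - A j) x) * bt (F j) (ta (A j) (ta (D - A j) x)))"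
   using DE(1)[OF j] by (intro Bochner_Integration.integral_cong) (auto simp: past_def ta_add[symmetric])
  also have "... = ?cov (A j) (F j)" by (rule integral_ta[of "%x. bt (A j) x * bt (F j) (ta (A j) x)"]) measurable
  finally have eq: "expectation (%x. past j x * bt (F j) (ta D x)) = ?cov (A j) (F j)" .
  have cov: "ka' < \<bar>?cov (A j) (F j)\<bar>" using pair(3)[of "r j"] by (simp add: A_def F_def)
  have sg1: "\<bar>sg j\<bar> = 1" "sg j * ?cov (A j) (F j) = \<bar>?cov (A j) (F j)\<bar>" using cov ka'(1) by (auto simp: sg_def sgn_if)
  have "expectation (%x. sg j * (past j x * bt (F j) (ta D x)) - 2 * ep) <= expectation (%x. sg j * a j (cell D x) * b j (cell E (ta D x)))"
  proof (rule integral_mono)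
   fix x assume x: "x \<in> space M"
   have "\<bar>a j (cell D x) * b j (cell E (ta D x)) - past j x * bt (F j) (ta D x)\<bar> <= 2 * ep"
    by (rule prod_near[OF a_near[OF j x] b_near[OF j ta_space[OF x]] ab1(1) bt_le_1])
   hence "\<bar>sg j * (a j (cell D x) * b j (cell E (ta D x)) - past j x * bt (F j) (ta D x))\<bar> <= 2 * ep"
    unfolding abs_mult sg1 by simp
   thus "sg j * (past j x * bt (F j) (ta D x)) - 2 * ep <= sg j * a j (cell D x) * b j (cell E (ta D x))"
    by (simp add: abs_le_iff algebra_simps)
  qed (use i int_ab in auto)
  moreover have "expectation (%x. sg j * (past j x * bt (F j) (ta D x)) - 2 * ep) = sg j * ?cov (A j) (F j) - 2 * ep"
   using i by (simp add: prob_space eq)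
  ultimately show ?thesis using cov sg1(2) by linarith
 qed
 have "real J * (ka' - 2 * ep) <= (\<Sum>j<J. expectation (%x. sg j * a j (cell D x) * b j (cell E (ta D x))))"
  using sum_mono[of "{..<J}" "%_. ka' - 2 * ep", OF cov_low] by simp
 also have "... = expectation (%x. \<Sum>j<J. sg j * a j (cell D x) * b j (cell E (ta D x)))"
  using int_ab by (intro Bochner_Integration.integral_sum[symmetric]) auto
 finally have low: "ka' - 2 * ep <= expectation (%x. H (cell D x) (cell E (ta D x)))"
  using J(1) by (simp add: H_def pos_le_divide_eq mult.commute)
 have sg_le: "\<bar>sg j\<bar> <= 1" for j by (simp add: sg_def sgn_if)
 have H1: "\<bar>H i k\<bar> <= 1" for i k
 proof -
  have "\<bar>\<Sum>j<J. sg j * a j i * b j k\<bar> <= (\<Sum>j<J. 1)"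
   using ab1 sg_le by (intro order_trans[OF sum_abs] sum_mono abs_mult_le_1)
  thus ?thesis using J(1) by (simp add: H_def)
 qed
 have measH: "(%x. H (cell D x) (cell E (ta D x))) \<in> borel_measurable M"
  unfolding H_def using meas_label meas_label2 by (intro borel_measurable_divide borel_measurable_sum borel_measurable_times) auto
 have "(ka' / 2)\<^sup>2 <= (expectation (%x. H (cell D x) (cell E (ta D x))))\<^sup>2"
  using low epka ka' by (intro power_mono) auto
 also have "... <= expectation (%x. (H (cell D x) (cell E (ta D x)))\<^sup>2)"
 proof -
  have i: "integrable M (%x. H (cell D x) (cell E (ta D x)))" "integrable M (%x. (H (cell D x) (cell E (ta D x)))\<^sup>2)"
   using H1 measH by (auto intro!: integrable_bounded[of _ 1] simp: abs_square_le_1)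
  show ?thesis using variance_eq[OF i] variance_positive[of "%x. H (cell D x) (cell E (ta D x))"] by simp
 qed
 also have "... <= K\<^sup>2 * (\<Sum>i<labels D. \<Sum>k<labels E. (H i k)\<^sup>2 * (lp D i * lp E k))"
  by (rule two_cells_bound) simp
 also have "(\<Sum>i<labels D. \<Sum>k<labels E. (H i k)\<^sup>2 * (lp D i * lp E k)) <= 6 * ep"
 proof -
  define P where "P = (%j j'. \<Sum>i<labels D. a j i * a j' i * lp D i)"
  define R where "R = (%j j'. \<Sum>k<labels E. b j k * b j' k * lp E k)"
  have P: "P j j' = expectation (%x. a j (cell D x) * a j' (cell D x))" for j j'
   unfolding P_def by (rule expectation_cell[symmetric])
  have R: "R j j' = expectation (%x. b j (cell E x) * b j' (cell E x))" for j j'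
   unfolding R_def by (rule expectation_cell[symmetric])
  have bdd: "\<bar>expectation h\<bar> <= e" if "h \<in> borel_measurable M" "\<And>x. x \<in> space M ==> \<bar>h x\<bar> <= e" for h :: "'a => real" and e
  proof -
   have "\<bar>expectation h\<bar> <= expectation (%x. e)"
    by (rule order_trans[OF integral_abs_bound integral_mono[OF integrable_abs[OF integrable_bounded[OF that]] integrable_const that(2)]])
   thus ?thesis by (simp add: prob_space)
  qed
  have P1: "\<bar>P j j'\<bar> <= 1" for j j' unfolding P using ab1 meas_label by (intro bdd borel_measurable_times abs_mult_le_1) auto
  have R1: "\<bar>R j j'\<bar> <= 1" for j j' unfolding R using ab1 meas_label by (intro bdd borel_measurable_times abs_mult_le_1) auto
  have R2: "\<bar>R j j'\<bar> <= 4 * ep" if jj: "j < J" "j' < J" "j ~= j'" for j j'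
  proof -
   have i1: "integrable M (%x. b j (cell E x) * b j' (cell E x))"
    using ab1 meas_label by (intro integrable_bounded[of _ 1] borel_measurable_times abs_mult_le_1) auto
   have i2: "integrable M (%x. bt (F j) x * bt (F j') x)"
    using bt_le_1 by (intro integrable_bounded[of _ 1] abs_mult_le_1) auto
   have "\<bar>expectation (%x. b j (cell E x) * b j' (cell E x) - bt (F j) x * bt (F j') x)\<bar> <= 2 * ep"
    using i1 i2 by (intro bdd prod_near b_near jj ab1 bt_le_1) auto
   hence "\<bar>R j j' - expectation (%x. bt (F j) x * bt (F j') x)\<bar> <= 2 * ep" using i1 i2 by (simp add: R)
   moreover have "\<bar>expectation (%x. bt (F j) x * bt (F j') x)\<bar> <= 2 * ep"
    using orth[of j j'] orth[of j' j] jj(3) by (cases "j < j'") (auto simp: mult.commute)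
   ultimately show ?thesis by linarith
  qed
  have sq: "(H i k)\<^sup>2 = (\<Sum>j<J. \<Sum>j'<J. sg j * sg j' * (a j i * a j' i) * (b j k * b j' k)) / (real J)\<^sup>2" for i k
   by (simp add: H_def power_divide power2_eq_square[of "\<Sum>j<J. _ j"] sum_product mult_ac)
  have "(\<Sum>i<labels D. \<Sum>k<labels E. (H i k)\<^sup>2 * (lp D i * lp E k)) =
   (\<Sum>i<labels D. \<Sum>k<labels E. \<Sum>j<J. \<Sum>j'<J. sg j * sg j' * (a j i * a j' i * lp D i) * (b j k * b j' k * lp E k)) / (real J)\<^sup>2"
   unfolding sq by (simp add: sum_divide_distrib sum_distrib_right sum_distrib_left mult_ac)
  also have "(\<Sum>i<labels D. \<Sum>k<labels E. \<Sum>j<J. \<Sum>j'<J. sg j * sg j' * (a j i * a j' i * lp D i) * (b j k * b j' k * lp E k)) =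
   (\<Sum>j<J. \<Sum>j'<J. \<Sum>i<labels D. \<Sum>k<labels E. sg j * sg j' * (a j i * a j' i * lp D i) * (b j k * b j' k * lp E k))"
   by (subst sum.swap, subst (3) sum.swap, subst sum.swap, subst (2) sum.swap, subst (3) sum.swap, subst (2) sum.swap) (rule refl)
  also have "... = (\<Sum>j<J. \<Sum>j'<J. sg j * sg j' * P j j' * R j j')"
  proof -
   have "(\<Sum>i<n. \<Sum>k<n'. s * p i * q k) = s * (\<Sum>i<n. p i) * (\<Sum>k<n'. q k)" for n n' s and p q :: "nat => real"
    unfolding mult.assoc sum_product by (simp only: sum_distrib_left)
   thus ?thesis unfolding P_def R_def by (simp only:)
  qed
  \<comment> \<open>The past factors enter through the bound 1. Off the diagonal the future factors
    are almost orthogonal, and after division by \<open>J\<^sup>2\<close> the diagonal contributes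
    \<open>1 / J\<close>.\<close>
  also have "... <= (\<Sum>j<J. \<Sum>j'<J. (if j = j' then 1 else 0) + 4 * ep)"
  proof (intro sum_mono)
   fix j j' assume jj: "j \<in> {..<J}" "j' \<in> {..<J}"
   have "\<bar>sg j * sg j' * P j j'\<bar> <= 1" by (intro abs_mult_le_1 sg_le P1)
   hence "\<bar>sg j * sg j' * P j j' * R j j'\<bar> <= \<bar>R j j'\<bar>"
    using mult_right_mono[of "\<bar>sg j * sg j' * P j j'\<bar>" 1 "\<bar>R j j'\<bar>"] by (simp add: abs_mult)
   thus "sg j * sg j' * P j j' * R j j' <= (if j = j' then 1 else 0) + 4 * ep"
    using R1[of j j'] R2[of j j'] jj ep by (auto simp: abs_le_iff)
  qed
  also have "... = real J + (real J)\<^sup>2 * (4 * ep)" by (simp add: sum.distrib power2_eq_square mult.assoc distrib_left)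
  also have "(real J + (real J)\<^sup>2 * (4 * ep)) / (real J)\<^sup>2 = 1 / real J + 4 * ep"
   using J(1) by (simp add: field_simps power2_eq_square)
  finally show ?thesis using J(2) by (simp add: divide_right_mono)
 qed
 finally have "(ka' / 2)\<^sup>2 <= 6 * (K\<^sup>2 * ep)" using K1 by (simp add: mult_left_mono mult_ac)
 thus False unfolding epK using ka'(1) by (simp add: power2_eq_square)
qed

end

lemma sum_inverse_le: "1 <= a ==> a <= b ==> (\<Sum>k\<in>{a..<b}. 1 / real k) <= 1 / real a + ln (real b / real a)"
proof -
 assume a: "1 <= a" "a <= b"
 have "(\<Sum>k\<in>{a..<Suc b}. 1 / real k) <= 1 / real a + ln (real b / real a)"
  using a(2)
 proof (induction b rule: dec_induct)
  case base
  thus ?case using a by simp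
 next
  case (step b)
  have b: "real b > 0" "real a > 0" using step a by auto
  have "ln (real b / real (Suc b)) <= real b / real (Suc b) - 1" using b by (intro ln_le_minus_one) simp
  also have "... = - (1 / real (Suc b))" by (simp add: field_simps)
  finally have "1 / real (Suc b) <= ln (real (Suc b) / real a) - ln (real b / real a)"
   using b by (simp add: ln_div)
  thus ?case using step by (simp add: sum.atLeastLessThan_Suc)
 qed
 moreover have "(\<Sum>k\<in>{a..<b}. 1 / real k) <= (\<Sum>k\<in>{a..<Suc b}. 1 / real k)" by (intro sum_mono2) auto
 ultimately show ?thesis by simp
qed

lemma sum_inverse_sqrt_le: "1 <= a ==> (\<Sum>k\<in>{a..<b}. 1 / (real k * sqrt (real k))) <= 4 / sqrt (real a)"
proof (cases "a <= b")
 case True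
 assume a: "1 <= a"
 \<comment> \<open>A telescoping majorant. The difference of \<open>1 / sqrt\<close> is about half
   of the summand, and the constant 4 leaves room for crude estimates valid from
   \<open>k = 1\<close> on.\<close>
 have step: "1 / (real k * sqrt (real k)) <= 4 / sqrt (real k) - 4 / sqrt (real (Suc k))" if k: "1 <= k" for k
 proof -
  define u v where "u = sqrt (real k)" and "v = sqrt (real (Suc k))"
  have u: "u >= 1" "u * u = real k" "v * v = u * u + 1" using k by (auto simp: u_def v_def)
  have vu: "u <= v" "v > 0" by (auto simp: u_def v_def)
  have "v * v <= (3 / 2 * u) * (3 / 2 * u)" using u mult_mono[OF u(1) u(1)] by simp
  hence v: "v <= 3 / 2 * u" using u(1) by (intro power2_le_imp_le[of v]) (auto simp: power2_eq_square)
  have "(v - u) * (v + u) = 1" using u by (simp add: algebra_simps)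
  moreover have "(v - u) * (v + u) <= (v - u) * (5 / 2 * u)" using v vu by (intro mult_left_mono) auto
  ultimately have "1 <= (v - u) * (5 / 2 * u)" by simp
  hence "v <= (v - u) * (5 / 2 * u) * v" using vu mult_right_mono[of 1 "(v - u) * (5 / 2 * u)" v] by simp
  also have "... <= (v - u) * (5 / 2 * u) * (3 / 2 * u)" using v vu u by (intro mult_left_mono) auto
  also have "... = 15 / 4 * ((v - u) * (u * u))" by (simp add: mult_ac)
  also have "... <= 4 * ((v - u) * (u * u))" using vu u(1) by (intro mult_right_mono) auto
  also have "... = 4 * (v - u) * (u * u)" by (simp add: mult_ac)
  finally have "v / (u * u * u * v) <= 4 * (v - u) * (u * u) / (u * u * u * v)" using u vu by (intro divide_right_mono) auto
  also have "v / (u * u * u * v) = 1 / (u * u * u)" using u vu by simp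
  also have "4 * (v - u) * (u * u) / (u * u * u * v) = 4 / u - 4 / v"
  proof -
   have "u ~= 0" "v ~= 0" using u(1) vu by auto
   thus ?thesis by (simp add: field_simps)
  qed
  finally show ?thesis unfolding u(2) unfolding u_def v_def .
 qed
 have "(\<Sum>k\<in>{a..<b}. 1 / (real k * sqrt (real k))) <= (\<Sum>k\<in>{a..<b}. 4 / sqrt (real k) - 4 / sqrt (real (Suc k)))"
  using a step by (intro sum_mono) auto
 also have "... = 4 / sqrt (real a) - 4 / sqrt (real b)"
  using sum_Suc_diff'[OF True, of "%k. - 4 / sqrt (real k)"] by simp
 finally show ?thesis by (simp add: order_trans)
qed simp

section \<open>Logarithmic averages over geometric blocks\<close>

context lipschitz_test
begin

text \<open>For \<open>k\<close> much larger than \<open>n\<close> the first \<open>n\<close> steps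
  contribute little to \<open>S k / sqrt k\<close>, by the first moment bound. Dropping them
  replaces \<open>bt k\<close> by the function of the adjacent block of length \<open>k - n\<close>,
  to which mixing applies.\<close>

lemma covariance_decay:
 assumes ka: "ka > 0"
 shows "\<exists>n1\<ge>1. \<exists>R\<ge>2. \<forall>n\<ge>n1. \<forall>k\<ge>R * n. \<bar>expectation (%x. bt n x * bt k x)\<bar> <= ka"
proof -
 obtain A where A: "A > 0" "\<And>n. expectation (%x. \<bar>S n x\<bar>) <= A * sqrt (real n)" using first_moment by blast
 obtain n0 where n0: "\<And>a b. a >= n0 ==> b >= n0 ==> \<bar>expectation (%x. bt a x * bt b (ta a x))\<bar> <= ka / 2"
  using mixing[of "ka / 2"] ka by auto
 \<comment> \<open>Dropping \<open>S n\<close> and renormalising by \<open>sqrt (k - n)\<close> each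
   cost at most \<open>L * A / sqrt R\<close> in mean.\<close>
 obtain R :: nat where R: "(4 * L * A / ka)\<^sup>2 + 2 <= real R" using real_arch_simple by blast
 have R2: "R >= 2" using R zero_le_power2[of "4 * L * A / ka"] by linarith
 have "(4 * L * A / ka)\<^sup>2 <= real R" using R by linarith
 hence "4 * L * A / ka <= sqrt (real R)" by (rule real_le_rsqrt)
 hence Rka: "L * A * (1 / sqrt (real R) + 1 / sqrt (real R)) <= ka / 2" using ka R2 by (simp add: field_simps)
 have "\<bar>expectation (%x. bt n x * bt k x)\<bar> <= ka" if n: "n >= max n0 1" and k: "k >= R * n" for n k
 proof -
  define d where "d = k - n"
  have "2 * n <= R * n" using R2 by simp
  hence "2 * n <= k" using k by linarith
  hence d: "k = n + d" "d >= n" "d >= n0" "n >= 1" "d >= 1" "k >= 1" using k n by (auto simp: d_def)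
  define rh where "rh = 1 / sqrt (real d) - 1 / sqrt (real k)"
  have rh: "rh >= 0" using d by (simp add: rh_def frac_le)
  define e where "e = (%x. L * (\<bar>S n x\<bar> / sqrt (real k) + \<bar>S d (ta n x)\<bar> * rh))"
  have iSd: "integrable M (%x. \<bar>S d (ta n x)\<bar>)"
   using S_bound[OF ta_space] by (intro integrable_bounded[of _ "B * real d"]) auto
  have mSd: "expectation (%x. \<bar>S d (ta n x)\<bar>) = expectation (%x. \<bar>S d x\<bar>)" by (rule integral_ta) measurable
  have ie: "integrable M e" unfolding e_def using integrable_S'(1) iSd by auto
  have "expectation e = L * (expectation (%x. \<bar>S n x\<bar>) / sqrt (real k) + expectation (%x. \<bar>S d x\<bar>) * rh)"
   unfolding e_def using integrable_S'(1) iSd mSd by simp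
  also have "... <= L * (A * sqrt (real n) / sqrt (real k) + A * sqrt (real d) * rh)"
   using A rh L_nonneg by (intro mult_left_mono add_mono divide_right_mono mult_right_mono) auto
  also have "... = L * A * (sqrt (real n / real k) + (1 - sqrt (real d / real k)))"
   using d by (simp add: rh_def real_sqrt_divide field_simps)
  also have "... <= L * A * (1 / sqrt (real R) + 1 / sqrt (real R))"
  proof (intro mult_left_mono add_mono)
   have "real (R * n) <= real k" using k by (simp only: of_nat_le_iff)
   hence nk: "real n / real k <= 1 / real R" using d R2 by (simp add: field_simps)
   have "sqrt (real n / real k) <= sqrt (1 / real R)" using nk by simp
   thus "sqrt (real n / real k) <= 1 / sqrt (real R)" by (simp add: real_sqrt_divide)
   have dk: "real d / real k = 1 - real n / real k" using d by (simp add: field_simps)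
   have "real d / real k <= 1" using d by simp
   hence "(real d / real k)\<^sup>2 <= real d / real k" unfolding power2_eq_square by (rule mult_left_le) simp
   hence "real d / real k <= sqrt (real d / real k)" by (rule real_le_rsqrt)
   moreover have "1 / real R <= 1 / sqrt (real R)" using R2 by (intro frac_le) (auto intro: real_le_lsqrt simp: power2_eq_square)
   ultimately show "1 - sqrt (real d / real k) <= 1 / sqrt (real R)" using dk nk by linarith
  qed (use L_nonneg A in auto)
  also have "... <= ka / 2" by (rule Rka)
  finally have Ee: "expectation e <= ka / 2" .
  have bb: "\<bar>bt k x - bt d (ta n x)\<bar> <= e x" if x: "x \<in> space M" for x
  proof -
   have "\<bar>bt k x - bt d (ta n x)\<bar> <= L * \<bar>S k x / sqrt (real k) - S d (ta n x) / sqrt (real d)\<bar>"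
    unfolding bt_def using g_lip by simp
   also have "S k x / sqrt (real k) - S d (ta n x) / sqrt (real d) = S n x / sqrt (real k) - S d (ta n x) * rh"
    unfolding d(1) S_add[OF x] by (simp add: rh_def d(1) add_divide_distrib algebra_simps)
   also have "L * \<bar>S n x / sqrt (real k) - S d (ta n x) * rh\<bar> <= e x"
    unfolding e_def using rh L_nonneg by (intro mult_left_mono order_trans[OF abs_triangle_ineq4]) (auto simp: abs_mult)
   finally show ?thesis .
  qed
  have i1: "integrable M (%x. bt n x * bt k x)"
   using bt_le_1 by (intro integrable_bounded[of _ 1] abs_mult_le_1) auto
  have i2: "integrable M (%x. bt n x * bt d (ta n x))"
   using bt_le_1 by (intro integrable_bounded[of _ 1] abs_mult_le_1) auto
  have "\<bar>expectation (%x. bt n x * bt k x) - expectation (%x. bt n x * bt d (ta n x))\<bar> =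
    \<bar>expectation (%x. bt n x * bt k x - bt n x * bt d (ta n x))\<bar>" using i1 i2 by simp
  also have "... <= expectation e"
  proof (intro order_trans[OF integral_abs_bound] integral_mono)
   fix x assume x: "x \<in> space M"
   have "\<bar>bt n x * bt k x - bt n x * bt d (ta n x)\<bar> = \<bar>bt n x\<bar> * \<bar>bt k x - bt d (ta n x)\<bar>"
    by (simp add: abs_mult[symmetric] right_diff_distrib)
   also have "... <= 1 * e x" using bt_le_1 bb[OF x] by (intro mult_mono) auto
   finally show "\<bar>bt n x * bt k x - bt n x * bt d (ta n x)\<bar> <= e x" by simp
  qed (use i1 i2 ie in auto)
  also note Ee
  finally have "\<bar>expectation (%x. bt n x * bt k x) - expectation (%x. bt n x * bt d (ta n x))\<bar> <= ka / 2" .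
  moreover have "\<bar>expectation (%x. bt n x * bt d (ta n x))\<bar> <= ka / 2" using n d by (intro n0) auto
  ultimately show ?thesis by linarith
 qed
 thus ?thesis using R2 by (intro exI[of _ "max n0 1"] conjI exI[of _ R]) auto
qed

text \<open>In logarithmic measure, for each \<open>n\<close> the indices \<open>k\<close> between
  \<open>n / R\<close> and \<open>R * n\<close> have mass at most \<open>1 + 2 * ln R\<close>, and
  there the covariance is bounded by 1; for all other pairs it is at most \<open>ka\<close>.\<close>

lemma second_moment:
 assumes ka: "ka > 0"
 shows "\<exists>n1\<ge>1. \<exists>D\<ge>0. \<forall>p q. n1 <= p --> p <= q --> expectation (%x. (\<Sum>n\<in>{p..<q}. bt n x / real n)\<^sup>2)
  <= (\<Sum>n\<in>{p..<q}. 1 / real n) * (ka * (\<Sum>n\<in>{p..<q}. 1 / real n) + D)"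
proof -
 obtain n1 R where n1: "n1 >= 1" "R >= 2" "\<And>n k. n >= n1 ==> k >= R * n ==> \<bar>expectation (%x. bt n x * bt k x)\<bar> <= ka"
  using covariance_decay[OF ka] by blast
 have "expectation (%x. (\<Sum>n\<in>{p..<q}. bt n x / real n)\<^sup>2)
  <= (\<Sum>n\<in>{p..<q}. 1 / real n) * (ka * (\<Sum>n\<in>{p..<q}. 1 / real n) + (1 + 2 * ln (real R)))" if p: "n1 <= p" "p <= q" for p q
 proof -
  let ?I = "{p..<q}"
  have i: "integrable M (%x. bt n x * bt k x)" for n k
   using bt_le_1 by (intro integrable_bounded[of _ 1] abs_mult_le_1) auto
  have sq: "(\<Sum>n\<in>?I. bt n x / real n)\<^sup>2 = (\<Sum>n\<in>?I. \<Sum>k\<in>?I. bt n x * bt k x / (real n * real k))" for x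
   by (simp add: power2_eq_square sum_product)
  have cov1: "\<bar>expectation (%x. bt n x * bt k x)\<bar> <= 1" for n k
  proof -
   have "\<bar>expectation (%x. bt n x * bt k x)\<bar> <= expectation (%x. 1)"
    using i bt_le_1 by (intro order_trans[OF integral_abs_bound] integral_mono abs_mult_le_1) auto
   thus ?thesis by (simp add: prob_space)
  qed
  have cov: "expectation (%x. bt n x * bt k x) <= ka + (if n < R * k \<and> k < R * n then 1 else 0)" if "n \<in> ?I" "k \<in> ?I" for n k
   using n1(3)[of n k] n1(3)[of k n] cov1[of n k] that p ka by (auto simp: mult.commute not_less abs_le_iff)
  have near: "(\<Sum>k\<in>?I. (if n < R * k \<and> k < R * n then 1 else 0) / real k) <= 1 + 2 * ln (real R)" if n: "n \<in> ?I" for n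
  proof -
   define a where "a = n div R + 1"
   have n0: "n >= 1" using n p n1(1) by auto
   have aR: "n < R * a" using n1(2) by (simp add: a_def dividend_less_times_div)
   have a_le: "a <= R * n" using n0 n1(2) div_le_dividend[of n R] mult_le_mono1[OF n1(2), of n] unfolding a_def by linarith
   have "(\<Sum>k\<in>?I. (if n < R * k \<and> k < R * n then 1 else 0) / real k) = (\<Sum>k\<in>{k\<in>?I. n < R * k \<and> k < R * n}. 1 / real k)"
    by (subst sum.inter_filter) (auto intro!: sum.cong)
   also have "... <= (\<Sum>k\<in>{a..<R * n}. 1 / real k)"
   proof (intro sum_mono2)
    show "{k \<in> ?I. n < R * k \<and> k < R * n} \<subseteq> {a..<R * n}"
    proof safe
     fix k assume k: "n < R * k" "k < R * n"
     have "n div R < k" using k(1) n1(2) by (simp add: div_less_iff_less_mult mult.commute)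
     thus "k \<in> {a..<R * n}" using k(2) by (simp add: a_def)
    qed
   qed auto
   also have "... <= 1 / real a + ln (real (R * n) / real a)" using a_le by (intro sum_inverse_le) (auto simp: a_def)
   also have "... <= 1 + ln (real R * real R)"
   proof (intro add_mono)
    show "1 / real a <= 1" by (simp add: a_def)
    have "real n <= real R * real a" using aR by (metis less_imp_le of_nat_le_iff of_nat_mult)
    hence "real R * real n <= real R * (real R * real a)" by (intro mult_left_mono) auto
    hence "real (R * n) / real a <= real R * real R" by (simp add: a_def divide_le_eq algebra_simps)
    moreover have "0 < real (R * n) / real a" using n0 n1(2) by (simp add: a_def)
    ultimately show "ln (real (R * n) / real a) <= ln (real R * real R)" using n1(2) by (intro ln_mono) auto
   qed
   also have "... = 1 + 2 * ln (real R)" using n1(2) by (simp add: ln_mult)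
   finally show ?thesis .
  qed
  have "expectation (%x. (\<Sum>n\<in>?I. bt n x / real n)\<^sup>2) = (\<Sum>n\<in>?I. \<Sum>k\<in>?I. expectation (%x. bt n x * bt k x) / (real n * real k))"
   unfolding sq using i by simp
  also have "... <= (\<Sum>n\<in>?I. \<Sum>k\<in>?I. (ka + (if n < R * k \<and> k < R * n then 1 else 0)) / (real n * real k))"
   using cov by (intro sum_mono divide_right_mono) auto
  also have "... = (\<Sum>n\<in>?I. 1 / real n * (ka * (\<Sum>k\<in>?I. 1 / real k) + (\<Sum>k\<in>?I. (if n < R * k \<and> k < R * n then 1 else 0) / real k)))"
  proof -
   have "(\<Sum>k\<in>?I. (ka + f k) / (t * real k)) = 1 / t * (ka * (\<Sum>k\<in>?I. 1 / real k) + (\<Sum>k\<in>?I. f k / real k))" for f t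
    by (simp add: sum_distrib_left sum.distrib add_divide_distrib distrib_left)
   thus ?thesis by simp
  qed
  also have "... <= (\<Sum>n\<in>?I. 1 / real n * (ka * (\<Sum>k\<in>?I. 1 / real k) + (1 + 2 * ln (real R))))"
   using near by (intro sum_mono mult_left_mono add_left_mono) auto
  also have "... = (\<Sum>n\<in>?I. 1 / real n) * (ka * (\<Sum>n\<in>?I. 1 / real n) + (1 + 2 * ln (real R)))"
   by (simp add: sum_distrib_right)
  finally show ?thesis .
 qed
 moreover have "0 <= 1 + 2 * ln (real R)" using n1(2) by simp
 ultimately show ?thesis using n1(1) by blast
qed

text \<open>The part of the block average that the block itself can see: at \<open>ta p x\<close> it
  depends on the orbit from time \<open>p\<close> on, so it is nearly a function of the label of one
  block and quasi-independence applies.\<close>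

definition local_sum :: "nat => nat => 'a => real" where
 "local_sum p q y = (\<Sum>n\<in>{p..<q}. (g (S (n - p) y / sqrt (real n)) - mu) / real n)"

lemma measurable_local_sum [measurable]: "local_sum p q \<in> borel_measurable M"
 unfolding local_sum_def by measurable

lemma local_sum_error:
 assumes x: "x \<in> space M"
 shows "\<bar>(\<Sum>n\<in>{p..<q}. bt n x / real n) - local_sum p q (ta p x)\<bar> <= (\<Sum>n\<in>{p..<q}. min 1 (L * \<bar>S p x\<bar> / sqrt (real n)) / real n)"
proof -
 have "\<bar>(\<Sum>n\<in>{p..<q}. bt n x / real n) - local_sum p q (ta p x)\<bar> =
   \<bar>\<Sum>n\<in>{p..<q}. (g (S n x / sqrt (real n)) - g (S (n - p) (ta p x) / sqrt (real n))) / real n\<bar>"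
  by (simp add: local_sum_def bt_def sum_subtractf[symmetric] diff_divide_distrib[symmetric])
 also have "... <= (\<Sum>n\<in>{p..<q}. min 1 (L * \<bar>S p x\<bar> / sqrt (real n)) / real n)"
 proof (intro order_trans[OF sum_abs] sum_mono)
  fix n assume n: "n \<in> {p..<q}"
  let ?D = "g (S n x / sqrt (real n)) - g (S (n - p) (ta p x) / sqrt (real n))"
  have "\<bar>?D\<bar> <= 1" using g_range[of "S n x / sqrt (real n)"] g_range[of "S (n - p) (ta p x) / sqrt (real n)"] by (simp add: abs_le_iff)
  moreover have "\<bar>?D\<bar> <= L * \<bar>S p x\<bar> / sqrt (real n)"
  proof -
   have "S n x - S (n - p) (ta p x) = S p x" using S_add[OF x, of p "n - p"] n by simp
   thus ?thesis using g_lip[of "S n x / sqrt (real n)" "S (n - p) (ta p x) / sqrt (real n)"]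
    by (simp add: diff_divide_distrib[symmetric])
  qed
  ultimately have "\<bar>?D\<bar> <= min 1 (L * \<bar>S p x\<bar> / sqrt (real n))" by simp
  thus "\<bar>?D / real n\<bar> <= min 1 (L * \<bar>S p x\<bar> / sqrt (real n)) / real n" by (simp add: divide_right_mono)
 qed
 finally show ?thesis .
qed

lemma local_sum_cell:
 assumes "x \<in> space M" "y \<in> space M" "cell (q - p) x = cell (q - p) y" and p: "1 <= p"
 shows "\<bar>local_sum p q x - local_sum p q y\<bar> <= 4 * L * c"
proof -
 have "\<bar>local_sum p q x - local_sum p q y\<bar> = \<bar>\<Sum>n\<in>{p..<q}. (g (S (n - p) x / sqrt (real n)) - g (S (n - p) y / sqrt (real n))) / real n\<bar>"
  by (simp add: local_sum_def sum_subtractf[symmetric] diff_divide_distrib[symmetric])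
 also have "... <= (\<Sum>n\<in>{p..<q}. L * c * (1 / (real n * sqrt (real n))))"
 proof (intro order_trans[OF sum_abs] sum_mono)
  fix n assume n: "n \<in> {p..<q}"
  let ?D = "g (S (n - p) x / sqrt (real n)) - g (S (n - p) y / sqrt (real n))"
  have "\<bar>?D\<bar> <= L * \<bar>S (n - p) x / sqrt (real n) - S (n - p) y / sqrt (real n)\<bar>" by (rule g_lip)
  also have "... = L * (\<bar>S (n - p) x - S (n - p) y\<bar> / sqrt (real n))" by (simp add: diff_divide_distrib[symmetric])
  also have "... <= L * (c / sqrt (real n))"
   using cell_S[OF assms(1-3)] n L_nonneg by (intro mult_left_mono divide_right_mono) auto
  finally have "\<bar>?D\<bar> / real n <= L * (c / sqrt (real n)) / real n" by (rule divide_right_mono) simp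
  thus "\<bar>?D / real n\<bar> <= L * c * (1 / (real n * sqrt (real n)))" by (simp add: mult_ac)
 qed
 also have "... = L * c * (\<Sum>n\<in>{p..<q}. 1 / (real n * sqrt (real n)))" by (simp add: sum_distrib_left)
 also have "... <= L * c * (4 / sqrt (real p))"
  using L_nonneg c_nonneg sum_inverse_sqrt_le[OF p] by (intro mult_left_mono) auto
 also have "... <= L * c * 4" using L_nonneg c_nonneg p by (intro mult_left_mono) (auto simp: divide_le_eq)
 finally show ?thesis by simp
qed

lemma local_sum_bound: "1 <= p ==> p <= q ==> \<bar>local_sum p q y\<bar> <= 1 + ln (real q / real p)"
proof -
 assume p: "1 <= p" "p <= q"
 have "\<bar>local_sum p q y\<bar> <= (\<Sum>n\<in>{p..<q}. 1 / real n)"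
  unfolding local_sum_def
 proof (intro order_trans[OF sum_abs] sum_mono)
  fix n
  have "\<bar>g (S (n - p) y / sqrt (real n)) - mu\<bar> <= 1" using g_range[of "S (n - p) y / sqrt (real n)"] mu by (simp add: abs_le_iff)
  thus "\<bar>(g (S (n - p) y / sqrt (real n)) - mu) / real n\<bar> <= 1 / real n"
   by (simp add: divide_right_mono)
 qed
 also have "... <= 1 / real p + ln (real q / real p)" by (rule sum_inverse_le[OF p])
 also have "1 / real p <= 1" using p by simp
 finally show ?thesis by simp
qed

end

lemma sum_consecutive_blocks:
 assumes a: "mono (a :: nat => nat)" and ij: "i <= J"
 shows "(\<Sum>j\<in>{i..<J}. \<Sum>n\<in>{a j..<a (Suc j)}. f n) = (\<Sum>n\<in>{a i..<a J}. f n)"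
 using ij
proof (induction J rule: dec_induct)
 case base
 thus ?case by simp
next
 case (step J)
 have "a i <= a J" "a J <= a (Suc J)" using a step by (auto intro: monoD)
 thus ?case using step by (simp add: sum.atLeastLessThan_concat)
qed

text \<open>Telescoping against \<open>4 * ln (1 + y / sqrt (real n))\<close>. The point is the
  logarithm: terms with \<open>sqrt n\<close> below \<open>y\<close> cost \<open>1 / n\<close> each
  and later ones decay, so an exponential moment of the error becomes a first moment of
  \<open>1 + y / sqrt p\<close>.\<close>

lemma sum_min_le:
 assumes y: "0 <= y" and p: "1 <= p"
 shows "(\<Sum>n\<in>{p..<q}. min 1 (y / sqrt (real n)) / real n) <= 1 + 4 * ln (1 + y / sqrt (real p))"
proof (cases "p < q")
 case True
 define \<phi> where "\<phi> = (%n. 4 * ln (1 + y / sqrt (real n)))"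
 have step: "min 1 (y / sqrt (real (Suc n))) / real (Suc n) <= \<phi> n - \<phi> (Suc n)" if n: "n >= 1" for n
 proof -
  define u v where "u = sqrt (real n)" and "v = sqrt (real (Suc n))"
  have uv: "u >= 1" "u <= v" "v * v = real (Suc n)" "v * v = u * u + 1" using n by (auto simp: u_def v_def)
  have v1: "v >= 1" using uv by linarith
  have "(v - u) * (v + u) = 1" using uv by (simp add: algebra_simps)
  moreover have "(v - u) * (v + u) <= (v - u) * (2 * v)" using uv by (intro mult_left_mono) auto
  ultimately have vu: "1 <= 2 * v * (v - u)" by (simp add: mult_ac)
  define t where "t = (u * (v + y)) / (v * (u + y))"
  have t: "t > 0" using uv v1 y by (simp add: t_def)
  have nz: "u ~= 0" "v ~= 0" "u + y ~= 0" "v + y ~= 0" using uv(1) v1 y by auto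
  have "1 + y / u = (u + y) / u" "1 + y / v = (v + y) / v" using nz by (auto simp: add_divide_distrib)
  hence ratio: "1 + y / u = (1 + y / v) / t" using nz by (simp add: t_def)
  have pos: "1 + y / v > 0" using v1 y by (simp add: add_pos_nonneg)
  have "ln (1 + y / u) = ln (1 + y / v) - ln t" unfolding ratio using pos t by (simp add: ln_div)
  moreover have "ln t <= t - 1" using t by (rule ln_le_minus_one)
  ultimately have 1: "4 * (1 - t) <= \<phi> n - \<phi> (Suc n)" unfolding \<phi>_def u_def[symmetric] v_def[symmetric] by argo
  have t1: "1 - t = y * (v - u) / (v * (u + y))"
  proof -
   have "1 - t = (v * (u + y) - u * (v + y)) / (v * (u + y))" using nz by (simp add: t_def diff_divide_distrib)
   also have "v * (u + y) - u * (v + y) = y * (v - u)" by (simp add: algebra_simps)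
   finally show ?thesis .
  qed
  have "min 1 (y / v) / (v * v) <= 4 * (1 - t)"
  proof -
   have "min 1 (y / v) * (v + y) <= 2 * y"
   proof (cases "y <= v")
    case True
    have "y / v * (v + y) = y + y * (y / v)" using v1 by (simp add: field_simps)
    also have "... <= y + y * 1" using True y v1 by (intro add_left_mono mult_left_mono) auto
    finally show ?thesis using True v1 by (simp add: min_def)
   next
    case False
    thus ?thesis using v1 by (simp add: min_def divide_le_eq)
   qed
   hence "min 1 (y / v) * (u + y) <= 2 * y"
    using uv(2) v1 y mult_left_mono[of "u + y" "v + y" "min 1 (y / v)"] by simp
   also have "... <= 2 * y * (2 * v * (v - u))" using vu y mult_left_mono[of 1 "2 * v * (v - u)" "2 * y"] by simp
   finally have "min 1 (y / v) * (u + y) / (v * v * (u + y)) <= 2 * y * (2 * v * (v - u)) / (v * v * (u + y))"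
    using uv v1 y by (intro divide_right_mono) auto
   moreover have "min 1 (y / v) * (u + y) / (v * v * (u + y)) = min 1 (y / v) / (v * v)" using uv y by simp
   moreover have "2 * y * (2 * v * (v - u)) / (v * v * (u + y)) = 4 * (1 - t)" unfolding t1 using v1 by simp
   ultimately show ?thesis by simp
  qed
  with 1 have "min 1 (y / v) / (v * v) <= \<phi> n - \<phi> (Suc n)" by linarith
  thus ?thesis unfolding uv(3) unfolding v_def .
 qed
 have "(\<Sum>n\<in>{p..<q}. min 1 (y / sqrt (real n)) / real n) =
   min 1 (y / sqrt (real p)) / real p + (\<Sum>n\<in>{Suc p..<q}. min 1 (y / sqrt (real n)) / real n)"
  using True by (rule sum.atLeast_Suc_lessThan)
 also have "(\<Sum>n\<in>{Suc p..<q}. min 1 (y / sqrt (real n)) / real n) = (\<Sum>n\<in>{p..<q - 1}. min 1 (y / sqrt (real (Suc n))) / real (Suc n))"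
  using True by (subst sum.shift_bounds_Suc_ivl[symmetric]) simp
 also have "... <= (\<Sum>n\<in>{p..<q - 1}. \<phi> n - \<phi> (Suc n))" using p step by (intro sum_mono) auto
 also have "... = \<phi> p - \<phi> (q - 1)"
  using True sum_Suc_diff'[of p "q - 1" "%n. - \<phi> n"] by simp
 also have "... <= \<phi> p" using y by (simp add: \<phi>_def)
 also have "min 1 (y / sqrt (real p)) / real p <= 1" using p y by (simp add: divide_le_eq)
 finally show ?thesis by (simp add: \<phi>_def)
qed (use y in auto)

text \<open>Markov's inequality at the level \<open>(2 * rh) ^ J\<close> leaves the probabilities
  \<open>(1 / 2) ^ J\<close>, which are summable.\<close>

lemma (in prob_space) AE_eventually_le_power:
 fixes Y :: "nat => 'a => real"
 assumes Y: "\<And>J. integrable M (Y J)" "\<And>J x. x \<in> space M ==> 0 <= Y J x"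
  and E: "\<And>J. expectation (Y J) <= rh ^ J" and rh: "rh > 0"
 shows "AE x in M. \<forall>\<^sub>F J in sequentially. Y J x <= (2 * rh) ^ J"
proof -
 let ?A = "%J. {x \<in> space M. (2 * rh) ^ J <= Y J x}"
 have [measurable]: "Y J \<in> borel_measurable M" for J using Y(1) by auto
 have pr: "prob (?A J) <= (1 / 2) ^ J" for J
 proof -
  have "prob (?A J) <= expectation (Y J) / (2 * rh) ^ J"
   using Y rh by (intro integral_Markov_inequality_measure[where A = "{}"]) auto
  also have "... <= rh ^ J / (2 * rh) ^ J" using rh by (intro divide_right_mono E) auto
  also have "... = (1 / 2) ^ J" using rh by (simp add: power_divide power_mult_distrib)
  finally show ?thesis .
 qed
 have "summable (%J. prob (?A J))"
  by (rule summable_comparison_test'[OF summable_geometric[of "1 / 2 :: real"], of 0]) (use pr in auto)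
 hence "AE x in M. \<forall>\<^sub>F J in sequentially. x \<in> space M - ?A J"
  by (intro borel_cantelli_AE1) (auto simp: emeasure_eq_measure)
 thus ?thesis by eventually_elim (auto elim: eventually_mono)
qed

text \<open>Exponential growth of products, at a rate including \<open>K\<close>, is what
  quasi-independence can give; its logarithm is an almost sure linear bound for sums over
  blocks.\<close>

lemma (in quasi_independent) AE_product_growth:
 assumes a: "mono a" and H: "\<And>j. H j \<in> borel_measurable M" "\<And>j x. x \<in> space M ==> 1 <= H j x"
   "\<And>j x. x \<in> space M ==> H j x <= b j"
  and le: "\<And>j x y. x \<in> space M ==> y \<in> space M ==>
   cell (a (Suc j) - a j) x = cell (a (Suc j) - a j) y ==> H j x <= H' j y"
  and H': "\<And>j. integrable M (H' j)" "\<And>j. expectation (H' j) <= rh"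
 shows "AE x in M. \<forall>\<^sub>F J in sequentially. (\<Sum>j<J. ln (H j (ta (a j) x))) <= real J * ln (2 * (K * rh))"
proof -
 let ?Y = "%J x. \<Prod>j<J. H j (ta (a j) x)"
 have H1: "1 <= H' j x" if "x \<in> space M" for j x using H(2)[OF that, of j] le[OF that that refl, of j] by linarith
 hence "expectation (%x. 1) <= expectation (H' 0)" by (intro integral_mono H') auto
 hence rh: "1 <= rh" using H'(2)[of 0] by (simp add: prob_space)
 hence Krh: "1 <= K * rh" using mult_mono[of 1 K 1 rh] K1 by simp
 have Y1: "1 <= ?Y J x" if "x \<in> space M" for J x using H(2) ta_space[OF that] by (intro prod_ge_1) auto
 have Y0: "0 <= ?Y J x" if "x \<in> space M" for J x using Y1[OF that, of J] by linarith
 have "AE x in M. \<forall>\<^sub>F J in sequentially. ?Y J x <= (2 * (K * rh)) ^ J"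
 proof (rule AE_eventually_le_power)
  show "integrable M (?Y J)" for J
  proof (rule integrable_bounded)
   show "?Y J \<in> borel_measurable M" using measurable_compose[OF measurable_ta H(1)] by measurable
   fix x assume x: "x \<in> space M"
   have "?Y J x <= (\<Prod>j<J. b j)" using H(2,3) ta_space[OF x] by (intro prod_mono) (auto intro: order_trans[OF zero_le_one])
   thus "\<bar>?Y J x\<bar> <= (\<Prod>j<J. b j)" using Y0[OF x, of J] by simp
  qed
  show "expectation (?Y J) <= (K * rh) ^ J" for J
  proof -
   have "expectation (?Y J) <= K ^ J * (\<Prod>j<J. expectation (H' j))"
    by (rule product_bound[OF a]) (use H(2) le H' in \<open>auto intro: order_trans[OF zero_le_one]\<close>)
   also have "... <= K ^ J * (\<Prod>j<J. rh)"
   proof (intro mult_left_mono prod_mono conjI H')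
    show "0 <= expectation (H' j)" for j
     using H1 by (intro integral_nonneg_AE AE_I2) (auto intro: order_trans[OF zero_le_one])
   qed (use K1 in simp)
   finally show ?thesis by (simp add: power_mult_distrib)
  qed
 qed (use Y0 Krh in auto)
 with AE_space show ?thesis
 proof eventually_elim
  case (elim x)
  show ?case using elim(2)
  proof eventually_elim
   case (elim J)
   have "H j (ta (a j) x) > 0" for j using H(2)[OF ta_space[OF \<open>x \<in> space M\<close>]] by (rule less_le_trans[OF zero_less_one])
   hence "(\<Sum>j<J. ln (H j (ta (a j) x))) = ln (?Y J x)" by (intro ln_prod[symmetric]) (auto simp: less_imp_neq[symmetric])
   also have "... <= ln ((2 * (K * rh)) ^ J)"
    using elim Y1[OF \<open>x \<in> space M\<close>, of J] by (intro ln_mono) auto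
   also have "... = real J * ln (2 * (K * rh))" using Krh by (intro ln_realpow)
   finally show ?case .
  qed
 qed
qed

context lipschitz_test
begin

lemma ln_large: "\<exists>Q0. \<forall>Q\<ge>Q0. X <= ln (real Q)"
proof -
 obtain Q0 :: nat where Q0: "exp X <= real Q0" using real_arch_simple by blast
 have "X <= ln (real Q)" if "Q >= Q0" for Q
 proof -
  have "exp X <= real Q" using Q0 that of_nat_mono[OF that, where 'a = real] by linarith
  moreover from this have "0 < real Q" using exp_gt_zero[of X] by linarith
  ultimately show ?thesis by (simp add: ln_ge_iff)
 qed
 thus ?thesis by blast
qed

text \<open>By invariance the local sum may be evaluated at \<open>ta p x\<close>, where it differs
  from the true block average by an error of bounded mean. Chebyshev's inequality handles the
  average and Markov's the error; both are negligible against \<open>ln Q\<close>, uniformly in the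
  position \<open>j\<close>.\<close>

lemma block_small:
 assumes de: "de > 0" and et: "et > 0"
 shows "\<exists>Q0\<ge>2. \<forall>Q\<ge>Q0. \<forall>j. prob {y \<in> space M. de * ln (real Q) < \<bar>local_sum (Q ^ Suc j) (Q ^ Suc (Suc j)) y\<bar>} <= et"
proof -
 obtain A where A: "A > 0" "\<And>n. expectation (%x. \<bar>S n x\<bar>) <= A * sqrt (real n)" using first_moment by blast
 \<comment> \<open>The budget \<open>et\<close> is split into thirds: the covariance
   \<open>ka\<close>, the near-diagonal constant \<open>D\<close>, and the influence of the
   past.\<close>
 define ka where "ka = et * de\<^sup>2 / 48"
 have ka: "ka > 0" using de et by (simp add: ka_def)
 obtain n1 D where n1: "n1 >= 1" "D >= 0" "\<And>p q. n1 <= p ==> p <= q ==> expectation (%x. (\<Sum>n\<in>{p..<q}. bt n x / real n)\<^sup>2)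
  <= (\<Sum>n\<in>{p..<q}. 1 / real n) * (ka * (\<Sum>n\<in>{p..<q}. 1 / real n) + D)" using second_moment[OF ka] by blast
 obtain Q0 where Q0: "\<And>Q. Q >= Q0 ==> 1 + 24 * D / (et * de\<^sup>2) + 24 * L * A / (de * et) <= ln (real Q)" using ln_large by blast
 have "prob {y \<in> space M. de * ln (real Q) < \<bar>local_sum (Q ^ Suc j) (Q ^ Suc (Suc j)) y\<bar>} <= et"
  if Q: "Q >= max 2 (max n1 Q0)" for Q j
 proof -
  define l where "l = ln (real Q)"
  have pos: "0 <= 24 * D / (et * de\<^sup>2)" "0 <= 24 * L * A / (de * et)" using n1(2) et de L_nonneg A(1) by auto
  have l: "1 <= l" "24 * D / (et * de\<^sup>2) <= l" "24 * L * A / (de * et) <= l" using Q0[of Q] Q pos unfolding l_def by auto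
  define p where "p = Q ^ Suc j"
  define q where "q = Q ^ Suc (Suc j)"
  have Q1: "1 <= Q" using Q by simp
  have "Q ^ 1 <= Q ^ Suc j" using Q1 by (intro power_increasing) auto
  hence "Q <= p" by (simp only: p_def power_one_right)
  hence p: "n1 <= p" "1 <= p" using Q by auto
  have pq: "p <= q" using Q1 by (simp add: p_def q_def)
  have qp: "real q / real p = real Q" using Q1 by (simp add: p_def q_def)
  define h where "h = (\<Sum>n\<in>{p..<q}. 1 / real n)"
  have h: "0 <= h" "h <= 2 * l"
  proof -
   show "0 <= h" by (simp add: h_def sum_nonneg)
   have "h <= 1 / real p + l" unfolding h_def l_def qp[symmetric] by (rule sum_inverse_le[OF p(2) pq])
   moreover have "1 / real p <= 1" using p by simp
   ultimately show "h <= 2 * l" using l(1) by linarith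
  qed
  let ?W = "%x. \<Sum>n\<in>{p..<q}. bt n x / real n"
  let ?e = "%x. \<Sum>n\<in>{p..<q}. min 1 (L * \<bar>S p x\<bar> / sqrt (real n)) / real n"
  let ?BL = "{y \<in> space M. de * l < \<bar>local_sum p q y\<bar>}"
  let ?BW = "{x \<in> space M. (de * l / 2)\<^sup>2 <= (?W x)\<^sup>2}"
  let ?BE = "{x \<in> space M. de * l / 2 <= ?e x}"
  have dl: "de * l / 2 > 0" using de l(1) by simp
  have "prob ?BL = prob {x \<in> space M. ta p x \<in> ?BL}" by (rule prob_ta[symmetric]) measurable
  also have "... <= prob (?BW \<union> ?BE)"
  proof (rule finite_measure_mono)
   show "{x \<in> space M. ta p x \<in> ?BL} \<subseteq> ?BW \<union> ?BE"
   proof safe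
    fix x assume x: "x \<in> space M" and b: "de * l < \<bar>local_sum p q (ta p x)\<bar>" and ne: "\<not> de * l / 2 <= ?e x"
    have "\<bar>?W x - local_sum p q (ta p x)\<bar> <= ?e x" by (rule local_sum_error[OF x])
    hence "\<bar>de * l / 2\<bar> <= \<bar>?W x\<bar>" using b ne dl by linarith
    thus "(de * l / 2)\<^sup>2 <= (?W x)\<^sup>2" by (simp only: abs_le_square_iff)
   qed
  qed measurable
  also have "... <= prob ?BW + prob ?BE" by (rule measure_Un_le) measurable
  also have "prob ?BW <= 2 * et / 3"
  proof -
   have "integrable M (%x. (?W x)\<^sup>2)"
   proof (rule integrable_bounded)
    fix x
    have "\<bar>?W x\<bar> <= h" unfolding h_def by (intro order_trans[OF sum_abs] sum_mono) (simp add: bt_le_1 divide_right_mono)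
    hence "\<bar>?W x\<bar>\<^sup>2 <= h\<^sup>2" by (intro power_mono) auto
    thus "\<bar>(?W x)\<^sup>2\<bar> <= h\<^sup>2" by simp
   qed measurable
   hence "prob ?BW <= expectation (%x. (?W x)\<^sup>2) / (de * l / 2)\<^sup>2"
    using dl by (intro integral_Markov_inequality_measure[where A = "{}"]) auto
   also have "... <= (2 * l) * (ka * (2 * l) + D) / (de * l / 2)\<^sup>2"
   proof (rule divide_right_mono)
    have "expectation (%x. (?W x)\<^sup>2) <= h * (ka * h + D)" unfolding h_def by (rule n1(3)[OF p(1) pq])
    also have "... <= (2 * l) * (ka * (2 * l) + D)" using h l(1) ka n1(2) by (intro mult_mono add_right_mono mult_left_mono) auto
    finally show "expectation (%x. (?W x)\<^sup>2) <= (2 * l) * (ka * (2 * l) + D)" .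
   qed simp
   also have "... = 16 * ka / de\<^sup>2 + 8 * D / (de\<^sup>2 * l)"
    using de l(1) by (simp add: field_simps power2_eq_square)
   also have "16 * ka / de\<^sup>2 = et / 3" using de by (simp add: ka_def)
   also have "8 * D / (de\<^sup>2 * l) <= et / 3" using l de et by (simp add: field_simps)
   finally show ?thesis by simp
  qed
  also have "prob ?BE <= et / 3"
  proof -
   have e_le: "0 <= ?e x" "?e x <= L * \<bar>S p x\<bar> * (4 / sqrt (real p))" for x
   proof -
    show "0 <= ?e x" using L_nonneg by (intro sum_nonneg) auto
    have "?e x <= (\<Sum>n\<in>{p..<q}. L * \<bar>S p x\<bar> * (1 / (real n * sqrt (real n))))"
    proof (rule sum_mono)
     fix n
     have "min 1 (L * \<bar>S p x\<bar> / sqrt (real n)) / real n <= L * \<bar>S p x\<bar> / sqrt (real n) / real n" by (intro divide_right_mono) auto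
     thus "min 1 (L * \<bar>S p x\<bar> / sqrt (real n)) / real n <= L * \<bar>S p x\<bar> * (1 / (real n * sqrt (real n)))" by (simp add: mult_ac)
    qed
    also have "... = L * \<bar>S p x\<bar> * (\<Sum>n\<in>{p..<q}. 1 / (real n * sqrt (real n)))" by (simp add: sum_distrib_left)
    also have "... <= L * \<bar>S p x\<bar> * (4 / sqrt (real p))" using L_nonneg sum_inverse_sqrt_le[OF p(2)] by (intro mult_left_mono) auto
    finally show "?e x <= L * \<bar>S p x\<bar> * (4 / sqrt (real p))" .
   qed
   have iR: "integrable M (%x. L * \<bar>S p x\<bar> * (4 / sqrt (real p)))" using integrable_S'(1) by simp
   have ie: "integrable M ?e"
   proof (rule Bochner_Integration.integrable_bound[OF iR])
    have "\<bar>?e x\<bar> <= \<bar>L * \<bar>S p x\<bar> * (4 / sqrt (real p))\<bar>" for x using e_le[of x] by linarith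
    thus "AE x in M. norm (?e x) <= norm (L * \<bar>S p x\<bar> * (4 / sqrt (real p)))" by (simp only: real_norm_def) simp
   qed measurable
   have "prob ?BE <= expectation ?e / (de * l / 2)"
    using ie dl e_le by (intro integral_Markov_inequality_measure[where A = "{}"]) auto
   also have "... <= (4 * L * A) / (de * l / 2)"
   proof (rule divide_right_mono)
    have "expectation ?e <= expectation (%x. L * \<bar>S p x\<bar> * (4 / sqrt (real p)))" using ie iR e_le by (intro integral_mono) auto
    also have "... = L * expectation (%x. \<bar>S p x\<bar>) * (4 / sqrt (real p))" using integrable_S'(1)[of p] by simp
    also have "... <= L * (A * sqrt (real p)) * (4 / sqrt (real p))"
     using A(2)[of p] L_nonneg by (intro mult_right_mono mult_left_mono) auto
    also have "... = 4 * L * A" using p by simp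
    finally show "expectation ?e <= 4 * L * A" .
   qed (use dl in simp)
   also have "... <= et / 3" using l de et by (simp add: field_simps)
   finally show ?thesis .
  qed
  finally show ?thesis by (simp add: p_def q_def l_def)
 qed
 thus ?thesis by (intro exI[of _ "max 2 (max n1 Q0)"]) auto
qed

text \<open>A Chernoff bound with weight \<open>exp al\<close> on each bad block. For large
  \<open>Q\<close> bad blocks are so rare that this weight has mean at most 2; the resulting growth
  rate \<open>4 * K\<close> per block is matched by \<open>al = ln (4 * K) / de\<close>.\<close>

lemma bad_blocks:
 assumes de: "de > 0"
 shows "\<exists>Q0\<ge>2. \<forall>Q\<ge>Q0. AE x in M. \<forall>\<^sub>F J in sequentially.
  real (card {j. j < J \<and> de * ln (real Q) < \<bar>local_sum (Q ^ Suc j) (Q ^ Suc (Suc j)) (ta (Q ^ Suc j) x)\<bar>}) <= de * real J"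
proof -
 define al where "al = ln (4 * K) / de"
 have al: "al > 0" using K1 de by (simp add: al_def)
 obtain Q1 where Q1: "Q1 >= 2" "\<And>Q j. Q >= Q1 ==> prob {y \<in> space M. de / 2 * ln (real Q) < \<bar>local_sum (Q ^ Suc j) (Q ^ Suc (Suc j)) y\<bar>} <= exp (- al)"
  using block_small[of "de / 2" "exp (- al)"] de by auto
 obtain Q2 where Q2: "\<And>Q. Q >= Q2 ==> 8 * L * c / de <= ln (real Q)" using ln_large by blast
 have "AE x in M. \<forall>\<^sub>F J in sequentially.
  real (card {j. j < J \<and> de * ln (real Q) < \<bar>local_sum (Q ^ Suc j) (Q ^ Suc (Suc j)) (ta (Q ^ Suc j) x)\<bar>}) <= de * real J"
  if Q: "Q >= max Q1 Q2" for Q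
 proof -
  define l where "l = ln (real Q)"
  have Q1': "1 <= Q" using Q Q1(1) by simp
  have gap: "de / 2 * l + 4 * L * c <= de * l" using Q2[of Q] Q de by (simp add: l_def field_simps)
  define a where "a = (%j. Q ^ Suc j)"
  have a: "mono a" unfolding a_def using Q1' by (intro monoI power_increasing) auto
  let ?l = "%j. local_sum (a j) (a (Suc j))"
  define H where "H = (%j y. if de * l < \<bar>?l j y\<bar> then exp al else 1)"
  \<comment> \<open>The lower threshold absorbs the variation \<open>4 * L * c\<close> of the local
    sum within a cell.\<close>
  define H' where "H' = (%j y. if de / 2 * l < \<bar>?l j y\<bar> then exp al else 1)"
  have mH: "H j \<in> borel_measurable M" "H' j \<in> borel_measurable M" for j unfolding H_def H'_def by measurable
  have iH': "integrable M (H' j)" for j by (rule integrable_bounded[of _ "exp al"]) (use mH al in \<open>auto simp: H'_def\<close>)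
  have EH': "expectation (H' j) <= 2" for j
  proof -
   let ?P = "{y \<in> space M. de / 2 * l < \<bar>?l j y\<bar>}"
   have P: "?P \<in> sets M" by measurable
   have iP: "integrable M (indicator ?P :: 'a => real)" using P by (simp add: integrable_indicator_iff emeasure_eq_measure)
   have "expectation (H' j) <= expectation (%y. 1 + exp al * indicator ?P y)"
    using iH' iP by (intro integral_mono) (auto simp: H'_def)
   also have "... = 1 + exp al * prob ?P" using iP P by (simp add: prob_space)
   also have "... <= 1 + exp al * exp (- al)" using Q1(2)[of Q j] Q by (simp add: a_def l_def)
   also have "... = 2" by (simp add: exp_minus)
   finally show ?thesis .
  qed
  have "AE x in M. \<forall>\<^sub>F J in sequentially. (\<Sum>j<J. ln (H j (ta (a j) x))) <= real J * ln (2 * (K * 2))"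
  proof (rule AE_product_growth[OF a mH(1) _ _ _ iH' EH', where b = "%_. exp al"])
   fix j x y assume xy: "x \<in> space M" "y \<in> space M" "cell (a (Suc j) - a j) x = cell (a (Suc j) - a j) y"
   have "1 <= a j" using Q1' by (simp add: a_def)
   from local_sum_cell[OF xy this] have "\<bar>?l j x - ?l j y\<bar> <= 4 * L * c" .
   hence "de * l < \<bar>?l j x\<bar> ==> de / 2 * l < \<bar>?l j y\<bar>" using gap by linarith
   thus "H j x <= H' j y" using al by (auto simp: H_def H'_def)
  qed (use al in \<open>auto simp: H_def\<close>)
  thus ?thesis
  proof eventually_elim
   case (elim x)
   thus ?case
   proof eventually_elim
    case (elim J)
    let ?b = "{j. j < J \<and> de * l < \<bar>?l j (ta (a j) x)\<bar>}"
    have "(\<Sum>j<J. ln (H j (ta (a j) x))) = (\<Sum>j\<in>{..<J}. if j \<in> ?b then al else 0)" unfolding H_def by (intro sum.cong) auto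
    also have "... = (\<Sum>j\<in>?b. al)" by (subst sum.inter_filter[symmetric]) (auto intro: sum.cong)
    finally have "real (card ?b) * al <= real J * ln (4 * K)" using elim by (simp add: mult_ac)
    also have "... = de * real J * al" using de by (simp add: al_def)
    finally have "real (card ?b) <= de * real J" using al by simp
    thus ?case by (simp add: a_def l_def)
   qed
  qed
 qed
 thus ?thesis using Q1(1) by (intro exI[of _ "max Q1 Q2"]) auto
qed

end

lemma ln_le_sum_inverse: "1 <= N ==> ln (real N) <= (\<Sum>n\<in>{1..<N}. 1 / real n)"
proof (induction N rule: dec_induct)
 case (step N)
 have "ln (real (Suc N)) - ln (real N) = ln (real (Suc N) / real N)" using step by (simp add: ln_div)
 also have "... <= real (Suc N) / real N - 1" using step by (intro ln_le_minus_one) simp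
 also have "... = 1 / real N" using step by (simp add: field_simps)
 finally show ?case using step by (simp add: sum.atLeastLessThan_Suc)
qed simp

lemma harmonic_log_limit: "(%N. (\<Sum>n\<in>{1..<N}. 1 / real n) / ln (real N)) \<longlonglongrightarrow> 1"
proof (rule tendsto_sandwich)
 have ev: "\<forall>\<^sub>F N in sequentially. 2 <= N" by (rule eventually_ge_at_top)
 show "\<forall>\<^sub>F N in sequentially. 1 <= (\<Sum>n\<in>{1..<N}. 1 / real n) / ln (real N)"
  using ev by eventually_elim (use ln_le_sum_inverse in \<open>auto simp: pos_le_divide_eq\<close>)
 show "\<forall>\<^sub>F N in sequentially. (\<Sum>n\<in>{1..<N}. 1 / real n) / ln (real N) <= (1 + ln (real N)) / ln (real N)"
  using ev
 proof eventually_elim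
  case (elim N)
  thus ?case using sum_inverse_le[of 1 N] by (intro divide_right_mono) auto
 qed
 show "(%N. (1 + ln (real N)) / ln (real N)) \<longlonglongrightarrow> 1" by real_asymp
qed simp

context lipschitz_test
begin

definition block_error :: "nat => nat => 'a => real" where
 "block_error p q x = (\<Sum>n\<in>{p..<q}. min 1 (L * \<bar>S p x\<bar> / sqrt (real n)) / real n)"

lemma min_add_le: "0 <= u ==> 0 <= v ==> min 1 (u + v) <= min 1 u + min 1 (v::real)"
 by (simp add: min_def)

lemma sum_triangle_swap:
 fixes f :: "nat => nat => real"
 shows "(\<Sum>j<J. \<Sum>i<j. f i j) = (\<Sum>i<J. \<Sum>j\<in>{Suc i..<J}. f i j)"
proof (induction J)
 case (Suc J)
 have "(\<Sum>i<Suc J. \<Sum>j\<in>{Suc i..<Suc J}. f i j) = (\<Sum>i<J. \<Sum>j\<in>{Suc i..<Suc J}. f i j)" by simp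
 also have "... = (\<Sum>i<J. (\<Sum>j\<in>{Suc i..<J}. f i j) + f i J)" by (intro sum.cong) (auto simp: sum.atLeastLessThan_Suc)
 also have "... = (\<Sum>j<Suc J. \<Sum>i<j. f i j)" by (simp add: sum.distrib Suc)
 finally show ?case by simp
qed simp

text \<open>
 Replacing \<open>S\<^sub>n\<close> by the part coming from its own block costs only a logarithm of the normalised
 previous block sums, and products of \<open>1 + L D\<^sub>i\<close> have at most exponential growth by
 quasi-independence.
\<close>

lemma error_bound:
 "\<exists>E>0. \<forall>Q\<ge>2. AE x in M. \<forall>\<^sub>F J in sequentially.
  (\<Sum>j<J. block_error (Q ^ Suc j) (Q ^ Suc (Suc j)) x) <= 4 * L * B * real Q + E * real J"
proof -
 obtain A where A: "A > 0" "\<And>n. expectation (%x. \<bar>S n x\<bar>) <= A * sqrt (real n)" using first_moment by blast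
 define rh where "rh = 1 + L * (A + c)"
 have rh: "rh >= 1" using A(1) L_nonneg c_nonneg by (simp add: rh_def)
 \<comment> \<open>It matters that \<open>E\<close> does not depend on \<open>Q\<close>: it is a
   price per block, to be compared with the logarithmic length \<open>ln Q\<close> of a block. The
   term with \<open>Q\<close> occurs once and not per block.\<close>
 define E where "E = 1 + 4 * ln (2 * (K * rh))"
 have Krh: "1 <= K * rh" using mult_mono[of 1 K 1 rh] K1 rh by simp
 hence E: "E > 0" by (simp add: E_def add_pos_nonneg)
 have "AE x in M. \<forall>\<^sub>F J in sequentially.
  (\<Sum>j<J. block_error (Q ^ Suc j) (Q ^ Suc (Suc j)) x) <= 4 * L * B * real Q + E * real J" if Q: "Q >= 2" for Q
 proof -
  define a where "a = (%j. Q ^ Suc j)"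
  have Q1: "1 <= Q" using Q by simp
  have a: "mono a" unfolding a_def using Q1 by (intro monoI power_increasing) auto
  have a1: "1 <= a j" for j using Q1 by (simp add: a_def)
  have aa: "a j <= a (Suc j)" for j using a by (simp add: monoD)
  let ?l = "%j. a (Suc j) - a j"
  \<comment> \<open>Block \<open>i\<close> influences later times, which are at least
    \<open>a (Suc i)\<close>, so its sum is normalised by the end of the block.\<close>
  define r where "r = (%j. sqrt (real (a (Suc j))))"
  have r: "r j >= 1" for j using a1[of "Suc j"] by (simp add: r_def)
  define H where "H = (%j y. 1 + L * \<bar>S (?l j) y\<bar> / r j)"
  define H' where "H' = (%j y. 1 + L * (\<bar>S (?l j) y\<bar> + c) / r j)"
  have H1: "1 <= H j y" for j y using L_nonneg r[of j] by (simp add: H_def)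
  have iH': "integrable M (H' j)" for j unfolding H'_def using integrable_S'(1) by simp
  have EH': "expectation (H' j) <= rh" for j
  proof -
   have "expectation (H' j) = 1 + L * (expectation (%x. \<bar>S (?l j) x\<bar>) + c) / r j"
    unfolding H'_def using integrable_S'(1) by (simp add: prob_space)
   also have "... <= 1 + L * (A * r j + c * r j) / r j"
   proof (intro add_left_mono divide_right_mono mult_left_mono add_mono)
    have "A * sqrt (real (?l j)) <= A * r j" unfolding r_def using A(1) by (intro mult_left_mono) auto
    thus "expectation (%x. \<bar>S (?l j) x\<bar>) <= A * r j" using A(2)[of "?l j"] by linarith
    show "c <= c * r j" using c_nonneg mult_left_mono[OF r[of j] c_nonneg] by simp
   qed (use L_nonneg r[of j] in auto)
   also have "... = rh" using r[of j] by (simp add: rh_def distrib_right[symmetric])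
   finally show ?thesis .
  qed
  have "AE x in M. \<forall>\<^sub>F J in sequentially. (\<Sum>j<J. ln (H j (ta (a j) x))) <= real J * ln (2 * (K * rh))"
  proof (rule AE_product_growth[OF a _ H1 _ _ iH' EH', where b = "%j. 1 + L * (B * real (?l j)) / r j"])
   show "H j \<in> borel_measurable M" for j unfolding H_def by measurable
   show "H j x <= 1 + L * (B * real (?l j)) / r j" if x: "x \<in> space M" for j x
    unfolding H_def using S_bound[OF x, of "?l j"] L_nonneg r[of j]
    by (intro add_left_mono divide_right_mono mult_left_mono) auto
   fix j x y assume xy: "x \<in> space M" "y \<in> space M" "cell (?l j) x = cell (?l j) y"
   have "\<bar>S (?l j) x\<bar> <= \<bar>S (?l j) y\<bar> + c" using cell_S[OF xy le_refl] by linarith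
   thus "H j x <= H' j y" unfolding H_def H'_def using L_nonneg r[of j]
    by (intro add_left_mono divide_right_mono mult_left_mono) auto
  qed
  with AE_space have "AE x in M. x \<in> space M \<and> (\<forall>\<^sub>F J in sequentially. (\<Sum>j<J. ln (H j (ta (a j) x))) <= real J * ln (2 * (K * rh)))"
   by eventually_elim auto
  thus ?thesis
  proof eventually_elim
   case (elim x)
   hence x: "x \<in> space M" and ev: "\<forall>\<^sub>F J in sequentially. (\<Sum>j<J. ln (H j (ta (a j) x))) <= real J * ln (2 * (K * rh))" by auto
   define y where "y = (%i. L * \<bar>S (?l i) (ta (a i) x)\<bar>)"
   define y0 where "y0 = L * \<bar>S Q x\<bar>"
   have y: "0 <= y i" "0 <= y0" for i using L_nonneg by (auto simp: y_def y0_def)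
   have S_le: "L * \<bar>S (a j) x\<bar> <= y0 + (\<Sum>i<j. y i)" for j
   proof (induction j)
    case 0
    thus ?case by (simp add: a_def y0_def)
   next
    case (Suc j)
    have "S (a (Suc j)) x = S (a j) x + S (?l j) (ta (a j) x)" using S_add[OF x, of "a j" "?l j"] aa[of j] by simp
    hence "\<bar>S (a (Suc j)) x\<bar> <= \<bar>S (a j) x\<bar> + \<bar>S (?l j) (ta (a j) x)\<bar>" by linarith
    hence "L * \<bar>S (a (Suc j)) x\<bar> <= L * (\<bar>S (a j) x\<bar> + \<bar>S (?l j) (ta (a j) x)\<bar>)" using L_nonneg by (rule mult_left_mono)
    thus ?case using Suc by (simp add: y_def distrib_left)
   qed
   \<comment> \<open>Subadditivity of \<open>min 1\<close> separates the influences of the earlier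
     blocks; the initial stretch \<open>y0\<close> enters linearly.\<close>
   have min_sum: "min 1 ((y0 + (\<Sum>i<j. y i)) / s) <= y0 / s + (\<Sum>i<j. min 1 (y i / s))" if s: "s > 0" for j s
   proof (induction j)
    case 0
    thus ?case by simp
   next
    case (Suc j)
    have "min 1 ((y0 + (\<Sum>i<Suc j. y i)) / s) = min 1 ((y0 + (\<Sum>i<j. y i)) / s + y j / s)"
     by (simp add: add_divide_distrib add.assoc)
    also have "... <= min 1 ((y0 + (\<Sum>i<j. y i)) / s) + min 1 (y j / s)"
     using y s by (intro min_add_le) (auto intro!: divide_nonneg_pos add_nonneg_nonneg sum_nonneg)
    finally show ?case using Suc by simp
   qed
   let ?B = "%j. {a j..<a (Suc j)}"
   have err: "block_error (a j) (a (Suc j)) x <= (\<Sum>n\<in>?B j. y0 / (real n * sqrt (real n))) + (\<Sum>i<j. \<Sum>n\<in>?B j. min 1 (y i / sqrt (real n)) / real n)" for j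
   proof -
    have "block_error (a j) (a (Suc j)) x <= (\<Sum>n\<in>?B j. (y0 / sqrt (real n) + (\<Sum>i<j. min 1 (y i / sqrt (real n)))) / real n)"
     unfolding block_error_def
    proof (intro sum_mono divide_right_mono)
     fix n assume "n \<in> ?B j"
     hence n: "sqrt (real n) > 0" using a1[of j] by simp
     have "min 1 (L * \<bar>S (a j) x\<bar> / sqrt (real n)) <= min 1 ((y0 + (\<Sum>i<j. y i)) / sqrt (real n))"
      using S_le[of j] n by (intro min.mono divide_right_mono) auto
     also have "... <= y0 / sqrt (real n) + (\<Sum>i<j. min 1 (y i / sqrt (real n)))" by (rule min_sum[OF n])
     finally show "min 1 (L * \<bar>S (a j) x\<bar> / sqrt (real n)) <= y0 / sqrt (real n) + (\<Sum>i<j. min 1 (y i / sqrt (real n)))" .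
    qed simp
    also have "... = (\<Sum>n\<in>?B j. y0 / (real n * sqrt (real n))) + (\<Sum>n\<in>?B j. \<Sum>i<j. min 1 (y i / sqrt (real n)) / real n)"
     by (simp add: add_divide_distrib sum.distrib sum_divide_distrib mult.commute)
    also have "(\<Sum>n\<in>?B j. \<Sum>i<j. min 1 (y i / sqrt (real n)) / real n) = (\<Sum>i<j. \<Sum>n\<in>?B j. min 1 (y i / sqrt (real n)) / real n)"
     by (rule sum.swap)
    finally show ?thesis .
   qed
   show ?case using ev
   proof eventually_elim
    case (elim J)
    have "(\<Sum>j<J. block_error (a j) (a (Suc j)) x) \<le>
      (\<Sum>j<J. \<Sum>n\<in>?B j. y0 / (real n * sqrt (real n))) + (\<Sum>j<J. \<Sum>i<j. \<Sum>n\<in>?B j. min 1 (y i / sqrt (real n)) / real n)"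
     unfolding sum.distrib[symmetric] by (intro sum_mono err)
    also have "(\<Sum>j<J. \<Sum>n\<in>?B j. y0 / (real n * sqrt (real n))) <= 4 * L * B * real Q"
    proof -
     have "(\<Sum>j<J. \<Sum>n\<in>?B j. y0 / (real n * sqrt (real n))) = (\<Sum>n\<in>{a 0..<a J}. y0 / (real n * sqrt (real n)))"
      using sum_consecutive_blocks[OF a, of 0 J "%n. y0 / (real n * sqrt (real n))"] by (simp add: atLeast0LessThan)
     also have "... = y0 * (\<Sum>n\<in>{a 0..<a J}. 1 / (real n * sqrt (real n)))" by (simp add: sum_distrib_left)
     also have "... <= y0 * (4 / sqrt (real (a 0)))" using y(2) by (intro mult_left_mono sum_inverse_sqrt_le a1) auto
     also have "... <= y0 * 4" using y(2) a1[of 0] by (intro mult_left_mono) (auto simp: divide_le_eq)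
     also have "... <= (L * (B * real Q)) * 4" unfolding y0_def using S_bound[OF x] L_nonneg by (intro mult_right_mono mult_left_mono) auto
     finally show ?thesis by simp
    qed
    \<comment> \<open>After exchanging the sums, the influence of block \<open>i\<close> on all
      later times is one sum to which \<open>sum_min_le\<close> applies.\<close>
    also have "(\<Sum>j<J. \<Sum>i<j. \<Sum>n\<in>?B j. min 1 (y i / sqrt (real n)) / real n) =
      (\<Sum>i<J. \<Sum>j\<in>{Suc i..<J}. \<Sum>n\<in>?B j. min 1 (y i / sqrt (real n)) / real n)" by (rule sum_triangle_swap)
    also have "... = (\<Sum>i<J. \<Sum>n\<in>{a (Suc i)..<a J}. min 1 (y i / sqrt (real n)) / real n)"
     by (intro sum.cong refl sum_consecutive_blocks[OF a]) auto
    also have "... <= (\<Sum>i<J. 1 + 4 * ln (H i (ta (a i) x)))"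
    proof (rule sum_mono)
     fix i
     show "(\<Sum>n\<in>{a (Suc i)..<a J}. min 1 (y i / sqrt (real n)) / real n) <= 1 + 4 * ln (H i (ta (a i) x))"
      using sum_min_le[OF y(1) a1, of i "Suc i" "a J"] by (simp add: H_def y_def r_def)
    qed
    also have "... <= real J + 4 * (real J * ln (2 * (K * rh)))" using elim by (simp add: sum.distrib sum_distrib_left[symmetric])
    finally show ?case by (simp add: a_def E_def algebra_simps)
   qed
  qed
 qed
 thus ?thesis using E by (intro exI[of _ E]) auto
qed

text \<open>Of the five shares of \<open>de\<close>, one comes from the good blocks, two from the
  bad ones, where the trivial bound \<open>1 + ln Q\<close> is used, one from the error
  \<open>E\<close>, and one absorbs the incomplete pieces at both ends and the constants.\<close>

lemma log_average_le:
 assumes de: "0 < de" "de <= 1"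
 shows "AE x in M. \<forall>\<^sub>F N in sequentially. \<bar>\<Sum>n\<in>{1..<N}. bt n x / real n\<bar> <= 5 * de * ln (real N)"
proof -
 obtain Q1 where Q1: "Q1 >= 2" "\<And>Q. Q >= Q1 ==> AE x in M. \<forall>\<^sub>F J in sequentially.
  real (card {j. j < J \<and> de * ln (real Q) < \<bar>local_sum (Q ^ Suc j) (Q ^ Suc (Suc j)) (ta (Q ^ Suc j) x)\<bar>}) <= de * real J"
  using bad_blocks[OF de(1)] by blast
 obtain E where E: "E > 0" "\<And>Q. Q >= 2 ==> AE x in M. \<forall>\<^sub>F J in sequentially.
  (\<Sum>j<J. block_error (Q ^ Suc j) (Q ^ Suc (Suc j)) x) <= 4 * L * B * real Q + E * real J" using error_bound by blast
 obtain Q2 where Q2: "\<And>Q. Q >= Q2 ==> 1 + E / de <= ln (real Q)" using ln_large by blast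
 define Q where "Q = max Q1 Q2"
 have Q: "2 <= Q" "1 <= Q" "Q1 <= Q" using Q1(1) by (auto simp: Q_def)
 define l where "l = ln (real Q)"
 have "0 <= E / de" using E(1) de by simp
 hence l: "1 <= l" "E / de <= l" using Q2[of Q] by (auto simp: l_def Q_def)
 have El: "E <= de * l" using l(2) de(1) by (simp add: pos_divide_le_eq mult.commute)
 define a where "a = (%j. Q ^ Suc j)"
 have a: "mono a" unfolding a_def using Q by (intro monoI power_increasing) auto
 have a1: "1 <= a j" for j using Q by (simp add: a_def)
 have aa: "a j <= a (Suc j)" for j using a by (simp add: monoD)
 have aQ: "real (a (Suc j)) / real (a j) = real Q" for j using Q by (simp add: a_def)
 define R where "R = 2 + 2 * l + 4 * L * B * real Q"
 have "AE x in M. x \<in> space M \<and>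
  (\<forall>\<^sub>F J in sequentially. real (card {j. j < J \<and> de * l < \<bar>local_sum (a j) (a (Suc j)) (ta (a j) x)\<bar>}) <= de * real J) \<and>
  (\<forall>\<^sub>F J in sequentially. (\<Sum>j<J. block_error (a j) (a (Suc j)) x) <= 4 * L * B * real Q + E * real J)"
  using AE_space Q1(2)[OF Q(3)] E(2)[OF Q(1)] by eventually_elim (auto simp: a_def l_def)
 thus ?thesis
 proof eventually_elim
  case (elim x)
  hence x: "x \<in> space M"
   and ev1: "\<forall>\<^sub>F J in sequentially. real (card {j. j < J \<and> de * l < \<bar>local_sum (a j) (a (Suc j)) (ta (a j) x)\<bar>}) <= de * real J"
   and ev2: "\<forall>\<^sub>F J in sequentially. (\<Sum>j<J. block_error (a j) (a (Suc j)) x) <= 4 * L * B * real Q + E * real J" by auto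
  have "\<forall>\<^sub>F J in sequentially. \<bar>\<Sum>n\<in>{a 0..<a J}. bt n x / real n\<bar> <= 4 * de * l * real J + 4 * L * B * real Q"
   using ev1 ev2
  proof eventually_elim
   case (elim J)
   let ?W = "%j. \<Sum>n\<in>{a j..<a (Suc j)}. bt n x / real n"
   let ?l = "%j. local_sum (a j) (a (Suc j)) (ta (a j) x)"
   let ?b = "{j. j < J \<and> de * l < \<bar>?l j\<bar>}"
   have l_le: "\<bar>?l j\<bar> <= de * l + (if j \<in> ?b then 2 * l else 0)" if j: "j < J" for j
   proof (cases "j \<in> ?b")
    case True
    have "\<bar>?l j\<bar> <= 1 + ln (real (a (Suc j)) / real (a j))" by (rule local_sum_bound[OF a1 aa])
    hence "\<bar>?l j\<bar> <= 1 + l" unfolding aQ by (simp add: l_def)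
    moreover have "0 <= de * l" using de l by simp
    ultimately show ?thesis using True l(1) by simp
   qed (use j in auto)
   have "\<bar>\<Sum>n\<in>{a 0..<a J}. bt n x / real n\<bar> = \<bar>\<Sum>j<J. ?W j\<bar>"
    using sum_consecutive_blocks[OF a, of 0 J "%n. bt n x / real n"] by (simp add: atLeast0LessThan)
   also have "... <= (\<Sum>j<J. \<bar>?l j\<bar> + block_error (a j) (a (Suc j)) x)"
   proof (rule order_trans[OF sum_abs], rule sum_mono)
    fix j
    show "\<bar>?W j\<bar> <= \<bar>?l j\<bar> + block_error (a j) (a (Suc j)) x"
     using local_sum_error[OF x, of "a j" "a (Suc j)"] unfolding block_error_def by linarith
   qed
   also have "... = (\<Sum>j<J. \<bar>?l j\<bar>) + (\<Sum>j<J. block_error (a j) (a (Suc j)) x)" by (rule sum.distrib)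
   also have "(\<Sum>j<J. \<bar>?l j\<bar>) <= (\<Sum>j<J. de * l + (if j \<in> ?b then 2 * l else 0))" using l_le by (intro sum_mono) auto
   also have "... = real J * (de * l) + real (card ?b) * (2 * l)"
   proof -
    have "(\<Sum>j<J. if j \<in> ?b then 2 * l else 0) = (\<Sum>j\<in>?b. 2 * l)"
     by (subst sum.inter_filter[symmetric]) (auto intro: sum.cong)
    thus ?thesis by (simp add: sum.distrib)
   qed
   also have "real (card ?b) * (2 * l) <= de * real J * (2 * l)" using elim(1) l(1) by (intro mult_right_mono) auto
   also have "(\<Sum>j<J. block_error (a j) (a (Suc j)) x) <= 4 * L * B * real Q + de * l * real J"
    using elim(2) mult_right_mono[OF El, of "real J"] by linarith
   finally show ?case by (simp add: algebra_simps)
  qed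
  then obtain J0 where J0: "\<And>J. J >= J0 ==> \<bar>\<Sum>n\<in>{a 0..<a J}. bt n x / real n\<bar> <= 4 * de * l * real J + 4 * L * B * real Q"
   unfolding eventually_sequentially by blast
  obtain N0 where N0: "\<And>N. N >= N0 ==> R / de <= ln (real N)" using ln_large by blast
  have piece: "\<bar>\<Sum>n\<in>{p..<q}. bt n x / real n\<bar> <= 1 + ln (real q / real p)" if "1 <= p" "p <= q" for p q
  proof -
   have "\<bar>\<Sum>n\<in>{p..<q}. bt n x / real n\<bar> <= (\<Sum>n\<in>{p..<q}. 1 / real n)"
    by (intro order_trans[OF sum_abs] sum_mono) (simp add: bt_le_1 divide_right_mono)
   also have "... <= 1 / real p + ln (real q / real p)" by (rule sum_inverse_le[OF that])
   also have "1 / real p <= 1" using that by simp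
   finally show ?thesis by simp
  qed
  show ?case
   unfolding eventually_sequentially
  proof (intro exI[of _ "max N0 (a (Suc J0))"] allI impI)
   fix N assume N: "max N0 (a (Suc J0)) <= N"
   hence N1: "1 <= N" using a1[of "Suc J0"] by linarith
   \<comment> \<open>\<open>N\<close> lies in the block with number \<open>J = k - 1\<close>,
     because \<open>a J = Q ^ Suc J\<close>.\<close>
   obtain k where k: "Q ^ k <= N" "N < Q ^ (k + 1)" using ex_power_ivl1[OF Q(1) N1] by blast
   have lt: "Q ^ Suc (Suc J0) < Q ^ (k + 1)" using N k(2) unfolding a_def by linarith
   have "1 < Q" using Q(1) by simp
   from power_less_imp_less_exp[OF this lt] have "Suc (Suc J0) < k + 1" .
   then obtain J where J: "k = Suc J" "J0 <= J" by (cases k) auto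
   have kJ: "a J <= N" "N <= a (Suc J)" using k J by (auto simp: a_def)
   have a0J: "a 0 <= a J" using a by (simp add: monoD)
   have "(\<Sum>n\<in>{1..<N}. bt n x / real n) = (\<Sum>n\<in>{1..<a 0}. bt n x / real n) + (\<Sum>n\<in>{a 0..<a J}. bt n x / real n) + (\<Sum>n\<in>{a J..<N}. bt n x / real n)"
    using a1[of 0] a0J kJ by (simp add: sum.atLeastLessThan_concat)
   moreover have "\<bar>\<Sum>n\<in>{1..<a 0}. bt n x / real n\<bar> <= 1 + l" using piece[OF le_refl a1[of 0]] by (simp add: a_def l_def)
   moreover have "\<bar>\<Sum>n\<in>{a J..<N}. bt n x / real n\<bar> <= 1 + l"
   proof -
    have "real N / real (a J) <= real (a (Suc J)) / real (a J)" using kJ(2) by (intro divide_right_mono) auto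
    hence "real N / real (a J) <= real Q" unfolding aQ .
    moreover have "0 < real N / real (a J)" using N1 a1[of J] by simp
    ultimately have "ln (real N / real (a J)) <= l" unfolding l_def using Q by (intro ln_mono) auto
    thus ?thesis using piece[OF a1 kJ(1)] by linarith
   qed
   moreover have "\<bar>\<Sum>n\<in>{a 0..<a J}. bt n x / real n\<bar> <= 4 * de * l * real J + 4 * L * B * real Q" by (rule J0[OF J(2)])
   ultimately have le: "\<bar>\<Sum>n\<in>{1..<N}. bt n x / real n\<bar> <= 4 * de * (l * real J) + R" unfolding R_def by linarith
   have "l * real J <= real (Suc J) * l" using l(1) by (simp add: algebra_simps)
   also have "... = ln (real (Q ^ Suc J))" unfolding l_def of_nat_power using Q by (subst ln_realpow) auto
   also have "... <= ln (real N)" using k(1) J(1) Q N1 by (intro ln_mono) (auto simp del: of_nat_power power_Suc)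
   finally have "4 * de * (l * real J) <= 4 * de * ln (real N)" using de(1) by (intro mult_left_mono) auto
   moreover have "R <= de * ln (real N)" using N0[of N] N de(1) by (simp add: pos_divide_le_eq mult.commute)
   ultimately show "\<bar>\<Sum>n\<in>{1..<N}. bt n x / real n\<bar> <= 5 * de * ln (real N)" using le by (simp add: algebra_simps)
  qed
 qed
qed

lemma sum_bt_limit: "AE x in M. (%N. (\<Sum>n\<in>{1..<N}. bt n x / real n) / ln (real N)) \<longlonglongrightarrow> 0"
proof -
 have "AE x in M. \<forall>k. \<forall>\<^sub>F N in sequentially. \<bar>\<Sum>n\<in>{1..<N}. bt n x / real n\<bar> <= 5 * (1 / real (Suc k)) * ln (real N)"
  unfolding AE_all_countable by (intro allI log_average_le) auto
 thus ?thesis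
 proof eventually_elim
  case (elim x)
  show ?case
  proof (rule LIMSEQ_I)
   fix e :: real assume e: "e > 0"
   obtain k where k: "5 / e < real k" using reals_Archimedean2 by blast
   have "5 * (1 / real (Suc k)) < e"
   proof -
    have "5 < real k * e" using k e by (simp add: pos_divide_less_eq)
    also have "... <= real (Suc k) * e" using e by simp
    finally show ?thesis by (simp add: divide_less_eq mult.commute)
   qed
   note small = this
   have "\<forall>\<^sub>F N in sequentially. \<bar>\<Sum>n\<in>{1..<N}. bt n x / real n\<bar> <= 5 * (1 / real (Suc k)) * ln (real N)" using elim by blast
   hence "\<forall>\<^sub>F N in sequentially. norm ((\<Sum>n\<in>{1..<N}. bt n x / real n) / ln (real N) - 0) < e"
    using eventually_gt_at_top[of 1]
   proof eventually_elim
    case (elim N)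
    have ln: "ln (real N) > 0" using elim(2) by simp
    have "\<bar>\<Sum>n\<in>{1..<N}. bt n x / real n\<bar> < e * ln (real N)"
     using elim(1) mult_strict_right_mono[OF small ln] by linarith
    thus ?case using ln by (simp add: pos_divide_less_eq)
   qed
   thus "\<exists>n0. \<forall>N\<ge>n0. norm ((\<Sum>n\<in>{1..<N}. bt n x / real n) / ln (real N) - 0) < e"
    by (simp add: eventually_sequentially)
  qed
 qed
qed

theorem log_average:
 "AE x in M. (%N. (\<Sum>n\<in>{1..<N}. g (S n x / sqrt (real n)) / real n) / ln (real N)) \<longlonglongrightarrow> mu"
 using sum_bt_limit
proof eventually_elim
 case (elim x)
 have "(\<Sum>n\<in>{1..<N}. g (S n x / sqrt (real n)) / real n) = (\<Sum>n\<in>{1..<N}. bt n x / real n) + mu * (\<Sum>n\<in>{1..<N}. 1 / real n)" for N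
  by (simp add: bt_def diff_divide_distrib sum_subtractf sum_distrib_left)
 thus ?case using tendsto_add[OF elim tendsto_mult[OF tendsto_const[of mu] harmonic_log_limit]] by (simp add: add_divide_distrib)
qed

end

section \<open>From integer times to continuous time\<close>

lemma integral_sum_compare:
 fixes Z g :: "real => real"
 assumes Z: "continuous_on {1..} Z" and step: "\<And>n t. 1 <= n ==> t \<in> {real n..real n + 1} ==> \<bar>Z t - Z (real n)\<bar> <= D / sqrt (real n)"
  and g: "\<And>u. 0 <= g u" "\<And>u. g u <= 1" "\<And>u v. \<bar>g u - g v\<bar> <= L * \<bar>u - v\<bar>" "continuous_on UNIV g" "0 <= L"
  and N: "1 <= N"
 shows "\<bar>integral {1..real N} (%t. 1 / t * g (Z t)) - (\<Sum>n\<in>{1..<N}. g (Z (real n)) / real n)\<bar> <= 4 * (1 + L * D)"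
proof -
 let ?h = "%t. 1 / t * g (Z t)"
 have cont: "continuous_on {a..b} ?h" if "1 <= a" for a b :: real
  using that by (intro continuous_intros continuous_on_compose2[OF g(4)] continuous_on_subset[OF Z]) auto
 have D: "0 <= D" using step[of 1 1] by simp
 \<comment> \<open>On a unit interval \<open>1 / t\<close> changes by the order of
   \<open>1 / n\<^sup>2\<close>, and \<open>g (Z t)\<close>, which has weight \<open>1 / n\<close>,
   by the order of \<open>1 / sqrt n\<close>. Both errors are summable, so sum and integral differ
   by a bounded amount.\<close>
 have one: "\<bar>integral {real n..real (Suc n)} ?h - g (Z (real n)) / real n\<bar> <= (1 + L * D) * (1 / (real n * sqrt (real n)))" if n: "1 <= n" for n
 proof -
  have n0: "real n >= 1" using n by simp
  have int: "?h integrable_on {real n..real (Suc n)}" by (rule integrable_continuous_interval[OF cont[OF n0]])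
  have "((%t. ?h t - g (Z (real n)) / real n) has_integral (integral {real n..real (Suc n)} ?h - g (Z (real n)) / real n)) {real n..real (Suc n)}"
   using has_integral_diff[OF integrable_integral[OF int] has_integral_const_real[of "g (Z (real n)) / real n" "real n" "real (Suc n)"]] by simp
  hence "norm (integral {real n..real (Suc n)} ?h - g (Z (real n)) / real n) <= (1 + L * D) * (1 / (real n * sqrt (real n))) * measure lborel {real n..real (Suc n)}"
  proof (rule has_integral_bound_real[OF _ finite.emptyI, rotated])
   show "0 <= (1 + L * D) * (1 / (real n * sqrt (real n)))" using g(5) D by simp
   show "norm (?h t - g (Z (real n)) / real n) <= (1 + L * D) * (1 / (real n * sqrt (real n)))"
    if "t \<in> {real n..real (Suc n)} - {}" for t
   proof -
    have t: "t \<in> {real n..real (Suc n)}" using that by simp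
    have t1: "real n <= t" "t <= real n + 1" using t by auto
    have "?h t - g (Z (real n)) / real n = (1 / t - 1 / real n) * g (Z t) + (g (Z t) - g (Z (real n))) / real n"
     by (simp add: diff_divide_distrib left_diff_distrib)
    also have "\<bar>...\<bar> <= \<bar>1 / t - 1 / real n\<bar> * \<bar>g (Z t)\<bar> + \<bar>g (Z t) - g (Z (real n))\<bar> / real n"
     by (intro order_trans[OF abs_triangle_ineq]) (simp add: abs_mult)
    also have "... <= 1 / (real n * sqrt (real n)) * 1 + (L * (D / sqrt (real n))) / real n"
    proof (intro add_mono mult_mono divide_right_mono)
     have "\<bar>1 / t - 1 / real n\<bar> = (t - real n) / (t * real n)" using t1 n0 by (simp add: abs_if field_simps)
     also have "... <= 1 / (real n * sqrt (real n))"
     proof (intro frac_le)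
      have "sqrt (real n) <= real n" using n0 by (intro real_le_lsqrt) (auto simp: power2_eq_square)
      hence "sqrt (real n) <= t" using t1 by linarith
      thus "real n * sqrt (real n) <= t * real n" using n0 by (simp add: mult.commute mult_right_mono)
     qed (use t1 n0 in auto)
     finally show "\<bar>1 / t - 1 / real n\<bar> <= 1 / (real n * sqrt (real n))" .
     show "\<bar>g (Z t)\<bar> <= 1" using g(1,2) by (simp add: abs_of_nonneg)
     have "\<bar>g (Z t) - g (Z (real n))\<bar> <= L * \<bar>Z t - Z (real n)\<bar>" by (rule g(3))
     also have "... <= L * (D / sqrt (real n))" using step[OF n, of t] t g(5) by (intro mult_left_mono) auto
     finally show "\<bar>g (Z t) - g (Z (real n))\<bar> <= L * (D / sqrt (real n))" .
    qed auto
    also have "... = (1 + L * D) * (1 / (real n * sqrt (real n)))" using n0 by (simp add: field_simps)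
    finally show "norm (?h t - g (Z (real n)) / real n) <= (1 + L * D) * (1 / (real n * sqrt (real n)))" by simp
   qed
  qed
  thus ?thesis by simp
 qed
 have split: "integral {1..real N} ?h = (\<Sum>n\<in>{1..<N}. integral {real n..real (Suc n)} ?h)" using N
 proof (induction N rule: dec_induct)
  case (step N)
  have "integral {1..real N} ?h + integral {real N..real (Suc N)} ?h = integral {1..real (Suc N)} ?h"
   using step by (intro Henstock_Kurzweil_Integration.integral_combine integrable_continuous_interval cont) auto
  thus ?case using step by (simp add: sum.atLeastLessThan_Suc)
 qed simp
 have "\<bar>integral {1..real N} ?h - (\<Sum>n\<in>{1..<N}. g (Z (real n)) / real n)\<bar> <= (\<Sum>n\<in>{1..<N}. (1 + L * D) * (1 / (real n * sqrt (real n))))"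
  unfolding split sum_subtractf[symmetric] using one by (intro order_trans[OF sum_abs] sum_mono) auto
 also have "... = (1 + L * D) * (\<Sum>n\<in>{1..<N}. 1 / (real n * sqrt (real n)))" by (simp add: sum_distrib_left)
 also have "... <= (1 + L * D) * 4" using sum_inverse_sqrt_le[of 1 N] D g(5) by (intro mult_left_mono) auto
 finally show ?thesis by simp
qed

lemma log_integral_limit:
 fixes Z g :: "real => real"
 assumes Z: "continuous_on {1..} Z" and step: "\<And>n t. 1 <= n ==> t \<in> {real n..real n + 1} ==> \<bar>Z t - Z (real n)\<bar> <= D / sqrt (real n)"
  and g: "\<And>u. 0 <= g u" "\<And>u. g u <= 1" "\<And>u v. \<bar>g u - g v\<bar> <= L * \<bar>u - v\<bar>" "continuous_on UNIV g" "0 <= L"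
  and lim: "(%N. (\<Sum>n\<in>{1..<N}. g (Z (real n)) / real n) / ln (real N)) \<longlonglongrightarrow> l"
 shows "((%R. 1 / ln R * integral {1..R} (%t. 1 / t * g (Z t))) \<longlongrightarrow> l) at_top"
proof -
 let ?h = "%t. 1 / t * g (Z t)"
 let ?N = "%R::real. nat \<lfloor>R\<rfloor>"
 let ?s = "%N. \<Sum>n\<in>{1..<N}. g (Z (real n)) / real n"
 define C where "C = 4 * (1 + L * D) + 1"
 have N_lim: "filterlim ?N sequentially at_top"
  by (rule filterlim_compose[OF filterlim_nat_sequentially filterlim_floor_sequentially])
 have main: "((%R. ?s (?N R) / ln (real (?N R))) \<longlongrightarrow> l) at_top" by (rule filterlim_compose[OF lim N_lim])
 have inv_ln: "((%R. c / ln R) \<longlongrightarrow> 0) at_top" for c :: real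
  by (rule real_tendsto_divide_at_top[OF tendsto_const ln_at_top])
 have bounds: "\<forall>\<^sub>F R in at_top. R >= (3::real)" by (rule eventually_ge_at_top)
 have ratio: "((%R. ln (real (?N R)) / ln R) \<longlongrightarrow> 1) at_top"
 proof (rule tendsto_sandwich)
  show "((%R::real. 1 - ln 2 / ln R) \<longlongrightarrow> 1) at_top" using tendsto_diff[OF tendsto_const[of 1] inv_ln[of "ln 2"]] by simp
  show "((%R::real. 1) \<longlongrightarrow> (1::real)) at_top" by simp
  show "\<forall>\<^sub>F R in at_top. 1 - ln 2 / ln R <= ln (real (?N R)) / ln R"
   using bounds
  proof eventually_elim
   case (elim R)
   have "R / 2 <= real (?N R)" using elim by linarith
   hence "ln (R / 2) <= ln (real (?N R))" using elim by (intro ln_mono) auto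
   hence "ln R - ln 2 <= ln (real (?N R))" using elim by (simp add: ln_div)
   hence "(ln R - ln 2) / ln R <= ln (real (?N R)) / ln R" using elim by (intro divide_right_mono) auto
   thus ?case using elim by (simp add: diff_divide_distrib)
  qed
  show "\<forall>\<^sub>F R in at_top. ln (real (?N R)) / ln R <= 1"
   using bounds
  proof eventually_elim
   case (elim R)
   have "ln (real (?N R)) <= ln R" using elim by (intro ln_mono) auto
   thus ?case using elim by (simp add: divide_le_eq)
  qed
 qed
 have "((%R. ?s (?N R) / ln (real (?N R)) * (ln (real (?N R)) / ln R)) \<longlongrightarrow> l * 1) at_top"
  by (intro tendsto_mult main ratio)
 moreover have "((%R. 1 / ln R * integral {1..R} ?h - ?s (?N R) / ln (real (?N R)) * (ln (real (?N R)) / ln R)) \<longlongrightarrow> 0) at_top"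
 proof (rule Lim_null_comparison)
  show "((%R. C / ln R) \<longlongrightarrow> 0) at_top" by (rule inv_ln)
  show "\<forall>\<^sub>F R in at_top. norm (1 / ln R * integral {1..R} ?h - ?s (?N R) / ln (real (?N R)) * (ln (real (?N R)) / ln R)) <= C / ln R"
   using bounds
  proof eventually_elim
   case (elim R)
   let ?n = "?N R"
   have n: "2 <= ?n" "real ?n <= R" "R <= real ?n + 1" using elim by linarith+
   have ln: "ln R > 0" "ln (real ?n) > 0" using elim n by auto
   have cont: "continuous_on {a..b} ?h" if "1 <= a" for a b :: real
    using that by (intro continuous_intros continuous_on_compose2[OF g(4)] continuous_on_subset[OF Z]) auto
   have "integral {1..real ?n} ?h + integral {real ?n..R} ?h = integral {1..R} ?h"
    using n elim by (intro Henstock_Kurzweil_Integration.integral_combine integrable_continuous_interval cont) auto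
   moreover have "norm (integral {real ?n..R} ?h) <= 1 * measure lborel {real ?n..R}"
   proof (rule has_integral_bound_real[OF _ finite.emptyI])
    show "(?h has_integral integral {real ?n..R} ?h) {real ?n..R}"
     using n by (intro integrable_integral integrable_continuous_interval cont) auto
    show "norm (?h t) <= 1" if t: "t \<in> {real ?n..R} - {}" for t
    proof -
     have "t >= 1" using t n(1) by auto
     hence "\<bar>1 / t\<bar> * \<bar>g (Z t)\<bar> <= 1 * 1" using g(1,2) by (intro mult_mono) (auto simp: abs_of_nonneg divide_le_eq)
     thus "norm (?h t) <= 1" by (simp add: abs_mult)
    qed
   qed simp
   moreover have "\<bar>integral {1..real ?n} ?h - ?s ?n\<bar> <= 4 * (1 + L * D)"
    using n by (intro integral_sum_compare[OF Z step g]) auto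
   moreover have "1 * measure lborel {real ?n..R} <= 1" using n(3) measure_lborel_Icc[OF n(2)] by linarith
   ultimately have "\<bar>integral {1..R} ?h - ?s ?n\<bar> <= C" unfolding C_def real_norm_def by linarith
   hence "\<bar>integral {1..R} ?h - ?s ?n\<bar> / ln R <= C / ln R" using ln by (intro divide_right_mono) auto
   moreover have "1 / ln R * integral {1..R} ?h - ?s ?n / ln (real ?n) * (ln (real ?n) / ln R) = (integral {1..R} ?h - ?s ?n) / ln R"
    using ln by (simp add: diff_divide_distrib)
   ultimately show ?case using ln by (simp add: abs_divide)
  qed
 qed
 ultimately show ?thesis using tendsto_add by fastforce
qed

lemma interval_mass:
 fixes M :: "real measure"
 assumes M: "prob_space M" and s: "sets M = sets borel" and e: "e > 0"
 shows "\<exists>n::nat. 1 - e <= measure M {- real n..real n}"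
proof -
 interpret prob_space M by (rule M)
 have sp: "space M = UNIV" using sets_eq_imp_space_eq[OF s] by simp
 have "(%n. prob {- real n..real n}) \<longlonglongrightarrow> prob (\<Union>n. {- real n..real n})"
  by (rule finite_Lim_measure_incseq) (auto simp: s intro!: incseq_SucI)
 also have "(\<Union>n. {- real n..real n}) = space M"
 proof -
  have "\<exists>n. y \<in> {- real n..real n}" for y
  proof -
   obtain n :: nat where "\<bar>y\<bar> <= real n" using real_arch_simple by blast
   thus ?thesis by (intro exI[of _ n]) (auto simp: abs_le_iff)
  qed
  thus ?thesis by (auto simp: sp)
 qed
 finally have "(%n. prob {- real n..real n}) \<longlonglongrightarrow> 1" by (simp add: prob_space)
 hence "\<forall>\<^sub>F n in sequentially. 1 - e < prob {- real n..real n}" using e by (intro order_tendstoD) auto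
 thus ?thesis by (auto simp: eventually_sequentially intro: less_imp_le)
qed

section \<open>Weak convergence from countably many test functions\<close>

lemma cts_step_eq: "a < b ==> cts_step a b u = max 0 (min 1 ((b - u) / (b - a)))"
 by (auto simp: cts_step_def min_def max_def field_simps)

lemma cts_step_range: "a < b ==> 0 <= cts_step a b u" "a < b ==> cts_step a b u <= 1"
 by (auto simp: cts_step_eq)

lemma cts_step_lip: "a < b ==> \<bar>cts_step a b u - cts_step a b v\<bar> <= 1 / (b - a) * \<bar>u - v\<bar>"
proof -
 assume ab: "a < b"
 have "\<bar>max 0 (min 1 p) - max 0 (min 1 q)\<bar> <= \<bar>p - q\<bar>" for p q :: real by (simp add: max_def min_def)
 hence "\<bar>cts_step a b u - cts_step a b v\<bar> <= \<bar>(b - u) / (b - a) - (b - v) / (b - a)\<bar>" unfolding cts_step_eq[OF ab] .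
 also have "... = 1 / (b - a) * \<bar>u - v\<bar>" using ab by (simp add: diff_divide_distrib[symmetric] abs_divide abs_minus_commute)
 finally show ?thesis .
qed

lemma continuous_cts_step: "a < b ==> continuous_on UNIV (cts_step a b)"
 by (rule uniformly_continuous_imp_continuous[OF cts_step_uniformly_continuous])

text \<open>Distribution functions are squeezed between integrals of steps. Rational steps on both
  sides of a continuity point suffice, so only countably many almost sure limits are
  required.\<close>

lemma weak_conv_rational_steps:
 assumes N: "\<And>n. real_distribution (N n)" and nu: "real_distribution nu"
  and lim: "\<And>r s. r \<in> \<rat> ==> s \<in> \<rat> ==> r < s ==> (%n. \<integral>y. cts_step r s y \<partial>N n) \<longlonglongrightarrow> (\<integral>y. cts_step r s y \<partial>nu)"
 shows "weak_conv_m N nu"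
 unfolding weak_conv_m_def weak_conv_def
proof (intro allI impI LIMSEQ_I)
 fix x e :: real assume c: "isCont (cdf nu) x" and e: "e > 0"
 obtain d where d: "d > 0" "\<And>y. \<bar>y - x\<bar> < d ==> \<bar>cdf nu y - cdf nu x\<bar> < e / 2"
  using c e unfolding continuous_at_eps_delta dist_real_def by (metis half_gt_zero)
 obtain r s r' s' where q: "r \<in> \<rat>" "s \<in> \<rat>" "r' \<in> \<rat>" "s' \<in> \<rat>" "x - d < r" "r < s" "s < x" "x < r'" "r' < s'" "s' < x + d"
  using Rats_dense_in_real d(1) by (metis diff_less_eq less_add_same_cancel1)
 have "e / 2 > 0" using e by simp
 from LIMSEQ_D[OF lim[OF q(1,2,6)] this] LIMSEQ_D[OF lim[OF q(3,4,9)] this]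
 obtain n1 n2 where n: "\<And>n. n >= n1 ==> \<bar>(\<integral>y. cts_step r s y \<partial>N n) - (\<integral>y. cts_step r s y \<partial>nu)\<bar> < e / 2"
   "\<And>n. n >= n2 ==> \<bar>(\<integral>y. cts_step r' s' y \<partial>N n) - (\<integral>y. cts_step r' s' y \<partial>nu)\<bar> < e / 2" by auto
 show "\<exists>n0. \<forall>n\<ge>n0. norm (cdf (N n) x - cdf nu x) < e"
 proof (intro exI allI impI)
  fix n assume nn: "max n1 n2 <= n"
  interpret Nn: real_distribution "N n" by (rule N)
  have mono: "cdf (N n) s <= cdf (N n) x" "cdf (N n) x <= cdf (N n) r'" using q(7,8) by (auto intro: Nn.cdf_nondecreasing)
  have "\<bar>cdf nu r - cdf nu x\<bar> < e / 2" "\<bar>cdf nu s' - cdf nu x\<bar> < e / 2" by (rule d(2), use q in linarith)+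
  moreover have "n1 <= n" "n2 <= n" using nn by auto
  ultimately show "norm (cdf (N n) x - cdf nu x) < e"
   using mono n(1)[of n] n(2)[of n] real_distribution.cdf_cts_step[OF N q(6), of n]
    real_distribution.cdf_cts_step[OF N q(9), of n] real_distribution.cdf_cts_step[OF nu q(6)] real_distribution.cdf_cts_step[OF nu q(9)]
   unfolding real_norm_def by linarith
 qed
qed

text \<open>The logarithmic average is the law of \<open>Z\<close> under the density
  \<open>1 / (t * ln R)\<close> on \<open>{1..R}\<close>. Having it as a genuine distribution gives
  access to distribution functions and the theory of weak convergence.\<close>

lemma log_law:
 fixes Z :: "real => real"
 assumes Z: "continuous_on {1..} Z" and R: "R > 1"
 shows "\<exists>M. real_distribution M \<and> (\<forall>g. continuous_on UNIV g -->
  (\<integral>y. (g y :: real) \<partial>M) = 1 / ln R * integral {1..R} (%t. 1 / t * g (Z t)))"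
proof -
 define rh where "rh = (%t. indicator {1..R} t / (t * ln R))"
 \<comment> \<open>Extension by 0 makes \<open>Z\<close> Borel measurable on the whole line without
   changing it where the density is positive.\<close>
 define Z' where "Z' = (%t. indicator {1..} t *\<^sub>R Z t)"
 have Z' [measurable]: "Z' \<in> borel_measurable borel" unfolding Z'_def by (rule borel_measurable_continuous_on_indicator[OF _ Z]) simp
 have rh [measurable]: "rh \<in> borel_measurable borel" unfolding rh_def by measurable
 have rh0: "0 <= rh t" for t using R by (simp add: rh_def indicator_def)
 have int: "integrable lborel (%t. rh t * g (Z' t))" "(\<integral>t. rh t * g (Z' t) \<partial>lborel) = 1 / ln R * integral {1..R} (%t. 1 / t * g (Z t))"
  if g: "continuous_on UNIV g" for g
 proof -
  have "continuous_on {1..R} (%t. g (Z t))"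
   by (rule continuous_on_compose2[OF g]) (auto intro: continuous_on_subset[OF Z])
  hence "continuous_on {1..R} (%t. 1 / t * g (Z t))" by (intro continuous_on_mult continuous_on_divide continuous_on_const continuous_on_id) auto
  hence si: "set_integrable lborel {1..R} (%t. 1 / t * g (Z t))" by (rule borel_integrable_atLeastAtMost')
  have eq: "rh t * g (Z' t) = 1 / ln R * (indicator {1..R} t *\<^sub>R (1 / t * g (Z t)))" for t
   by (simp add: rh_def Z'_def indicator_def)
  show "integrable lborel (%t. rh t * g (Z' t))" unfolding eq using si unfolding set_integrable_def by (rule integrable_mult_right)
  show "(\<integral>t. rh t * g (Z' t) \<partial>lborel) = 1 / ln R * integral {1..R} (%t. 1 / t * g (Z t))"
   unfolding eq integral_mult_right_zero set_borel_integral_eq_integral(2)[OF si, unfolded set_lebesgue_integral_def] ..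
 qed
 have "((%t. 1 / t) has_integral (ln R - ln 1)) {1..R}"
  using R by (intro fundamental_theorem_of_calculus)
   (auto intro!: derivative_eq_intros simp: has_real_derivative_iff_has_vector_derivative[symmetric])
 hence one: "integral {1..R} (%t. 1 / t * 1) = ln R" by (simp add: integral_unique)
 have "emeasure (density lborel rh) UNIV = (\<integral>\<^sup>+t. rh t \<partial>lborel)" by (simp add: emeasure_density)
 also have "... = ennreal (\<integral>t. rh t * 1 \<partial>lborel)"
  using int(1)[OF continuous_on_const[of UNIV 1]] rh0 by (simp add: nn_integral_eq_integral)
 also have "... = 1" unfolding int(2)[OF continuous_on_const] one using R by simp
 finally have "prob_space (density lborel rh)" by (intro prob_spaceI) simp
 hence "prob_space (distr (density lborel rh) borel Z')" by (rule prob_space.prob_space_distr) simp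
 hence "real_distribution (distr (density lborel rh) borel Z')" unfolding real_distribution_def real_distribution_axioms_def by simp
 moreover have "(\<integral>y. g y \<partial>distr (density lborel rh) borel Z') = 1 / ln R * integral {1..R} (%t. 1 / t * g (Z t))"
  if g: "continuous_on UNIV g" for g
 proof -
  have [measurable]: "g \<in> borel_measurable borel" using g by (rule borel_measurable_continuous_onI)
  have "(\<integral>y. g y \<partial>distr (density lborel rh) borel Z') = (\<integral>t. g (Z' t) \<partial>density lborel rh)" by (intro integral_distr) auto
  also have "... = (\<integral>t. rh t *\<^sub>R g (Z' t) \<partial>lborel)" using rh0 by (intro integral_density) auto
  finally show ?thesis using int(2)[OF g] by simp
 qed
 ultimately show ?thesis by blast
qed

lemma weak_limit_of_steps:
 fixes Z :: "real => real"
 assumes Z: "continuous_on {1..} Z" and nu: "real_distribution nu"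
  and lim: "\<And>r s. r \<in> \<rat> ==> s \<in> \<rat> ==> r < s ==>
   ((%R. 1 / ln R * integral {1..R} (%t. 1 / t * cts_step r s (Z t))) \<longlongrightarrow> (\<integral>y. cts_step r s y \<partial>nu)) at_top"
  and g: "continuous_on UNIV g" "bounded (range g)"
 shows "((%R. 1 / ln R * integral {1..R} (%t. 1 / t * g (Z t))) \<longlongrightarrow> (\<integral>y. g y \<partial>nu)) at_top"
proof (rule tendsto_at_topI_sequentially)
 fix X :: "nat => real" assume X: "filterlim X at_top sequentially"
 have ev: "\<forall>\<^sub>F n in sequentially. X n > 1" using X by (simp add: filterlim_at_top_dense)
 obtain M where M: "\<And>R. R > 1 ==> real_distribution (M R)"
  "\<And>R g. R > 1 ==> continuous_on UNIV g ==> (\<integral>y. (g y :: real) \<partial>M R) = 1 / ln R * integral {1..R} (%t. 1 / t * g (Z t))"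
  using log_law[OF Z] by metis
 \<comment> \<open>The value \<open>nu\<close> is a filler for the finitely many indices with
   \<open>X n <= 1\<close>, where no law is defined.\<close>
 define N where "N = (%n. if X n > 1 then M (X n) else nu)"
 have Ng: "\<forall>\<^sub>F n in sequentially. 1 / ln (X n) * integral {1..X n} (%t. 1 / t * g (Z t)) = (\<integral>y. g y \<partial>N n)" if "continuous_on UNIV g" for g
  using ev by eventually_elim (simp add: N_def M(2) that)
 have N: "real_distribution (N n)" for n using M(1) nu by (simp add: N_def)
 have "weak_conv_m N nu"
 proof (rule weak_conv_rational_steps[OF N nu])
  fix r s :: real assume rs: "r \<in> \<rat>" "s \<in> \<rat>" "r < s"
  show "(%n. \<integral>y. cts_step r s y \<partial>N n) \<longlonglongrightarrow> (\<integral>y. cts_step r s y \<partial>nu)"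
   by (rule Lim_transform_eventually[OF filterlim_compose[OF lim[OF rs] X] Ng[OF continuous_cts_step[OF rs(3)]]])
 qed
 moreover obtain B where "\<And>y. norm (g y) <= B" using g(2) unfolding bounded_iff by auto
 moreover have "isCont g y" for y using g(1) by (simp add: continuous_on_eq_continuous_at)
 ultimately have "(%n. \<integral>y. g y \<partial>N n) \<longlonglongrightarrow> (\<integral>y. g y \<partial>nu)" using N nu by (intro weak_conv_imp_integral_bdd_continuous_conv)
 thus "(%n. 1 / ln (X n) * integral {1..X n} (%t. 1 / t * g (Z t))) \<longlonglongrightarrow> (\<integral>y. g y \<partial>nu)"
  by (rule Lim_transform_eventually) (use Ng[OF g(1)] in \<open>auto elim: eventually_mono\<close>)
qed

section \<open>The observed flow as a quasi-independent process\<close>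

locale observed_flow = gibbs_scales A G T X \<phi> m lev C
 for A :: "('a::t2_space, 'e::euclidean_space) chart set" and G :: "('a, 'e) metric_tensor"
  and T :: "real => 'a => 'a" and X :: "'a set" and \<phi> :: "'a => real" and m :: "'a measure" and lev C +
 fixes f :: "'a => real" and c B sigma2 :: real
 assumes continuous_f: "continuous_on X f" and f_bound: "x \<in> X ==> \<bar>f x\<bar> <= B"
  and variation: "x \<in> X ==> z \<in> nb (lev 0) 0 (real n) x ==>
   \<bar>birkhoff_integral T f (real n) x - birkhoff_integral T f (real n) z\<bar> <= c"
  and sigma2: "sigma2 >= 0"
  and clt: "weak_conv_at_top (%R. distr m borel (%x. 1 / sqrt R * integral {0..R} (%t. f (T t x)))) (centred_normal sigma2)"
begin

abbreviation bi :: "real => 'a => real" where "bi \<equiv> birkhoff_integral T f"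

lemma bi_add: "x \<in> X ==> 0 <= s ==> 0 <= t ==> bi (s + t) x = bi s x + bi t (T s x)"
 using Henstock_Kurzweil_Integration.integral_combine[of 0 s "s + t" "%u. f (T u x)"]
  integrable_continuous_interval[OF continuous_on_orbit[OF continuous_f], of x 0 "s + t"]
  orbit_integral_shift[OF continuous_f, of x s "s + t"]
 by (simp add: birkhoff_integral_def)

lemma bi_bound: assumes x: "x \<in> X" and t: "0 <= t" shows "\<bar>bi t x\<bar> <= B * t"
proof -
 have "0 <= B" using f_bound[OF x] by linarith
 moreover have "((%u. f (T u x)) has_integral bi t x) {0..t}"
  unfolding birkhoff_integral_def by (intro integrable_integral integrable_continuous_interval continuous_on_orbit[OF continuous_f x])
 moreover have "norm (f (T u x)) <= B" for u using f_bound[of "T u x"] x by simp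
 ultimately have "norm (bi t x) <= B * measure lborel {0..t}" by (intro has_integral_bound_real[OF _ finite.emptyI]) auto
 thus ?thesis using t by simp
qed

lemma continuous_bi: "continuous_on X (bi t)"
proof -
 have "continuous_on (X \<times> cbox 0 t) (%(x, u). f (T u x))"
  unfolding case_prod_beta
  by (rule continuous_on_compose2[OF continuous_f]) (auto intro!: continuous_T_compose continuous_intros)
 from integral_continuous_on_param[OF this] show ?thesis by (simp add: birkhoff_integral_def[abs_def])
qed

lemma measurable_bi [measurable]: "bi t \<in> borel_measurable m"
 by (rule measurable_continuous[OF continuous_bi])

lemma continuous_bi_time: "x \<in> X ==> continuous_on {0..} (%t. bi t x)"
 unfolding continuous_on_eq_continuous_within
proof
 fix t :: real assume x: "x \<in> X" and t: "t \<in> {0..}"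
 have "continuous_on {0..t + 1} (%t. bi t x)"
  unfolding birkhoff_integral_def
  by (intro indefinite_integral_continuous_1 integrable_continuous_interval continuous_on_orbit[OF continuous_f x])
 hence "continuous (at t within {0..t + 1}) (%t. bi t x)" using t by (auto simp: continuous_on_eq_continuous_within)
 moreover have "at t within {0..t + 1} = at t within {0..}"
  by (rule at_within_nhd[of t "{..<t + 1}"]) auto
 ultimately show "continuous (at t within {0..}) (%t. bi t x)" by simp
qed

lemma bi_shift: assumes x: "x \<in> X" and s: "0 <= s" shows "\<bar>bi s (T t x) - bi s x\<bar> <= 2 * B * \<bar>t\<bar>"
proof -
 have pos: "\<bar>bi s (T t y) - bi s y\<bar> <= 2 * B * t" if y: "y \<in> X" and t: "0 <= t" for y t
 proof -
  have "bi t y + bi s (T t y) = bi s y + bi t (T s y)"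
   using bi_add[OF y s t] bi_add[OF y t s] by (simp add: add.commute)
  thus ?thesis using bi_bound[OF y t] bi_bound[of "T s y" t] y t by (simp add: abs_le_iff)
 qed
 show ?thesis
 proof (cases "0 <= t")
  case True
  thus ?thesis using pos[OF x True] by simp
 next
  case False
  thus ?thesis using pos[of "T t x" "- t"] x by (simp add: abs_minus_commute)
 qed
qed

lemma prob_centred_normal: "prob_space (centred_normal sigma2)" and sets_centred_normal: "sets (centred_normal sigma2) = sets borel"
 using sigma2 by (auto simp: centred_normal_def intro: prob_space_return prob_space_normal_density)

lemma real_distribution_centred_normal: "real_distribution (centred_normal sigma2)"
 using prob_centred_normal sets_centred_normal by (simp add: real_distribution_def real_distribution_axioms_def)

lemma clt_integer:
 assumes g: "continuous_on UNIV (g :: real => real)" "bounded (range g)"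
 shows "(%n. \<integral>x. g (bi (real n) x / sqrt (real n)) \<partial>m) \<longlonglongrightarrow> (\<integral>y. g y \<partial>centred_normal sigma2)"
proof -
 have "((%R. \<integral>y. g y \<partial>distr m borel (%x. 1 / sqrt R * integral {0..R} (%t. f (T t x)))) \<longlongrightarrow> (\<integral>y. g y \<partial>centred_normal sigma2)) at_top"
  using clt g unfolding weak_conv_at_top_def by blast
 from filterlim_compose[OF this filterlim_real_sequentially]
 have "(%n. \<integral>y. g y \<partial>distr m borel (%x. 1 / sqrt (real n) * bi (real n) x)) \<longlonglongrightarrow> (\<integral>y. g y \<partial>centred_normal sigma2)"
  unfolding birkhoff_integral_def .
 moreover have "(\<integral>y. g y \<partial>distr m borel (%x. 1 / sqrt (real n) * bi (real n) x)) = (\<integral>x. g (bi (real n) x / sqrt (real n)) \<partial>m)" for n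
  using g(1) by (subst integral_distr) (auto intro: borel_measurable_continuous_onI)
 ultimately show ?thesis by simp
qed

lemma tightness: assumes e: "e > 0" shows "\<exists>t. \<forall>n\<ge>1. measure m {x \<in> space m. t * sqrt (real n) < \<bar>bi (real n) x\<bar>} <= e"
proof -
 obtain k :: nat where k: "1 - e / 2 <= measure (centred_normal sigma2) {- real k..real k}"
  using interval_mass[OF prob_centred_normal sets_centred_normal, of "e / 2"] e by auto
 \<comment> \<open>Vanishes on \<open>{- real k..real k}\<close> and equals 1 beyond
   \<open>real k + 1\<close>: a continuous replacement for the indicator of the tail, to which weak
   convergence applies.\<close>
 define h where "h = (%y::real. max 0 (min 1 (\<bar>y\<bar> - real k)))"
 have h: "0 <= h y" "h y <= 1" for y by (auto simp: h_def)
 have hc: "continuous_on UNIV h" unfolding h_def by (intro continuous_intros)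
 have hb: "bounded (range h)" using h by (auto simp: bounded_iff abs_of_nonneg intro!: exI[of _ 1])
 interpret nu: prob_space "centred_normal sigma2" by (rule prob_centred_normal)
 have "(\<integral>y. h y \<partial>centred_normal sigma2) <= (\<integral>y. 1 - indicator {- real k..real k} y \<partial>centred_normal sigma2)"
 proof (rule integral_mono)
  have hm: "h \<in> borel_measurable (centred_normal sigma2)"
   using hc by (subst measurable_cong_sets[OF sets_centred_normal refl]) (rule borel_measurable_continuous_onI)
  show "integrable (centred_normal sigma2) h" by (rule nu.integrable_const_bound[of _ 1]) (use hm h in auto)
  show "integrable (centred_normal sigma2) (%y. 1 - indicator {- real k..real k} y :: real)"
   by (simp add: integrable_indicator_iff nu.emeasure_eq_measure sets_centred_normal)
  show "h y <= 1 - indicator {- real k..real k} y" for y by (auto simp: h_def indicator_def abs_le_iff)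
 qed
 also have "... = 1 - measure (centred_normal sigma2) {- real k..real k}"
  by (subst Bochner_Integration.integral_diff)
   (auto simp: nu.prob_space integrable_indicator_iff nu.emeasure_eq_measure sets_centred_normal)
 finally have "(\<integral>y. h y \<partial>centred_normal sigma2) < e" using k e by linarith
 from order_tendstoD(2)[OF clt_integer[OF hc hb] this]
 obtain n0 where n0: "\<And>n. n >= n0 ==> (\<integral>x. h (bi (real n) x / sqrt (real n)) \<partial>m) < e" by (auto simp: eventually_sequentially)
 obtain x0 where "x0 \<in> X" using not_empty by (auto simp: space_m)
 hence B0: "0 <= B" using f_bound[of x0] by linarith
 \<comment> \<open>The second value settles the finitely many \<open>n < n0\<close>, where the
   integral is at most \<open>B * n\<close>, hence at most
   \<open>B * sqrt n0 * sqrt n\<close>.\<close>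
 define t where "t = max (real k + 1) (B * sqrt (real n0))"
 have "measure m {x \<in> space m. t * sqrt (real n) < \<bar>bi (real n) x\<bar>} <= e" if n: "n >= 1" for n
 proof (cases "n >= n0")
  case True
  let ?P = "{x \<in> space m. t * sqrt (real n) < \<bar>bi (real n) x\<bar>}"
  have P: "?P \<in> sets m" by measurable
  have "measure m ?P = (\<integral>x. indicator ?P x \<partial>m)" using P by simp
  also have "... <= (\<integral>x. h (bi (real n) x / sqrt (real n)) \<partial>m)"
  proof (rule integral_mono)
   show "integrable m (indicator ?P :: 'a => real)" using P by (simp add: integrable_indicator_iff emeasure_eq_measure)
   have "h \<in> borel_measurable borel" using hc by (rule borel_measurable_continuous_onI)
   thus "integrable m (%x. h (bi (real n) x / sqrt (real n)))"
    using h by (intro integrable_const_bound[of _ 1]) auto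
   fix x
   show "indicator ?P x <= h (bi (real n) x / sqrt (real n))"
   proof (cases "x \<in> ?P")
    case True
    have "(real k + 1) * sqrt (real n) <= t * sqrt (real n)" by (intro mult_right_mono) (auto simp: t_def)
    hence "(real k + 1) * sqrt (real n) < \<bar>bi (real n) x\<bar>" using True by auto
    hence "real k + 1 < \<bar>bi (real n) x\<bar> / sqrt (real n)" using n by (simp add: pos_less_divide_eq)
    thus ?thesis using True by (simp add: h_def abs_divide)
   qed (simp add: h)
  qed
  also have "... < e" by (rule n0[OF True])
  finally show ?thesis by simp
 next
  case False
  have "\<bar>bi (real n) x\<bar> <= t * sqrt (real n)" if x: "x \<in> space m" for x
  proof -
   have "\<bar>bi (real n) x\<bar> <= B * (sqrt (real n) * sqrt (real n))" using bi_bound[of x "real n"] x by (simp add: space_m)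
   also have "... <= B * (sqrt (real n0) * sqrt (real n))" using B0 False by (intro mult_left_mono mult_right_mono) auto
   also have "... <= t * sqrt (real n)" unfolding mult.assoc[symmetric] by (intro mult_right_mono) (auto simp: t_def)
   finally show ?thesis .
  qed
  hence "{x \<in> space m. t * sqrt (real n) < \<bar>bi (real n) x\<bar>} = {}" by (auto simp: not_less)
  thus ?thesis using e by (simp only: measure_empty)
 qed
 thus ?thesis by blast
qed

lemma variation_le:
 assumes "x \<in> X" "z \<in> nb (lev 0) 0 (real n) x" "i <= n"
 shows "\<bar>bi (real i) x - bi (real i) z\<bar> <= c"
proof -
 have "z \<in> nb (lev 0) 0 (real i) x" using assms(2,3) nb_subset[of 0 0 0 0 "real i" "real n" x] by auto
 thus ?thesis by (rule variation[OF assms(1)])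
qed

sublocale quasi_independent m "%n. T (real n)" "%n. bi (real n)" cell "C ^ 5" c B
proof unfold_locales
 show "T (real (i + n)) x = T (real n) (T (real i) x)" for i n x by (simp add: T_T)
 show "bi (real (i + n)) x = bi (real i) x + bi (real n) (T (real i) x)" if "x \<in> space m" for i n x
  using bi_add[of x "real i" "real n"] that by (simp add: space_m)
 show "\<bar>bi (real n) x\<bar> <= B * real n" if "x \<in> space m" for n x
  using bi_bound[of x "real n"] that by (simp add: space_m)
 show "\<exists>k. \<forall>x\<in>space m. cell n x < k" for n using cell_finite[of n] by (simp add: space_m)
 show "\<bar>bi (real i) x - bi (real i) y\<bar> <= c" if "x \<in> space m" "y \<in> space m" "cell n x = cell n y" "i <= n" for x y n i
  using variation_le[OF _ cell_near that(4)] that(1-3) by (simp add: space_m)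
 show "prob {x \<in> space m. \<forall>j<n. cell (a (Suc j) - a j) (T (real (a j)) x) = l j}
   <= (C ^ 5) ^ n * (\<Prod>j<n. prob {x \<in> space m. cell (a (Suc j) - a j) x = l j})" if "mono a" for a n l
  using quasi_bernoulli[OF that, of n l] by (simp add: space_m)
 show "1 <= C ^ 5" using C1 by simp
qed (use tightness distr_T in auto)

text \<open>The orbit up to time \<open>n\<close> determines the Birkhoff integral up to
  \<open>c\<close>, hence the test function up to \<open>w n\<close>, which is of order
  \<open>1 / sqrt n\<close>. So the bound \<open>sqrt (33 * w n)\<close> of the ergodic estimate
  tends to 0, while the means tend to 0 by the central limit theorem.\<close>

lemma lipschitz_test_cts_step:
 assumes rs: "r < s"
 shows "lipschitz_test m (%n. T (real n)) (%n. bi (real n)) cell (C ^ 5) c B (cts_step r s) (1 / (s - r))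
  (\<integral>y. cts_step r s y \<partial>centred_normal sigma2)"
proof -
 let ?g = "cts_step r s" and ?mu = "\<integral>y. cts_step r s y \<partial>centred_normal sigma2"
 let ?L = "1 / (s - r)"
 interpret nu: real_distribution "centred_normal sigma2" by (rule real_distribution_centred_normal)
 have "0 <= ?mu" "?mu <= 1" using cts_step_range[OF rs] nu.integrable_cts_step[OF rs] by (auto intro: integral_nonneg_AE nu.integral_le_const)
 then interpret lipschitz_function m "%n. T (real n)" "%n. bi (real n)" cell "C ^ 5" c B ?g ?L ?mu
  using rs by unfold_locales (simp_all add: cts_step_range cts_step_lip[OF rs, simplified])
 show ?thesis
 proof unfold_locales
  fix e :: real assume e: "e > 0"
  have inv: "\<forall>\<^sub>F n in sequentially. \<forall>x\<in>X. \<bar>bt n (T t x) - bt n x\<bar> <= e" if e: "e > 0" for t e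
  proof -
   have "(%n. ?L * (2 * B * \<bar>t\<bar>) / sqrt (real n)) \<longlonglongrightarrow> 0" by real_asymp
   hence "\<forall>\<^sub>F n in sequentially. ?L * (2 * B * \<bar>t\<bar>) / sqrt (real n) < e" using e by (rule order_tendstoD)
   thus ?thesis
   proof eventually_elim
    case (elim n)
    show ?case
    proof
     fix x assume x: "x \<in> X"
     have "?L * \<bar>bi (real n) (T t x) - bi (real n) x\<bar> / sqrt (real n) <= ?L * (2 * B * \<bar>t\<bar>) / sqrt (real n)"
      using bi_shift[OF x, of "real n" t] L_nonneg by (intro divide_right_mono mult_left_mono) auto
     thus "\<bar>bt n (T t x) - bt n x\<bar> <= e" using elim bt_lip[of n "T t x" x] by linarith
    qed
   qed
  qed
  let ?E = "%n. expectation (bt n)"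
  have "(%n. expectation (%x. ?g (bi (real n) x / sqrt (real n))) - ?mu) \<longlonglongrightarrow> ?mu - ?mu"
   using cts_step_range[OF rs] by (intro tendsto_diff tendsto_const clt_integer continuous_cts_step[OF rs]) (auto simp: bounded_iff abs_of_nonneg intro!: exI[of _ 1])
  moreover have Eeq: "?E n = expectation (%x. ?g (bi (real n) x / sqrt (real n))) - ?mu" for n
   unfolding bt_def[abs_def] using g_range by (subst Bochner_Integration.integral_diff) (auto simp: prob_space intro!: integrable_bounded[of _ 1])
  ultimately have "\<forall>\<^sub>F n in sequentially. \<bar>?E n\<bar> < e / 2"
   using e LIMSEQ_D[of ?E 0 "e / 2"] by (auto simp: eventually_sequentially)
  \<comment> \<open>The summand 1 ensures that \<open>w n\<close> is positive.\<close>
  moreover define w where "w = (%n. (?L * c + 1) / sqrt (real n))"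
  have "(%n. 33 * w n) \<longlonglongrightarrow> 0" unfolding w_def by real_asymp
  from tendsto_real_sqrt[OF this] have "\<forall>\<^sub>F n in sequentially. sqrt (33 * w n) < e / 2" using e by (intro order_tendstoD) auto
  ultimately have "\<forall>\<^sub>F n in sequentially. 1 <= n \<and> \<bar>?E n\<bar> < e / 2 \<and> sqrt (33 * w n) < e / 2"
   using eventually_ge_at_top[of 1] by eventually_elim auto
  then obtain n0 where n0: "\<And>n. n >= n0 ==> 1 <= n \<and> \<bar>?E n\<bar> < e / 2 \<and> sqrt (33 * w n) < e / 2" by (auto simp: eventually_sequentially)
  have "\<forall>\<^sub>F k in sequentially. \<bar>expectation (%x. bt n x * bt k x)\<bar> <= e" if n: "n >= n0" for n
  proof -
   let ?u = "%x. bt n x - ?E n"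
   have n1: "sqrt (real n) > 0" using n0[OF n] by simp
   have "- ?mu <= ?E n" "?E n <= 1 - ?mu" using bt_range integrable_bt by (auto intro: integral_ge_const integral_le_const)
   hence u1: "\<bar>?u x\<bar> <= 1" for x using bt_range[of n x] by linarith
   have "\<forall>\<^sub>F k in sequentially. \<bar>expectation (%x. ?u x * bt k x)\<bar> <= e / 2"
   proof (rule asymptotic_decorrelation)
    show "w n > 0" using L_nonneg c_nonneg n1 by (auto simp: w_def intro!: divide_pos_pos add_nonneg_pos mult_nonneg_nonneg)
    show "determined (w n) (real n) ?u"
     unfolding determined_def
    proof (intro ballI)
     fix p q assume p: "p \<in> X" and q: "q \<in> nb (lev 0) (- real n) (real n) p"
     have "q \<in> nb (lev 0) 0 (real n) p" using q nb_subset[of 0 0 "- real n" 0 "real n" "real n" p] by auto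
     hence "\<bar>bi (real n) p - bi (real n) q\<bar> <= c" by (rule variation[OF p])
     hence "?L * \<bar>bi (real n) p - bi (real n) q\<bar> / sqrt (real n) <= w n"
      unfolding w_def using L_nonneg by (intro divide_right_mono add_increasing2 mult_left_mono) auto
     thus "\<bar>?u p - ?u q\<bar> <= w n" using bt_lip[of n p q] by simp
    qed
   qed (use u1 bt_le_1 inv n0[OF n] integrable_bt in \<open>auto simp: prob_space\<close>)
   thus ?thesis
   proof eventually_elim
    case (elim k)
    have i: "integrable m (%x. ?u x * bt k x)" using u1 bt_le_1 by (intro integrable_bounded[of _ 1] abs_mult_le_1) auto
    have "expectation (%x. bt n x * bt k x) = expectation (%x. ?u x * bt k x + ?E n * bt k x)" by (simp add: algebra_simps)
    also have "... = expectation (%x. ?u x * bt k x) + ?E n * ?E k" using i integrable_bt[of k] by simp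
    finally have eq: "expectation (%x. bt n x * bt k x) = expectation (%x. ?u x * bt k x) + ?E n * ?E k" .
    have "\<bar>expectation (%x. bt n x * bt k x)\<bar> <= e / 2 + \<bar>?E n\<bar> * 1"
     unfolding eq
    proof (intro order_trans[OF abs_triangle_ineq] add_mono elim)
     have "\<bar>?E k\<bar> <= expectation (%x. 1)"
      using integrable_bt bt_le_1 by (intro order_trans[OF integral_abs_bound] integral_mono) auto
     thus "\<bar>?E n * ?E k\<bar> <= \<bar>?E n\<bar> * 1" unfolding abs_mult by (intro mult_left_mono) (auto simp: prob_space)
    qed
    thus ?case using n0[OF n] by linarith
   qed
  qed
  thus "\<exists>n0. \<forall>n\<ge>n0. \<forall>\<^sub>F k in sequentially. \<bar>expectation (%x. bt n x * bt k x)\<bar> <= e" by blast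
 qed
qed

theorem almost_sure_clt:
 "AE x in m. \<forall>g :: real => real. continuous_on UNIV g --> bounded (range g) -->
   ((%R. 1 / ln R * integral {1..R} (%t. 1 / t * g (1 / sqrt t * bi t x)))
    \<longlongrightarrow> (\<integral>y. g y \<partial>centred_normal sigma2)) at_top"
proof -
 let ?Q = "{(r, s) \<in> \<rat> \<times> \<rat>. r < (s::real)}"
 have "countable ?Q" by (rule countable_subset[of _ "\<rat> \<times> \<rat>"]) (auto intro: countable_rat)
 moreover have "\<forall>q\<in>?Q. AE x in m. (%N. (\<Sum>n\<in>{1..<N}. cts_step (fst q) (snd q) (bi (real n) x / sqrt (real n)) / real n) / ln (real N))
   \<longlonglongrightarrow> (\<integral>y. cts_step (fst q) (snd q) y \<partial>centred_normal sigma2)"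
  using lipschitz_test.log_average[OF lipschitz_test_cts_step] by auto
 ultimately have "AE x in m. \<forall>q\<in>?Q. (%N. (\<Sum>n\<in>{1..<N}. cts_step (fst q) (snd q) (bi (real n) x / sqrt (real n)) / real n) / ln (real N))
   \<longlonglongrightarrow> (\<integral>y. cts_step (fst q) (snd q) y \<partial>centred_normal sigma2)"
  by (subst AE_ball_countable)
 thus ?thesis using AE_space
 proof eventually_elim
  case (elim x)
  hence x: "x \<in> X" by (simp add: space_m)
  have B0: "0 <= B" using f_bound[OF x] by linarith
  define Z where "Z = (%t. 1 / sqrt t * bi t x)"
  have Zc: "continuous_on {1..} Z"
   unfolding Z_def by (intro continuous_intros continuous_on_subset[OF continuous_bi_time[OF x]]) auto
  \<comment> \<open>Within a unit of time the integral changes by at most \<open>B\<close>. The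
    factor \<open>1 / sqrt t\<close> changes by at most \<open>1 / (n * sqrt n)\<close> and
    multiplies an integral of size at most \<open>B * n\<close>; this gives the constant
    \<open>2 * B\<close>.\<close>
  have step: "\<bar>Z t - Z (real n)\<bar> <= 2 * B / sqrt (real n)" if n: "1 <= n" and t: "t \<in> {real n..real n + 1}" for n t
  proof -
   have t1: "1 <= real n" "real n <= t" "t <= real n + 1" using n t by auto
   define u v where "u = sqrt (real n)" and "v = sqrt t"
   have uv: "1 <= u" "u <= v" "u * u = real n" "v * v = t" using t1 by (auto simp: u_def v_def)
   have "bi t x = bi (real n) x + bi (t - real n) (T (real n) x)" using bi_add[OF x, of "real n" "t - real n"] t1 by simp
   moreover have "\<bar>bi (t - real n) (T (real n) x)\<bar> <= B * (t - real n)" using t1 x by (intro bi_bound) auto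
   moreover have "B * (t - real n) <= B * 1" using B0 t1 by (intro mult_left_mono) auto
   ultimately have d: "\<bar>bi t x - bi (real n) x\<bar> <= B" by simp
   have "Z t - Z (real n) = 1 / v * (bi t x - bi (real n) x) - (1 / u - 1 / v) * bi (real n) x"
    by (simp add: Z_def u_def v_def algebra_simps)
   also have "\<bar>...\<bar> <= \<bar>1 / v\<bar> * \<bar>bi t x - bi (real n) x\<bar> + \<bar>1 / u - 1 / v\<bar> * \<bar>bi (real n) x\<bar>"
    by (intro order_trans[OF abs_triangle_ineq4]) (simp add: abs_mult)
   also have "... <= 1 / u * B + 1 / (u * (u * u)) * (B * real n)"
   proof (intro add_mono mult_mono d)
    show "\<bar>1 / v\<bar> <= 1 / u" using uv by (simp add: frac_le)
    have "(v - u) * (v + u) <= 1" using uv t1 by (simp add: algebra_simps)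
    moreover have "(v - u) * u <= (v - u) * (v + u)" using uv by (intro mult_left_mono) auto
    ultimately have "(v - u) * u <= 1" by linarith
    hence "(v - u) * u / (u * u * v) <= 1 / (u * u * v)" using uv by (intro divide_right_mono) auto
    also have "... <= 1 / (u * u * u)" using uv(1,2) by (intro frac_le mult_left_mono mult_pos_pos) auto
    also have "(v - u) * u / (u * u * v) = 1 / u - 1 / v"
    proof -
     have "u ~= 0" "v ~= 0" using uv by auto
     thus ?thesis by (simp add: field_simps)
    qed
    finally have "1 / u - 1 / v <= 1 / (u * (u * u))" by (simp add: mult.assoc)
    moreover have "0 <= 1 / u - 1 / v" using uv by (simp add: frac_le)
    ultimately show "\<bar>1 / u - 1 / v\<bar> <= 1 / (u * (u * u))" by simp
    show "\<bar>bi (real n) x\<bar> <= B * real n" by (intro bi_bound x) simp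
   qed (use uv B0 in auto)
   also have "... = 2 * B / sqrt (real n)"
    unfolding uv(3)[symmetric] using uv(1) by (simp add: u_def[symmetric])
   finally show ?thesis .
  qed
  have lim: "((%R. 1 / ln R * integral {1..R} (%t. 1 / t * cts_step r s (Z t))) \<longlongrightarrow> (\<integral>y. cts_step r s y \<partial>centred_normal sigma2)) at_top"
   if rs: "r \<in> \<rat>" "s \<in> \<rat>" "r < s" for r s
  proof (rule log_integral_limit[OF Zc step cts_step_range[OF rs(3)] cts_step_lip[OF rs(3)] continuous_cts_step[OF rs(3)]])
   show "0 <= 1 / (s - r)" using rs by simp
   have "(r, s) \<in> ?Q" using rs by simp
   from elim(1)[rule_format, OF this]
   show "(%N. (\<Sum>n\<in>{1..<N}. cts_step r s (Z (real n)) / real n) / ln (real N)) \<longlonglongrightarrow> (\<integral>y. cts_step r s y \<partial>centred_normal sigma2)"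
    by (simp add: Z_def)
  qed
  show ?case
  proof (intro allI impI)
   fix g :: "real => real" assume g: "continuous_on UNIV g" "bounded (range g)"
   have "((%R. 1 / ln R * integral {1..R} (%t. 1 / t * g (Z t))) \<longlongrightarrow> (\<integral>y. g y \<partial>centred_normal sigma2)) at_top"
    by (rule weak_limit_of_steps[OF Zc real_distribution_centred_normal lim g])
   thus "((%R. 1 / ln R * integral {1..R} (%t. 1 / t * g (1 / sqrt t * bi t x))) \<longlongrightarrow> (\<integral>y. g y \<partial>centred_normal sigma2)) at_top"
    by (simp only: Z_def)
  qed
 qed
qed

end

theorem proposition2p18:
  fixes A :: "('a::t2_space, 'e::euclidean_space) chart set"
    and G :: "('a, 'e) metric_tensor"
    and T :: "real \<Rightarrow> 'a \<Rightarrow> 'a"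
    and X :: "'a set"
    and m :: "'a measure"
    and \<phi> f :: "'a \<Rightarrow> real"
    and sigma2 :: real
  assumes "compact (UNIV :: 'a set)" and "smooth_atlas A" and "riemannian_metric A G"
    and "C1_flow A T" and "axiom_A A G T"
    and "basic_set A G T X" and "topologically_transitive_on T X"
    and "hoelder_on (riemannian_dist A G) X \<phi>"
    and "gibbs_measure (riemannian_dist A G) T X \<phi> m"
    and "hoelder_on (riemannian_dist A G) X f"
    and "(\<integral>x. f x \<partial>m) = 0"
    and "sigma2 \<ge> 0"
    and "weak_conv_at_top
           (\<lambda>R. distr m borel (\<lambda>x. 1 / sqrt R * integral {0..R} (\<lambda>t. f (T t x))))
           (centred_normal sigma2)"
  shows "AE x in m. \<forall>g :: real \<Rightarrow> real. continuous_on UNIV g \<longrightarrow> bounded (range g) \<longrightarrow>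
           ((\<lambda>R. 1 / ln R * integral {1..R}
                (\<lambda>t. 1 / t * g (1 / sqrt t * integral {0..t} (\<lambda>s. f (T s x)))))
             \<longlongrightarrow> (\<integral>y. g y \<partial>centred_normal sigma2)) at_top"
proof -
 let ?d = "riemannian_dist A G"
 have "riemannian_atlas A G" using assms(2,3) by (rule riemannian_atlas.intro)
 hence bf: "basic_flow A G T X" using assms(1,4,6) by (intro basic_flow.intro basic_flow_axioms.intro)
 hence gf: "gibbs_flow A G T X \<phi> m" using assms(8,9) by (intro gibbs_flow.intro gibbs_flow_axioms.intro)
 \<comment> \<open>The order of choices: the variation of \<open>f\<close> determines the scale
   \<open>ep\<close>, and the scales of the Gibbs measure are then taken below it.\<close>
 obtain ep c where ep: "ep > 0" and "c > 0" and c: "\<And>x z (n::nat). x \<in> X ==> z \<in> X ==>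
   (\<And>s. s <= n ==> ?d (T (real s) x) (T (real s) z) <= ep) ==>
   \<bar>birkhoff_integral T f (real n) x - birkhoff_integral T f (real n) z\<bar> <= c"
  using basic_flow.birkhoff_integral_variation[OF bf assms(10)] by metis
 obtain lev C where gs: "gibbs_scales A G T X \<phi> m lev C" and lev: "lev 0 <= ep"
  by (rule gibbs_flow.ex_scales[OF gf ep])
 have cont: "continuous_on X f" by (rule basic_flow.hoelder_continuous[OF bf assms(10)])
 obtain B where "B > 0" and B: "\<And>x. x \<in> X ==> \<bar>f x\<bar> <= B" using basic_flow.bounded_on_X[OF bf cont] by metis
 have "observed_flow A G T X \<phi> m lev C f c B sigma2"
 proof (rule observed_flow.intro[OF gs observed_flow_axioms.intro[OF cont B _ assms(12,13)]])
  fix x z n assume x: "x \<in> X" and "z \<in> gibbs_flow.nb A G T X (lev 0) 0 (real n) x"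
  hence z: "z \<in> X" "\<And>u. u \<in> {0..real n} ==> ?d (T u x) (T u z) < lev 0"
   unfolding gibbs_flow.nb_def[OF gf] by auto
  show "\<bar>birkhoff_integral T f (real n) x - birkhoff_integral T f (real n) z\<bar> <= c"
  proof (rule c[OF x z(1)])
   fix s assume "s <= n"
   hence "?d (T (real s) x) (T (real s) z) < lev 0" by (intro z(2)) simp
   thus "?d (T (real s) x) (T (real s) z) <= ep" using lev by simp
  qed
 qed
 from observed_flow.almost_sure_clt[OF this] show ?thesis unfolding birkhoff_integral_def .
qed

end
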